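(* Let $N\ge2$ and let $\Omega=\{x\in\mathbb{R}^N : \eta^-(x')<x_N<\eta^+(x')\}$, where $\eta^\pm:\mathbb{R}^{N-1}\to\mathbb{R}$ are Lipschitz continuous functions with $\eta^-<\eta^+$, and set $L:=|\eta^-|_{0,1}+|\eta^+|_{0,1}$. Let $0<a<1$ and $1<p<\infty$. Suppose that $f^\pm\in L^p_{\mathrm{loc}}(\mathbb{R}^{N-1})$ satisfy $$\int_{\mathbb{R}^{N-1}}\frac{|f^+(x')-f^-(x')|^p}{(\eta^+(x')-\eta^-(x'))^{p-1}}\,dx'<\infty$$ and $$|f^-|_{\tilde{W}^{1-1/p,p}_{(a(\eta^+-\eta^-))}(\mathbb{R}^{N-1})}<\infty,\qquad|f^+|_{\tilde{W}^{1-1/p,p}_{(a(\eta^+-\eta^-))}(\mathbb{R}^{N-1})}<\infty.$$ Then there exists $u\in\dot{W}^{1,p}(\Omega)$ such that $\operatorname{Tr}(u)(x',\eta^\pm(x'))=f^\pm(x')$ for $x'\in\mathbb{R}^{N-1}$, and $$\begin{aligned}\int_\Omega|\nabla u(x)|^p\,dx\le{}&c(1+L)^p\int_{\mathbb{R}^{N-1}}\frac{|f^+(x')-f^-(x')|^p}{(\eta^+(x')-\eta^-(x'))^{p-1}}\,dx'\\&+c(1+L)^p|f^-|^p_{\tilde{W}^{1-1/p,p}_{(a(\eta^+-\eta^-))}(\mathbb{R}^{N-1})}+c(1+L)^p|f^+|^p_{\tilde{W}^{1-1/p,p}_{(a(\eta^+-\eta^-))}(\mathbb{R}^{N-1})}\end{aligned}$$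 for some constant $c=c(a,N,p)>0$. Moreover, the map $(f^-,f^+)\mapsto u$ is linear.
   Context: Points are written $x=(x',x_N)\in\mathbb{R}^{N-1}\times\mathbb{R}$. $|\eta|_{0,1}:=\sup_{x'\ne y'}|\eta(x')-\eta(y')|/|x'-y'|$ is the Lipschitz seminorm. $\dot{W}^{1,p}(\Omega)$ is the space of real-valued $u\in L^1_{\mathrm{loc}}(\Omega)$ whose first-order weak derivatives all belong to $L^p(\Omega)$. $\operatorname{Tr}:\dot{W}^{1,p}(\Omega)\to L^p_{\mathrm{loc}}(\partial\Omega)$ is the boundary trace operator: the linear operator that agrees with restriction to $\partial\Omega$ on $\dot{W}^{1,p}(\Omega)\cap C^0(\overline\Omega)$ and satisfies $\int_\Omega u\,\partial_i\psi\,dx=-\int_\Omega\psi\,\partial_iu\,dx+\int_{\partial\Omega}\psi\operatorname{Tr}(u)\nu_i\,d\mathcal{H}^{N-1}$ for all $\psi\in C^1_c(\mathbb{R}^N)$ and all $i$, with $\nu$ the outward unit normal (it is the usual Sobolev trace on bounded Lipschitz subdomains). For a positive continuous function $\sigma$ on $\mathbb{R}^{N-1}$ and $f\in L^1_{\mathrm{loc}}(\mathbb{R}^{N-1})$, $$|f|_{\tilde{W}^{1-1/p,p}_{(\sigma)}(\mathbb{R}^{N-1})}:=\left(\int_{\mathbb{R}^{N-1}}\int_{B'(0,\sigma(x'))}\frac{|f(x'+h')-f(x')|^p}{|h'|^{p+N-2}}\,dh'\,dx'\right)^{1/p},$$ with $B'(0,r)$ the open ball in $\mathbb{R}^{N-1}$.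 *)

theory Defs
  imports "HOL-Analysis.Analysis"
begin

text \<open>
  Points of \<open>\<real>\<^sup>N\<close> are pairs \<open>(x', x\<^sub>N)\<close> of type \<open>real ^ 'n \<times> real\<close>, with \<open>CARD('n) = N - 1\<close>; hence
  \<open>N \<ge> 2\<close> is automatic. The norm of the product type is the Euclidean one, and \<^const>\<open>Basis\<close>
  consists of the \<open>N\<close> coordinate directions. Elements of Lebesgue and Sobolev spaces are
  represented by functions, considered up to equality almost everywhere.
\<close>

definition lip_seminorm :: "('a::euclidean_space \<Rightarrow> real) \<Rightarrow> real" where
  "lip_seminorm \<eta> = (SUP (x, y)\<in>{(x, y). x \<noteq> y}. \<bar>\<eta> x - \<eta> y\<bar> / norm (x - y))"

definition strip :: "('a::euclidean_space \<Rightarrow> real) \<Rightarrow> ('a \<Rightarrow> real) \<Rightarrow> ('a \<times> real) set" where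
  "strip \<eta>m \<eta>p = {x. \<eta>m (fst x) < snd x \<and> snd x < \<eta>p (fst x)}"


subsection \<open>Test functions\<close>

text \<open>Classical partial derivative in the direction \<open>i\<close> (used with \<open>i \<in> Basis\<close>).\<close>

definition partial :: "'a::euclidean_space \<Rightarrow> ('a \<Rightarrow> real) \<Rightarrow> 'a \<Rightarrow> real" where
  "partial i f x = deriv (\<lambda>t. f (x + t *\<^sub>R i)) 0"

primrec C_diff :: "nat \<Rightarrow> ('a::euclidean_space \<Rightarrow> real) \<Rightarrow> bool" where
  "C_diff 0 f \<longleftrightarrow> continuous_on UNIV f"
| "C_diff (Suc k) f \<longleftrightarrow>
     (\<forall>x. f differentiable (at x)) \<and> (\<forall>i\<in>Basis. C_diff k (partial i f))"

definition C1_compact :: "('a::euclidean_space \<Rightarrow> real) set" where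
  "C1_compact = {\<psi>. C_diff 1 \<psi> \<and> (\<exists>K. compact K \<and> (\<forall>x. x \<notin> K \<longrightarrow> \<psi> x = 0))}"

definition Cinf_compact :: "'a::euclidean_space set \<Rightarrow> ('a \<Rightarrow> real) set" where
  "Cinf_compact \<Omega> =
     {\<psi>. (\<forall>k. C_diff k \<psi>) \<and> (\<exists>K. compact K \<and> K \<subseteq> \<Omega> \<and> (\<forall>x. x \<notin> K \<longrightarrow> \<psi> x = 0))}"


subsection \<open>Homogeneous Sobolev spaces\<close>

definition L1_loc :: "'a::euclidean_space set \<Rightarrow> ('a \<Rightarrow> real) set" where
  "L1_loc \<Omega> = {u. \<forall>K. compact K \<and> K \<subseteq> \<Omega> \<longrightarrow> set_integrable lebesgue K u}"

definition Lp_loc :: "real \<Rightarrow> ('a::euclidean_space \<Rightarrow> real) set" where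
  "Lp_loc p = {f. f \<in> borel_measurable lebesgue \<and>
     (\<forall>K. compact K \<longrightarrow> (\<integral>\<^sup>+x\<in>K. ennreal (\<bar>f x\<bar> powr p) \<partial>lebesgue) < \<infinity>)}"

definition has_weak_gradient ::
    "'a::euclidean_space set \<Rightarrow> ('a \<Rightarrow> real) \<Rightarrow> ('a \<Rightarrow> 'a) \<Rightarrow> bool" where
  "has_weak_gradient \<Omega> u G \<longleftrightarrow>
     u \<in> L1_loc \<Omega> \<and>
     (\<forall>i\<in>Basis. (\<lambda>x. G x \<bullet> i) \<in> L1_loc \<Omega> \<and>
       (\<forall>\<psi>\<in>Cinf_compact \<Omega>.
         (LINT x:\<Omega>|lebesgue. u x * partial i \<psi> x) = - (LINT x:\<Omega>|lebesgue. (G x \<bullet> i) * \<psi> x)))"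

definition hom_sobolev :: "'a::euclidean_space set \<Rightarrow> real \<Rightarrow> ('a \<Rightarrow> real) set" where
  "hom_sobolev \<Omega> p = {u. \<exists>G. has_weak_gradient \<Omega> u G \<and>
     (\<forall>i\<in>Basis. (\<integral>\<^sup>+x\<in>\<Omega>. ennreal (\<bar>G x \<bullet> i\<bar> powr p) \<partial>lebesgue) < \<infinity>)}"


subsection \<open>The boundary of the strip and the trace\<close>

text \<open>
  The partial derivatives of a Lipschitz function exist almost everywhere; the values of
  \<^const>\<open>partial\<close> on the exceptional null set are irrelevant below.
\<close>

definition grad :: "('a::euclidean_space \<Rightarrow> real) \<Rightarrow> 'a \<Rightarrow> 'a" where
  "grad \<eta> x = (\<Sum>i\<in>Basis. partial i \<eta> x *\<^sub>R i)"

text \<open>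
  The boundary of the strip is the disjoint union of the graphs of \<open>\<eta>m\<close> and \<open>\<eta>p\<close>. The restriction
  of \<open>\<H>\<^sup>N\<^sup>-\<^sup>1\<close> to the boundary is the surface measure of these two Lipschitz graphs, with area
  element \<open>sqrt (1 + |\<nabla>\<eta>|\<^sup>2) dx'\<close>. It is taken as a Borel measure on the whole space that is
  concentrated on the boundary.
\<close>

definition boundary_measure ::
    "('a::euclidean_space \<Rightarrow> real) \<Rightarrow> ('a \<Rightarrow> real) \<Rightarrow> ('a \<times> real) measure" where
  "boundary_measure \<eta>m \<eta>p = measure_of UNIV (sets borel) (\<lambda>A.
     (\<integral>\<^sup>+y. indicator A (y, \<eta>m y) * ennreal (sqrt (1 + (norm (grad \<eta>m y))\<^sup>2)) \<partial>lebesgue) +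
     (\<integral>\<^sup>+y. indicator A (y, \<eta>p y) * ennreal (sqrt (1 + (norm (grad \<eta>p y))\<^sup>2)) \<partial>lebesgue))"

text \<open>Outward unit normal of the strip at a boundary point: upwards on the graph of \<open>\<eta>p\<close>,
  downwards on the graph of \<open>\<eta>m\<close>.\<close>

definition outer_normal ::
    "('a::euclidean_space \<Rightarrow> real) \<Rightarrow> ('a \<Rightarrow> real) \<Rightarrow> 'a \<times> real \<Rightarrow> 'a \<times> real" where
  "outer_normal \<eta>m \<eta>p x =
     (if snd x = \<eta>p (fst x)
      then (- grad \<eta>p (fst x), 1) /\<^sub>R sqrt (1 + (norm (grad \<eta>p (fst x)))\<^sup>2)
      else (grad \<eta>m (fst x), -1) /\<^sub>R sqrt (1 + (norm (grad \<eta>m (fst x)))\<^sup>2))"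

text \<open>
  \<open>has_trace \<eta>m \<eta>p p u g\<close> says that \<open>Tr u = g\<close> almost everywhere on the boundary, for
  \<open>u\<close> in \<^const>\<open>hom_sobolev\<close>. The relation is the graph of the trace operator: \<open>g\<close> is locally in
  \<open>L\<^sup>p\<close> on the boundary, is the restriction of the continuous representative of \<open>u\<close> on the closed
  strip whenever there is one, and satisfies the integration by parts formula, which determines
  \<open>g\<close> almost everywhere. The integrability of \<open>u x * partial i \<psi> x\<close>, implicit in that
  formula, is made explicit, because the integral of a non-integrable function is \<open>0\<close> by
  convention.
\<close>

definition has_trace ::
    "('a::euclidean_space \<Rightarrow> real) \<Rightarrow> ('a \<Rightarrow> real) \<Rightarrow> real \<Rightarrow>
     ('a \<times> real \<Rightarrow> real) \<Rightarrow> ('a \<times> real \<Rightarrow> real) \<Rightarrow> bool" where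
  "has_trace \<eta>m \<eta>p p u g \<longleftrightarrow>
     g \<in> borel_measurable borel \<and>
     (\<forall>K. compact K \<longrightarrow>
        (\<integral>\<^sup>+x\<in>K. ennreal (\<bar>g x\<bar> powr p) \<partial>boundary_measure \<eta>m \<eta>p) < \<infinity>) \<and>
     (\<forall>w. continuous_on (closure (strip \<eta>m \<eta>p)) w \<and>
          (AE x in lebesgue. x \<in> strip \<eta>m \<eta>p \<longrightarrow> u x = w x) \<longrightarrow>
        (AE x in boundary_measure \<eta>m \<eta>p. g x = w x)) \<and>
     (\<exists>G. has_weak_gradient (strip \<eta>m \<eta>p) u G \<and>
        (\<forall>\<psi>\<in>C1_compact. \<forall>i\<in>Basis.
           set_integrable lebesgue (strip \<eta>m \<eta>p) (\<lambda>x. u x * partial i \<psi> x) \<and>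
           (LINT x:strip \<eta>m \<eta>p|lebesgue. u x * partial i \<psi> x) =
             - (LINT x:strip \<eta>m \<eta>p|lebesgue. \<psi> x * (G x \<bullet> i))
             + (LINT x|boundary_measure \<eta>m \<eta>p. \<psi> x * g x * (outer_normal \<eta>m \<eta>p x \<bullet> i))))"


subsection \<open>The boundary data\<close>

text \<open>
  The \<open>p\<close>-th power of the screened seminorm of \<open>f\<close> with screening function \<open>\<sigma>\<close>. With
  \<open>CARD('n) = N - 1\<close>, the exponent \<open>p + N - 2\<close> of \<open>|h'|\<close> is \<open>p + CARD('n) - 1\<close>.
\<close>

definition screened_seminorm_pow ::
    "real \<Rightarrow> (real ^ 'n \<Rightarrow> real) \<Rightarrow> (real ^ 'n \<Rightarrow> real) \<Rightarrow> ennreal" where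
  "screened_seminorm_pow p \<sigma> f =
     (\<integral>\<^sup>+x. (\<integral>\<^sup>+h\<in>ball 0 (\<sigma> x).
        ennreal (\<bar>f (x + h) - f x\<bar> powr p / norm h powr (p + real CARD('n) - 1)) \<partial>lebesgue) \<partial>lebesgue)"

definition weighted_gap ::
    "real \<Rightarrow> ('a::euclidean_space \<Rightarrow> real) \<Rightarrow> ('a \<Rightarrow> real) \<Rightarrow>
     ('a \<Rightarrow> real) \<Rightarrow> ('a \<Rightarrow> real) \<Rightarrow> ennreal" where
  "weighted_gap p \<eta>m \<eta>p fm fp =
     (\<integral>\<^sup>+x. ennreal (\<bar>fp x - fm x\<bar> powr p / (\<eta>p x - \<eta>m x) powr (p - 1)) \<partial>lebesgue)"

definition boundary_data ::
    "real \<Rightarrow> real \<Rightarrow> (real ^ 'n \<Rightarrow> real) \<Rightarrow> (real ^ 'n \<Rightarrow> real) \<Rightarrow>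
     ((real ^ 'n \<Rightarrow> real) \<times> (real ^ 'n \<Rightarrow> real)) set" where
  "boundary_data a p \<eta>m \<eta>p = {(fm, fp).
     fm \<in> Lp_loc p \<and> fp \<in> Lp_loc p \<and>
     weighted_gap p \<eta>m \<eta>p fm fp < \<infinity> \<and>
     screened_seminorm_pow p (\<lambda>x. a * (\<eta>p x - \<eta>m x)) fm < \<infinity> \<and>
     screened_seminorm_pow p (\<lambda>x. a * (\<eta>p x - \<eta>m x)) fp < \<infinity>}"

text \<open>
  Linearity of \<open>T\<close> as a map on equivalence classes modulo null sets: the case \<open>h = f\<close> a.e.
  (\<open>\<alpha> = 1\<close>, \<open>\<beta> = 0\<close>) says that the class of \<open>T f\<close> depends only on the class of \<open>f\<close>.
\<close>

definition linear_ae ::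
    "(('a::euclidean_space \<Rightarrow> real) \<times> ('a \<Rightarrow> real)) set \<Rightarrow> ('a \<times> real) set \<Rightarrow>
     (('a \<Rightarrow> real) \<times> ('a \<Rightarrow> real) \<Rightarrow> 'a \<times> real \<Rightarrow> real) \<Rightarrow> bool" where
  "linear_ae D \<Omega> T \<longleftrightarrow>
     (\<forall>f\<in>D. \<forall>g\<in>D. \<forall>h\<in>D. \<forall>\<alpha> \<beta>.
        (AE x in lebesgue. fst h x = \<alpha> * fst f x + \<beta> * fst g x) \<and>
        (AE x in lebesgue. snd h x = \<alpha> * snd f x + \<beta> * snd g x) \<longrightarrow>
        (AE x in lebesgue. x \<in> \<Omega> \<longrightarrow> T h x = \<alpha> * T f x + \<beta> * T g x))"

end

theory Submission
  imports Defs
begin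

text \<open>
  Write \<open>d = \<eta>p - \<eta>m\<close>, let \<open>\<tau>m\<close> and \<open>\<tau>p\<close> be the vertical distances of a point \<open>X = (x, t)\<close> of
  the strip to the lower and the upper graph, and let \<open>F f x e\<close> be the average of \<open>f\<close> over the
  ball of radius \<open>e\<close> about \<open>x\<close>, weighted by a tent function. The extension is
  \<open>u X = (1 - \<tau>m / d) * F fm x (a * \<tau>m) + (\<tau>m / d) * F fp x (a * \<tau>p)\<close>.
  Everything is controlled by the single function
  \<open>H X = \<bar>fp x - fm x\<bar> / d + A fm x (a * \<tau>m) / (a * \<tau>m) + A fp x (a * \<tau>p) / (a * \<tau>p)\<close>, where \<open>A f x e\<close>
  is the mean of \<open>\<bar>f - f x\<bar>\<close> over the ball: the local Lipschitz constant of \<open>u\<close> at \<open>X\<close> is at most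
  \<open>C * (1 + L) * H X\<close>, and \<open>\<bar>u X - fm x\<bar> \<le> C * \<tau>m * H X\<close>, \<open>\<bar>u X - fp x\<bar> \<le> C * \<tau>p * H X\<close>. By Jensen's
  inequality and Tonelli's theorem, the \<open>p\<close>-th power of \<open>H\<close> has integral at most a constant times
  the weighted gap plus the two screened seminorms; the radii stay below \<open>a * d x\<close>, which is
  exactly the screening.

  A Lipschitz function of compact support is differentiable almost everywhere in each direction and
  its directional derivatives have integral \<open>0\<close>. For a test function \<open>\<psi>\<close> and a cutoff \<open>\<zeta>\<close>
  that vanishes within distance \<open>\<delta>\<close> of the two graphs, apply this to \<open>u * \<psi> * \<zeta>\<close>. The derivative of
  \<open>\<zeta>\<close> lives in the layer \<open>\<delta> < \<tau> < 2 * \<delta>\<close>, where \<open>\<bar>u - f\<bar> / \<delta> \<le> 2 * C * H\<close> is dominated, so that the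
  layers converge to the boundary integrals as \<open>\<delta>\<close> tends to \<open>0\<close>.
\<close>


section \<open>Dini derivatives and null sets on the line\<close>

text \<open>The radii \<open>a * \<tau>m\<close> and \<open>a * \<tau>p\<close> shrink to 0 at the
  graph whose datum is averaged, so each average returns its datum there, while the other datum
  enters with a weight that vanishes. The data may be unbounded and discontinuous, so
  \<open>u\<close> is in general not Lipschitz up to the boundary; the cutoffs keep all
  differentiation in the interior. \<open>H\<close> at \<open>X\<close> measures oscillation against
  the datum at the base point of \<open>X\<close> itself and need not be locally bounded. It bounds
  the slope of \<open>u\<close> at the single point \<open>X\<close>, and local Lipschitz continuity
  comes from a cruder estimate that subtracts no value of the datum. The exponents match because the
  integral of \<open>e powr (- (N - 1 + p))\<close> over \<open>e > norm h\<close> is a multiple of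
  \<open>norm h powr (- (p + N - 2))\<close>, the kernel of the seminorm. The trace must also agree
  with a continuous representative, if there is one. This is checked on vertical lines: on almost
  all of them \<open>H\<close> is integrable, which fails if \<open>u\<close> tends to anything but
  the datum.\<close>

lemma dini_nondecreasing:
  fixes H :: "real \<Rightarrow> real"
  assumes cont: "continuous_on {a..b} H" and "a \<le> b"
    and step: "\<And>x \<delta>. a \<le> x \<Longrightarrow> x < b \<Longrightarrow> \<delta> > 0 \<Longrightarrow> \<exists>h. 0 < h \<and> h < \<delta> \<and> H x \<le> H (x + h)"
  shows "H a \<le> H b"
proof -
  \<comment> \<open>This set is closed, hence contains its supremum; from a supremum below
    \<open>b\<close> a step without decrease would lead to a larger element.\<close>
  let ?S = "{x \<in> {a..b}. H a \<le> H x}"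
  have cl: "closed ?S"
    using continuous_closed_preimage[OF cont, of "{H a..}"] by (auto simp: vimage_def Int_def)
  have ne: "?S \<noteq> {}" using \<open>a \<le> b\<close> by auto
  have bdd: "bdd_above ?S" by (rule bdd_aboveI[of _ b]) auto
  define c where "c = Sup ?S"
  have c: "c \<in> ?S" unfolding c_def by (rule closed_contains_Sup[OF ne bdd cl])
  have "c = b"
  proof (rule ccontr)
    assume "c \<noteq> b"
    then have "c < b" using c by auto
    then obtain h where h: "0 < h" "h < b - c" "H c \<le> H (c + h)"
      using step[of c "b - c"] c by auto
    then have "c + h \<in> ?S" using c by auto
    then have "c + h \<le> c" unfolding c_def using bdd by (rule cSup_upper)
    then show False using h by simp
  qed
  then show ?thesis using c by auto
qed

text \<open>
  For an open \<open>V\<close> containing the part of the interval outside \<open>E\<close>, the function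
  \<open>r * x + (C - r) * \<bar>V \<inter> {a..x}\<bar> - f x\<close> has, at every point, arbitrarily small right increments that are nonnegative.
\<close>

lemma lower_dini_increment_le:
  fixes f :: "real \<Rightarrow> real"
  assumes lip: "\<And>x y. \<bar>f x - f y\<bar> \<le> C * \<bar>x - y\<bar>"
    and E: "E \<in> sets borel" and "r \<le> C" and "a \<le> b"
    and dini: "\<And>x \<delta>. x \<in> E \<Longrightarrow> \<delta> > 0 \<Longrightarrow> \<exists>h. 0 < h \<and> h < \<delta> \<and> f (x + h) - f x \<le> r * h"
  shows "f b - f a \<le> r * (b - a) + (C - r) * measure lborel ({a..b} - E)"
proof -
  have "f b - f a \<le> r * (b - a) + (C - r) * measure lborel ({a..b} - E) + (C - r) * e"
    if "e > 0" for e
  proof -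
    have meas: "{a..b} - E \<in> sets lborel" using E by auto
    have finE: "emeasure lborel ({a..b} - E) < \<infinity>"
      using emeasure_mono[of "{a..b} - E" "{a..b}" lborel] \<open>a \<le> b\<close>
      by (auto simp: top.extremum_strict le_less_trans)
    \<comment> \<open>Outer regularity: \<open>V\<close> exceeds the exceptional part of the
      interval by measure less than \<open>e\<close>. Being open, it contains a short interval to
      the right of each of its points.\<close>
    obtain V where V: "open V" "{a..b} - E \<subseteq> V" "emeasure lborel (V - ({a..b} - E)) < ennreal e"
      using outer_regular_lborel[of "{a..b} - E" e] E \<open>e > 0\<close> by auto
    define m where "m = (\<lambda>x. measure lborel (V \<inter> {a..x}))"
    have Vmeas [measurable]: "V \<in> sets borel" using V by auto
    have fin: "V \<inter> {a..x} \<in> fmeasurable lborel" for x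
    proof (rule fmeasurableI2)
      show "{a..x} \<in> fmeasurable lborel"
        by (cases "a \<le> x") (auto simp: fmeasurable_def)
    qed auto
    have lipm: "\<bar>m x - m y\<bar> \<le> \<bar>x - y\<bar>" if "x \<ge> a" "y \<ge> a" for x y
    proof -
      have *: "m x \<le> m y \<and> m y \<le> m x + (y - x)" if "x \<le> y" "a \<le> x" for x y
      proof
        show "m x \<le> m y" unfolding m_def
          by (rule measure_mono_fmeasurable) (use that fin[of y] fmeasurableD in auto)
        have f: "{x..y} \<in> fmeasurable lborel" using that by (auto simp: fmeasurable_def)
        have "m y \<le> measure lborel ((V \<inter> {a..x}) \<union> {x..y})" unfolding m_def
          by (rule measure_mono_fmeasurable)
            (use that fin[of x] fin[of y] f in \<open>auto intro!: fmeasurable.Un dest: fmeasurableD\<close>)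
        also have "\<dots> \<le> m x + measure lborel {x..y}" unfolding m_def
          by (rule measure_Un_le) auto
        finally show "m y \<le> m x + (y - x)" using that by simp
      qed
      show ?thesis using *[of x y] *[of y x] that by (cases "x \<le> y") auto
    qed
    have "r * a + (C - r) * m a - f a \<le> r * b + (C - r) * m b - f b"
    proof (rule dini_nondecreasing[where H = "\<lambda>x. r * x + (C - r) * m x - f x"])
      have "continuous_on UNIV f"
      proof -
        have "C \<ge> 0" using lip[of 0 1] by auto
        then have "C-lipschitz_on UNIV f" using lip by (auto simp: lipschitz_on_def dist_real_def)
        then show ?thesis by (rule lipschitz_on_continuous_on)
      qed
      moreover have "continuous_on {a..b} m"
      proof -
        have "1-lipschitz_on {a..b} m" using lipm by (auto simp: lipschitz_on_def dist_real_def)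
        then show ?thesis by (rule lipschitz_on_continuous_on)
      qed
      ultimately show "continuous_on {a..b} (\<lambda>x. r * x + (C - r) * m x - f x)"
        by (intro continuous_intros) (auto intro: continuous_on_subset)
    next
      fix x \<delta> :: real assume x: "a \<le> x" "x < b" "\<delta> > 0"
      \<comment> \<open>In \<open>E\<close> the Dini assumption pays for the increment of
        \<open>f\<close>, and \<open>m\<close> does not decrease. Elsewhere \<open>x\<close> lies in
        \<open>V\<close>, where \<open>m\<close> grows at unit rate, and
        \<open>r + (C - r) = C\<close> pays for the Lipschitz bound of \<open>f\<close>.\<close>
      show "\<exists>h. 0 < h \<and> h < \<delta> \<and> r * x + (C - r) * m x - f x \<le> r * (x + h) + (C - r) * m (x + h) - f (x + h)"
      proof (cases "x \<in> E")
        case True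
        then obtain h where h: "0 < h" "h < \<delta>" "f (x + h) - f x \<le> r * h" using dini x by blast
        have "m x \<le> m (x + h)" unfolding m_def
          by (rule measure_mono_fmeasurable) (use h fin fmeasurableD in auto)
        then have "(C - r) * m x \<le> (C - r) * m (x + h)" using \<open>r \<le> C\<close> by (intro mult_left_mono) auto
        then show ?thesis using h by (intro exI[of _ h]) (auto simp: algebra_simps)
      next
        case False
        then have "x \<in> V" using V x by auto
        then obtain d where d: "d > 0" "ball x d \<subseteq> V" using V(1) openE by blast
        define h where "h = min d \<delta> / 2"
        have h: "0 < h" "h < \<delta>" "h < d" using d x unfolding h_def by auto
        have sub: "{x<..x+h} \<subseteq> V" using d h by (auto simp: subset_iff dist_real_def)
        have "m x + h = measure lborel (V \<inter> {a..x}) + measure lborel {x<..x+h}"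
          using h unfolding m_def by simp
        also have "\<dots> = measure lborel ((V \<inter> {a..x}) \<union> {x<..x+h})"
        proof (rule measure_Union[symmetric])
          show "emeasure lborel {x<..x+h} \<noteq> \<infinity>" using h by simp
          show "emeasure lborel (V \<inter> {a..x}) \<noteq> \<infinity>" using fin[of x] by (auto simp: fmeasurable_def)
        qed auto
        also have "\<dots> \<le> m (x + h)" unfolding m_def
          by (rule measure_mono_fmeasurable) (use h x sub fin fmeasurableD in auto)
        finally have "(C - r) * (m x + h) \<le> (C - r) * m (x + h)"
          using \<open>r \<le> C\<close> by (intro mult_left_mono) auto
        moreover have "f (x + h) - f x \<le> C * h" using lip[of "x + h" x] h by auto
        ultimately show ?thesis using h by (intro exI[of _ h]) (auto simp: algebra_simps)
      qed
    qed (fact \<open>a \<le> b\<close>)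
    moreover have "m a = 0"
    proof -
      have "m a \<le> measure lborel {a}" unfolding m_def
        by (rule measure_mono_fmeasurable) (auto simp: fmeasurable_def)
      then show ?thesis by (intro antisym) (simp_all add: m_def)
    qed
    moreover have "m b \<le> measure lborel ({a..b} - E) + e"
    proof -
      have f1: "{a..b} - E \<in> fmeasurable lborel" using meas finE by (simp add: fmeasurable_def)
      have f2: "V - ({a..b} - E) \<in> fmeasurable lborel"
        using meas V(3) less_trans[OF V(3), of \<infinity>] by (auto simp: fmeasurable_def)
      have "m b \<le> measure lborel (({a..b} - E) \<union> (V - ({a..b} - E)))" unfolding m_def
        using f1 f2 fin by (intro measure_mono_fmeasurable fmeasurable.Un) (auto dest: fmeasurableD)
      also have "\<dots> \<le> measure lborel ({a..b} - E) + measure lborel (V - ({a..b} - E))"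
        using f1 f2 by (intro measure_Un_le) (auto dest: fmeasurableD)
      also have "measure lborel (V - ({a..b} - E)) \<le> e"
        using V(3) \<open>e > 0\<close> by (simp add: measure_def enn2real_leI order.strict_implies_order)
      finally show ?thesis by simp
    qed
    then have "(C - r) * m b \<le> (C - r) * (measure lborel ({a..b} - E) + e)"
      using \<open>r \<le> C\<close> by (intro mult_left_mono) auto
    ultimately show ?thesis by (simp add: algebra_simps)
  qed
  note bound = this
  show ?thesis
  proof (rule field_le_epsilon)
    fix e :: real assume "e > 0"
    \<comment> \<open>The summand 1 keeps the denominator positive when
      \<open>r = C\<close>.\<close>
    define e' where "e' = e / (C - r + 1)"
    have "(C - r) * e' \<le> e" "e' > 0" using \<open>e > 0\<close> \<open>r \<le> C\<close> unfolding e'_def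
      by (auto simp: field_simps)
    then show "f b - f a \<le> r * (b - a) + (C - r) * measure lborel ({a..b} - E) + e"
      using bound[of e'] by linarith
  qed
qed

text \<open>An elementary form of the density theorem. A bounded piece of measure \<open>m\<close>
  is covered by nonoverlapping intervals of total length at most \<open>m + e\<close>; thinness in
  each of them gives \<open>m \<le> k * (m + e)\<close> for every \<open>e > 0\<close>, which forces
  \<open>m = 0\<close> because \<open>k < 1\<close>.\<close>

lemma null_set_if_thin_in_intervals:
  fixes S :: "real set"
  assumes S: "S \<in> sets borel" and "0 \<le> k" "k < 1"
    and thin: "\<And>a b. a \<le> b \<Longrightarrow> measure lborel (S \<inter> {a..b}) \<le> k * (b - a)"
  shows "S \<in> null_sets lborel"
proof -
  have "emeasure lborel (S \<inter> {-real N..real N}) = 0" for N :: nat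
  proof -
    let ?T = "S \<inter> {-real N..real N}"
    have T: "?T \<in> sets borel" using S by auto
    have Tl: "?T \<in> lmeasurable"
      by (rule fmeasurableI2[of "{-real N..real N}"]) (use T in auto)
    let ?m = "measure lborel ?T"
    have "?m \<le> k * (?m + e)" if "e > 0" for e
    proof -
      have sub: "?T \<subseteq> cbox (- real N) (real N)" by auto
      show ?thesis
      proof (rule measurable_outer_intervals_bounded[OF Tl sub \<open>e > 0\<close>])
        fix \<D> :: "real set set"
        assume D: "countable \<D>"
          "\<And>K. K \<in> \<D> \<Longrightarrow> K \<subseteq> cbox (-real N) (real N) \<and> K \<noteq> {} \<and> (\<exists>c d. K = cbox c d)"
          "pairwise (\<lambda>A B. interior A \<inter> interior B = {}) \<D>"
          "?T \<subseteq> \<Union>\<D>" "\<Union>\<D> \<in> lmeasurable" "measure lebesgue (\<Union>\<D>) \<le> measure lebesgue ?T + e"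
        have bK: "K \<in> sets borel" if "K \<in> \<D>" for K using D(2)[OF that] by auto
        have int_meas: "interior K \<in> sets borel" for K :: "real set" by auto
        \<comment> \<open>The covering intervals can meet in endpoints only: their interiors are
          disjoint, so that measures add up, and the countably many endpoints are
          negligible.\<close>
        have null: "(\<Union>K\<in>\<D>. K - interior K) \<in> null_sets lborel"
        proof (rule null_sets_UN'[OF D(1)])
          fix K assume "K \<in> \<D>"
          then obtain c d where K: "K = {c..d}" using D(2) by force
          have "K - interior K \<subseteq> {c, d}" unfolding K by auto
          moreover have "{c, d} \<in> null_sets lborel" by (intro countable_imp_null_set_lborel) auto
          ultimately show "K - interior K \<in> null_sets lborel"
            using bK[OF \<open>K \<in> \<D>\<close>] null_sets_subset by (metis int_meas sets.Diff sets_lborel)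
      qed
      have "emeasure lborel ?T \<le> emeasure lborel ((\<Union>K\<in>\<D>. ?T \<inter> interior K) \<union> (\<Union>K\<in>\<D>. K - interior K))"
      proof (rule emeasure_mono)
        show "?T \<subseteq> (\<Union>K\<in>\<D>. ?T \<inter> interior K) \<union> (\<Union>K\<in>\<D>. K - interior K)" using D(4) by blast
      qed (use D(1) bK T in \<open>auto intro!: sets.Un sets.countable_UN''\<close>)
      also have "\<dots> = emeasure lborel (\<Union>K\<in>\<D>. ?T \<inter> interior K)"
        using null D(1) T by (intro emeasure_Un_null_set sets.countable_UN'') auto
      also have "\<dots> = (\<integral>\<^sup>+K. emeasure lborel (?T \<inter> interior K) \<partial>count_space \<D>)"
        using D(1,3) T
        by (intro emeasure_UN_countable) (auto simp: disjoint_family_on_def pairwise_def)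
      also have "\<dots> \<le> (\<integral>\<^sup>+K. ennreal k * emeasure lborel (interior K) \<partial>count_space \<D>)"
      proof (rule nn_integral_mono)
        fix K assume "K \<in> space (count_space \<D>)"
        then obtain c d where K: "K = {c..d}" "c \<le> d" using D(2) by force
        have cd: "{c..d} \<in> fmeasurable lborel" using K by (simp add: fmeasurable_def)
        have f: "?T \<inter> {c..d} \<in> fmeasurable lborel"
          by (rule fmeasurableI2[OF cd]) (use T in auto)
        have f2: "S \<inter> {c..d} \<in> fmeasurable lborel"
          by (rule fmeasurableI2[OF cd]) (use S in auto)
        have "emeasure lborel (?T \<inter> interior K) \<le> emeasure lborel (?T \<inter> {c..d})"
          using T unfolding K by (intro emeasure_mono) auto
        also have "\<dots> = ennreal (measure lborel (?T \<inter> {c..d}))"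
          using f by (rule emeasure_eq_measure2)
        also have "\<dots> \<le> ennreal (measure lborel (S \<inter> {c..d}))"
          using f f2 by (intro ennreal_leI measure_mono_fmeasurable) (auto dest: fmeasurableD)
        also have "\<dots> \<le> ennreal (k * (d - c))" using thin[OF K(2)] by (rule ennreal_leI)
        also have "\<dots> = ennreal k * emeasure lborel (interior K)"
          using K \<open>0 \<le> k\<close> by (simp add: ennreal_mult)
        finally show "emeasure lborel (?T \<inter> interior K) \<le> ennreal k * emeasure lborel (interior K)" .
      qed
      also have "\<dots> = ennreal k * (\<integral>\<^sup>+K. emeasure lborel (interior K) \<partial>count_space \<D>)"
        by (rule nn_integral_cmult) auto
      also have "(\<integral>\<^sup>+K. emeasure lborel (interior K) \<partial>count_space \<D>) = emeasure lborel (\<Union>K\<in>\<D>. interior K)"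
        using D(1,3) by (intro emeasure_UN_countable[symmetric]) (auto simp: disjoint_family_on_def pairwise_def)
      also have "\<dots> \<le> emeasure lebesgue (\<Union>\<D>)"
      proof -
        have "(\<Union>K\<in>\<D>. interior K) \<in> sets borel" by (intro borel_open open_UN) auto
        then have "emeasure lborel (\<Union>K\<in>\<D>. interior K) = emeasure lebesgue (\<Union>K\<in>\<D>. interior K)"
          by simp
        also have "\<dots> \<le> emeasure lebesgue (\<Union>\<D>)"
          using D(5) interior_subset by (intro emeasure_mono) (auto dest: fmeasurableD)
        finally show ?thesis .
      qed
      also have "\<dots> = ennreal (measure lebesgue (\<Union>\<D>))" using D(5) by (rule emeasure_eq_measure2)
      also have "\<dots> \<le> ennreal (?m + e)"
      proof (rule ennreal_leI)
        have "measure lebesgue ?T = ?m" using T by (intro measure_completion) auto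
        then show "measure lebesgue (\<Union>\<D>) \<le> ?m + e" using D(6) by simp
      qed
      finally have "emeasure lborel ?T \<le> ennreal k * ennreal (?m + e)"
        by (simp add: mult_left_mono)
      moreover have "emeasure lborel ?T = ennreal ?m"
        using Tl T by (intro emeasure_eq_measure2) (auto simp: fmeasurable_def emeasure_completion)
      ultimately have "ennreal ?m \<le> ennreal (k * (?m + e))"
        using \<open>0 \<le> k\<close> \<open>e > 0\<close> by (simp add: ennreal_mult)
      then show ?thesis using \<open>0 \<le> k\<close> \<open>e > 0\<close> by (subst (asm) ennreal_le_iff) auto
      qed
    qed
    note bound = this
    have "(1 - k) * ?m \<le> 0"
    proof (rule field_le_epsilon)
      fix e :: real assume e: "e > 0"
      have "?m \<le> k * ?m + k * e" using bound[OF e] by (simp add: algebra_simps)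
      moreover have "k * e \<le> e" using \<open>k < 1\<close> e by simp
      ultimately show "(1 - k) * ?m \<le> 0 + e" by (simp add: algebra_simps)
    qed
    then have "?m \<le> 0" using \<open>k < 1\<close> by (simp add: mult_le_0_iff)
    then have "?m = 0" by (simp add: measure_le_0_iff)
    moreover have "emeasure lborel ?T = ennreal ?m"
      using Tl T by (intro emeasure_eq_measure2) (auto simp: fmeasurable_def emeasure_completion)
    ultimately show ?thesis by simp
  qed
  then have "(\<Union>N. S \<inter> {-real N..real N}) \<in> null_sets lborel"
    using S by (intro null_sets_UN) (auto simp: null_sets_def)
  moreover have "(\<Union>N. S \<inter> {-real N..real N}) = S"
  proof -
    have "\<exists>N::nat. -real N \<le> x \<and> x \<le> real N" for x
    proof -
      obtain N :: nat where "\<bar>x\<bar> \<le> real N" using real_arch_simple by blast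
      then show ?thesis by (intro exI[of _ N]) auto
    qed
    then show ?thesis by auto
  qed
  ultimately show ?thesis by simp
qed

text \<open>On \<open>E\<close> the function tends to grow at rate at most \<open>r\<close> seen
  from the left and at rate at least \<open>s\<close> seen from the right. The increment estimate
  for the reflection \<open>- f (- x)\<close> bounds \<open>f b - f a\<close> from above, the one
  for \<open>- f\<close> bounds it from below. Together they give
  \<open>(s - r) * (b - a) \<le> l * \<bar>{a..b} - E\<bar>\<close>, so \<open>E\<close> misses a
  fixed fraction of every interval.\<close>

lemma null_dini_gap_real:
  fixes f :: "real \<Rightarrow> real"
  assumes lip: "\<And>x y. \<bar>f x - f y\<bar> \<le> C * \<bar>x - y\<bar>" and "r < s"
    and E: "E \<in> sets borel"
    and lower: "\<And>x \<delta>. x \<in> E \<Longrightarrow> \<delta> > 0 \<Longrightarrow> \<exists>h. 0 < h \<and> h < \<delta> \<and> f x - f (x - h) \<le> r * h"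
    and upper: "\<And>x \<delta>. x \<in> E \<Longrightarrow> \<delta> > 0 \<Longrightarrow> \<exists>h. 0 < h \<and> h < \<delta> \<and> f (x + h) - f x \<ge> s * h"
  shows "E \<in> null_sets lborel"
proof -
  \<comment> \<open>Enlarged so that both rates, \<open>r\<close> and \<open>- s\<close>, are at
    most the Lipschitz constant, as the increment estimate requires.\<close>
  define D where "D = max C (max \<bar>r\<bar> \<bar>s\<bar>)"
  have lipD: "\<bar>f x - f y\<bar> \<le> D * \<bar>x - y\<bar>" for x y
    using lip[of x y] mult_right_mono[of C D "\<bar>x - y\<bar>"] unfolding D_def by linarith
  have rs: "r \<le> D" "- s \<le> D" unfolding D_def by linarith+
  define l where "l = 2 * D + s - r"
  have l: "l > 0" "s - r \<le> l" using \<open>r < s\<close> rs unfolding l_def D_def by linarith+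
  have key: "(s - r) * (b - a) \<le> l * measure lborel ({a..b} - E)" if "a \<le> b" for a b
  proof -
    let ?E' = "uminus -` E"
    have E': "?E' \<in> sets borel" using measurable_sets[OF borel_measurable_uminus[OF measurable_ident] , of E] E by auto
    have 1: "- f (- (- a)) - (- f (- (- b))) \<le> r * (- a - (- b)) + (D - r) * measure lborel ({- b..- a} - ?E')"
    proof (rule lower_dini_increment_le[where f = "\<lambda>x. - f (- x)" and C = D, OF _ E' rs(1)])
      show "\<bar>- f (- x) - - f (- y)\<bar> \<le> D * \<bar>x - y\<bar>" for x y using lipD[of "- x" "- y"] by (simp add: abs_minus_commute)
      show "\<exists>h. 0 < h \<and> h < \<delta> \<and> - f (- (x + h)) - - f (- x) \<le> r * h" if "x \<in> ?E'" "\<delta> > 0" for x \<delta>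
        using lower[of "- x" \<delta>] that by auto
    qed (use that in auto)
    have 2: "- f b - - f a \<le> - s * (b - a) + (D - - s) * measure lborel ({a..b} - E)"
    proof (rule lower_dini_increment_le[where f = "\<lambda>x. - f x" and C = D, OF _ E rs(2) that])
      show "\<bar>- f x - - f y\<bar> \<le> D * \<bar>x - y\<bar>" for x y using lipD[of x y] by (simp add: abs_minus_commute)
      show "\<exists>h. 0 < h \<and> h < \<delta> \<and> - f (x + h) - - f x \<le> - s * h" if "x \<in> E" "\<delta> > 0" for x \<delta>
        using upper[OF that] by force
    qed
    have "measure lborel ({- b..- a} - ?E') = measure lborel ({a..b} - E)"
    proof -
      have "measure lborel ({a..b} - E) = measure (distr lborel borel uminus) ({a..b} - E)"
        using lborel_distr_uminus by metis
      also have "\<dots> = measure lborel (uminus -` ({a..b} - E) \<inter> space lborel)"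
        using E by (intro measure_distr) auto
      also have "uminus -` ({a..b} - E) \<inter> space lborel = {- b..- a} - ?E'" by auto
      finally show ?thesis by simp
    qed
    with 1 2 show ?thesis unfolding l_def by (simp add: algebra_simps)
  qed
  show ?thesis
  proof (rule null_set_if_thin_in_intervals[OF E, of "1 - (s - r) / l"])
    fix a b :: real assume ab: "a \<le> b"
    have "measure lborel (E \<inter> {a..b}) = measure lborel {a..b} - measure lborel ({a..b} - E)"
    proof -
      have "measure lborel ({a..b} - (E \<inter> {a..b})) = measure lborel {a..b} - measure lborel (E \<inter> {a..b})"
        using E ab by (intro measure_Diff) auto
      moreover have "{a..b} - (E \<inter> {a..b}) = {a..b} - E" by auto
      ultimately show ?thesis by simp
    qed
    also have "\<dots> \<le> (b - a) - (s - r) / l * (b - a)"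
      using key[OF ab] l ab by (simp add: field_simps)
    finally show "measure lborel (E \<inter> {a..b}) \<le> (1 - (s - r) / l) * (b - a)"
      by (simp add: algebra_simps)
  qed (use l \<open>r < s\<close> in \<open>auto simp: field_simps\<close>)
qed

section \<open>Directional derivatives of Lipschitz functions\<close>

text \<open>\<open>partial\<close> alone cannot express differentiability, because
  \<open>deriv\<close> returns a value also where no derivative exists.\<close>

definition dir_diff :: "'a::euclidean_space \<Rightarrow> ('a \<Rightarrow> real) \<Rightarrow> 'a \<Rightarrow> bool" where
  "dir_diff i h x \<longleftrightarrow> (\<exists>D. ((\<lambda>t. h (x + t *\<^sub>R i)) has_real_derivative D) (at 0))"

lemma dir_diff_iff_partial:
  "dir_diff i h x \<longleftrightarrow> ((\<lambda>t. h (x + t *\<^sub>R i)) has_real_derivative partial i h x) (at 0)"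
  unfolding dir_diff_def partial_def by (metis DERIV_imp_deriv)

lemma partialI:
  "((\<lambda>t. h (x + t *\<^sub>R i)) has_real_derivative D) (at 0) \<Longrightarrow> partial i h x = D"
  unfolding partial_def by (rule DERIV_imp_deriv)

text \<open>If the inequality failed, two rationals \<open>r < s\<close> would fit strictly between
  the two sides, and either alternative of the hypothesis contradicts one of them. Rational bounds
  keep the number of exceptional sets countable.\<close>

lemma Limsup_right_le_Liminf_left:
  fixes f :: "real \<Rightarrow> real"
  assumes nogap: "\<And>r s. r < s \<Longrightarrow> r \<in> \<rat> \<Longrightarrow> s \<in> \<rat> \<Longrightarrow>
     \<exists>\<delta>>0. (\<forall>h. 0 < h \<and> h < \<delta> \<longrightarrow> f x - f (x - h) \<ge> r * h) \<or> (\<forall>h. 0 < h \<and> h < \<delta> \<longrightarrow> f (x + h) - f x \<le> s * h)"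
  shows "Limsup (at_right 0) (\<lambda>h. ereal ((f (x + h) - f x) / h)) \<le> Liminf (at_left 0) (\<lambda>h. ereal ((f (x + h) - f x) / h))"
proof (rule ccontr)
  let ?Q = "\<lambda>h. ereal ((f (x + h) - f x) / h)"
  assume "\<not> ?thesis"
  then have lt: "Liminf (at_left 0) ?Q < Limsup (at_right 0) ?Q" by simp
  obtain s' :: rat where s': "Liminf (at_left 0) ?Q < ereal (real_of_rat s')" "ereal (real_of_rat s') < Limsup (at_right 0) ?Q"
    using ereal_dense3[OF lt] by auto
  obtain r' :: rat where r': "Liminf (at_left 0) ?Q < ereal (real_of_rat r')" "ereal (real_of_rat r') < ereal (real_of_rat s')"
    using ereal_dense3[OF s'(1)] by auto
  define r s where "r = real_of_rat r'" and "s = real_of_rat s'"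
  have "r < s" "r \<in> \<rat>" "s \<in> \<rat>" using r' unfolding r_def s_def by auto
  then obtain \<delta> where d: "\<delta> > 0" and alt: "(\<forall>h. 0 < h \<and> h < \<delta> \<longrightarrow> f x - f (x - h) \<ge> r * h) \<or> (\<forall>h. 0 < h \<and> h < \<delta> \<longrightarrow> f (x + h) - f x \<le> s * h)"
    using nogap by blast
  from alt show False
  proof
    assume *: "\<forall>h. 0 < h \<and> h < \<delta> \<longrightarrow> f x - f (x - h) \<ge> r * h"
    have "eventually (\<lambda>h. ereal r \<le> ?Q h) (at_left 0)"
      unfolding eventually_at_left_field
    proof (intro exI[of _ "-\<delta>"] conjI allI impI)
      fix y assume "- \<delta> < y" "y < 0"
      then show "ereal r \<le> ?Q y" using *[rule_format, of "- y"] by (auto simp: field_simps)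
    qed (use d in auto)
    then have "ereal r \<le> Liminf (at_left 0) ?Q" by (rule Liminf_bounded)
    then show False using r' unfolding r_def by simp
  next
    assume *: "\<forall>h. 0 < h \<and> h < \<delta> \<longrightarrow> f (x + h) - f x \<le> s * h"
    have "eventually (\<lambda>h. ?Q h \<le> ereal s) (at_right 0)"
      unfolding eventually_at_right_field
      by (intro exI[of _ "\<delta>"]) (use d * in \<open>auto simp: field_simps\<close>)
    then have "Limsup (at_right 0) ?Q \<le> ereal s" by (rule Limsup_bounded)
    then show False using s' unfolding s_def by simp
  qed
qed

text \<open>The second gap condition is the first one for \<open>- f (- y)\<close>, and gives the
  upper left derivative at most the lower right one. With the trivial inequalities between lower and
  upper limits this closes a cycle, so all four Dini derivatives agree. The Lipschitz bound makes
  their common value finite.\<close>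

lemma differentiable_if_no_dini_gap:
  fixes f :: "real \<Rightarrow> real"
  assumes lip: "\<And>h. \<bar>f (x + h) - f x\<bar> \<le> C * \<bar>h\<bar>"
    and gap1: "\<And>r s. r < s \<Longrightarrow> r \<in> \<rat> \<Longrightarrow> s \<in> \<rat> \<Longrightarrow>
     \<exists>\<delta>>0. (\<forall>h. 0 < h \<and> h < \<delta> \<longrightarrow> f x - f (x - h) \<ge> r * h) \<or> (\<forall>h. 0 < h \<and> h < \<delta> \<longrightarrow> f (x + h) - f x \<le> s * h)"
    and gap2: "\<And>r s. r < s \<Longrightarrow> r \<in> \<rat> \<Longrightarrow> s \<in> \<rat> \<Longrightarrow>
     \<exists>\<delta>>0. (\<forall>h. 0 < h \<and> h < \<delta> \<longrightarrow> f (x + h) - f x \<ge> r * h) \<or> (\<forall>h. 0 < h \<and> h < \<delta> \<longrightarrow> f x - f (x - h) \<le> s * h)"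
  shows "\<exists>D. (f has_real_derivative D) (at x)"
proof -
  let ?Q = "\<lambda>h. ereal ((f (x + h) - f x) / h)"
  have 1: "Limsup (at_right 0) ?Q \<le> Liminf (at_left 0) ?Q"
    by (rule Limsup_right_le_Liminf_left[OF gap1])
  have "Limsup (at_right 0) (\<lambda>h. ereal ((- f (- (- x + h)) - - f (- (- x))) / h)) \<le> Liminf (at_left 0) (\<lambda>h. ereal ((- f (- (- x + h)) - - f (- (- x))) / h))"
    by (rule Limsup_right_le_Liminf_left[where f = "\<lambda>y. - f (- y)" and x = "- x"]) (use gap2 in \<open>simp add: algebra_simps\<close>)
  moreover have "ereal ((- f (- (- x + h)) - - f (- (- x))) / h) = ?Q (- h)" for h by (simp add: field_simps minus_divide_left)
  ultimately have 2: "Limsup (at_right 0) (\<lambda>h. ?Q (- h)) \<le> Liminf (at_left 0) (\<lambda>h. ?Q (- h))"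
    by simp
  have l: "Liminf (at_right 0) ?Q = Liminf (at_left 0) (\<lambda>h. ?Q (- h))"
    using Liminf_filtermap_eq[of "uminus :: real \<Rightarrow> real" "at_left 0" ?Q] at_right_minus[of 0] by (simp add: inj_def)
  have r: "Limsup (at_left 0) ?Q = Limsup (at_right 0) (\<lambda>h. ?Q (- h))"
    using Limsup_filtermap_eq[of "uminus :: real \<Rightarrow> real" "at_right 0" ?Q] at_left_minus[of 0] by (simp add: inj_def)
  from 2 have 2: "Limsup (at_left 0) ?Q \<le> Liminf (at_right 0) ?Q"
    by (simp only: l r)
  let ?l = "Limsup (at_right 0) ?Q"
  have "Liminf (at_left 0) ?Q \<le> Limsup (at_left 0) ?Q" "Liminf (at_right 0) ?Q \<le> Limsup (at_right 0) ?Q"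
    by (rule Liminf_le_Limsup; simp)+
  with 1 2 have eqs: "Liminf (at_left 0) ?Q = ?l" "Limsup (at_left 0) ?Q = ?l" "Liminf (at_right 0) ?Q = ?l"
    by order+
  have "(?Q \<longlongrightarrow> ?l) (at_left 0)" "(?Q \<longlongrightarrow> ?l) (at_right 0)"
    using eqs by (simp_all add: tendsto_iff_Liminf_eq_Limsup)
  then have lim: "(?Q \<longlongrightarrow> ?l) (at 0)" by (rule filterlim_split_at)
  have "?Q h \<le> ereal C \<and> ereal (- C) \<le> ?Q h" if "h \<noteq> 0" for h
  proof -
    have "\<bar>(f (x + h) - f x) / h\<bar> \<le> C" using lip[of h] that by (simp add: abs_divide field_simps)
    then show ?thesis unfolding ereal_less_eq by linarith
  qed
  then have "eventually (\<lambda>h. ?Q h \<le> ereal C) (at 0)" "eventually (\<lambda>h. ereal (- C) \<le> ?Q h) (at 0)"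
    unfolding eventually_at_filter by (simp_all del: ereal_less_eq)
  then have "?l \<le> ereal C" "ereal (- C) \<le> ?l"
    using tendsto_upperbound[OF lim] tendsto_lowerbound[OF lim] by (auto simp: trivial_limit_at)
  then obtain D where "?l = ereal D" by (cases ?l) auto
  then have "((\<lambda>h. (f (x + h) - f x) / h) \<longlongrightarrow> D) (at 0)" using lim by simp
  then show ?thesis unfolding DERIV_def by blast
qed


text \<open>
  By translation invariance the measure of \<open>E\<close> is its average over the translates by \<open>t *\<^sub>R i\<close>,
  \<open>0 \<le> t \<le> 1\<close>; this replaces a choice of coordinates adapted to \<open>i\<close>.
\<close>

lemma null_set_if_null_on_lines:
  fixes i :: "'a::euclidean_space"
  assumes E: "E \<in> sets borel"
    and slices: "\<And>x. {t. x + t *\<^sub>R i \<in> E} \<in> null_sets lborel"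
  shows "E \<in> null_sets lborel"
proof -
  have [measurable]: "E \<in> sets borel" by fact
  have "emeasure lborel E = (\<integral>\<^sup>+t. emeasure lborel E * indicator {0..1::real} t \<partial>lborel)"
    by (simp add: nn_integral_cmult_indicator)
  also have "\<dots> = (\<integral>\<^sup>+t. (\<integral>\<^sup>+x. indicator E (x + t *\<^sub>R i) * indicator {0..1::real} t \<partial>lborel) \<partial>lborel)"
  proof (rule nn_integral_cong)
    fix t :: real
    have "(\<integral>\<^sup>+x. indicator E (x + t *\<^sub>R i) \<partial>lborel) = (\<integral>\<^sup>+x. indicator E x \<partial>distr lborel borel ((+) (t *\<^sub>R i)))"
      by (subst nn_integral_distr) (auto simp: add.commute)
    also have "\<dots> = emeasure lborel E" by (simp add: lborel_distr_plus)
    finally show "emeasure lborel E * indicator {0..1::real} t = (\<integral>\<^sup>+x. indicator E (x + t *\<^sub>R i) * indicator {0..1::real} t \<partial>lborel)"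
      by (subst nn_integral_multc) auto
  qed
  also have "\<dots> = (\<integral>\<^sup>+x. (\<integral>\<^sup>+t. indicator E (x + t *\<^sub>R i) * indicator {0..1::real} t \<partial>lborel) \<partial>lborel)"
    by (rule lborel_pair.Fubini') measurable
  also have "\<dots> = (\<integral>\<^sup>+(x::'a). 0 \<partial>lborel)"
  proof (rule nn_integral_cong)
    fix x :: 'a
    have "AE t in lborel. t \<notin> {t. x + t *\<^sub>R i \<in> E}" using slices by (rule AE_not_in)
    then show "(\<integral>\<^sup>+t. indicator E (x + t *\<^sub>R i) * indicator {0..1::real} t \<partial>lborel) = 0"
      by (subst nn_integral_0_iff_AE) (auto simp: indicator_def)
  qed
  finally show ?thesis using E by (simp add: null_sets_def)
qed

text \<open>
  The points where the lower left Dini derivative in direction \<open>i\<close> is below \<open>r\<close> and the upper right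
  one is above \<open>s\<close> (or equal to these bounds). If all these sets with \<open>r < s\<close>, for \<open>(i, h)\<close> and for
  \<open>(- i, - h)\<close>, miss \<open>x\<close>, then the four Dini derivatives at \<open>x\<close> agree.
\<close>

definition dini_gap :: "'a::euclidean_space \<Rightarrow> ('a \<Rightarrow> real) \<Rightarrow> real \<Rightarrow> real \<Rightarrow> 'a set" where
  "dini_gap i h r s = (\<Inter>n::nat. (\<Union>t\<in>{0<..<1 / Suc n}. {x. h x - h (x - t *\<^sub>R i) < r * t})
      \<inter> (\<Union>t\<in>{0<..<1 / Suc n}. {x. h (x + t *\<^sub>R i) - h x > s * t}))"

lemma mem_dini_gap_iff:
  "x \<in> dini_gap i h r s \<longleftrightarrow> (\<forall>n::nat. (\<exists>t\<in>{0<..<1 / Suc n}. h x - h (x - t *\<^sub>R i) < r * t) \<and>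
     (\<exists>t\<in>{0<..<1 / Suc n}. h (x + t *\<^sub>R i) - h x > s * t))"
  by (simp only: dini_gap_def mem_Collect_eq INT_iff Int_iff UN_iff UNIV_I simp_thms Ball_def)

text \<open>The unions run over uncountably many \<open>t\<close>, but for continuous
  \<open>h\<close> every member is open; only the countable intersection over \<open>n\<close>
  leaves the open sets.\<close>

lemma dini_gap_borel:
  fixes h :: "'a::euclidean_space \<Rightarrow> real"
  assumes "continuous_on UNIV h"
  shows "dini_gap i h r s \<in> sets borel"
proof -
  have c: "continuous_on UNIV (\<lambda>x. h (x + v))" "continuous_on UNIV (\<lambda>x. h (x - v))" for v
    by (rule continuous_on_compose2[OF assms]; auto intro: continuous_intros)+
  have "open {x. h x - h (x - t *\<^sub>R i) < r * t}" "open {x. h (x + t *\<^sub>R i) - h x > s * t}" for t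
    by (intro open_Collect_less continuous_on_diff continuous_on_const assms c)+
  then have "open (\<Union>t\<in>T. {x. h x - h (x - t *\<^sub>R i) < r * t})" "open (\<Union>t\<in>T. {x. h (x + t *\<^sub>R i) - h x > s * t})" for T
    by blast+
  then show ?thesis unfolding dini_gap_def by (intro sets.countable_INT'' sets.Int borel_open) auto
qed

lemma dini_gap_null:
  fixes h :: "'a::euclidean_space \<Rightarrow> real"
  assumes lip: "\<And>x y. \<bar>h x - h y\<bar> \<le> C * norm (x - y)" and "r < s"
  shows "dini_gap i h r s \<in> null_sets lborel"
proof -
  obtain b :: 'a where "b \<in> Basis" using nonempty_Basis by blast
  then have "C \<ge> 0" using lip[of 0 b] by simp
  then have "C-lipschitz_on UNIV h" using lip by (auto simp: lipschitz_on_def dist_norm)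
  then have cont: "continuous_on UNIV h" by (rule lipschitz_on_continuous_on)
  show ?thesis
  proof (rule null_set_if_null_on_lines[OF dini_gap_borel[OF cont], where i = i])
    fix x
    let ?f = "\<lambda>t. h (x + t *\<^sub>R i)"
    let ?E = "{t. x + t *\<^sub>R i \<in> dini_gap i h r s}"
    show "?E \<in> null_sets lborel"
    proof (rule null_dini_gap_real[where f = ?f, OF _ \<open>r < s\<close>])
      show "\<bar>?f t - ?f u\<bar> \<le> (C * norm i) * \<bar>t - u\<bar>" for t u
        using lip[of "x + t *\<^sub>R i" "x + u *\<^sub>R i"] by (simp flip: scaleR_diff_left add: mult_ac)
      have "(\<lambda>t. x + t *\<^sub>R i) -` dini_gap i h r s \<inter> space borel \<in> sets borel"
        by (rule measurable_sets[OF _ dini_gap_borel[OF cont]]) measurable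
      then show "?E \<in> sets borel" by (simp add: vimage_def)
      fix t \<delta> :: real assume t: "t \<in> ?E" "\<delta> > 0"
      obtain n where n: "1 / Suc n < \<delta>" using nat_approx_posE[OF \<open>\<delta> > 0\<close>] by blast
      have "(\<exists>u\<in>{0<..<1 / Suc n}. h (x + t *\<^sub>R i) - h (x + t *\<^sub>R i - u *\<^sub>R i) < r * u) \<and>
        (\<exists>u\<in>{0<..<1 / Suc n}. h (x + t *\<^sub>R i + u *\<^sub>R i) - h (x + t *\<^sub>R i) > s * u)"
        using t(1) by (simp only: mem_dini_gap_iff mem_Collect_eq)
      then obtain u v where "0 < u" "u < 1 / Suc n" "h (x + t *\<^sub>R i) - h (x + t *\<^sub>R i - u *\<^sub>R i) < r * u"
        "0 < v" "v < 1 / Suc n" "h (x + t *\<^sub>R i + v *\<^sub>R i) - h (x + t *\<^sub>R i) > s * v" by auto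
      then show "\<exists>h. 0 < h \<and> h < \<delta> \<and> ?f t - ?f (t - h) \<le> r * h" "\<exists>h. 0 < h \<and> h < \<delta> \<and> s * h \<le> ?f (t + h) - ?f t"
        using n by (intro exI[of _ u], simp add: algebra_simps, intro exI[of _ v], simp add: algebra_simps)
    qed
  qed
qed

text \<open>Rademacher's theorem in the form used below, one direction at a time. A point that
  avoids the countably many null gap sets with rational \<open>r < s\<close> has no gap between its
  Dini derivatives.\<close>

lemma lipschitz_AE_dir_diff:
  fixes h :: "'a::euclidean_space \<Rightarrow> real"
  assumes lip: "\<And>x y. \<bar>h x - h y\<bar> \<le> C * norm (x - y)"
  shows "AE x in lborel. dir_diff i h x"
proof -
  have null: "AE x in lborel. x \<notin> dini_gap j h r s" "AE x in lborel. x \<notin> dini_gap j (\<lambda>x. - h x) r s" if "r < s" for r s j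
  proof -
    have "\<bar>- h x - - h y\<bar> \<le> C * norm (x - y)" for x y using lip[of y x] by (simp add: norm_minus_commute)
    then show "AE x in lborel. x \<notin> dini_gap j (\<lambda>x. - h x) r s"
      by (intro AE_not_in dini_gap_null[OF _ that, where C = C])
    show "AE x in lborel. x \<notin> dini_gap j h r s" by (rule AE_not_in) (rule dini_gap_null[OF lip that])
  qed
  let ?RR = "{(r, s). r \<in> \<rat> \<and> s \<in> \<rat> \<and> r < (s::real)}"
  have "countable ?RR"
    by (rule countable_subset[of _ "\<rat> \<times> \<rat>"]) (auto intro: countable_rat)
  then have "AE x in lborel. \<forall>p\<in>?RR. x \<notin> dini_gap i h (fst p) (snd p) \<and> x \<notin> dini_gap (- i) (\<lambda>x. - h x) (fst p) (snd p)"
    by (subst AE_ball_countable) (auto intro!: null)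
  then show ?thesis
  proof eventually_elim
    case (elim x)
    have "\<exists>D. ((\<lambda>t. h (x + t *\<^sub>R i)) has_real_derivative D) (at 0)"
    proof (rule differentiable_if_no_dini_gap)
      show "\<bar>h (x + (0 + t) *\<^sub>R i) - h (x + 0 *\<^sub>R i)\<bar> \<le> (C * norm i) * \<bar>t\<bar>" for t
        using lip[of "x + t *\<^sub>R i" x] by (simp add: mult_ac)
    next
      fix r s :: real assume rs: "r < s" "r \<in> \<rat>" "s \<in> \<rat>"
      then have "x \<notin> dini_gap i h r s" using elim by auto
      then obtain n :: nat where "(\<forall>t\<in>{0<..<1 / Suc n}. \<not> h x - h (x - t *\<^sub>R i) < r * t) \<or> (\<forall>t\<in>{0<..<1 / Suc n}. \<not> h (x + t *\<^sub>R i) - h x > s * t)"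
        unfolding mem_dini_gap_iff by blast
      then show "\<exists>\<delta>>0. (\<forall>t. 0 < t \<and> t < \<delta> \<longrightarrow> r * t \<le> h (x + 0 *\<^sub>R i) - h (x + (0 - t) *\<^sub>R i)) \<or>
           (\<forall>t. 0 < t \<and> t < \<delta> \<longrightarrow> h (x + (0 + t) *\<^sub>R i) - h (x + 0 *\<^sub>R i) \<le> s * t)"
        by (intro exI[of _ "1 / Suc n"]) (auto simp: not_less)
    next
      fix r s :: real assume rs: "r < s" "r \<in> \<rat>" "s \<in> \<rat>"
      then have "x \<notin> dini_gap (- i) (\<lambda>x. - h x) r s" using elim by auto
      then obtain n :: nat where "(\<forall>t\<in>{0<..<1 / Suc n}. \<not> - h x - - h (x - t *\<^sub>R (- i)) < r * t) \<or> (\<forall>t\<in>{0<..<1 / Suc n}. \<not> - h (x + t *\<^sub>R (- i)) - - h x > s * t)"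
        unfolding mem_dini_gap_iff by blast
      then show "\<exists>\<delta>>0. (\<forall>t. 0 < t \<and> t < \<delta> \<longrightarrow> r * t \<le> h (x + (0 + t) *\<^sub>R i) - h (x + 0 *\<^sub>R i)) \<or>
           (\<forall>t. 0 < t \<and> t < \<delta> \<longrightarrow> h (x + 0 *\<^sub>R i) - h (x + (0 - t) *\<^sub>R i) \<le> s * t)"
        by (intro exI[of _ "1 / Suc n"]) (auto simp: not_less)
    qed
    then show ?case unfolding dir_diff_def .
  qed
qed

text \<open>Written for the sake of measurability: the difference quotients are compared with each
  other instead of with an unknown limit, the outer quantifiers are countable, and the inequality is
  not strict. For continuous \<open>h\<close> the uncountable quantifiers over \<open>s\<close> and
  \<open>t\<close> then intersect closed sets.\<close>

lemma dir_diff_iff_Cauchy: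
  "dir_diff i h x \<longleftrightarrow> (\<forall>k::nat. \<exists>m::nat. \<forall>s\<in>{s. s \<noteq> 0 \<and> \<bar>s\<bar> < 1 / Suc m}. \<forall>t\<in>{t. t \<noteq> 0 \<and> \<bar>t\<bar> < 1 / Suc m}.
     \<bar>(h (x + s *\<^sub>R i) - h x) / s - (h (x + t *\<^sub>R i) - h x) / t\<bar> \<le> 1 / Suc k)"
  (is "_ \<longleftrightarrow> (\<forall>k. \<exists>m. ?P k m)")
proof
  let ?Q = "\<lambda>s. (h (x + s *\<^sub>R i) - h x) / s"
  assume "dir_diff i h x"
  then obtain D where "(?Q \<longlongrightarrow> D) (at 0)" unfolding dir_diff_def DERIV_def by auto
  note lim = this
  show "\<forall>k. \<exists>m. ?P k m"
  proof
    fix k :: nat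
    have "eventually (\<lambda>s. dist (?Q s) D < 1 / Suc k / 2) (at 0)" by (rule tendstoD[OF lim]) simp
    then obtain d where d: "d > 0" "\<And>s. s \<noteq> 0 \<Longrightarrow> dist s 0 < d \<Longrightarrow> dist (?Q s) D < 1 / Suc k / 2"
      unfolding eventually_at by auto
    obtain m where m: "1 / Suc m < d" using nat_approx_posE[OF \<open>d > 0\<close>] by blast
    have "\<bar>?Q s - ?Q t\<bar> \<le> 1 / Suc k" if "s \<noteq> 0" "t \<noteq> 0" "\<bar>s\<bar> < 1 / Suc m" "\<bar>t\<bar> < 1 / Suc m" for s t
    proof -
      have "\<bar>?Q s - D\<bar> < 1 / Suc k / 2" "\<bar>?Q t - D\<bar> < 1 / Suc k / 2"
        using d(2)[of s] d(2)[of t] that m unfolding dist_real_def by auto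
      moreover have "\<bar>u - v\<bar> \<le> e" if "\<bar>u - D\<bar> < e / 2" "\<bar>v - D\<bar> < e / 2" for u v e :: real
        using that by linarith
      ultimately show ?thesis by blast
    qed
    then show "\<exists>m. ?P k m" by (intro exI[of _ m]) auto
  qed
next
  let ?Q = "\<lambda>s. (h (x + s *\<^sub>R i) - h x) / s"
  assume P: "\<forall>k. \<exists>m. ?P k m"
  have "Cauchy (\<lambda>n. ?Q (1 / Suc n))"
  proof (rule CauchyI')
    fix e :: real assume "e > 0"
    obtain k where k: "1 / Suc k < e" using nat_approx_posE[OF \<open>e > 0\<close>] by blast
    obtain m where m: "?P k m" using P by blast
    have "dist (?Q (1 / Suc a)) (?Q (1 / Suc b)) < e" if "Suc m \<le> a" "a < b" for a b
    proof -
      have "1 / Suc a < 1 / Suc m" "1 / Suc b < 1 / Suc m" using that by (auto simp: divide_simps)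
      then show ?thesis using m[THEN bspec, THEN bspec, of "1 / Suc a" "1 / Suc b"] k unfolding dist_real_def by simp
    qed
    then show "\<exists>M. \<forall>m\<ge>M. \<forall>n>m. dist (?Q (1 / Suc m)) (?Q (1 / Suc n)) < e" by blast
  qed
  then obtain D where D: "(\<lambda>n. ?Q (1 / Suc n)) \<longlonglongrightarrow> D"
    using Cauchy_convergent_iff convergent_def by blast
  have "(?Q \<longlongrightarrow> D) (at 0)"
  proof (rule tendstoI)
    fix e :: real assume "e > 0"
    obtain k where k: "1 / Suc k < e" using nat_approx_posE[OF \<open>e > 0\<close>] by blast
    obtain m where m: "?P k m" using P by blast
    have "dist (?Q s) D < e" if "s \<noteq> 0" "\<bar>s\<bar> < 1 / Suc m" for s
    proof -
      have "(\<lambda>n. \<bar>?Q s - ?Q (1 / Suc n)\<bar>) \<longlonglongrightarrow> \<bar>?Q s - D\<bar>" by (intro tendsto_intros D)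
      then have "\<bar>?Q s - D\<bar> \<le> 1 / Suc k"
      proof (rule LIMSEQ_le_const2)
        show "\<exists>N. \<forall>n\<ge>N. \<bar>?Q s - ?Q (1 / Suc n)\<bar> \<le> 1 / Suc k"
        proof (intro exI[of _ "Suc m"] allI impI)
          fix n assume "n \<ge> Suc m"
          then have "1 / Suc n < 1 / Suc m" by (auto simp: divide_simps)
          then show "\<bar>?Q s - ?Q (1 / Suc n)\<bar> \<le> 1 / Suc k" using m[THEN bspec, THEN bspec, of s "1 / Suc n"] that by simp
        qed
      qed
      then show ?thesis using k by (simp add: dist_real_def)
    qed
    then show "eventually (\<lambda>s. dist (?Q s) D < e) (at 0)"
      unfolding eventually_at by (intro exI[of _ "1 / Suc m"]) auto
  qed
  then show "dir_diff i h x" unfolding dir_diff_def DERIV_def by auto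
qed

lemma dir_diff_borel:
  fixes h :: "'a::euclidean_space \<Rightarrow> real"
  assumes cont: "continuous_on UNIV h"
  shows "{x. dir_diff i h x} \<in> sets borel"
proof -
  have "{x. dir_diff i h x} = (\<Inter>k::nat. \<Union>m::nat. \<Inter>s\<in>{s. s \<noteq> 0 \<and> \<bar>s\<bar> < 1 / Suc m}. \<Inter>t\<in>{t. t \<noteq> 0 \<and> \<bar>t\<bar> < 1 / Suc m}.
      {x. \<bar>(h (x + s *\<^sub>R i) - h x) / s - (h (x + t *\<^sub>R i) - h x) / t\<bar> \<le> 1 / Suc k})"
    by (rule set_eqI) (simp only: mem_Collect_eq INT_iff UN_iff dir_diff_iff_Cauchy UNIV_I Ball_def Bex_def simp_thms)
  also have "\<dots> \<in> sets borel"
  proof -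
    have c: "continuous_on UNIV (\<lambda>x. h (x + v))" for v
      by (rule continuous_on_compose2[OF assms]) (auto intro: continuous_intros)
    have "closed (\<Inter>s\<in>{s. s \<noteq> 0 \<and> \<bar>s\<bar> < 1 / Suc m}. \<Inter>t\<in>{t. t \<noteq> 0 \<and> \<bar>t\<bar> < 1 / Suc m}.
      {x. \<bar>(h (x + s *\<^sub>R i) - h x) / s - (h (x + t *\<^sub>R i) - h x) / t\<bar> \<le> 1 / Suc k})" for m k :: nat
    proof (intro closed_INT ballI)
      show "closed {x. \<bar>(h (x + s *\<^sub>R i) - h x) / s - (h (x + t *\<^sub>R i) - h x) / t\<bar> \<le> 1 / Suc k}"
        if "s \<in> {s. s \<noteq> 0 \<and> \<bar>s\<bar> < 1 / Suc m}" "t \<in> {t. t \<noteq> 0 \<and> \<bar>t\<bar> < 1 / Suc m}" for s t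
        using that by (intro closed_Collect_le continuous_on_rabs continuous_on_diff continuous_on_divide continuous_on_const assms c) auto
    qed
    then have cl: "(\<Inter>s\<in>{s. s \<noteq> 0 \<and> \<bar>s\<bar> < 1 / Suc m}. \<Inter>t\<in>{t. t \<noteq> 0 \<and> \<bar>t\<bar> < 1 / Suc m}.
      {x. \<bar>(h (x + s *\<^sub>R i) - h x) / s - (h (x + t *\<^sub>R i) - h x) / t\<bar> \<le> 1 / Suc k}) \<in> sets borel" for m k :: nat
      by (rule borel_closed)
    show ?thesis by (rule sets.countable_INT, rule image_subsetI, rule sets.countable_UN, rule image_subsetI, rule cl, rule UNIV_not_empty)
  qed
  finally show ?thesis .
qed

lemma partial_lim:
  assumes "dir_diff i h x"
  shows "(\<lambda>n. (h (x + (1 / Suc n) *\<^sub>R i) - h x) / (1 / Suc n)) \<longlonglongrightarrow> partial i h x"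
proof -
  have "((\<lambda>t. (h (x + t *\<^sub>R i) - h x) / t) \<longlongrightarrow> partial i h x) (at 0)"
    using assms unfolding dir_diff_iff_partial DERIV_def by simp
  moreover have "filterlim (\<lambda>n. 1 / real (Suc n)) (at 0) sequentially"
  proof -
    have "(\<lambda>n. 1 / real (Suc n)) \<longlonglongrightarrow> 0" using LIMSEQ_Suc[OF lim_1_over_n] by simp
    then show ?thesis by (simp add: filterlim_at)
  qed
  ultimately show ?thesis by (rule filterlim_compose)
qed

text \<open>
  Borel, not merely Lebesgue, measurability is needed: \<^const>\<open>boundary_measure\<close> is not complete, and
  the integral of a non-measurable function is \<open>0\<close> by convention. Where the derivative does not
  exist, \<^const>\<open>partial\<close> has a fixed junk value.
\<close>

lemma partial_borel_measurable:
  fixes h :: "'a::euclidean_space \<Rightarrow> real"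
  assumes cont: "continuous_on UNIV h"
  shows "partial i h \<in> borel_measurable borel"
proof -
  \<comment> \<open>Where no derivative exists, the predicate from which \<open>deriv\<close>
    chooses is constantly false, so the choice is this same number at all such points.\<close>
  define J where "J = (SOME D::real. False)"
  define B where "B = {x. dir_diff i h x}"
  have [measurable]: "B \<in> sets borel" unfolding B_def by (rule dir_diff_borel[OF cont])
  have [measurable]: "h \<in> borel_measurable borel" using cont by (rule borel_measurable_continuous_onI)
  define q where "q = (\<lambda>n x. if x \<in> B then (h (x + (1 / Suc n) *\<^sub>R i) - h x) / (1 / Suc n) else J)"
  have J: "partial i h x = J" if "x \<notin> B" for x
  proof -
    have "\<not> (\<exists>D. ((\<lambda>t. h (x + t *\<^sub>R i)) has_real_derivative D) (at 0))" using that unfolding B_def dir_diff_def by auto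
    then have "((\<lambda>t. h (x + t *\<^sub>R i)) has_real_derivative D) (at 0) = False" for D by blast
    then show ?thesis unfolding partial_def deriv_def J_def by (simp only:)
  qed
  have "(\<lambda>n. q n x) \<longlonglongrightarrow> partial i h x" for x
  proof (cases "dir_diff i h x")
    case True
    then show ?thesis using partial_lim[of i h x] by (simp only: q_def B_def mem_Collect_eq if_True)
  next
    case False
    then have "q n x = J" for n by (simp only: q_def B_def mem_Collect_eq if_False)
    moreover have "partial i h x = J" using J[of x] False by (simp only: B_def mem_Collect_eq not_False_eq_True)
    ultimately show ?thesis by (simp only: tendsto_const)
  qed
  moreover have "q n \<in> borel_measurable borel" for n unfolding q_def by measurable
  ultimately show ?thesis by (rule borel_measurable_LIMSEQ_real[where u = q])
qed

lemma partial_bound: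
  assumes "dir_diff i h x" and "eventually (\<lambda>t. \<bar>h (x + t *\<^sub>R i) - h x\<bar> \<le> M * \<bar>t\<bar>) (at 0)"
  shows "\<bar>partial i h x\<bar> \<le> M"
proof -
  have "((\<lambda>t. (h (x + t *\<^sub>R i) - h x) / t) \<longlongrightarrow> partial i h x) (at 0)"
    using assms(1) unfolding dir_diff_iff_partial DERIV_def by simp
  then have "((\<lambda>t. \<bar>(h (x + t *\<^sub>R i) - h x) / t\<bar>) \<longlongrightarrow> \<bar>partial i h x\<bar>) (at 0)" by (rule tendsto_rabs)
  moreover have "eventually (\<lambda>t. \<bar>(h (x + t *\<^sub>R i) - h x) / t\<bar> \<le> M) (at 0)"
    using assms(2) eventually_neq_at_within[of 0 0]
    by eventually_elim (simp add: pos_divide_le_eq)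
  ultimately show ?thesis by (rule tendsto_upperbound) simp
qed

lemma partial_bound_lipschitz:
  assumes "dir_diff i h x" and lip: "\<And>x y. \<bar>h x - h y\<bar> \<le> C * norm (x - y)"
  shows "\<bar>partial i h x\<bar> \<le> C * norm i"
proof (rule partial_bound[OF assms(1)], rule always_eventually, rule allI)
  show "\<bar>h (x + t *\<^sub>R i) - h x\<bar> \<le> C * norm i * \<bar>t\<bar>" for t
    using lip[of "x + t *\<^sub>R i" x] by (simp add: mult_ac)
qed

text \<open>By translation invariance every difference quotient of \<open>h\<close> has integral 0.
  The quotients are bounded by \<open>C * norm i\<close> on a fixed ball and converge almost
  everywhere, so dominated convergence transfers this to the derivative.\<close>

lemma integral_partial_eq_0:
  fixes h :: "'a::euclidean_space \<Rightarrow> real"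
  assumes lip: "\<And>x y. \<bar>h x - h y\<bar> \<le> C * norm (x - y)"
    and K: "compact K" "\<And>x. x \<notin> K \<Longrightarrow> h x = 0"
  shows "integrable lborel (partial i h)" "(LINT x|lborel. partial i h x) = 0"
proof -
  have cont: "continuous_on UNIV h"
  proof (cases "C \<ge> 0")
    case True
    then have "C-lipschitz_on UNIV h" using lip by (auto simp: lipschitz_on_def dist_norm)
    then show ?thesis by (rule lipschitz_on_continuous_on)
  next
    case False
    have "h x = h 0" for x using lip[of x 0] False mult_nonpos_nonneg[of C "norm (x - 0)"] by simp
    then have "h = (\<lambda>x. h 0)" by auto
    then show ?thesis by (metis continuous_on_const)
  qed
  have [measurable]: "h \<in> borel_measurable borel" using cont by (rule borel_measurable_continuous_onI)
  have [measurable]: "partial i h \<in> borel_measurable borel" by (rule partial_borel_measurable[OF cont])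
  obtain R where R: "\<And>x. x \<in> K \<Longrightarrow> norm x \<le> R" using compact_imp_bounded[OF K(1)] unfolding bounded_iff by auto
  define q where "q = (\<lambda>n x. (h (x + (1 / Suc n) *\<^sub>R i) - h x) / (1 / Suc n))"
  \<comment> \<open>The shifts have length at most \<open>norm i\<close>; outside the ball of radius
    \<open>R + norm i\<close> both \<open>h x\<close> and the shifted value vanish.\<close>
  define w where "w = (\<lambda>x. C * norm i * indicator (cball (0::'a) (R + norm i)) x)"
  have w: "integrable lborel w" unfolding w_def
    by (intro integrable_mult_right integrable_real_indicator emeasure_lborel_cball_finite) auto
  have hint: "integrable lborel h"
  proof -
    have "integrable lborel (\<lambda>x. indicator K x *\<^sub>R h x)"
      by (rule borel_integrable_compact[OF K(1) continuous_on_subset[OF cont]]) auto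
    moreover have "(\<lambda>x. indicator K x *\<^sub>R h x) = h"
      by (rule ext) (use K(2) in \<open>auto simp: indicator_def\<close>)
    ultimately show ?thesis by simp
  qed
  have trans: "integrable lborel (\<lambda>x. h (x + v)) \<and> (LINT x|lborel. h (x + v)) = (LINT x|lborel. h x)" for v
  proof -
    have "integrable (distr lborel borel ((+) v)) h" using hint by (simp add: lborel_distr_plus)
    then have "integrable lborel (\<lambda>x. h (v + x))" by (subst (asm) integrable_distr_eq) auto
    moreover have "(LINT x|distr lborel borel ((+) v). h x) = (LINT x|lborel. h (v + x))" by (rule integral_distr) auto
    ultimately show ?thesis by (simp add: lborel_distr_plus add.commute)
  qed
  have q0: "(LINT x|lborel. q n x) = 0" for n
    unfolding q_def using trans[of "(1 / Suc n) *\<^sub>R i"] hint by (simp add: Bochner_Integration.integral_diff)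
  have lim: "AE x in lborel. (\<lambda>n. q n x) \<longlonglongrightarrow> partial i h x"
    using lipschitz_AE_dir_diff[OF lip, of i] by eventually_elim (simp only: q_def partial_lim)
  have bnd: "AE x in lborel. norm (q n x) \<le> w x" for n
  proof (rule AE_I2)
    fix x
    have small: "norm ((1 / Suc n) *\<^sub>R i) \<le> norm i" by (simp add: divide_simps mult_le_cancel_left1)
    show "norm (q n x) \<le> w x"
    proof (cases "x \<in> cball 0 (R + norm i)")
      case True
      have "norm (q n x) = \<bar>h (x + (1 / Suc n) *\<^sub>R i) - h x\<bar> * Suc n" unfolding q_def by (simp add: abs_mult)
      also have "\<dots> \<le> C * norm ((1 / Suc n) *\<^sub>R i) * Suc n"
        using lip[of "x + (1 / Suc n) *\<^sub>R i" x] by (intro mult_right_mono) (auto simp del: norm_scaleR)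
      also have "\<dots> = C * norm i" by (simp add: field_simps)
      finally show ?thesis using True by (simp add: w_def)
    next
      case False
      then have "norm x > R + norm i" by simp
      then have "norm x > R" "norm (x + (1 / Suc n) *\<^sub>R i) > R"
        using norm_ge_zero[of i] small norm_diff_ineq[of x "(1 / Suc n) *\<^sub>R i"] by linarith+
      then have "h x = 0" "h (x + (1 / Suc n) *\<^sub>R i) = 0" using K(2) R by (meson not_le)+
      then show ?thesis using False by (simp add: q_def w_def)
    qed
  qed
  have qm [measurable]: "q n \<in> borel_measurable lborel" for n unfolding q_def by measurable
  show "integrable lborel (partial i h)"
    by (rule integrable_dominated_convergence[OF _ _ w lim bnd]) auto
  have "(\<lambda>n. LINT x|lborel. q n x) \<longlonglongrightarrow> (LINT x|lborel. partial i h x)"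
    by (rule integral_dominated_convergence[OF _ _ w lim bnd]) auto
  then show "(LINT x|lborel. partial i h x) = 0" using q0 by (simp add: LIMSEQ_const_iff)
qed

section \<open>Locally Lipschitz functions\<close>

text \<open>The balls are not cut down to \<open>U\<close>: the property speaks of full
  neighbourhoods of the points of \<open>U\<close>, and so it passes to unions.\<close>

definition loc_lip :: "'a::metric_space set \<Rightarrow> ('a \<Rightarrow> real) \<Rightarrow> bool" where
  "loc_lip U f \<longleftrightarrow> (\<forall>x\<in>U. \<exists>r>0. \<exists>C\<ge>0. \<forall>y\<in>ball x r. \<forall>z\<in>ball x r. \<bar>f y - f z\<bar> \<le> C * dist y z)"

lemma loc_lipE:
  assumes "loc_lip U f" "x \<in> U"
  obtains r C where "r > 0" "C \<ge> 0" "\<And>y z. dist x y < r \<Longrightarrow> dist x z < r \<Longrightarrow> \<bar>f y - f z\<bar> \<le> C * dist y z"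
  using assms unfolding loc_lip_def by (auto simp: mem_ball)

lemma loc_lipI:
  assumes "\<And>x. x \<in> U \<Longrightarrow> \<exists>r>0. \<exists>C\<ge>0. \<forall>y z. dist x y < r \<longrightarrow> dist x z < r \<longrightarrow> \<bar>f y - f z\<bar> \<le> C * dist y z"
  shows "loc_lip U f"
  unfolding loc_lip_def
proof
  fix x assume "x \<in> U"
  then obtain r C where *: "r > 0" "C \<ge> 0" "\<forall>y z. dist x y < r \<longrightarrow> dist x z < r \<longrightarrow> \<bar>f y - f z\<bar> \<le> C * dist y z"
    using assms by blast
  show "\<exists>r>0. \<exists>C\<ge>0. \<forall>y\<in>ball x r. \<forall>z\<in>ball x r. \<bar>f y - f z\<bar> \<le> C * dist y z"
    by (rule exI[of _ r], rule conjI, fact, rule exI[of _ C], rule conjI, fact) (use * in auto)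
qed

lemma loc_lip_lipschitz:
  assumes "\<And>x y. \<bar>f x - f y\<bar> \<le> C * dist x y"
  shows "loc_lip U f"
proof (rule loc_lipI)
  fix x
  have "\<bar>f y - f z\<bar> \<le> max C 0 * dist y z" for y z
    using assms[of y z] mult_right_mono[of C "max C 0" "dist y z"] by simp
  then show "\<exists>r>0. \<exists>C\<ge>0. \<forall>y z. dist x y < r \<longrightarrow> dist x z < r \<longrightarrow> \<bar>f y - f z\<bar> \<le> C * dist y z"
    by (intro exI[of _ 1] conjI exI[of _ "max C 0"]) auto
qed

lemma loc_lip_const: "loc_lip U (\<lambda>_. c)"
  by (rule loc_lip_lipschitz[where C = 0]) simp

lemma loc_lip_add:
  assumes "loc_lip U f" "loc_lip U g"
  shows "loc_lip U (\<lambda>x. f x + g x)"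
proof (rule loc_lipI)
  fix x assume x: "x \<in> U"
  obtain r C where f: "r > 0" "C \<ge> 0" "\<And>y z. dist x y < r \<Longrightarrow> dist x z < r \<Longrightarrow> \<bar>f y - f z\<bar> \<le> C * dist y z"
    using loc_lipE[OF assms(1) x] by metis
  obtain s D where g: "s > 0" "D \<ge> 0" "\<And>y z. dist x y < s \<Longrightarrow> dist x z < s \<Longrightarrow> \<bar>g y - g z\<bar> \<le> D * dist y z"
    using loc_lipE[OF assms(2) x] by metis
  have "\<bar>f y + g y - (f z + g z)\<bar> \<le> (C + D) * dist y z" if "dist x y < min r s" "dist x z < min r s" for y z
    using f(3)[of y z] g(3)[of y z] that by (simp add: distrib_right)
  then show "\<exists>r>0. \<exists>C\<ge>0. \<forall>y z. dist x y < r \<longrightarrow> dist x z < r \<longrightarrow> \<bar>f y + g y - (f z + g z)\<bar> \<le> C * dist y z"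
    using f g by (intro exI[of _ "min r s"] conjI exI[of _ "C + D"]) auto
qed

lemma loc_lip_mult:
  assumes "loc_lip U f" "loc_lip U g"
  shows "loc_lip U (\<lambda>x. f x * g x)"
proof (rule loc_lipI)
  fix x assume x: "x \<in> U"
  obtain r C where f: "r > 0" "C \<ge> 0" "\<And>y z. dist x y < r \<Longrightarrow> dist x z < r \<Longrightarrow> \<bar>f y - f z\<bar> \<le> C * dist y z"
    using loc_lipE[OF assms(1) x] by metis
  obtain s D where g: "s > 0" "D \<ge> 0" "\<And>y z. dist x y < s \<Longrightarrow> dist x z < s \<Longrightarrow> \<bar>g y - g z\<bar> \<le> D * dist y z"
    using loc_lipE[OF assms(2) x] by metis
  define M where "M = \<bar>f x\<bar> + C * r"
  define N where "N = \<bar>g x\<bar> + D * s"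
  have MN: "M \<ge> 0" "N \<ge> 0" using f g unfolding M_def N_def by auto
  have "\<bar>f y * g y - f z * g z\<bar> \<le> (M * D + N * C) * dist y z" if "dist x y < min r s" "dist x z < min r s" for y z
  proof -
    have "\<bar>f y - f x\<bar> \<le> C * dist y x" using f(3)[of y x] f(1) that by simp
    also have "\<dots> \<le> C * r" using that f by (intro mult_left_mono) (auto simp: dist_commute)
    finally have fy: "\<bar>f y\<bar> \<le> M" unfolding M_def by linarith
    have "\<bar>g z - g x\<bar> \<le> D * dist z x" using g(3)[of z x] g(1) that by simp
    also have "\<dots> \<le> D * s" using that g by (intro mult_left_mono) (auto simp: dist_commute)
    finally have gz: "\<bar>g z\<bar> \<le> N" unfolding N_def by linarith
    have "\<bar>f y * g y - f z * g z\<bar> = \<bar>f y * (g y - g z) + g z * (f y - f z)\<bar>" by (simp add: algebra_simps)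
    also have "\<dots> \<le> \<bar>f y\<bar> * \<bar>g y - g z\<bar> + \<bar>g z\<bar> * \<bar>f y - f z\<bar>" by (metis abs_mult abs_triangle_ineq)
    also have "\<dots> \<le> M * (D * dist y z) + N * (C * dist y z)"
      using fy gz f(3)[of y z] g(3)[of y z] that MN by (intro add_mono mult_mono) auto
    finally show ?thesis by (simp add: algebra_simps)
  qed
  then show "\<exists>r>0. \<exists>C\<ge>0. \<forall>y z. dist x y < r \<longrightarrow> dist x z < r \<longrightarrow> \<bar>f y * g y - f z * g z\<bar> \<le> C * dist y z"
    using f g MN by (intro exI[of _ "min r s"] conjI exI[of _ "M * D + N * C"]) auto
qed

lemma loc_lip_diff:
  assumes "loc_lip U f" "loc_lip U g"
  shows "loc_lip U (\<lambda>x. f x - g x)"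
  using loc_lip_add[OF assms(1) loc_lip_mult[OF loc_lip_const[of U "-1"] assms(2)]] by simp

lemma loc_lip_inverse:
  assumes "loc_lip U f" "\<And>x. x \<in> U \<Longrightarrow> f x \<noteq> 0"
  shows "loc_lip U (\<lambda>x. inverse (f x))"
proof (rule loc_lipI)
  fix x assume x: "x \<in> U"
  obtain r C where f: "r > 0" "C \<ge> 0" "\<And>y z. dist x y < r \<Longrightarrow> dist x z < r \<Longrightarrow> \<bar>f y - f z\<bar> \<le> C * dist y z"
    using loc_lipE[OF assms(1) x] by metis
  define m where "m = \<bar>f x\<bar> / 2"
  have m: "m > 0" using assms(2)[OF x] unfolding m_def by simp
  \<comment> \<open>Within this distance of \<open>x\<close> the function changes by at most
    \<open>m\<close>, half of \<open>\<bar>f x\<bar>\<close>, and thus stays away from 0.\<close>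
  define s where "s = min r (m / (C + 1))"
  have s: "s > 0" "s \<le> r" "C * s \<le> m"
  proof -
    show "s > 0" "s \<le> r" using f m unfolding s_def by auto
    have "C * s \<le> C * (m / (C + 1))" using f unfolding s_def by (intro mult_left_mono) auto
    also have "\<dots> \<le> m" using f m by (simp add: field_simps)
    finally show "C * s \<le> m" .
  qed
  have low: "m \<le> \<bar>f y\<bar>" if "dist x y < s" for y
  proof -
    have "\<bar>f y - f x\<bar> \<le> C * dist y x" using f(3)[of y x] f(1) that s by simp
    also have "\<dots> \<le> C * s" using that f by (intro mult_left_mono) (auto simp: dist_commute)
    finally show ?thesis using s(3) unfolding m_def by linarith
  qed
  have "\<bar>inverse (f y) - inverse (f z)\<bar> \<le> (C / (m * m)) * dist y z" if "dist x y < s" "dist x z < s" for y z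
  proof -
    have lo: "m \<le> \<bar>f y\<bar>" "m \<le> \<bar>f z\<bar>" using low that by auto
    then have "f y \<noteq> 0" "f z \<noteq> 0" using m by auto
    then have "\<bar>inverse (f y) - inverse (f z)\<bar> = \<bar>f y - f z\<bar> / (\<bar>f y\<bar> * \<bar>f z\<bar>)"
      by (simp add: inverse_diff_inverse abs_mult divide_inverse mult_ac abs_minus_commute)
    also have "\<dots> \<le> (C * dist y z) / (m * m)"
      using f(3)[of y z] that s lo m by (intro frac_le mult_mono) auto
    finally show ?thesis by simp
  qed
  then show "\<exists>r>0. \<exists>C\<ge>0. \<forall>y z. dist x y < r \<longrightarrow> dist x z < r \<longrightarrow> \<bar>inverse (f y) - inverse (f z)\<bar> \<le> C * dist y z"
    using f m s by (intro exI[of _ s] conjI exI[of _ "C / (m * m)"]) auto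
qed

lemma loc_lip_compose:
  assumes "loc_lip V f" "\<And>x y. dist (g x) (g y) \<le> L * dist x y" "\<And>x. x \<in> U \<Longrightarrow> g x \<in> V"
  shows "loc_lip U (\<lambda>x. f (g x))"
proof (rule loc_lipI)
  fix x assume x: "x \<in> U"
  obtain r C where f: "r > 0" "C \<ge> 0" "\<And>y z. dist (g x) y < r \<Longrightarrow> dist (g x) z < r \<Longrightarrow> \<bar>f y - f z\<bar> \<le> C * dist y z"
    using loc_lipE[OF assms(1) assms(3)[OF x]] by metis
  define M where "M = max L 0 + 1"
  have M: "M > 0" "dist (g y) (g z) \<le> M * dist y z" for y z
  proof -
    show "M > 0" unfolding M_def by simp
    have "L \<le> M" unfolding M_def by simp
    then show "dist (g y) (g z) \<le> M * dist y z"
      using assms(2)[of y z] mult_right_mono[of L M "dist y z"] by simp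
  qed
  have near: "dist (g x) (g y) < r" if "dist x y < r / M" for y
    using M(2)[of x y] mult_strict_left_mono[OF that M(1)] M(1) by simp
  have "\<bar>f (g y) - f (g z)\<bar> \<le> (C * M) * dist y z" if "dist x y < r / M" "dist x z < r / M" for y z
    using f(3)[OF near near, OF that] mult_left_mono[OF M(2)[of y z] f(2)] by (simp add: mult_ac)
  then show "\<exists>r>0. \<exists>C\<ge>0. \<forall>y z. dist x y < r \<longrightarrow> dist x z < r \<longrightarrow> \<bar>f (g y) - f (g z)\<bar> \<le> C * dist y z"
    using f M(1) by (intro exI[of _ "r / M"] conjI exI[of _ "C * M"]) auto
qed

lemma loc_lip_subset: "loc_lip U f \<Longrightarrow> V \<subseteq> U \<Longrightarrow> loc_lip V f"
  unfolding loc_lip_def by blast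

lemma loc_lip_open_cong:
  assumes "loc_lip U f" "open U" "\<And>x. x \<in> U \<Longrightarrow> g x = f x"
  shows "loc_lip U g"
proof (rule loc_lipI)
  fix x assume x: "x \<in> U"
  obtain r C where f: "r > 0" "C \<ge> 0" "\<And>y z. dist x y < r \<Longrightarrow> dist x z < r \<Longrightarrow> \<bar>f y - f z\<bar> \<le> C * dist y z"
    using loc_lipE[OF assms(1) x] by metis
  obtain s where s: "s > 0" "ball x s \<subseteq> U" using assms(2) x openE by blast
  have "\<bar>g y - g z\<bar> \<le> C * dist y z" if "dist x y < min r s" "dist x z < min r s" for y z
  proof -
    have "y \<in> U" "z \<in> U" using s(2) that by auto
    then show ?thesis using f(3)[of y z] that assms(3) by simp
  qed
  then show "\<exists>r>0. \<exists>C\<ge>0. \<forall>y z. dist x y < r \<longrightarrow> dist x z < r \<longrightarrow> \<bar>g y - g z\<bar> \<le> C * dist y z"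
    using f s by (intro exI[of _ "min r s"] conjI exI[of _ C]) auto
qed

lemma loc_lip_Un: "loc_lip U f \<Longrightarrow> loc_lip V f \<Longrightarrow> loc_lip (U \<union> V) f"
  unfolding loc_lip_def by blast

lemma loc_lip_continuous_on:
  assumes "loc_lip U f" shows "continuous_on U f"
  unfolding continuous_on_eq_continuous_within
proof
  fix x assume x: "x \<in> U"
  obtain r C where f: "r > 0" "C \<ge> 0" "\<And>y z. dist x y < r \<Longrightarrow> dist x z < r \<Longrightarrow> \<bar>f y - f z\<bar> \<le> C * dist y z"
    using loc_lipE[OF assms x] by metis
  have "isCont f x"
    unfolding continuous_at_eps_delta
  proof (intro allI impI)
    fix e :: real assume "e > 0"
    define d where "d = min r (e / (C + 1))"
    have "d > 0" using f \<open>e > 0\<close> unfolding d_def by auto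
    moreover have "dist (f y) (f x) < e" if "dist y x < d" for y
    proof -
      have "\<bar>f y - f x\<bar> \<le> C * dist y x" using f(3)[of y x] f(1) that unfolding d_def by (simp add: dist_commute)
      also have "\<dots> \<le> C * (e / (C + 1))" using that f unfolding d_def by (intro mult_left_mono) auto
      also have "\<dots> < e" using f \<open>e > 0\<close> by (simp add: field_simps)
      finally show ?thesis by (simp add: dist_real_def)
    qed
    ultimately show "\<exists>d>0. \<forall>x'. dist x' x < d \<longrightarrow> dist (f x') (f x) < e" by blast
  qed
  then show "continuous (at x within U) f" by (rule continuous_at_imp_continuous_at_within)
qed

text \<open>Otherwise there are pairs with difference quotient above \<open>n\<close>, one point of
  each lying in \<open>K\<close>. As \<open>f\<close> is bounded, the distances of the pairs tend to
  0, so both points come close to a limit point \<open>l\<close> in \<open>K\<close> along a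
  subsequence, against the Lipschitz bound near \<open>l\<close>.\<close>

lemma loc_lip_compact_support:
  fixes f :: "'a::metric_space \<Rightarrow> real"
  assumes f: "loc_lip UNIV f" and K: "compact K" "\<And>x. x \<notin> K \<Longrightarrow> f x = 0"
  shows "\<exists>C\<ge>0. \<forall>x y. \<bar>f x - f y\<bar> \<le> C * dist x y"
proof (rule ccontr)
  assume "\<not> ?thesis"
  then have "\<exists>x y. \<not> \<bar>f x - f y\<bar> \<le> real n * dist x y" for n :: nat by (meson of_nat_0_le_iff)
  then have "\<exists>x y. x \<in> K \<and> \<not> \<bar>f x - f y\<bar> \<le> real n * dist x y" for n :: nat
  proof -
    obtain x y where xy: "\<not> \<bar>f x - f y\<bar> \<le> real n * dist x y" using \<open>\<And>n. \<exists>x y. \<not> \<bar>f x - f y\<bar> \<le> real n * dist x y\<close> by blast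
    then have "x \<in> K \<or> y \<in> K" using K(2)[of x] K(2)[of y] by force
    then show ?thesis using xy by (metis abs_minus_commute dist_commute)
  qed
  then obtain X Y where XY: "\<And>n. X n \<in> K" "\<And>n. real n * dist (X n) (Y n) < \<bar>f (X n) - f (Y n)\<bar>"
    by (metis not_le)
  have cont: "continuous_on UNIV f" using f by (rule loc_lip_continuous_on)
  have "compact (f ` K)" using continuous_on_subset[OF cont] K(1) by (intro compact_continuous_image) auto
  then have "bounded (f ` K)" by (rule compact_imp_bounded)
  then obtain M where M: "\<And>x. x \<in> K \<Longrightarrow> \<bar>f x\<bar> \<le> M" by (auto simp: bounded_iff)
  have M0: "M \<ge> 0" using M[OF XY(1)[of 0]] by linarith
  have bd: "\<bar>f x\<bar> \<le> M" for x using M[of x] K(2)[of x] M0 by (cases "x \<in> K") auto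
  obtain l s where l: "l \<in> K" "strict_mono s" "(X \<circ> s) \<longlonglongrightarrow> l"
    using K(1) XY(1) unfolding compact_def by blast
  obtain r C where rC: "r > 0" "C \<ge> 0" "\<And>y z. dist l y < r \<Longrightarrow> dist l z < r \<Longrightarrow> \<bar>f y - f z\<bar> \<le> C * dist y z"
    using loc_lipE[OF f, of l] by (metis UNIV_I)
  obtain N1 where N1: "\<And>n. n \<ge> N1 \<Longrightarrow> dist (X (s n)) l < r / 2"
    using metric_LIMSEQ_D[OF l(3), of "r/2"] rC(1) by auto
  obtain N2 :: nat where N2: "real N2 > 4 * M / r" using reals_Archimedean2 by blast
  obtain N3 :: nat where N3: "real N3 > C" using reals_Archimedean2 by blast
  \<comment> \<open>Above \<open>4 * M / r\<close> the second point of the pair is within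
    \<open>r / 2\<close> of the first; above \<open>C\<close> the quotient violates the local bound
    at \<open>l\<close>.\<close>
  define n where "n = Suc (max N1 (max N2 N3))"
  have sn: "s n \<ge> n" using l(2) by (rule seq_suble)
  have n: "n \<ge> N1" "real (s n) > 4 * M / r" "real (s n) > C" "real (s n) > 0"
    using N2 N3 sn unfolding n_def by linarith+
  have "real (s n) * dist (X (s n)) (Y (s n)) < 2 * M"
    using XY(2)[of "s n"] bd[of "X (s n)"] bd[of "Y (s n)"] by linarith
  then have "dist (X (s n)) (Y (s n)) < 2 * M / real (s n)" using n(4) by (simp add: field_simps)
  also have "\<dots> \<le> r / 2" using n(2,4) rC(1) by (simp add: field_simps)
  finally have XYd: "dist (X (s n)) (Y (s n)) < r / 2" .
  have "dist l (X (s n)) < r" using N1[OF n(1)] rC(1) by (simp add: dist_commute)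
  moreover have "dist l (Y (s n)) < r" using XYd N1[OF n(1)] dist_triangle[of l "Y (s n)" "X (s n)"]
    by (simp add: dist_commute)
  ultimately have "\<bar>f (X (s n)) - f (Y (s n))\<bar> \<le> C * dist (X (s n)) (Y (s n))" by (rule rC(3))
  also have "\<dots> \<le> real (s n) * dist (X (s n)) (Y (s n))" using n(3) by (intro mult_right_mono) auto
  finally show False using XY(2)[of "s n"] by simp
qed

section \<open>Differentiation and integration by parts for locally Lipschitz functions\<close>

lemma dir_diff_open_cong:
  fixes x :: "'a::euclidean_space"
  assumes "open U" "x \<in> U" "\<And>y. y \<in> U \<Longrightarrow> f y = g y"
  shows "dir_diff i f x \<longleftrightarrow> dir_diff i g x" "partial i f x = partial i g x"
proof -
  have "eventually (\<lambda>t. x + t *\<^sub>R i \<in> U) (nhds (0::real))"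
  proof -
    have "((\<lambda>t. x + t *\<^sub>R i) \<longlongrightarrow> x + 0 *\<^sub>R i) (nhds 0)" by (intro tendsto_intros filterlim_ident)
    then show ?thesis using assms(1,2) by (auto simp: tendsto_def)
  qed
  then have ev: "eventually (\<lambda>t. f (x + t *\<^sub>R i) = g (x + t *\<^sub>R i)) (nhds 0)"
    by eventually_elim (rule assms(3))
  have iff: "((\<lambda>t. f (x + t *\<^sub>R i)) has_real_derivative D) (at 0) \<longleftrightarrow> ((\<lambda>t. g (x + t *\<^sub>R i)) has_real_derivative D) (at 0)" for D
    by (rule DERIV_cong_ev[OF refl ev refl])
  show "dir_diff i f x \<longleftrightarrow> dir_diff i g x" unfolding dir_diff_def by (simp only: iff)
  show "partial i f x = partial i g x" unfolding partial_def deriv_def by (simp only: iff)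
qed

lemma dir_diff_mult:
  assumes "dir_diff i f x" "dir_diff i g x"
  shows "dir_diff i (\<lambda>x. f x * g x) x" "partial i (\<lambda>x. f x * g x) x = partial i f x * g x + f x * partial i g x"
proof -
  have "((\<lambda>t. f (x + t *\<^sub>R i) * g (x + t *\<^sub>R i)) has_real_derivative
     partial i f x * g (x + 0 *\<^sub>R i) + partial i g x * f (x + 0 *\<^sub>R i)) (at 0)"
    using assms unfolding dir_diff_iff_partial by (rule DERIV_mult)
  then have *: "((\<lambda>t. f (x + t *\<^sub>R i) * g (x + t *\<^sub>R i)) has_real_derivative
     partial i f x * g x + f x * partial i g x) (at 0)" by (simp add: mult.commute)
  show "dir_diff i (\<lambda>x. f x * g x) x" unfolding dir_diff_def using * by blast
  show "partial i (\<lambda>x. f x * g x) x = partial i f x * g x + f x * partial i g x" using * by (rule partialI)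
qed

lemma partial_const: "partial i (\<lambda>_. c) x = 0"
  by (rule partialI) simp

text \<open>Near each point \<open>f\<close> coincides with a globally Lipschitz function, namely
  \<open>f\<close> composed with the nearest point projection onto a small closed ball, which does
  not increase distances. By Lindelof's theorem countably many such balls cover
  \<open>U\<close>.\<close>

lemma loc_lip_AE_dir_diff:
  fixes f :: "'a::euclidean_space \<Rightarrow> real"
  assumes f: "loc_lip U f" and "open U"
  shows "AE x in lborel. x \<in> U \<longrightarrow> dir_diff i f x"
proof -
  define \<F> where "\<F> = {B. open B \<and> B \<subseteq> U \<and> (AE x in lborel. x \<in> B \<longrightarrow> dir_diff i f x)}"
  have "\<exists>B\<in>\<F>. x \<in> B" if x: "x \<in> U" for x
  proof -
    obtain r C where rC: "r > 0" "C \<ge> 0" "\<And>y z. dist x y < r \<Longrightarrow> dist x z < r \<Longrightarrow> \<bar>f y - f z\<bar> \<le> C * dist y z"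
      using loc_lipE[OF f x] by metis
    obtain s where s: "s > 0" "ball x s \<subseteq> U" using \<open>open U\<close> x openE by blast
    define d where "d = min r s / 2"
    have d: "d > 0" "d < r" "d < s" using rC s unfolding d_def by auto
    let ?S = "cball x d"
    have S: "convex ?S" "closed ?S" "?S \<noteq> {}" using d by auto
    define g where "g y = f (closest_point ?S y)" for y
    have "\<bar>g y - g z\<bar> \<le> C * norm (y - z)" for y z
    proof -
      have "closest_point ?S y \<in> ?S" "closest_point ?S z \<in> ?S" using closest_point_in_set S by blast+
      then have "\<bar>g y - g z\<bar> \<le> C * dist (closest_point ?S y) (closest_point ?S z)"
        using d unfolding g_def by (intro rC(3)) (auto simp: mem_cball)
      also have "\<dots> \<le> C * dist y z" using S rC(2) by (intro mult_left_mono closest_point_lipschitz) auto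
      finally show ?thesis by (simp add: dist_norm)
    qed
    then have "AE y in lborel. dir_diff i g y" by (rule lipschitz_AE_dir_diff)
    then have "AE y in lborel. y \<in> ball x d \<longrightarrow> dir_diff i f y"
    proof eventually_elim
      case (elim y)
      show ?case
      proof
        assume y: "y \<in> ball x d"
        have "g z = f z" if "z \<in> ball x d" for z
          using that unfolding g_def by (subst closest_point_self) auto
        then show "dir_diff i f y" using dir_diff_open_cong(1)[OF open_ball y, of g f i] elim by blast
      qed
    qed
    moreover have "ball x d \<subseteq> U" using s d by auto
    ultimately have "ball x d \<in> \<F>" unfolding \<F>_def by auto
    then show ?thesis using d by (intro bexI[of _ "ball x d"]) auto
  qed
  then have U: "\<Union>\<F> = U" unfolding \<F>_def by blast
  obtain \<G> where G: "\<G> \<subseteq> \<F>" "countable \<G>" "\<Union>\<G> = \<Union>\<F>"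
    using Lindelof[of \<F>] unfolding \<F>_def by blast
  have "AE x in lborel. \<forall>B\<in>\<G>. x \<in> B \<longrightarrow> dir_diff i f x"
    using G(1,2) unfolding \<F>_def by (subst AE_ball_countable) auto
  then show ?thesis
    by eventually_elim (use G(3) U in blast)
qed

text \<open>The product is locally Lipschitz on \<open>U\<close>, and on \<open>- K\<close> because
  it vanishes there. These open sets cover the space, so the product is locally, and by compact
  support globally, Lipschitz, whatever \<open>u\<close> does at and beyond the boundary of
  \<open>U\<close>.\<close>

lemma integral_by_parts_compact_support:
  fixes u :: "'a::euclidean_space \<Rightarrow> real"
  assumes u: "loc_lip U u" and "open U"
    and \<phi>: "loc_lip UNIV \<phi>" and K: "compact K" "K \<subseteq> U" "\<And>x. x \<notin> K \<Longrightarrow> \<phi> x = 0"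
  shows "integrable lborel (\<lambda>x. partial i (\<lambda>x. u x * \<phi> x) x)"
    and "(LINT x|lborel. partial i (\<lambda>x. u x * \<phi> x) x) = 0"
    and "AE x in lborel. partial i (\<lambda>x. u x * \<phi> x) x = indicator U x * (partial i u x * \<phi> x + u x * partial i \<phi> x)"
proof -
  let ?h = "\<lambda>x. u x * \<phi> x"
  have "closed K" using K(1) by (rule compact_imp_closed)
  have "loc_lip U ?h" using u loc_lip_subset[OF \<phi>] by (intro loc_lip_mult) auto
  moreover have "loc_lip (- K) ?h"
    by (rule loc_lip_open_cong[OF loc_lip_const[of _ 0]]) (use \<open>closed K\<close> K in auto)
  ultimately have "loc_lip (U \<union> - K) ?h" by (rule loc_lip_Un)
  then have "loc_lip UNIV ?h" using K(2) by (elim loc_lip_subset) auto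
  then obtain C where C: "\<And>x y. \<bar>?h x - ?h y\<bar> \<le> C * dist x y"
    using loc_lip_compact_support[of ?h K] K by auto
  then have lip: "\<bar>?h x - ?h y\<bar> \<le> C * norm (x - y)" for x y by (simp add: dist_norm)
  show "integrable lborel (\<lambda>x. partial i ?h x)" "(LINT x|lborel. partial i ?h x) = 0"
    using integral_partial_eq_0[OF lip K(1)] K(3) by simp_all
  have "AE x in lborel. dir_diff i \<phi> x" using loc_lip_AE_dir_diff[OF \<phi>] by simp
  with loc_lip_AE_dir_diff[OF u \<open>open U\<close>, of i]
  show "AE x in lborel. partial i ?h x = indicator U x * (partial i u x * \<phi> x + u x * partial i \<phi> x)"
  proof eventually_elim
    case (elim x)
    show ?case
    proof (cases "x \<in> U")
      case True
      then show ?thesis using elim dir_diff_mult(2)[of i u x \<phi>] by simp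
    next
      case False
      then have "x \<in> - K" using K(2) by blast
      then have "partial i ?h x = partial i (\<lambda>_. 0) x"
        using \<open>closed K\<close> K(3) by (intro dir_diff_open_cong(2)[of "- K"]) auto
      then show ?thesis using False by (simp add: partial_const)
    qed
  qed
qed

lemma C1_compact_props:
  fixes \<psi> :: "'a::euclidean_space \<Rightarrow> real"
  assumes "\<psi> \<in> C1_compact"
  obtains K M where "compact K" "\<And>x. x \<notin> K \<Longrightarrow> \<psi> x = 0" "M \<ge> 0"
    "\<And>x. \<bar>\<psi> x\<bar> \<le> M" "\<And>x y. \<bar>\<psi> x - \<psi> y\<bar> \<le> M * norm (x - y)" "continuous_on UNIV \<psi>"
    "\<And>i x. i \<in> Basis \<Longrightarrow> dir_diff i \<psi> x" "\<And>i. i \<in> Basis \<Longrightarrow> continuous_on UNIV (partial i \<psi>)"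
    "\<And>i x. i \<in> Basis \<Longrightarrow> \<bar>partial i \<psi> x\<bar> \<le> M" "\<And>i x. x \<notin> K \<Longrightarrow> partial i \<psi> x = 0"
proof -
  obtain K where K: "compact K" "\<And>x. x \<notin> K \<Longrightarrow> \<psi> x = 0"
    using assms unfolding C1_compact_def by blast
  have diff: "\<psi> differentiable (at x)" for x using assms unfolding C1_compact_def by simp
  have pc: "continuous_on UNIV (partial i \<psi>)" if "i \<in> Basis" for i using assms that unfolding C1_compact_def by simp
  have cont: "continuous_on UNIV \<psi>"
    by (intro continuous_at_imp_continuous_on ballI differentiable_imp_continuous_within diff)
  have der: "((\<lambda>t. \<psi> (x + t *\<^sub>R i)) has_real_derivative \<psi>' i) (at 0)" if "(\<psi> has_derivative \<psi>') (at x)" for x i \<psi>'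
  proof -
    have "((\<lambda>t. x + t *\<^sub>R i) has_derivative (\<lambda>t. t *\<^sub>R i)) (at 0)" by (auto intro!: derivative_eq_intros)
    moreover have "(\<psi> has_derivative \<psi>') (at (x + 0 *\<^sub>R i))" using that by simp
    ultimately have "((\<lambda>t. \<psi> (x + t *\<^sub>R i)) has_derivative (\<lambda>t. \<psi>' (t *\<^sub>R i))) (at 0)"
      by (rule has_derivative_compose)
    moreover have "(\<lambda>t. \<psi>' (t *\<^sub>R i)) = (*) (\<psi>' i)"
      using has_derivative_linear[OF that] by (auto simp: linear_cmul)
    ultimately show ?thesis by (simp add: has_field_derivative_def)
  qed
  have dd: "dir_diff i \<psi> x" for i x using diff[of x] der unfolding differentiable_def dir_diff_def by blast
  have p0: "partial i \<psi> x = 0" if "x \<notin> K" for i x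
  proof -
    have "partial i \<psi> x = partial i (\<lambda>_. 0) x"
      by (rule dir_diff_open_cong(2)[of "- K"]) (use that K compact_imp_closed in auto)
    then show ?thesis by (simp add: partial_const)
  qed
  have bound: "\<exists>M\<ge>0. \<forall>x. \<bar>g x\<bar> \<le> M" if "continuous_on UNIV g" "\<And>x. x \<notin> K \<Longrightarrow> g x = 0" for g :: "'a \<Rightarrow> real"
  proof -
    have "compact (g ` K)" using continuous_on_subset[OF that(1)] K(1) by (intro compact_continuous_image) auto
    then have "bounded (g ` K)" by (rule compact_imp_bounded)
    then obtain M where M: "\<And>x. x \<in> K \<Longrightarrow> \<bar>g x\<bar> \<le> M" by (auto simp: bounded_iff)
    have "\<bar>g x\<bar> \<le> max M 0" for x using M[of x] that(2)[of x] by (cases "x \<in> K") auto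
    then show ?thesis by (intro exI[of _ "max M 0"]) auto
  qed
  obtain M0 where M0: "M0 \<ge> 0" "\<And>x. \<bar>\<psi> x\<bar> \<le> M0" using bound[OF cont K(2)] by blast
  have "\<forall>i\<in>Basis. \<exists>M\<ge>0. \<forall>x. \<bar>partial i \<psi> x\<bar> \<le> M" using bound[OF pc p0] by blast
  then obtain Mi where Mi: "\<And>i. i \<in> Basis \<Longrightarrow> Mi i \<ge> 0" "\<And>i x. i \<in> Basis \<Longrightarrow> \<bar>partial i \<psi> x\<bar> \<le> Mi i"
    by metis
  \<comment> \<open>Expanding a vector in coordinates shows that the sum of the coordinate bounds
    dominates the operator norm of the derivative; the mean value inequality makes it a Lipschitz
    constant.\<close>
  define M1 where "M1 = (\<Sum>i\<in>Basis. Mi i)"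
  have M1: "M1 \<ge> 0" "\<And>i. i \<in> Basis \<Longrightarrow> Mi i \<le> M1" unfolding M1_def using Mi(1)
    by (auto intro: sum_nonneg member_le_sum)
  have lip: "norm (\<psi> x - \<psi> y) \<le> M1 * norm (x - y)" for x y
  proof -
    have "\<forall>x. \<exists>D. (\<psi> has_derivative D) (at x)" using diff unfolding differentiable_def by blast
    then obtain D where D: "\<And>x. (\<psi> has_derivative D x) (at x)" by metis
    show ?thesis
    proof (rule differentiable_bound[of UNIV])
      show "(\<psi> has_derivative D x) (at x within UNIV)" for x using D by simp
      show "onorm (D x) \<le> M1" for x
      proof (rule onorm_bound)
        fix v :: 'a
        have lin: "linear (D x)" using D has_derivative_linear by blast
        have "D x v = D x (\<Sum>i\<in>Basis. (v \<bullet> i) *\<^sub>R i)" by (simp add: euclidean_representation)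
        also have "\<dots> = (\<Sum>i\<in>Basis. (v \<bullet> i) * D x i)"
          using lin by (simp add: linear_sum linear_cmul)
        finally have eq: "D x v = (\<Sum>i\<in>Basis. (v \<bullet> i) * D x i)" .
        have "norm (D x v) \<le> (\<Sum>i\<in>Basis. \<bar>(v \<bullet> i) * D x i\<bar>)" unfolding eq real_norm_def by (rule sum_abs)
        also have "\<dots> \<le> (\<Sum>i\<in>Basis. norm v * Mi i)"
        proof (rule sum_mono)
          fix i :: 'a assume i: "i \<in> Basis"
          have "D x i = partial i \<psi> x" using der[OF D] by (rule partialI[symmetric])
          then show "\<bar>(v \<bullet> i) * D x i\<bar> \<le> norm v * Mi i"
            using Mi(2)[OF i, of x] Basis_le_norm[OF i, of v] by (simp add: abs_mult mult_mono)
        qed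
        also have "\<dots> = M1 * norm v" unfolding M1_def by (simp add: sum_distrib_left mult.commute)
        finally show "norm (D x v) \<le> M1 * norm v" .
      qed (fact M1)
    qed auto
  qed
  show ?thesis
  proof (rule that[of K "max M0 M1"])
    show "\<bar>\<psi> x - \<psi> y\<bar> \<le> max M0 M1 * norm (x - y)" for x y
      using lip[of x y] mult_right_mono[of M1 "max M0 M1" "norm (x - y)"] by simp
    show "\<bar>partial i \<psi> x\<bar> \<le> max M0 M1" if "i \<in> Basis" for i x
      using Mi(2)[OF that, of x] M1(2)[OF that] by simp
  qed (use K M0 cont dd pc p0 in \<open>auto simp: le_max_iff_disj\<close>)
qed

section \<open>The boundary measure\<close>

text \<open>\<open>boundary_measure\<close> is given only by its values on sets. This lifts the
  splitting into two graphs from sets to functions, by induction over the construction of a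
  measurable function.\<close>

lemma nn_integral_sum_measure:
  assumes sets: "sets N = sets M1" "sets N = sets M2"
    and em: "\<And>A. A \<in> sets N \<Longrightarrow> emeasure N A = emeasure M1 A + emeasure M2 A"
    and f: "f \<in> borel_measurable N"
  shows "(\<integral>\<^sup>+x. f x \<partial>N) = (\<integral>\<^sup>+x. f x \<partial>M1) + (\<integral>\<^sup>+x. f x \<partial>M2)"
  using f
proof (induction rule: borel_measurable_induct)
  case (cong f g)
  have "space N = space M1" "space N = space M2" using sets by (auto dest: sets_eq_imp_space_eq)
  then show ?case using cong(3,4) by (metis (mono_tags, lifting) nn_integral_cong)
next
  case (set A)
  then show ?case using em sets by simp
next
  case (mult u c)
  then have "u \<in> borel_measurable M1" "u \<in> borel_measurable M2"
    using sets by (auto cong: measurable_cong_sets)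
  then show ?case using mult by (simp add: nn_integral_cmult distrib_left)
next
  case (add u v)
  then have "u \<in> borel_measurable M1" "u \<in> borel_measurable M2" "v \<in> borel_measurable M1" "v \<in> borel_measurable M2"
    using sets by (auto cong: measurable_cong_sets)
  then show ?case using add by (simp add: nn_integral_add ac_simps)
next
  case (seq U)
  then have m: "\<And>i. U i \<in> borel_measurable M1" "\<And>i. U i \<in> borel_measurable M2"
    using sets by (auto cong: measurable_cong_sets)
  have inc: "incseq (\<lambda>i. \<integral>\<^sup>+x. U i x \<partial>M)" for M
    using seq(3) by (auto simp: incseq_def le_fun_def intro!: nn_integral_mono)
  have SU: "Sup (range U) = (\<lambda>x. SUP i. U i x)" by (rule ext) (simp add: image_comp)
  have "(\<integral>\<^sup>+x. (SUP i. U i x) \<partial>N) = (SUP i. \<integral>\<^sup>+x. U i x \<partial>N)"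
    using seq by (intro nn_integral_monotone_convergence_SUP) auto
  also have "\<dots> = (SUP i. (\<integral>\<^sup>+x. U i x \<partial>M1) + (\<integral>\<^sup>+x. U i x \<partial>M2))" using seq by simp
  also have "\<dots> = (SUP i. \<integral>\<^sup>+x. U i x \<partial>M1) + (SUP i. \<integral>\<^sup>+x. U i x \<partial>M2)"
    by (rule ennreal_SUP_add[OF inc inc])
  also have "(SUP i. \<integral>\<^sup>+x. U i x \<partial>M1) = (\<integral>\<^sup>+x. (SUP i. U i x) \<partial>M1)"
    using seq(3) m by (intro nn_integral_monotone_convergence_SUP[symmetric]) auto
  also have "(SUP i. \<integral>\<^sup>+x. U i x \<partial>M2) = (\<integral>\<^sup>+x. (SUP i. U i x) \<partial>M2)"
    using seq(3) m by (intro nn_integral_monotone_convergence_SUP[symmetric]) auto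
  finally show ?case unfolding SU .
qed

lemma integral_sum_measure:
  fixes f :: "'b \<Rightarrow> real"
  assumes sets: "sets N = sets M1" "sets N = sets M2"
    and em: "\<And>A. A \<in> sets N \<Longrightarrow> emeasure N A = emeasure M1 A + emeasure M2 A"
    and f: "integrable M1 f" "integrable M2 f"
  shows "integrable N f" "(LINT x|N. f x) = (LINT x|M1. f x) + (LINT x|M2. f x)"
proof -
  have m: "f \<in> borel_measurable N"
    using borel_measurable_integrable[OF f(1)] sets by (auto cong: measurable_cong_sets)
  note nn = nn_integral_sum_measure[OF sets em]
  have fin: "(\<integral>\<^sup>+x. ennreal (norm (f x)) \<partial>M1) < \<infinity>" "(\<integral>\<^sup>+x. ennreal (norm (f x)) \<partial>M2) < \<infinity>"
    using f by (auto simp: integrable_iff_bounded)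
  show N: "integrable N f"
    unfolding integrable_iff_bounded using m fin by (subst nn) auto
  have le: "(\<integral>\<^sup>+x. ennreal (f x) \<partial>M) < top" "(\<integral>\<^sup>+x. ennreal (- f x) \<partial>M) < top" if "integrable M f" for M :: "'b measure"
  proof -
    have "(\<integral>\<^sup>+x. ennreal (norm (f x)) \<partial>M) < top" using that by (auto simp: integrable_iff_bounded)
    moreover have "(\<integral>\<^sup>+x. ennreal (f x) \<partial>M) \<le> (\<integral>\<^sup>+x. ennreal (norm (f x)) \<partial>M)" "(\<integral>\<^sup>+x. ennreal (- f x) \<partial>M) \<le> (\<integral>\<^sup>+x. ennreal (norm (f x)) \<partial>M)"
      by (auto intro!: nn_integral_mono ennreal_leI)
    ultimately show "(\<integral>\<^sup>+x. ennreal (f x) \<partial>M) < top" "(\<integral>\<^sup>+x. ennreal (- f x) \<partial>M) < top" by auto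
  qed
  have "(\<integral>\<^sup>+x. ennreal (f x) \<partial>N) = (\<integral>\<^sup>+x. ennreal (f x) \<partial>M1) + (\<integral>\<^sup>+x. ennreal (f x) \<partial>M2)"
    "(\<integral>\<^sup>+x. ennreal (- f x) \<partial>N) = (\<integral>\<^sup>+x. ennreal (- f x) \<partial>M1) + (\<integral>\<^sup>+x. ennreal (- f x) \<partial>M2)"
    using m by (auto intro!: nn)
  then show "(LINT x|N. f x) = (LINT x|M1. f x) + (LINT x|M2. f x)"
    using le[OF f(1)] le[OF f(2)]
    by (simp add: real_lebesgue_integral_def N f enn2real_plus)
qed

definition area :: "('a::euclidean_space \<Rightarrow> real) \<Rightarrow> 'a \<Rightarrow> real" where
  "area \<eta> y = sqrt (1 + (norm (grad \<eta> y))\<^sup>2)"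

text \<open>One graph's share of \<open>boundary_measure\<close>, written as a push-forward of a
  density, so that integrals with respect to it reduce to weighted integrals over the base.\<close>

definition graph_measure :: "('a::euclidean_space \<Rightarrow> real) \<Rightarrow> ('a \<times> real) measure" where
  "graph_measure \<eta> = distr (density lborel (\<lambda>y. ennreal (area \<eta> y))) borel (\<lambda>y. (y, \<eta> y))"

lemma area_ge_1: "area \<eta> y \<ge> 1"
  unfolding area_def by simp

lemma grad_borel:
  assumes "continuous_on UNIV \<eta>"
  shows "grad \<eta> \<in> borel_measurable borel"
  unfolding grad_def[abs_def] using partial_borel_measurable[OF assms] by measurable

lemma area_borel:
  assumes "continuous_on UNIV \<eta>"
  shows "area \<eta> \<in> borel_measurable borel"
proof -
  have [measurable]: "grad \<eta> \<in> borel_measurable borel" by (rule grad_borel[OF assms])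
  show ?thesis unfolding area_def[abs_def] by measurable
qed

lemma graph_map_measurable:
  assumes "continuous_on UNIV (\<eta> :: 'a::euclidean_space \<Rightarrow> real)"
  shows "(\<lambda>y. (y, \<eta> y)) \<in> borel_measurable borel"
  by (intro borel_measurable_continuous_onI continuous_on_Pair continuous_on_id assms)

lemma sets_graph_measure [simp]: "sets (graph_measure \<eta>) = sets borel"
  by (simp add: graph_measure_def)

lemma nn_integral_graph_measure:
  assumes c: "continuous_on UNIV \<eta>" and [measurable]: "f \<in> borel_measurable borel"
  shows "(\<integral>\<^sup>+x. f x \<partial>graph_measure \<eta>) = (\<integral>\<^sup>+y. ennreal (area \<eta> y) * f (y, \<eta> y) \<partial>lborel)"
proof -
  have [measurable]: "(\<lambda>y. (y, \<eta> y)) \<in> borel_measurable borel" by (rule graph_map_measurable[OF c])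
  have [measurable]: "area \<eta> \<in> borel_measurable borel" by (rule area_borel[OF c])
  have [measurable]: "(\<lambda>y. f (y, \<eta> y)) \<in> borel_measurable borel"
    using measurable_compose[OF graph_map_measurable[OF c] assms(2)] .
  show ?thesis unfolding graph_measure_def
    by (subst nn_integral_distr) (auto simp: nn_integral_density)
qed

lemma integral_graph_measure:
  fixes f :: "'a::euclidean_space \<times> real \<Rightarrow> real"
  assumes c: "continuous_on UNIV \<eta>" and [measurable]: "f \<in> borel_measurable borel"
  shows "integrable (graph_measure \<eta>) f \<longleftrightarrow> integrable lborel (\<lambda>y. area \<eta> y * f (y, \<eta> y))"
    and "(LINT x|graph_measure \<eta>. f x) = (LINT y|lborel. area \<eta> y * f (y, \<eta> y))"
proof -
  have [measurable]: "(\<lambda>y. (y, \<eta> y)) \<in> borel_measurable borel" by (rule graph_map_measurable[OF c])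
  have [measurable]: "area \<eta> \<in> borel_measurable borel" by (rule area_borel[OF c])
  have [measurable]: "(\<lambda>y. f (y, \<eta> y)) \<in> borel_measurable borel"
    using measurable_compose[OF graph_map_measurable[OF c] assms(2)] .
  have pos: "0 \<le> area \<eta> y" for y using area_ge_1[of \<eta> y] by linarith
  show "integrable (graph_measure \<eta>) f \<longleftrightarrow> integrable lborel (\<lambda>y. area \<eta> y * f (y, \<eta> y))"
    unfolding graph_measure_def
    by (subst integrable_distr_eq) (auto simp: integrable_density pos)
  show "(LINT x|graph_measure \<eta>. f x) = (LINT y|lborel. area \<eta> y * f (y, \<eta> y))"
    unfolding graph_measure_def
    by (subst integral_distr) (auto simp: integral_density pos)
qed

text \<open>\<open>measure_of\<close> yields the zero measure unless its set function is countably
  additive. Hence the defining formula becomes available only after that has been shown; additivity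
  is inherited from the two graph measures.\<close>

lemma boundary_measure_emeasure:
  assumes c: "continuous_on UNIV \<eta>m" "continuous_on UNIV \<eta>p"
  shows "sets (boundary_measure \<eta>m \<eta>p) = sets borel"
    and "A \<in> sets borel \<Longrightarrow> emeasure (boundary_measure \<eta>m \<eta>p) A = emeasure (graph_measure \<eta>m) A + emeasure (graph_measure \<eta>p) A"
proof -
  define \<mu> where "\<mu> = (\<lambda>A. (\<integral>\<^sup>+y. indicator A (y, \<eta>m y) * ennreal (sqrt (1 + (norm (grad \<eta>m y))\<^sup>2)) \<partial>lebesgue) +
     (\<integral>\<^sup>+y. indicator A (y, \<eta>p y) * ennreal (sqrt (1 + (norm (grad \<eta>p y))\<^sup>2)) \<partial>lebesgue))"
  have bm: "boundary_measure \<eta>m \<eta>p = measure_of UNIV (sets borel) \<mu>"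
    unfolding boundary_measure_def \<mu>_def ..
  have g: "emeasure (graph_measure \<eta>) A = (\<integral>\<^sup>+y. indicator A (y, \<eta> y) * ennreal (sqrt (1 + (norm (grad \<eta> y))\<^sup>2)) \<partial>lebesgue)"
    if "A \<in> sets borel" "continuous_on UNIV \<eta>" for A and \<eta> :: "'a \<Rightarrow> real"
  proof -
    have "emeasure (graph_measure \<eta>) A = (\<integral>\<^sup>+x. indicator A x \<partial>graph_measure \<eta>)" using that by simp
    also have "\<dots> = (\<integral>\<^sup>+y. ennreal (area \<eta> y) * indicator A (y, \<eta> y) \<partial>lborel)"
      using that by (intro nn_integral_graph_measure) auto
    finally show ?thesis by (simp add: nn_integral_completion area_def mult.commute)
  qed
  have \<mu>: "\<mu> A = emeasure (graph_measure \<eta>m) A + emeasure (graph_measure \<eta>p) A" if "A \<in> sets borel" for A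
    unfolding \<mu>_def using g[OF that c(1)] g[OF that c(2)] by simp
  have sa: "sigma_algebra UNIV (sets (borel :: ('a \<times> real) measure))"
    using sets.sigma_algebra_axioms[of borel] by simp
  show sb: "sets (boundary_measure \<eta>m \<eta>p) = sets borel"
    unfolding bm using sa sets.sigma_sets_eq[of "borel :: ('a \<times> real) measure"] by (simp add: sigma_algebra.sets_measure_of_eq)
  show "emeasure (boundary_measure \<eta>m \<eta>p) A = emeasure (graph_measure \<eta>m) A + emeasure (graph_measure \<eta>p) A" if A: "A \<in> sets borel" for A
  proof -
    have "emeasure (boundary_measure \<eta>m \<eta>p) A = \<mu> A"
    proof (rule emeasure_measure_of[OF bm])
      show "positive (sets (boundary_measure \<eta>m \<eta>p)) \<mu>" unfolding positive_def sb by (simp add: \<mu>)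
      show "countably_additive (sets (boundary_measure \<eta>m \<eta>p)) \<mu>"
        unfolding countably_additive_def sb
      proof (intro allI impI)
        fix A :: "nat \<Rightarrow> ('a \<times> real) set"
        assume A: "range A \<subseteq> sets borel" "disjoint_family A" "\<Union> (range A) \<in> sets borel"
        have "(\<Sum>i. \<mu> (A i)) = (\<Sum>i. emeasure (graph_measure \<eta>m) (A i) + emeasure (graph_measure \<eta>p) (A i))"
          using A(1) by (simp add: \<mu> range_subsetD)
        also have "\<dots> = (\<Sum>i. emeasure (graph_measure \<eta>m) (A i)) + (\<Sum>i. emeasure (graph_measure \<eta>p) (A i))"
          by (rule suminf_add[symmetric]) auto
        also have "\<dots> = \<mu> (\<Union> (range A))"
          using A by (simp add: \<mu> suminf_emeasure)
        finally show "(\<Sum>i. \<mu> (A i)) = \<mu> (\<Union> (range A))" .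
      qed
    qed (use A sb in \<open>auto simp: sets.sets_into_space\<close>)
    then show ?thesis using \<mu>[OF A] by simp
  qed
qed

lemma nn_integral_boundary_measure:
  assumes c: "continuous_on UNIV \<eta>m" "continuous_on UNIV \<eta>p" and f: "f \<in> borel_measurable borel"
  shows "(\<integral>\<^sup>+x. f x \<partial>boundary_measure \<eta>m \<eta>p) =
     (\<integral>\<^sup>+y. ennreal (area \<eta>m y) * f (y, \<eta>m y) \<partial>lborel) + (\<integral>\<^sup>+y. ennreal (area \<eta>p y) * f (y, \<eta>p y) \<partial>lborel)"
proof -
  have "f \<in> borel_measurable (boundary_measure \<eta>m \<eta>p)"
    using f boundary_measure_emeasure(1)[OF c] by (auto cong: measurable_cong_sets)
  then show ?thesis
    using nn_integral_sum_measure[of "boundary_measure \<eta>m \<eta>p" "graph_measure \<eta>m" "graph_measure \<eta>p" f]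
      boundary_measure_emeasure[OF c] by (simp add: nn_integral_graph_measure c f)
qed

lemma integral_boundary_measure:
  fixes f :: "'a::euclidean_space \<times> real \<Rightarrow> real"
  assumes c: "continuous_on UNIV \<eta>m" "continuous_on UNIV \<eta>p" and f: "f \<in> borel_measurable borel"
    and i: "integrable lborel (\<lambda>y. area \<eta>m y * f (y, \<eta>m y))" "integrable lborel (\<lambda>y. area \<eta>p y * f (y, \<eta>p y))"
  shows "(LINT x|boundary_measure \<eta>m \<eta>p. f x) =
     (LINT y|lborel. area \<eta>m y * f (y, \<eta>m y)) + (LINT y|lborel. area \<eta>p y * f (y, \<eta>p y))"
  using integral_sum_measure(2)[of "boundary_measure \<eta>m \<eta>p" "graph_measure \<eta>m" "graph_measure \<eta>p" f]
    boundary_measure_emeasure[OF c] i by (simp add: integral_graph_measure c f)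

text \<open>The set of bad points is enclosed in a Borel set: the cylinder over a Borel null set of
  the base, together with everything off the two graphs. Both parts have boundary measure 0.\<close>

lemma AE_boundary_measure:
  assumes c: "continuous_on UNIV \<eta>m" "continuous_on UNIV \<eta>p"
    and P: "AE y in lborel. P (y, \<eta>m y) \<and> P (y, \<eta>p y)"
  shows "AE x in boundary_measure \<eta>m \<eta>p. P x"
proof -
  obtain N where N: "{y \<in> space lborel. \<not> (P (y, \<eta>m y) \<and> P (y, \<eta>p y))} \<subseteq> N" "emeasure lborel N = 0" "N \<in> sets lborel"
    using P by (rule AE_E)
  have [measurable]: "N \<in> sets borel" using N(3) by simp
  have [measurable]: "\<eta>m \<in> borel_measurable borel" "\<eta>p \<in> borel_measurable borel"
    using c by (auto intro: borel_measurable_continuous_onI)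
  define A where "A = {x. fst x \<in> N \<or> (snd x \<noteq> \<eta>m (fst x) \<and> snd x \<noteq> \<eta>p (fst x))}"
  have A: "A \<in> sets borel"
  proof -
    have "{x \<in> space (borel \<Otimes>\<^sub>M borel). fst x \<in> N \<or> (snd x \<noteq> \<eta>m (fst x) \<and> snd x \<noteq> \<eta>p (fst x))} \<in> sets (borel \<Otimes>\<^sub>M borel)"
      by measurable
    then show ?thesis unfolding A_def borel_prod by simp
  qed
  have AE0: "AE y in lborel. y \<notin> N" using N by (intro AE_not_in) auto
  have "emeasure (boundary_measure \<eta>m \<eta>p) A = (\<integral>\<^sup>+x. indicator A x \<partial>boundary_measure \<eta>m \<eta>p)"
    using A boundary_measure_emeasure(1)[OF c] by simp
  also have "\<dots> = (\<integral>\<^sup>+y. ennreal (area \<eta>m y) * indicator A (y, \<eta>m y) \<partial>lborel) + (\<integral>\<^sup>+y. ennreal (area \<eta>p y) * indicator A (y, \<eta>p y) \<partial>lborel)"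
    using A by (intro nn_integral_boundary_measure c) auto
  also have "(\<integral>\<^sup>+y. ennreal (area \<eta>m y) * indicator A (y, \<eta>m y) \<partial>lborel) = (\<integral>\<^sup>+(y::'a). 0 \<partial>lborel)"
    using AE0 by (intro nn_integral_cong_AE) (auto simp: A_def)
  also have "(\<integral>\<^sup>+y. ennreal (area \<eta>p y) * indicator A (y, \<eta>p y) \<partial>lborel) = (\<integral>\<^sup>+(y::'a). 0 \<partial>lborel)"
    using AE0 by (intro nn_integral_cong_AE) (auto simp: A_def)
  finally have "emeasure (boundary_measure \<eta>m \<eta>p) A = 0" by simp
  then have "A \<in> null_sets (boundary_measure \<eta>m \<eta>p)"
    using A boundary_measure_emeasure(1)[OF c] by (simp add: null_sets_def)
  then show ?thesis
  proof (rule AE_I')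
    show "{x \<in> space (boundary_measure \<eta>m \<eta>p). \<not> P x} \<subseteq> A"
    proof
      fix x assume x: "x \<in> {x \<in> space (boundary_measure \<eta>m \<eta>p). \<not> P x}"
      show "x \<in> A"
      proof (rule ccontr)
        assume "x \<notin> A"
        then have "fst x \<notin> N" "snd x = \<eta>m (fst x) \<or> snd x = \<eta>p (fst x)" unfolding A_def by auto
        then have "P (fst x, \<eta>m (fst x)) \<and> P (fst x, \<eta>p (fst x))" using N(1) by auto
        then have "P x" using \<open>snd x = \<eta>m (fst x) \<or> snd x = \<eta>p (fst x)\<close> by (metis prod.collapse)
        then show False using x by simp
      qed
    qed
  qed
qed

section \<open>Layers along a graph\<close>

lemma fst_borel [measurable]: "fst \<in> borel_measurable (borel :: ('a::euclidean_space \<times> real) measure)"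
  by (intro borel_measurable_continuous_onI continuous_intros)

lemma snd_borel [measurable]: "snd \<in> borel_measurable (borel :: ('a::euclidean_space \<times> real) measure)"
  by (intro borel_measurable_continuous_onI continuous_intros)

lemma nn_integral_lborel_prod:
  fixes h :: "'a::euclidean_space \<times> real \<Rightarrow> ennreal"
  assumes "h \<in> borel_measurable borel"
  shows "(\<integral>\<^sup>+X. h X \<partial>lborel) = (\<integral>\<^sup>+x. (\<integral>\<^sup>+t. h (x, t) \<partial>lborel) \<partial>lborel)"
  using lborel.nn_integral_fst[of h lborel] assms by (simp add: lborel_prod)

lemma integral_lborel_prod:
  fixes h :: "'a::euclidean_space \<times> real \<Rightarrow> real"
  assumes "integrable lborel h"
  shows "(LINT X|lborel. h X) = (LINT x|lborel. (LINT t|lborel. h (x, t)))"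
  using lborel_pair.integral_fst'[of h] assms by (simp add: lborel_prod)

text \<open>Every vertical line meets the graph in one point, so Tonelli's theorem applies. Used for
  the shifted graphs on which the cutoffs have their kinks.\<close>

lemma AE_graph:
  fixes \<eta> :: "'a::euclidean_space \<Rightarrow> real"
  assumes [measurable]: "\<eta> \<in> borel_measurable borel"
  shows "AE X in lborel. snd X \<noteq> \<eta> (fst X)"
proof -
  have m: "{X. snd X = \<eta> (fst X)} \<in> sets borel"
  proof -
    have "{X \<in> space borel. snd X = \<eta> (fst X)} \<in> sets borel" by measurable
    then show ?thesis by simp
  qed
  then have "emeasure lborel {X. snd X = \<eta> (fst X)} = (\<integral>\<^sup>+X. indicator {X. snd X = \<eta> (fst X)} X \<partial>lborel)" by simp
  also have "\<dots> = (\<integral>\<^sup>+x. (\<integral>\<^sup>+t. indicator {X. snd X = \<eta> (fst X)} (x, t) \<partial>lborel) \<partial>lborel)"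
    using m by (intro nn_integral_lborel_prod) auto
  also have "\<dots> = (\<integral>\<^sup>+(x::'a). 0 \<partial>lborel)"
  proof (rule nn_integral_cong)
    fix x :: 'a
    have "(\<integral>\<^sup>+t. indicator {X. snd X = \<eta> (fst X)} (x, t) \<partial>lborel) = (\<integral>\<^sup>+t. indicator {\<eta> x} t \<partial>lborel)"
      by (intro nn_integral_cong) (auto simp: indicator_def)
    then show "(\<integral>\<^sup>+t. indicator {X. snd X = \<eta> (fst X)} (x, t) \<partial>lborel) = 0" by simp
  qed
  finally have "{X. snd X = \<eta> (fst X)} \<in> null_sets lborel" using m by (simp add: null_sets_def)
  then have "AE X in lborel. X \<notin> {X. snd X = \<eta> (fst X)}" by (rule AE_not_in)
  then show ?thesis by simp
qed

text \<open>\<open>\<theta> n\<close> is, up to sign and slope, the derivative of the cutoff, and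
  \<open>\<sigma>\<close> selects the side of the graph. Replace \<open>u X * \<psi> X\<close> by
  its boundary counterpart \<open>f * \<psi>\<close> on the graph. The error \<open>e n\<close> is
  dominated by an integrable function, since a factor \<open>2 * \<delta> n\<close> cancels the
  \<open>1 / \<delta> n\<close>, and it vanishes at each fixed point for large \<open>n\<close>. The
  main term \<open>g n\<close> already has the limit as its integral, for every
  \<open>n\<close>.\<close>

lemma layer_limit:
  fixes \<eta> f b :: "'a::euclidean_space \<Rightarrow> real" and u \<psi> H :: "'a \<times> real \<Rightarrow> real" and \<sigma> :: real
  assumes [measurable]: "\<eta> \<in> borel_measurable borel" "f \<in> borel_measurable borel" "b \<in> borel_measurable borel"
      "u \<in> borel_measurable borel" "\<psi> \<in> borel_measurable borel" "H \<in> borel_measurable borel" "\<Omega> \<in> sets borel" "K \<in> sets borel"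
    and \<sigma>: "\<sigma> = 1 \<or> \<sigma> = -1" and \<delta>0: "\<delta>0 > 0"
    and inside: "\<And>x t. x \<in> K \<Longrightarrow> 0 < \<sigma> * (t - \<eta> x) \<Longrightarrow> \<sigma> * (t - \<eta> x) < \<delta>0 \<Longrightarrow> (x, t) \<in> \<Omega>"
    and bound: "\<And>x t. (x, t) \<in> \<Omega> \<Longrightarrow> 0 < \<sigma> * (t - \<eta> x) \<Longrightarrow> \<bar>u (x, t) - f x\<bar> \<le> \<sigma> * (t - \<eta> x) * H (x, t)"
    and H0: "\<And>X. H X \<ge> 0"
    and intH: "integrable lborel (\<lambda>X. indicator \<Omega> X * indicator K (fst X) * H X)"
    and intf: "integrable lborel (\<lambda>X. indicator \<Omega> X * indicator K (fst X) * \<bar>f (fst X)\<bar>)"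
    and \<psi>: "\<And>X. \<bar>\<psi> X\<bar> \<le> M" "\<And>x t s. \<bar>\<psi> (x, t) - \<psi> (x, s)\<bar> \<le> M * \<bar>t - s\<bar>" "\<And>x t. x \<notin> K \<Longrightarrow> \<psi> (x, t) = 0"
    and b: "\<And>x. \<bar>b x\<bar> \<le> B"
  defines "\<delta> \<equiv> \<lambda>n::nat. \<delta>0 / (real n + 2)"
  defines "\<theta> \<equiv> \<lambda>n X. indicator {\<delta> n<..<2 * \<delta> n} (\<sigma> * (snd X - \<eta> (fst X))) / \<delta> n"
  shows "integrable lborel (\<lambda>X. indicator \<Omega> X * (u X * \<psi> X * b (fst X)) * \<theta> n X)" (is "?A n")
    and "(\<lambda>n. LINT X|lborel. indicator \<Omega> X * (u X * \<psi> X * b (fst X)) * \<theta> n X)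
      \<longlonglongrightarrow> (LINT x|lborel. f x * \<psi> (x, \<eta> x) * b x)"
proof -
  \<comment> \<open>The summand 2 in the denominator puts even the first layer, of outer depth
    \<open>2 * \<delta> 0\<close>, within the range of \<open>inside\<close>.\<close>
  have \<delta>: "\<delta> n > 0" "2 * \<delta> n \<le> \<delta>0" for n using \<delta>0 unfolding \<delta>_def by (auto simp: field_simps)
  have MB: "M \<ge> 0" "B \<ge> 0" using \<psi>(1)[of "(0,0)"] b[of 0] by linarith+
  define \<tau> where "\<tau> = (\<lambda>X. \<sigma> * (snd X - \<eta> (fst X)))"
  have [measurable]: "\<tau> \<in> borel_measurable borel" unfolding \<tau>_def by measurable
  have [measurable]: "\<theta> n \<in> borel_measurable borel" for n unfolding \<theta>_def by measurable
  define e where "e = (\<lambda>n X. indicator \<Omega> X * ((u X * \<psi> X - f (fst X) * \<psi> (fst X, \<eta> (fst X))) * b (fst X)) * \<theta> n X)"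
  define g where "g = (\<lambda>n X. indicator \<Omega> X * (f (fst X) * \<psi> (fst X, \<eta> (fst X)) * b (fst X)) * \<theta> n X)"
  have [measurable]: "e n \<in> borel_measurable borel" "g n \<in> borel_measurable borel" for n
    unfolding e_def g_def by measurable
  define w where "w = (\<lambda>X. 2 * B * M * (indicator \<Omega> X * indicator K (fst X) * H X + indicator \<Omega> X * indicator K (fst X) * \<bar>f (fst X)\<bar>))"
  have w: "integrable lborel w" unfolding w_def by (intro integrable_mult_right Bochner_Integration.integrable_add intH intf)
  have w0: "w X \<ge> 0" for X using MB H0 unfolding w_def by simp
  have ew: "norm (e n X) \<le> w X" for n X
  proof (cases "X \<in> \<Omega> \<and> \<tau> X \<in> {\<delta> n<..<2 * \<delta> n} \<and> fst X \<in> K")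
    case True
    then have t: "\<tau> X > 0" "\<tau> X \<le> 2 * \<delta> n" using \<delta>[of n] by auto
    have a: "\<bar>snd X - \<eta> (fst X)\<bar> = \<tau> X" using t(1) \<sigma> unfolding \<tau>_def by auto
    have 1: "\<bar>u X - f (fst X)\<bar> \<le> \<tau> X * H X" using bound[of "fst X" "snd X"] True t unfolding \<tau>_def by simp
    have 2: "\<bar>\<psi> X - \<psi> (fst X, \<eta> (fst X))\<bar> \<le> M * \<tau> X" using \<psi>(2)[of "fst X" "snd X" "\<eta> (fst X)"] a by simp
    have "\<bar>u X * \<psi> X - f (fst X) * \<psi> (fst X, \<eta> (fst X))\<bar> = \<bar>(u X - f (fst X)) * \<psi> X + f (fst X) * (\<psi> X - \<psi> (fst X, \<eta> (fst X)))\<bar>"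
      by (simp add: algebra_simps)
    also have "\<dots> \<le> \<bar>u X - f (fst X)\<bar> * \<bar>\<psi> X\<bar> + \<bar>f (fst X)\<bar> * \<bar>\<psi> X - \<psi> (fst X, \<eta> (fst X))\<bar>"
      by (metis abs_mult abs_triangle_ineq)
    also have "\<dots> \<le> (\<tau> X * H X) * M + \<bar>f (fst X)\<bar> * (M * \<tau> X)"
      using 1 2 \<psi>(1)[of X] t H0[of X] by (intro add_mono mult_mono) auto
    also have "\<dots> = \<tau> X * (M * (H X + \<bar>f (fst X)\<bar>))" by (simp add: algebra_simps)
    also have "\<dots> \<le> (2 * \<delta> n) * (M * (H X + \<bar>f (fst X)\<bar>))" using t MB H0[of X] by (intro mult_right_mono) auto
    finally have 3: "\<bar>u X * \<psi> X - f (fst X) * \<psi> (fst X, \<eta> (fst X))\<bar> \<le> (2 * \<delta> n) * (M * (H X + \<bar>f (fst X)\<bar>))" .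
    have "norm (e n X) = \<bar>u X * \<psi> X - f (fst X) * \<psi> (fst X, \<eta> (fst X))\<bar> * \<bar>b (fst X)\<bar> / \<delta> n"
      using True \<delta>[of n] unfolding e_def \<theta>_def \<tau>_def by (simp add: abs_mult)
    also have "\<dots> \<le> (2 * \<delta> n) * (M * (H X + \<bar>f (fst X)\<bar>)) * B / \<delta> n"
      using 3 b[of "fst X"] \<delta>[of n] MB H0[of X] by (intro divide_right_mono mult_mono) auto
    also have "\<dots> = w X" using True \<delta>(1)[of n] unfolding w_def by (simp add: field_simps)
    finally show ?thesis .
  next
    case False
    then have "e n X = 0" using \<psi>(3)[of "fst X" "snd X"] \<psi>(3)[of "fst X" "\<eta> (fst X)"] unfolding e_def \<theta>_def \<tau>_def by auto
    then show ?thesis using w0 by simp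
  qed
  have eint: "integrable lborel (e n)" for n
    by (rule Bochner_Integration.integrable_bound[OF w]) (use ew w0 in \<open>auto intro!: AE_I2\<close>)
  have \<delta>0: "\<delta> \<longlonglongrightarrow> 0"
    unfolding \<delta>_def using LIMSEQ_ignore_initial_segment[OF lim_const_over_n[of \<delta>0], of 2] by (simp add: add.commute)
  have elim: "(\<lambda>n. e n X) \<longlonglongrightarrow> 0" for X
  proof (cases "\<tau> X > 0")
    case True
    have "eventually (\<lambda>n. \<delta> n < \<tau> X / 2) sequentially" using \<delta>0 True by (intro order_tendstoD(2)[OF \<delta>0]) auto
    then have "eventually (\<lambda>n. e n X = 0) sequentially"
      by eventually_elim (auto simp: e_def \<theta>_def \<tau>_def)
    then show ?thesis by (rule tendsto_eventually)
  next
    case False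
    have "e n X = 0" for n using False \<delta>(1)[of n] by (auto simp: e_def \<theta>_def \<tau>_def)
    then show ?thesis by simp
  qed
  have lim0: "(\<lambda>n. LINT X|lborel. e n X) \<longlonglongrightarrow> (LINT X|(lborel :: ('a \<times> real) measure). 0)"
    by (rule integral_dominated_convergence[OF _ _ w]) (use elim ew in auto)
  have gint: "integrable lborel (g n)" for n
  proof (rule Bochner_Integration.integrable_bound)
    show "integrable lborel (\<lambda>X. (indicator \<Omega> X * indicator K (fst X) * \<bar>f (fst X)\<bar>) * (M * B / \<delta> n))"
      using intf by (rule integrable_mult_left)
    show "AE X in lborel. norm (g n X) \<le> norm ((indicator \<Omega> X * indicator K (fst X) * \<bar>f (fst X)\<bar>) * (M * B / \<delta> n))"
    proof (rule AE_I2)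
      fix X
      show "norm (g n X) \<le> norm ((indicator \<Omega> X * indicator K (fst X) * \<bar>f (fst X)\<bar>) * (M * B / \<delta> n))"
      proof (cases "X \<in> \<Omega> \<and> \<tau> X \<in> {\<delta> n<..<2 * \<delta> n} \<and> fst X \<in> K")
        case True
        then have "norm (g n X) = \<bar>f (fst X)\<bar> * \<bar>\<psi> (fst X, \<eta> (fst X))\<bar> * \<bar>b (fst X)\<bar> / \<delta> n"
          using \<delta>[of n] unfolding g_def \<theta>_def \<tau>_def by (simp add: abs_mult)
        also have "\<dots> \<le> \<bar>f (fst X)\<bar> * M * B / \<delta> n"
          using \<psi>(1) b \<delta>[of n] MB by (intro divide_right_mono mult_mono) auto
        also have "\<dots> \<le> norm ((indicator \<Omega> X * indicator K (fst X) * \<bar>f (fst X)\<bar>) * (M * B / \<delta> n))"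
          using True MB \<delta>(1)[of n] by (simp add: abs_mult)
        finally show ?thesis .
      next
        case False
        then have "g n X = 0" using \<psi>(3)[of "fst X" "\<eta> (fst X)"] unfolding g_def \<theta>_def \<tau>_def by auto
        then show ?thesis by simp
      qed
    qed
  qed measurable
  have gval: "(LINT X|lborel. g n X) = (LINT x|lborel. f x * \<psi> (x, \<eta> x) * b x)" for n
  proof -
    have "(LINT X|lborel. g n X) = (LINT x|lborel. (LINT t|lborel. g n (x, t)))" by (rule integral_lborel_prod[OF gint])
    also have "\<dots> = (LINT x|lborel. f x * \<psi> (x, \<eta> x) * b x)"
    proof (rule Bochner_Integration.integral_cong[OF refl])
      fix x
      show "(LINT t|lborel. g n (x, t)) = f x * \<psi> (x, \<eta> x) * b x"
      proof (cases "x \<in> K")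
        case False
        then show ?thesis using \<psi>(3)[of x] unfolding g_def by simp
      next
        case True
        \<comment> \<open>The slice of the layer over \<open>x\<close>. It lies in
          \<open>\<Omega>\<close> and has length \<open>\<delta> n\<close>, which cancels the factor
          in \<open>\<theta>\<close>.\<close>
        define T where "T = (if \<sigma> = 1 then {\<eta> x + \<delta> n<..<\<eta> x + 2 * \<delta> n} else {\<eta> x - 2 * \<delta> n<..<\<eta> x - \<delta> n})"
        have T: "measure lborel T = \<delta> n" "T \<in> sets borel" "emeasure lborel T < \<infinity>" using \<delta>(1)[of n] unfolding T_def by auto
        have g_eq: "g n (x, t) = (f x * \<psi> (x, \<eta> x) * b x / \<delta> n) * indicator T t" for t
        proof -
          have iff: "\<sigma> * (t - \<eta> x) \<in> {\<delta> n<..<2 * \<delta> n} \<longleftrightarrow> t \<in> T" using \<sigma> unfolding T_def by auto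
          have "(x, t) \<in> \<Omega>" if "t \<in> T"
            using iff that inside[OF True, of t] \<delta>[of n] by auto
          then show ?thesis using iff unfolding g_def \<theta>_def by (auto simp: indicator_def)
        qed
        show ?thesis unfolding g_eq using T \<delta>(1)[of n] by simp
      qed
    qed
    finally show ?thesis .
  qed
  have eq: "indicator \<Omega> X * (u X * \<psi> X * b (fst X)) * \<theta> n X = e n X + g n X" for n X
    unfolding e_def g_def by (simp add: algebra_simps)
  show "?A n" unfolding eq by (intro Bochner_Integration.integrable_add eint gint)
  have "(LINT X|lborel. indicator \<Omega> X * (u X * \<psi> X * b (fst X)) * \<theta> n X) = (LINT X|lborel. e n X) + (LINT x|lborel. f x * \<psi> (x, \<eta> x) * b x)" for n
    unfolding eq using eint gint gval by (simp add: Bochner_Integration.integral_add)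
  then show "(\<lambda>n. LINT X|lborel. indicator \<Omega> X * (u X * \<psi> X * b (fst X)) * \<theta> n X)
      \<longlonglongrightarrow> (LINT x|lborel. f x * \<psi> (x, \<eta> x) * b x)"
    using tendsto_add[OF lim0 tendsto_const[of "LINT x|lborel. f x * \<psi> (x, \<eta> x) * b x"]] by simp
qed

text \<open>If \<open>l \<noteq> c\<close>, then \<open>h t\<close> is at least a multiple of \<open>1 / \<bar>t - e\<bar>\<close> near \<open>e\<close>, hence not integrable.\<close>

lemma no_other_limit_at_endpoint:
  fixes v h :: "real \<Rightarrow> real"
  assumes "\<alpha> < \<beta>" and e: "e = \<alpha> \<or> e = \<beta>"
    and bnd: "AE t in lborel. t \<in> {\<alpha><..<\<beta>} \<longrightarrow> \<bar>v t - c\<bar> \<le> \<bar>t - e\<bar> * h t"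
    and fin: "(\<integral>\<^sup>+t. indicator {\<alpha><..<\<beta>} t * ennreal (h t) \<partial>lborel) < \<infinity>"
    and [measurable]: "h \<in> borel_measurable borel"
    and lim: "(v \<longlongrightarrow> l) (at e within {\<alpha><..<\<beta>})"
  shows "l = c"
proof (rule ccontr)
  assume "l \<noteq> c"
  define \<epsilon> where "\<epsilon> = \<bar>l - c\<bar> / 2"
  have \<epsilon>: "\<epsilon> > 0" using \<open>l \<noteq> c\<close> unfolding \<epsilon>_def by simp
  have "eventually (\<lambda>t. dist (v t) l < \<epsilon>) (at e within {\<alpha><..<\<beta>})" using lim \<epsilon> by (rule tendstoD)
  then obtain s where s: "s > 0" "\<And>t. t \<in> {\<alpha><..<\<beta>} \<Longrightarrow> t \<noteq> e \<Longrightarrow> dist t e < s \<Longrightarrow> dist (v t) l < \<epsilon>"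
    unfolding eventually_at by blast
  define \<delta>0 where "\<delta>0 = min s (\<beta> - \<alpha>)"
  have \<delta>0: "\<delta>0 > 0" using s \<open>\<alpha> < \<beta>\<close> unfolding \<delta>0_def by auto
  define \<delta> where "\<delta> = (\<lambda>n::nat. \<delta>0 / (real n + 2))"
  have \<delta>: "\<delta> n > 0" "2 * \<delta> n \<le> \<delta>0" for n using \<delta>0 unfolding \<delta>_def by (auto simp: field_simps)
  have \<delta>lim: "\<delta> \<longlonglongrightarrow> 0" unfolding \<delta>_def using LIMSEQ_ignore_initial_segment[OF lim_const_over_n[of \<delta>0], of 2] by (simp add: add.commute)
  define T where "T = (\<lambda>n. if e = \<alpha> then {e + \<delta> n<..<e + 2 * \<delta> n} else {e - 2 * \<delta> n<..<e - \<delta> n})"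
  have Tm [measurable]: "T n \<in> sets borel" for n unfolding T_def by auto
  have Tme: "emeasure lborel (T n) = ennreal (\<delta> n)" for n using \<delta>(1)[of n] unfolding T_def by auto
  have Tsub: "t \<in> {\<alpha><..<\<beta>} \<and> t \<noteq> e \<and> dist t e < s \<and> \<bar>t - e\<bar> < 2 * \<delta> n \<and> \<bar>t - e\<bar> > \<delta> n" if "t \<in> T n" for t n
    using that e \<delta>[of n] \<open>\<alpha> < \<beta>\<close> unfolding T_def \<delta>0_def dist_real_def by (auto split: if_splits)
  \<comment> \<open>On an interval of length \<open>\<delta> n\<close> at distance below
    \<open>2 * \<delta> n\<close> from \<open>e\<close> the function \<open>h\<close> is at least
    \<open>\<epsilon> / (2 * \<delta> n)\<close>. So these intervals, although they shrink to
    \<open>e\<close>, each carry mass at least \<open>\<epsilon> / 2\<close>, which dominated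
    convergence rules out.\<close>
  have low: "ennreal (\<epsilon> / 2) \<le> (\<integral>\<^sup>+t. indicator (T n) t * (indicator {\<alpha><..<\<beta>} t * ennreal (h t)) \<partial>lborel)" for n
  proof -
    have "ennreal (\<epsilon> / 2) = ennreal (\<epsilon> / (2 * \<delta> n)) * emeasure lborel (T n)"
      using \<delta>(1)[of n] \<epsilon> by (simp add: Tme ennreal_mult'[symmetric])
    also have "\<dots> = (\<integral>\<^sup>+t. ennreal (\<epsilon> / (2 * \<delta> n)) * indicator (T n) t \<partial>lborel)"
      by (simp add: nn_integral_cmult_indicator)
    also have "\<dots> \<le> (\<integral>\<^sup>+t. indicator (T n) t * (indicator {\<alpha><..<\<beta>} t * ennreal (h t)) \<partial>lborel)"
    proof (rule nn_integral_mono_AE, use bnd in eventually_elim)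
      case (elim t)
      show ?case
      proof (cases "t \<in> T n")
        case True
        have t: "t \<in> {\<alpha><..<\<beta>}" "dist (v t) l < \<epsilon>" "\<bar>t - e\<bar> < 2 * \<delta> n" "\<bar>t - e\<bar> > 0"
          using Tsub[OF True] s(2)[of t] \<delta>(1)[of n] by auto
        have "\<bar>l - c\<bar> \<le> \<bar>v t - l\<bar> + \<bar>v t - c\<bar>" by arith
        then have "\<epsilon> \<le> \<bar>v t - c\<bar>" using t(2) unfolding \<epsilon>_def dist_real_def by simp
        also have "\<dots> \<le> \<bar>t - e\<bar> * h t" using elim t(1) by blast
        finally have *: "\<epsilon> \<le> \<bar>t - e\<bar> * h t" .
        then have "h t > 0" using \<epsilon> t(4) by (smt (verit) mult_nonneg_nonpos)
        then have "\<bar>t - e\<bar> * h t \<le> (2 * \<delta> n) * h t" using t(3) by (intro mult_right_mono) auto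
        then have "\<epsilon> / (2 * \<delta> n) \<le> h t" using * \<delta>(1)[of n] by (simp add: field_simps)
        then show ?thesis using True t(1) by (simp add: ennreal_leI)
      qed simp
    qed
    finally show ?thesis .
  qed
  have "(\<lambda>n. \<integral>\<^sup>+t. indicator (T n) t * (indicator {\<alpha><..<\<beta>} t * ennreal (h t)) \<partial>lborel) \<longlonglongrightarrow> (\<integral>\<^sup>+(t::real). 0 \<partial>lborel)"
  proof (rule nn_integral_dominated_convergence[where w = "\<lambda>t. indicator {\<alpha><..<\<beta>} t * ennreal (h t)"])
    show "AE t in lborel. (\<lambda>n. indicator (T n) t * (indicator {\<alpha><..<\<beta>} t * ennreal (h t))) \<longlonglongrightarrow> 0"
    proof (rule AE_I2)
      fix t :: real
      have "eventually (\<lambda>n. t \<notin> T n) sequentially"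
      proof (cases "t = e")
        case True
        then show ?thesis using Tsub by (intro always_eventually) blast
      next
        case False
        then have "eventually (\<lambda>n. \<delta> n < \<bar>t - e\<bar> / 2) sequentially" by (intro order_tendstoD(2)[OF \<delta>lim]) auto
        then show ?thesis
        proof eventually_elim
          case (elim n)
          then show ?case using Tsub[of t n] by auto
        qed
      qed
      then have "eventually (\<lambda>n. indicator (T n) t * (indicator {\<alpha><..<\<beta>} t * ennreal (h t)) = 0) sequentially"
        by eventually_elim simp
      then show "(\<lambda>n. indicator (T n) t * (indicator {\<alpha><..<\<beta>} t * ennreal (h t))) \<longlonglongrightarrow> 0" by (rule tendsto_eventually)
    qed
  qed (use fin in \<open>auto simp: indicator_def\<close>)
  then have "ennreal (\<epsilon> / 2) \<le> (\<integral>\<^sup>+(t::real). 0 \<partial>lborel)"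
    using low by (intro LIMSEQ_le_const[where X = "\<lambda>n. \<integral>\<^sup>+t. indicator (T n) t * (indicator {\<alpha><..<\<beta>} t * ennreal (h t)) \<partial>lborel"]) auto
  then show False using \<epsilon> by simp
qed

section \<open>Integration by parts up to the boundary\<close>

text \<open>\<open>ramp (\<tau> / \<delta>)\<close> is 0 up to depth \<open>\<delta>\<close> and 1
  from depth \<open>2 * \<delta>\<close> on, so that its derivative lives in the layer of
  \<open>layer_limit\<close>.\<close>

definition ramp :: "real \<Rightarrow> real" where
  "ramp s = max 0 (min 1 (s - 1))"

lemma ramp_lipschitz: "\<bar>ramp s - ramp t\<bar> \<le> \<bar>s - t\<bar>"
  unfolding ramp_def by (auto simp: max_def min_def)

lemma ramp_bounds: "0 \<le> ramp s" "ramp s \<le> 1"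
  unfolding ramp_def by auto

lemma ramp_eq: "s \<le> 1 \<Longrightarrow> ramp s = 0" "2 \<le> s \<Longrightarrow> ramp s = 1" "1 \<le> s \<Longrightarrow> s \<le> 2 \<Longrightarrow> ramp s = s - 1"
  unfolding ramp_def by auto

lemma dir_diff_affine:
  assumes "dir_diff i \<tau> X"
  shows "dir_diff i (\<lambda>X. \<tau> X / \<delta> - c) X" "partial i (\<lambda>X. \<tau> X / \<delta> - c) X = partial i \<tau> X / \<delta>"
proof -
  have "((\<lambda>t. \<tau> (X + t *\<^sub>R i) / \<delta> - c) has_real_derivative partial i \<tau> X / \<delta> - 0) (at 0)"
    by (intro DERIV_diff DERIV_cdivide DERIV_const) (use assms in \<open>simp add: dir_diff_iff_partial\<close>)
  then have *: "((\<lambda>t. \<tau> (X + t *\<^sub>R i) / \<delta> - c) has_real_derivative partial i \<tau> X / \<delta>) (at 0)" by simp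
  show "dir_diff i (\<lambda>X. \<tau> X / \<delta> - c) X" unfolding dir_diff_def using * by blast
  show "partial i (\<lambda>X. \<tau> X / \<delta> - c) X = partial i \<tau> X / \<delta>" using * by (rule partialI)
qed

lemma partial_ramp:
  fixes \<tau> :: "'a::euclidean_space \<Rightarrow> real"
  assumes cont: "continuous_on UNIV \<tau>" and d: "dir_diff i \<tau> X" and "\<delta> > 0" "\<tau> X \<noteq> \<delta>" "\<tau> X \<noteq> 2 * \<delta>"
  shows "dir_diff i (\<lambda>X. ramp (\<tau> X / \<delta>)) X"
    and "partial i (\<lambda>X. ramp (\<tau> X / \<delta>)) X = indicator {\<delta><..<2 * \<delta>} (\<tau> X) / \<delta> * partial i \<tau> X"
proof -
  have const: "dir_diff i (\<lambda>X. c) X" for c :: real unfolding dir_diff_def by (auto intro!: exI[of _ 0])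
  consider "\<tau> X < \<delta>" | "\<tau> X > 2 * \<delta>" | "\<delta> < \<tau> X" "\<tau> X < 2 * \<delta>" using assms by linarith
  then have "dir_diff i (\<lambda>X. ramp (\<tau> X / \<delta>)) X \<and> partial i (\<lambda>X. ramp (\<tau> X / \<delta>)) X = indicator {\<delta><..<2 * \<delta>} (\<tau> X) / \<delta> * partial i \<tau> X"
  proof cases
    case 1
    have o: "open {X. \<tau> X < \<delta>}" by (intro open_Collect_less cont continuous_on_const)
    have eq: "ramp (\<tau> Y / \<delta>) = 0" if "Y \<in> {X. \<tau> X < \<delta>}" for Y using that \<open>\<delta> > 0\<close> by (intro ramp_eq) (auto simp: field_simps)
    show ?thesis
      using dir_diff_open_cong[OF o, of X "\<lambda>X. ramp (\<tau> X / \<delta>)" "\<lambda>_. 0" i] eq 1 const[of 0] partial_const[of i 0 X] by simp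
  next
    case 2
    have o: "open {X. 2 * \<delta> < \<tau> X}" by (intro open_Collect_less cont continuous_on_const)
    have eq: "ramp (\<tau> Y / \<delta>) = 1" if "Y \<in> {X. 2 * \<delta> < \<tau> X}" for Y using that \<open>\<delta> > 0\<close> by (intro ramp_eq) (auto simp: field_simps)
    show ?thesis
      using dir_diff_open_cong[OF o, of X "\<lambda>X. ramp (\<tau> X / \<delta>)" "\<lambda>_. 1" i] eq 2 const[of 1] partial_const[of i 1 X] by simp
  next
    case 3
    have o: "open ({X. \<delta> < \<tau> X} \<inter> {X. \<tau> X < 2 * \<delta>})" by (intro open_Int open_Collect_less cont continuous_on_const)
    have eq: "ramp (\<tau> Y / \<delta>) = \<tau> Y / \<delta> - 1" if "Y \<in> {X. \<delta> < \<tau> X} \<inter> {X. \<tau> X < 2 * \<delta>}" for Y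
      using that \<open>\<delta> > 0\<close> by (intro ramp_eq) (auto simp: field_simps)
    show ?thesis
      using dir_diff_open_cong[OF o, of X "\<lambda>X. ramp (\<tau> X / \<delta>)" "\<lambda>X. \<tau> X / \<delta> - 1" i] eq 3 dir_diff_affine[OF d, of \<delta> 1] by simp
  qed
  then show "dir_diff i (\<lambda>X. ramp (\<tau> X / \<delta>)) X"
    "partial i (\<lambda>X. ramp (\<tau> X / \<delta>)) X = indicator {\<delta><..<2 * \<delta>} (\<tau> X) / \<delta> * partial i \<tau> X" by auto
qed

lemma graph_distance_lipschitz:
  fixes \<eta> :: "'a::euclidean_space \<Rightarrow> real"
  assumes lip: "\<And>x y. \<bar>\<eta> x - \<eta> y\<bar> \<le> L * norm (x - y)" and \<sigma>: "\<bar>\<sigma>\<bar> = 1"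
  shows "\<bar>\<sigma> * (snd X - \<eta> (fst X)) - \<sigma> * (snd Y - \<eta> (fst Y))\<bar> \<le> (1 + \<bar>L\<bar>) * norm (X - Y)"
proof -
  have "\<bar>\<sigma> * (snd X - \<eta> (fst X)) - \<sigma> * (snd Y - \<eta> (fst Y))\<bar> = \<bar>\<sigma>\<bar> * \<bar>(snd X - \<eta> (fst X)) - (snd Y - \<eta> (fst Y))\<bar>"
    by (simp add: abs_mult[symmetric] right_diff_distrib)
  also have "\<dots> \<le> \<bar>snd X - snd Y\<bar> + \<bar>\<eta> (fst X) - \<eta> (fst Y)\<bar>" using \<sigma> by simp
  also have "\<dots> \<le> norm (X - Y) + \<bar>L\<bar> * norm (X - Y)"
  proof (rule add_mono)
    show "\<bar>snd X - snd Y\<bar> \<le> norm (X - Y)" using norm_snd_le[of "X - Y"] by (metis snd_diff real_norm_def norm_snd_le prod.collapse)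
    have "norm (fst X - fst Y) \<le> norm (X - Y)" by (metis fst_diff norm_fst_le prod.collapse)
    then have "\<bar>L\<bar> * norm (fst X - fst Y) \<le> \<bar>L\<bar> * norm (X - Y)" by (intro mult_left_mono) auto
    moreover have "L * norm (fst X - fst Y) \<le> \<bar>L\<bar> * norm (fst X - fst Y)" by (intro mult_right_mono) auto
    ultimately show "\<bar>\<eta> (fst X) - \<eta> (fst Y)\<bar> \<le> \<bar>L\<bar> * norm (X - Y)" using lip[of "fst X" "fst Y"] by linarith
  qed
  finally show ?thesis by (simp add: algebra_simps)
qed

text \<open>The hypothesis concerns the distance on the product space, where differentiability is
  known almost everywhere; the derivative of \<open>\<eta>\<close> at the base point is recovered by
  solving for \<open>\<eta>\<close>. This avoids lifting null sets from the base.\<close>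

lemma partial_graph_distance:
  fixes \<eta> :: "'a::euclidean_space \<Rightarrow> real"
  assumes d: "dir_diff i (\<lambda>X. \<sigma> * (snd X - \<eta> (fst X))) X" and \<sigma>: "\<sigma> \<noteq> 0"
  shows "partial i (\<lambda>X. \<sigma> * (snd X - \<eta> (fst X))) X = \<sigma> * (snd i - partial (fst i) \<eta> (fst X))"
proof -
  let ?P = "partial i (\<lambda>X. \<sigma> * (snd X - \<eta> (fst X))) X"
  have "((\<lambda>t. \<sigma> * (snd (X + t *\<^sub>R i) - \<eta> (fst (X + t *\<^sub>R i)))) has_real_derivative ?P) (at 0)"
    using d unfolding dir_diff_iff_partial .
  then have "((\<lambda>t. snd X + t * snd i - (\<sigma> * (snd (X + t *\<^sub>R i) - \<eta> (fst (X + t *\<^sub>R i)))) / \<sigma>) has_real_derivative snd i - ?P / \<sigma>) (at 0)"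
  proof -
    assume *: "((\<lambda>t. \<sigma> * (snd (X + t *\<^sub>R i) - \<eta> (fst (X + t *\<^sub>R i)))) has_real_derivative ?P) (at 0)"
    have "((\<lambda>t. snd X + t * snd i) has_real_derivative snd i) (at 0)" by (auto intro!: derivative_eq_intros)
    then show ?thesis using * by (intro DERIV_diff DERIV_cdivide)
  qed
  moreover have "snd X + t * snd i - (\<sigma> * (snd (X + t *\<^sub>R i) - \<eta> (fst (X + t *\<^sub>R i)))) / \<sigma> = \<eta> (fst X + t *\<^sub>R fst i)" for t
    using \<sigma> by simp
  ultimately have "((\<lambda>t. \<eta> (fst X + t *\<^sub>R fst i)) has_real_derivative snd i - ?P / \<sigma>) (at 0)" by simp
  then have "partial (fst i) \<eta> (fst X) = snd i - ?P / \<sigma>" by (rule partialI)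
  then show ?thesis using \<sigma> by (simp add: field_simps)
qed

text \<open>The bound holds at every point: where \<open>h\<close> has no derivative,
  \<open>partial\<close> is the default value of \<open>deriv\<close>, whose absolute value is
  included in the maximum.\<close>

lemma partial_bounded:
  assumes lip: "\<And>x y. \<bar>h x - h y\<bar> \<le> C * norm (x - y)"
  shows "\<exists>B. \<forall>x. \<bar>partial i h x\<bar> \<le> B"
proof -
  have "\<bar>partial i h x\<bar> \<le> max (C * norm i) \<bar>SOME D::real. False\<bar>" for x
  proof (cases "dir_diff i h x")
    case True
    then show ?thesis using partial_bound_lipschitz[OF _ lip] by (simp add: le_max_iff_disj)
  next
    case False
    then have "((\<lambda>t. h (x + t *\<^sub>R i)) has_real_derivative D) (at 0) = False" for D unfolding dir_diff_def by blast
    then have "partial i h x = (SOME D::real. False)" unfolding partial_def deriv_def by (simp only:)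
    then show ?thesis by simp
  qed
  then show ?thesis by blast
qed

text \<open>Takes the place of Hoelder's inequality: on sets of finite measure it turns
  integrability of the \<open>p\<close>-th power into integrability.\<close>

lemma le_1_plus_powr:
  fixes a p :: real assumes "a \<ge> 0" "p \<ge> 1" shows "a \<le> 1 + a powr p"
proof (cases "a \<le> 1")
  case False
  then have "a powr 1 \<le> a powr p" using assms by (intro powr_mono) auto
  then show ?thesis using False by simp
qed (use powr_ge_zero[of a p] in linarith)

lemma Lp_loc_abs_integrable:
  fixes f :: "'a::euclidean_space \<Rightarrow> real"
  assumes f: "f \<in> Lp_loc p" "f \<in> borel_measurable borel" and "p \<ge> 1" and K: "compact K"
  shows "integrable lborel (\<lambda>x. indicator K x * \<bar>f x\<bar>)"
proof (rule integrableI_bounded)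
  have [measurable]: "f \<in> borel_measurable borel" "K \<in> sets borel" using f K by (auto intro: borel_compact)
  show "(\<lambda>x. indicator K x * \<bar>f x\<bar>) \<in> borel_measurable lborel" by measurable
  have "(\<integral>\<^sup>+x. ennreal (norm (indicator K x * \<bar>f x\<bar>)) \<partial>lborel) \<le> (\<integral>\<^sup>+x. indicator K x + ennreal (\<bar>f x\<bar> powr p) * indicator K x \<partial>lborel)"
  proof (rule nn_integral_mono)
    fix x
    show "ennreal (norm (indicator K x * \<bar>f x\<bar>)) \<le> indicator K x + ennreal (\<bar>f x\<bar> powr p) * indicator K x"
      using ennreal_leI[OF le_1_plus_powr[of "\<bar>f x\<bar>" p]] \<open>p \<ge> 1\<close> by (auto simp: indicator_def)
  qed
  also have "\<dots> = emeasure lborel K + (\<integral>\<^sup>+x. ennreal (\<bar>f x\<bar> powr p) * indicator K x \<partial>lborel)"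
    by (subst nn_integral_add) auto
  also have "\<dots> < \<infinity>"
  proof -
    have "(\<integral>\<^sup>+x. ennreal (\<bar>f x\<bar> powr p) * indicator K x \<partial>lborel) < \<infinity>"
      using f(1) K unfolding Lp_loc_def by (auto simp: nn_integral_completion)
    moreover have "emeasure lborel K < \<infinity>" using emeasure_compact_finite[OF K] by simp
    ultimately show ?thesis by simp
  qed
  finally show "(\<integral>\<^sup>+x. ennreal (norm (indicator K x * \<bar>f x\<bar>)) \<partial>lborel) < \<infinity>" .
qed

section \<open>The strip, and functions on it that are controlled near both graphs\<close>

locale lipschitz_strip =
  fixes \<eta>m \<eta>p :: "'a::euclidean_space \<Rightarrow> real" and L :: real
  assumes lipm: "\<And>x y. \<bar>\<eta>m x - \<eta>m y\<bar> \<le> L * norm (x - y)"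
    and lipp: "\<And>x y. \<bar>\<eta>p x - \<eta>p y\<bar> \<le> L * norm (x - y)"
    and gap: "\<And>y. \<eta>m y < \<eta>p y" and L0: "L \<ge> 0"
begin

abbreviation "\<Omega> \<equiv> strip \<eta>m \<eta>p"

lemma mem_strip: "(x, t) \<in> \<Omega> \<longleftrightarrow> \<eta>m x < t \<and> t < \<eta>p x"
  by (simp add: strip_def)

lemma cont_eta: "continuous_on UNIV \<eta>m" "continuous_on UNIV \<eta>p"
proof -
  have "L-lipschitz_on UNIV \<eta>m" "L-lipschitz_on UNIV \<eta>p"
    using lipm lipp L0 by (auto simp: lipschitz_on_def dist_norm)
  then show "continuous_on UNIV \<eta>m" "continuous_on UNIV \<eta>p" by (auto intro: lipschitz_on_continuous_on)
qed

lemma eta_borel [measurable]: "\<eta>m \<in> borel_measurable borel" "\<eta>p \<in> borel_measurable borel"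
  using cont_eta by (auto intro: borel_measurable_continuous_onI)

lemma cont_eta_fst: "continuous_on S (\<lambda>X. \<eta>m (fst X))" "continuous_on S (\<lambda>X. \<eta>p (fst X))"
  by (rule continuous_on_compose2[OF cont_eta(1)] continuous_on_compose2[OF cont_eta(2)]; auto intro: continuous_intros)+

lemma open_strip: "open \<Omega>"
proof -
  have "\<Omega> = {X. \<eta>m (fst X) < snd X} \<inter> {X. snd X < \<eta>p (fst X)}" by (auto simp: strip_def)
  then show ?thesis by (simp only:) (intro open_Int open_Collect_less cont_eta_fst continuous_intros)
qed

lemma strip_borel [measurable]: "\<Omega> \<in> sets borel"
  using open_strip by simp

lemma gap_bounds:
  assumes "compact K"
  obtains d0 d1 where "d0 > 0" "d1 \<ge> 0" "\<And>x. x \<in> K \<Longrightarrow> d0 \<le> \<eta>p x - \<eta>m x" "\<And>x. x \<in> K \<Longrightarrow> \<eta>p x - \<eta>m x \<le> d1"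
proof (cases "K = {}")
  case True
  then show ?thesis using that[of 1 1] by auto
next
  case False
  have c: "continuous_on K (\<lambda>x. \<eta>p x - \<eta>m x)"
    by (intro continuous_intros continuous_on_subset[OF cont_eta(1)] continuous_on_subset[OF cont_eta(2)]) auto
  obtain a where a: "a \<in> K" "\<And>x. x \<in> K \<Longrightarrow> \<eta>p a - \<eta>m a \<le> \<eta>p x - \<eta>m x"
    using continuous_attains_inf[OF assms False c] by auto
  obtain b where b: "b \<in> K" "\<And>x. x \<in> K \<Longrightarrow> \<eta>p x - \<eta>m x \<le> \<eta>p b - \<eta>m b"
    using continuous_attains_sup[OF assms False c] by auto
  show ?thesis using that[of "\<eta>p a - \<eta>m a" "\<eta>p b - \<eta>m b"] a b gap[of a] gap[of b] by auto
qed

lemma lift_integrable: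
  fixes f :: "'a \<Rightarrow> real"
  assumes K: "compact K" and [measurable]: "f \<in> borel_measurable borel"
    and int: "integrable lborel (\<lambda>x. indicator K x * \<bar>f x\<bar>)"
  shows "integrable lborel (\<lambda>X. indicator \<Omega> X * indicator K (fst X) * \<bar>f (fst X)\<bar>)"
proof (rule integrableI_bounded)
  have [measurable]: "K \<in> sets borel" using K by (auto intro: borel_compact)
  show "(\<lambda>X. indicator \<Omega> X * indicator K (fst X) * \<bar>f (fst X)\<bar>) \<in> borel_measurable lborel" by measurable
  obtain d1 where d: "d1 \<ge> 0" "\<And>x. x \<in> K \<Longrightarrow> \<eta>p x - \<eta>m x \<le> d1" using gap_bounds[OF K] by metis
  have "(\<integral>\<^sup>+X. ennreal (norm (indicator \<Omega> X * indicator K (fst X) * \<bar>f (fst X)\<bar>)) \<partial>lborel)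
    = (\<integral>\<^sup>+x. (\<integral>\<^sup>+t. ennreal (norm (indicator \<Omega> (x, t) * indicator K x * \<bar>f x\<bar>)) \<partial>lborel) \<partial>lborel)"
    by (subst nn_integral_lborel_prod) auto
  also have "\<dots> \<le> (\<integral>\<^sup>+x. ennreal (norm (indicator K x * \<bar>f x\<bar>)) * ennreal d1 \<partial>lborel)"
  proof (rule nn_integral_mono)
    fix x
    have "(\<integral>\<^sup>+t. ennreal (norm (indicator \<Omega> (x, t) * indicator K x * \<bar>f x\<bar>)) \<partial>lborel)
      = (\<integral>\<^sup>+t. ennreal (norm (indicator K x * \<bar>f x\<bar>)) * indicator {\<eta>m x<..<\<eta>p x} t \<partial>lborel)"
      by (intro nn_integral_cong) (auto simp: indicator_def mem_strip)
    also have "\<dots> = ennreal (norm (indicator K x * \<bar>f x\<bar>)) * ennreal (\<eta>p x - \<eta>m x)"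
      using gap[of x] by (subst nn_integral_cmult_indicator) auto
    also have "\<dots> \<le> ennreal (norm (indicator K x * \<bar>f x\<bar>)) * ennreal d1"
      using d(2)[of x] by (cases "x \<in> K") (auto intro!: mult_left_mono ennreal_leI)
    finally show "(\<integral>\<^sup>+t. ennreal (norm (indicator \<Omega> (x, t) * indicator K x * \<bar>f x\<bar>)) \<partial>lborel) \<le> ennreal (norm (indicator K x * \<bar>f x\<bar>)) * ennreal d1" .
  qed
  also have "\<dots> = (\<integral>\<^sup>+x. ennreal (norm (indicator K x * \<bar>f x\<bar>)) \<partial>lborel) * ennreal d1"
    by (rule nn_integral_multc) measurable
  also have "\<dots> < \<infinity>" using int by (auto simp: integrable_iff_bounded ennreal_mult_less_top)
  finally show "(\<integral>\<^sup>+X. ennreal (norm (indicator \<Omega> X * indicator K (fst X) * \<bar>f (fst X)\<bar>)) \<partial>lborel) < \<infinity>" .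
qed

end

text \<open>All that the trace argument uses about the extension. Since \<open>u\<close> is
  Lipschitz only locally inside the strip, \<open>partial i u\<close> is not known to be Borel on
  the whole space; \<open>D\<close> is a Borel function that represents it almost everywhere in the
  strip. The same \<open>H\<close> bounds the gradient and the approach to both data.\<close>

locale strip_function = lipschitz_strip +
  fixes u H :: "'a \<times> real \<Rightarrow> real" and fm fp :: "'a \<Rightarrow> real" and D :: "'a \<times> real \<Rightarrow> 'a \<times> real" and c p :: real
  assumes u_lip: "loc_lip \<Omega> u" and u_borel [measurable]: "u \<in> borel_measurable borel"
    and H_borel [measurable]: "H \<in> borel_measurable borel" and H0: "\<And>X. H X \<ge> 0"
    and fm_borel [measurable]: "fm \<in> borel_measurable borel" and fp_borel [measurable]: "fp \<in> borel_measurable borel"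
    and D_borel [measurable]: "D \<in> borel_measurable borel"
    and D_eq: "\<And>i. i \<in> Basis \<Longrightarrow> AE X in lborel. X \<in> \<Omega> \<longrightarrow> partial i u X = D X \<bullet> i"
    and D_bound: "AE X in lborel. X \<in> \<Omega> \<longrightarrow> norm (D X) \<le> c * H X" and c0: "c \<ge> 0"
    and near_m: "\<And>x t. (x, t) \<in> \<Omega> \<Longrightarrow> \<bar>u (x, t) - fm x\<bar> \<le> (t - \<eta>m x) * H (x, t)"
    and near_p: "\<And>x t. (x, t) \<in> \<Omega> \<Longrightarrow> \<bar>u (x, t) - fp x\<bar> \<le> (\<eta>p x - t) * H (x, t)"
    and p1: "p > 1"
    and H_Lp: "(\<integral>\<^sup>+X. indicator \<Omega> X * ennreal (H X powr p) \<partial>lborel) < \<infinity>"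
    and fm_Lp: "fm \<in> Lp_loc p" and fp_Lp: "fp \<in> Lp_loc p"
begin

lemma f_int:
  assumes "compact K"
  shows "integrable lborel (\<lambda>x. indicator K x * \<bar>fm x\<bar>)" "integrable lborel (\<lambda>x. indicator K x * \<bar>fp x\<bar>)"
  using Lp_loc_abs_integrable[OF fm_Lp fm_borel _ assms] Lp_loc_abs_integrable[OF fp_Lp fp_borel _ assms] p1 by auto

lemma f_lift_int:
  assumes "compact K"
  shows "integrable lborel (\<lambda>X. indicator \<Omega> X * indicator K (fst X) * \<bar>fm (fst X)\<bar>)"
    "integrable lborel (\<lambda>X. indicator \<Omega> X * indicator K (fst X) * \<bar>fp (fst X)\<bar>)"
  using lift_integrable[OF assms fm_borel] lift_integrable[OF assms fp_borel] f_int[OF assms] by auto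

lemma H_int:
  assumes K: "compact K"
  shows "integrable lborel (\<lambda>X. indicator \<Omega> X * indicator K (fst X) * H X)"
proof (rule integrableI_bounded)
  have [measurable]: "K \<in> sets borel" using K by (auto intro: borel_compact)
  show "(\<lambda>X. indicator \<Omega> X * indicator K (fst X) * H X) \<in> borel_measurable lborel" by measurable
  have "integrable lborel (\<lambda>x. indicator K x * \<bar>1::real\<bar>)"
    using emeasure_compact_finite[OF K] by (simp add: integrable_real_indicator)
  then have 1: "integrable lborel (\<lambda>X. indicator \<Omega> X * indicator K (fst X) * \<bar>1::real\<bar>)"
    by (intro lift_integrable[OF K]) auto
  have "(\<integral>\<^sup>+X. ennreal (norm (indicator \<Omega> X * indicator K (fst X) * H X)) \<partial>lborel)
    \<le> (\<integral>\<^sup>+X. ennreal (norm (indicator \<Omega> X * indicator K (fst X) * \<bar>1::real\<bar>)) + indicator \<Omega> X * ennreal (H X powr p) \<partial>lborel)"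
  proof (rule nn_integral_mono)
    fix X
    show "ennreal (norm (indicator \<Omega> X * indicator K (fst X) * H X)) \<le> ennreal (norm (indicator \<Omega> X * indicator K (fst X) * \<bar>1::real\<bar>)) + indicator \<Omega> X * ennreal (H X powr p)"
      using ennreal_leI[OF le_1_plus_powr[of "H X" p]] p1 H0[of X] by (auto simp: indicator_def)
  qed
  also have "\<dots> = (\<integral>\<^sup>+X. ennreal (norm (indicator \<Omega> X * indicator K (fst X) * \<bar>1::real\<bar>)) \<partial>lborel) + (\<integral>\<^sup>+X. indicator \<Omega> X * ennreal (H X powr p) \<partial>lborel)"
    by (rule nn_integral_add) measurable
  also have "\<dots> < \<infinity>" using 1 H_Lp by (auto simp: integrable_iff_bounded)
  finally show "(\<integral>\<^sup>+X. ennreal (norm (indicator \<Omega> X * indicator K (fst X) * H X)) \<partial>lborel) < \<infinity>" .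
qed

lemma u_int:
  assumes K: "compact K"
  shows "integrable lborel (\<lambda>X. indicator \<Omega> X * indicator K (fst X) * \<bar>u X\<bar>)"
proof -
  have [measurable]: "K \<in> sets borel" using K by (auto intro: borel_compact)
  obtain d1 where d: "d1 \<ge> 0" "\<And>x. x \<in> K \<Longrightarrow> \<eta>p x - \<eta>m x \<le> d1" using gap_bounds[OF K] by metis
  show ?thesis
  proof (rule Bochner_Integration.integrable_bound)
    show "integrable lborel (\<lambda>X. indicator \<Omega> X * indicator K (fst X) * \<bar>fm (fst X)\<bar> + d1 * (indicator \<Omega> X * indicator K (fst X) * H X))"
      by (intro Bochner_Integration.integrable_add integrable_mult_right f_lift_int H_int K)
    show "AE X in lborel. norm (indicator \<Omega> X * indicator K (fst X) * \<bar>u X\<bar>) \<le> norm (indicator \<Omega> X * indicator K (fst X) * \<bar>fm (fst X)\<bar> + d1 * (indicator \<Omega> X * indicator K (fst X) * H X))"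
    proof (rule AE_I2)
      fix X :: "'a \<times> real"
      show "norm (indicator \<Omega> X * indicator K (fst X) * \<bar>u X\<bar>) \<le> norm (indicator \<Omega> X * indicator K (fst X) * \<bar>fm (fst X)\<bar> + d1 * (indicator \<Omega> X * indicator K (fst X) * H X))"
      proof (cases "X \<in> \<Omega> \<and> fst X \<in> K")
        case True
        obtain x t where X: "X = (x, t)" by (cases X)
        have "t - \<eta>m x \<le> d1" using True d(2)[of x] unfolding X mem_strip by auto
        then have "(t - \<eta>m x) * H X \<le> d1 * H X" using H0 by (intro mult_right_mono) auto
        then have "\<bar>u X\<bar> \<le> \<bar>fm x\<bar> + d1 * H X" using near_m[of x t] True unfolding X by auto
        then show ?thesis using True X by simp
      qed auto
    qed
  qed measurable
qed

text \<open>The boundary terms are written over the base. \<open>bm\<close> and \<open>bp\<close>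
  are the area element times the component along \<open>i\<close> of the upward unit normal; as the
  outward normal points down on the lower graph, that term carries a minus sign.\<close>

lemma integration_by_parts:
  assumes \<psi>: "\<psi> \<in> C1_compact" and i: "i \<in> Basis"
  defines "bm \<equiv> \<lambda>y. snd i - partial (fst i) \<eta>m y" and "bp \<equiv> \<lambda>y. snd i - partial (fst i) \<eta>p y"
  shows "integrable lborel (\<lambda>X. indicator \<Omega> X * (u X * partial i \<psi> X))" (is "integrable _ ?U")
    and "integrable lborel (\<lambda>X. indicator \<Omega> X * (\<psi> X * (D X \<bullet> i)))" (is "integrable _ ?V")
    and "(LINT X|lborel. indicator \<Omega> X * (u X * partial i \<psi> X)) =
        - (LINT X|lborel. indicator \<Omega> X * (\<psi> X * (D X \<bullet> i)))
        + (LINT y|lborel. fp y * \<psi> (y, \<eta>p y) * bp y) - (LINT y|lborel. fm y * \<psi> (y, \<eta>m y) * bm y)"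
proof -
  obtain K M where K: "compact K" "\<And>x. x \<notin> K \<Longrightarrow> \<psi> x = 0" and M: "M \<ge> 0"
    "\<And>x. \<bar>\<psi> x\<bar> \<le> M" "\<And>x y. \<bar>\<psi> x - \<psi> y\<bar> \<le> M * norm (x - y)" and c\<psi>: "continuous_on UNIV \<psi>"
    and dd: "\<And>i x. i \<in> Basis \<Longrightarrow> dir_diff i \<psi> x" and cp: "\<And>i. i \<in> Basis \<Longrightarrow> continuous_on UNIV (partial i \<psi>)"
    and pM: "\<And>i x. i \<in> Basis \<Longrightarrow> \<bar>partial i \<psi> x\<bar> \<le> M" and p0: "\<And>i x. x \<notin> K \<Longrightarrow> partial i \<psi> x = 0"
    using C1_compact_props[OF \<psi>] by metis
  have meas [measurable]: "\<psi> \<in> borel_measurable borel" "partial i \<psi> \<in> borel_measurable borel"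
    "bm \<in> borel_measurable borel" "bp \<in> borel_measurable borel"
    using c\<psi> cp[OF i] partial_borel_measurable[OF cont_eta(1)] partial_borel_measurable[OF cont_eta(2)]
    by (auto simp: bm_def bp_def intro: borel_measurable_continuous_onI)
  define Kx where "Kx = fst ` K"
  have Kx: "compact Kx" unfolding Kx_def by (intro compact_continuous_image continuous_intros K)
  have Kx_borel [measurable]: "Kx \<in> sets borel" using Kx by (auto intro: borel_compact)
  have KKx: "fst X \<in> Kx" if "X \<in> K" for X using that unfolding Kx_def by auto
  have \<psi>0: "\<psi> X = 0" "partial i \<psi> X = 0" if "fst X \<notin> Kx" for X using K(2) p0 KKx that by blast+
  show Uint: "integrable lborel ?U"
  proof (rule Bochner_Integration.integrable_bound)
    show "integrable lborel (\<lambda>X. M * (indicator \<Omega> X * indicator Kx (fst X) * \<bar>u X\<bar>))"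
      by (intro integrable_mult_right u_int Kx)
    show "AE X in lborel. norm (?U X) \<le> norm (M * (indicator \<Omega> X * indicator Kx (fst X) * \<bar>u X\<bar>))"
    proof (rule AE_I2)
      fix X :: "'a \<times> real"
      show "norm (?U X) \<le> norm (M * (indicator \<Omega> X * indicator Kx (fst X) * \<bar>u X\<bar>))"
        using \<psi>0[of X] M(1) mult_left_mono[OF pM[OF i, of X], of "\<bar>u X\<bar>"]
        by (cases "fst X \<in> Kx") (auto simp: indicator_def abs_mult mult.commute)
    qed
  qed measurable
  have normD: "\<bar>D X \<bullet> i\<bar> \<le> norm (D X)" for X using Basis_le_norm[OF i] by simp
  show Vint: "integrable lborel ?V"
  proof (rule Bochner_Integration.integrable_bound)
    show "integrable lborel (\<lambda>X. M * c * (indicator \<Omega> X * indicator Kx (fst X) * H X))"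
      by (intro integrable_mult_right H_int Kx)
    show "AE X in lborel. norm (?V X) \<le> norm (M * c * (indicator \<Omega> X * indicator Kx (fst X) * H X))"
      using D_bound
    proof eventually_elim
      case (elim X)
      show ?case
      proof (cases "X \<in> \<Omega> \<and> fst X \<in> Kx")
        case True
        then have "\<bar>D X \<bullet> i\<bar> \<le> c * H X" using elim normD[of X] by auto
        then have "\<bar>\<psi> X\<bar> * \<bar>D X \<bullet> i\<bar> \<le> M * (c * H X)" using M by (intro mult_mono) auto
        then show ?thesis using True M(1) c0 H0[of X] by (simp add: abs_mult)
      qed (use \<psi>0[of X] in auto)
    qed
  qed measurable
  obtain d0 where d0: "d0 > 0" "\<And>x. x \<in> Kx \<Longrightarrow> d0 \<le> \<eta>p x - \<eta>m x" using gap_bounds[OF Kx] by metis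
  \<comment> \<open>Half of the smallest gap over \<open>Kx\<close>, so that
    \<open>4 * \<delta> n \<le> d0\<close>: two layers of depth \<open>2 * \<delta> n\<close> at
    opposite graphs do not overlap there.\<close>
  define \<delta>0 where "\<delta>0 = d0 / 2"
  define \<delta> where "\<delta> = (\<lambda>n::nat. \<delta>0 / (real n + 2))"
  have \<delta>: "\<delta> n > 0" "4 * \<delta> n \<le> d0" for n using d0 unfolding \<delta>_def \<delta>0_def by (auto simp: field_simps)
  have \<delta>lim: "\<delta> \<longlonglongrightarrow> 0"
    unfolding \<delta>_def using LIMSEQ_ignore_initial_segment[OF lim_const_over_n[of \<delta>0], of 2] by (simp add: add.commute)
  obtain Bm where Bm: "\<And>x. \<bar>partial (fst i) \<eta>m x\<bar> \<le> Bm" using partial_bounded[OF lipm] by blast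
  obtain Bp where Bp: "\<And>x. \<bar>partial (fst i) \<eta>p x\<bar> \<le> Bp" using partial_bounded[OF lipp] by blast
  have bmb: "\<bar>bm x\<bar> \<le> \<bar>snd i\<bar> + Bm" "\<bar>bp x\<bar> \<le> \<bar>snd i\<bar> + Bp" for x using Bm[of x] Bp[of x] unfolding bm_def bp_def by linarith+
  define \<tau>m where "\<tau>m = (\<lambda>X. 1 * (snd X - \<eta>m (fst X)))"
  define \<tau>p where "\<tau>p = (\<lambda>X. -1 * (snd X - \<eta>p (fst X)))"
  define \<theta>m where "\<theta>m = (\<lambda>n X. indicator {\<delta> n<..<2 * \<delta> n} (\<tau>m X) / \<delta> n)"
  define \<theta>p where "\<theta>p = (\<lambda>n X. indicator {\<delta> n<..<2 * \<delta> n} (\<tau>p X) / \<delta> n)"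
  have \<psi>lip: "\<bar>\<psi> (x, t) - \<psi> (x, s)\<bar> \<le> M * \<bar>t - s\<bar>" for x t s
    using M(3)[of "(x, t)" "(x, s)"] by (simp add: norm_Pair)
  define Cm where "Cm = (\<lambda>n X. indicator \<Omega> X * (u X * \<psi> X * bm (fst X)) * \<theta>m n X)"
  define Cp where "Cp = (\<lambda>n X. indicator \<Omega> X * (u X * \<psi> X * bp (fst X)) * \<theta>p n X)"
  have s1: "(1::real) = 1 \<or> (1::real) = -1" and s2: "(-1::real) = 1 \<or> (-1::real) = -1" by auto
  have \<delta>0pos: "\<delta>0 > 0" using d0 unfolding \<delta>0_def by simp
  have \<psi>K: "\<psi> (x, t) = 0" if "x \<notin> Kx" for x t using \<psi>0(1)[of "(x, t)"] that by simp
  have in_m: "(x, t) \<in> \<Omega>" if "x \<in> Kx" "0 < 1 * (t - \<eta>m x)" "1 * (t - \<eta>m x) < \<delta>0" for x t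
    using d0(2)[OF that(1)] that d0(1) unfolding mem_strip \<delta>0_def by auto
  have nnear_m: "\<bar>u (x, t) - fm x\<bar> \<le> 1 * (t - \<eta>m x) * H (x, t)" if "(x, t) \<in> \<Omega>" "0 < 1 * (t - \<eta>m x)" for x t
    using near_m[OF that(1)] by simp
  note LCm = layer_limit[OF eta_borel(1) fm_borel meas(3) u_borel meas(1) H_borel strip_borel Kx_borel s1 \<delta>0pos in_m nnear_m H0 H_int[OF Kx]
      f_lift_int(1)[OF Kx] M(2) \<psi>lip \<psi>K bmb(1)]
  have Cm: "integrable lborel (Cm n)" "(\<lambda>n. LINT X|lborel. Cm n X) \<longlonglongrightarrow> (LINT x|lborel. fm x * \<psi> (x, \<eta>m x) * bm x)" for n
    unfolding Cm_def \<theta>m_def \<tau>m_def \<delta>_def by (rule LCm(1); assumption) (rule LCm(2); assumption)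
  have in_p: "(x, t) \<in> \<Omega>" if "x \<in> Kx" "0 < -1 * (t - \<eta>p x)" "-1 * (t - \<eta>p x) < \<delta>0" for x t
    using d0(2)[OF that(1)] that d0(1) unfolding mem_strip \<delta>0_def by auto
  have nnear_p: "\<bar>u (x, t) - fp x\<bar> \<le> -1 * (t - \<eta>p x) * H (x, t)" if "(x, t) \<in> \<Omega>" "0 < -1 * (t - \<eta>p x)" for x t
    using near_p[OF that(1)] by simp
  note LCp = layer_limit[OF eta_borel(2) fp_borel meas(4) u_borel meas(1) H_borel strip_borel Kx_borel s2 \<delta>0pos in_p nnear_p H0 H_int[OF Kx]
      f_lift_int(2)[OF Kx] M(2) \<psi>lip \<psi>K bmb(2)]
  have Cp: "integrable lborel (Cp n)" "(\<lambda>n. LINT X|lborel. Cp n X) \<longlonglongrightarrow> (LINT x|lborel. fp x * \<psi> (x, \<eta>p x) * bp x)" for n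
    unfolding Cp_def \<theta>p_def \<tau>p_def \<delta>_def by (rule LCp(1); assumption) (rule LCp(2); assumption)
  have lip\<tau>: "\<bar>\<tau>m X - \<tau>m Y\<bar> \<le> (1 + \<bar>L\<bar>) * norm (X - Y)" "\<bar>\<tau>p X - \<tau>p Y\<bar> \<le> (1 + \<bar>L\<bar>) * norm (X - Y)" for X Y
    unfolding \<tau>m_def \<tau>p_def by (rule graph_distance_lipschitz[OF lipm] graph_distance_lipschitz[OF lipp]; simp)+
  have ll: "loc_lip UNIV \<tau>m" "loc_lip UNIV \<tau>p"
    using lip\<tau> by (auto intro!: loc_lip_lipschitz simp: dist_norm)
  have cont\<tau>: "continuous_on UNIV \<tau>m" "continuous_on UNIV \<tau>p"
    using ll by (auto intro: loc_lip_continuous_on)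
  have [measurable]: "\<tau>m \<in> borel_measurable borel" "\<tau>p \<in> borel_measurable borel"
    using cont\<tau> by (auto intro: borel_measurable_continuous_onI)
  define \<zeta> where "\<zeta> = (\<lambda>n X. ramp (\<tau>m X / \<delta> n) * ramp (\<tau>p X / \<delta> n))"
  have \<zeta>01: "0 \<le> \<zeta> n X" "\<zeta> n X \<le> 1" for n X
    unfolding \<zeta>_def using ramp_bounds by (auto intro!: mult_nonneg_nonneg mult_le_one)
  have ramp_ll: "loc_lip UNIV (\<lambda>X. ramp (\<tau> X / \<delta> n))" if "\<And>X Y. \<bar>\<tau> X - \<tau> Y\<bar> \<le> (1 + \<bar>L\<bar>) * norm (X - Y)" for \<tau> :: "'a \<times> real \<Rightarrow> real" and n
  proof (rule loc_lip_lipschitz)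
    fix X Y
    have "\<bar>ramp (\<tau> X / \<delta> n) - ramp (\<tau> Y / \<delta> n)\<bar> \<le> \<bar>\<tau> X / \<delta> n - \<tau> Y / \<delta> n\<bar>" by (rule ramp_lipschitz)
    also have "\<dots> = \<bar>\<tau> X - \<tau> Y\<bar> / \<delta> n" using \<delta>(1)[of n] by (simp add: diff_divide_distrib[symmetric] abs_divide)
    also have "\<dots> \<le> (1 + \<bar>L\<bar>) * norm (X - Y) / \<delta> n" using that \<delta>(1)[of n] by (intro divide_right_mono) auto
    finally show "\<bar>ramp (\<tau> X / \<delta> n) - ramp (\<tau> Y / \<delta> n)\<bar> \<le> (1 + \<bar>L\<bar>) / \<delta> n * dist X Y" by (simp add: dist_norm)
  qed
  have \<zeta>ll: "loc_lip UNIV (\<zeta> n)" for n unfolding \<zeta>_def by (intro loc_lip_mult ramp_ll lip\<tau>)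
  have [measurable]: "\<zeta> n \<in> borel_measurable borel" for n
    using loc_lip_continuous_on[OF \<zeta>ll] by (rule borel_measurable_continuous_onI)
  define \<phi> where "\<phi> = (\<lambda>n X. \<psi> X * \<zeta> n X)"
  have \<psi>ll: "loc_lip UNIV \<psi>" using M(3) by (intro loc_lip_lipschitz[where C = M]) (simp add: dist_norm)
  have \<phi>ll: "loc_lip UNIV (\<phi> n)" for n unfolding \<phi>_def by (intro loc_lip_mult \<psi>ll \<zeta>ll)
  \<comment> \<open>A compact subset of the strip outside which the cut-off test function vanishes;
    it keeps distance from both graphs.\<close>
  define S where "S = (\<lambda>n. K \<inter> {X. \<delta> n \<le> \<tau>m X} \<inter> {X. \<delta> n \<le> \<tau>p X})"
  have S: "compact (S n)" for n unfolding S_def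
    by (intro compact_Int_closed K closed_Collect_le cont\<tau> continuous_on_const)
  have S\<Omega>: "S n \<subseteq> \<Omega>" for n
  proof
    fix X assume "X \<in> S n"
    then show "X \<in> \<Omega>" using \<delta>(1)[of n] unfolding S_def \<tau>m_def \<tau>p_def by (cases X) (auto simp: mem_strip)
  qed
  have \<phi>0: "\<phi> n X = 0" if XS: "X \<notin> S n" for n X
  proof -
    consider "X \<notin> K" | "\<tau>m X / \<delta> n \<le> 1" | "\<tau>p X / \<delta> n \<le> 1"
      using XS \<delta>(1)[of n] unfolding S_def by (force simp: field_simps)
    then show ?thesis by cases (auto simp: \<phi>_def \<zeta>_def K(2) ramp_eq(1))
  qed
  have ibp: "integrable lborel (\<lambda>X. partial i (\<lambda>X. u X * \<phi> n X) X)"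
    "(LINT X|lborel. partial i (\<lambda>X. u X * \<phi> n X) X) = 0"
    "AE X in lborel. partial i (\<lambda>X. u X * \<phi> n X) X = indicator \<Omega> X * (partial i u X * \<phi> n X + u X * partial i (\<phi> n) X)" for n
    by (rule integral_by_parts_compact_support[OF u_lip open_strip \<phi>ll S S\<Omega>], rule \<phi>0, assumption)+
  \<comment> \<open>Product rule off the null set of kinks. The depths have derivatives
    \<open>bm\<close> and \<open>- bp\<close>, which is the origin of the opposite signs of
    \<open>Cm n\<close> and \<open>Cp n\<close>.\<close>
  have dec: "AE X in lborel. partial i (\<lambda>X. u X * \<phi> n X) X = ?V X * \<zeta> n X + ?U X * \<zeta> n X + Cm n X - Cp n X" for n
  proof -
    have g1: "AE X in lborel. snd X \<noteq> \<eta>m (fst X) + \<delta> n" "AE X in lborel. snd X \<noteq> \<eta>m (fst X) + 2 * \<delta> n"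
      "AE X in lborel. snd X \<noteq> \<eta>p (fst X) - \<delta> n" "AE X in lborel. snd X \<noteq> \<eta>p (fst X) - 2 * \<delta> n"
      by (rule AE_graph; measurable)+
    have g2: "AE X in lborel. dir_diff i \<tau>m X" "AE X in lborel. dir_diff i \<tau>p X"
      by (rule lipschitz_AE_dir_diff[OF lip\<tau>(1)] lipschitz_AE_dir_diff[OF lip\<tau>(2)])+
    show ?thesis using ibp(3)[of n] g1 g2 D_eq[OF i]
    proof eventually_elim
      case (elim X)
      show ?case
      proof (cases "X \<in> \<Omega>")
        case False
        then show ?thesis using elim(1) unfolding Cm_def Cp_def by simp
      next
        case True
        have ne: "\<tau>m X \<noteq> \<delta> n" "\<tau>m X \<noteq> 2 * \<delta> n" "\<tau>p X \<noteq> \<delta> n" "\<tau>p X \<noteq> 2 * \<delta> n"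
          using elim(2-5) unfolding \<tau>m_def \<tau>p_def by auto
        note rm = partial_ramp[OF cont\<tau>(1) elim(6) \<delta>(1) ne(1,2)]
        note rp = partial_ramp[OF cont\<tau>(2) elim(7) \<delta>(1) ne(3,4)]
        have pm: "partial i \<tau>m X = bm (fst X)"
          using partial_graph_distance[of i 1 \<eta>m X] elim(6) unfolding \<tau>m_def bm_def by simp
        have pp: "partial i \<tau>p X = - bp (fst X)"
          using partial_graph_distance[of i "-1" \<eta>p X] elim(7) unfolding \<tau>p_def bp_def by simp
        have p\<zeta>: "dir_diff i (\<zeta> n) X" "partial i (\<zeta> n) X = \<theta>m n X * bm (fst X) * ramp (\<tau>p X / \<delta> n) - ramp (\<tau>m X / \<delta> n) * (\<theta>p n X * bp (fst X))"
          unfolding \<zeta>_def using dir_diff_mult[OF rm(1) rp(1)] rm(2) rp(2) pm pp unfolding \<theta>m_def \<theta>p_def by simp_all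
        have p\<phi>: "partial i (\<phi> n) X = partial i \<psi> X * \<zeta> n X + \<psi> X * partial i (\<zeta> n) X"
          unfolding \<phi>_def by (rule dir_diff_mult(2)[OF dd[OF i] p\<zeta>(1)])
        \<comment> \<open>Over \<open>Kx\<close> the two depths add up to at least
          \<open>4 * \<delta> n\<close>, so where one ramp is not constant the other one equals 1.
          Off \<open>Kx\<close> the factor \<open>\<psi> X\<close> is 0.\<close>
        have key: "\<psi> X * (\<theta>m n X * ramp (\<tau>p X / \<delta> n)) = \<psi> X * \<theta>m n X \<and> \<psi> X * (ramp (\<tau>m X / \<delta> n) * \<theta>p n X) = \<psi> X * \<theta>p n X"
        proof (cases "fst X \<in> Kx")
          case False
          then show ?thesis using \<psi>0 by simp
        next
          case True
          have sum: "\<tau>m X + \<tau>p X \<ge> 4 * \<delta> n" using d0(2)[OF True] \<delta>(2)[of n] unfolding \<tau>m_def \<tau>p_def by simp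
          have "\<theta>m n X * ramp (\<tau>p X / \<delta> n) = \<theta>m n X"
          proof (cases "\<tau>m X < 2 * \<delta> n")
            case True
            then have "2 \<le> \<tau>p X / \<delta> n" using sum \<delta>(1)[of n] by (simp add: field_simps)
            then show ?thesis by (simp add: ramp_eq)
          qed (simp add: \<theta>m_def)
          moreover have "ramp (\<tau>m X / \<delta> n) * \<theta>p n X = \<theta>p n X"
          proof (cases "\<tau>p X < 2 * \<delta> n")
            case True
            then have "2 \<le> \<tau>m X / \<delta> n" using sum \<delta>(1)[of n] by (simp add: field_simps)
            then show ?thesis by (simp add: ramp_eq)
          qed (simp add: \<theta>p_def)
          ultimately show ?thesis by simp
        qed
        have "\<psi> X * partial i (\<zeta> n) X = (\<psi> X * (\<theta>m n X * ramp (\<tau>p X / \<delta> n))) * bm (fst X) - (\<psi> X * (ramp (\<tau>m X / \<delta> n) * \<theta>p n X)) * bp (fst X)"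
          unfolding p\<zeta>(2) by (simp add: algebra_simps)
        also have "\<dots> = \<psi> X * \<theta>m n X * bm (fst X) - \<psi> X * \<theta>p n X * bp (fst X)" by (simp only: key)
        finally have e2: "partial i (\<phi> n) X = partial i \<psi> X * \<zeta> n X + (\<psi> X * \<theta>m n X * bm (fst X) - \<psi> X * \<theta>p n X * bp (fst X))"
          unfolding p\<phi> by (simp only:)
        have "partial i (\<lambda>X. u X * \<phi> n X) X = (D X \<bullet> i) * \<phi> n X + u X * partial i (\<phi> n) X"
          using elim(1,8) True by simp
        then show ?thesis unfolding e2 using True by (simp add: Cm_def Cp_def \<phi>_def algebra_simps)
      qed
    qed
  qed
  have V\<zeta>: "integrable lborel (\<lambda>X. ?V X * \<zeta> n X)" for n
    by (rule Bochner_Integration.integrable_bound[OF Vint]) (use \<zeta>01 in \<open>auto simp: abs_mult intro!: AE_I2 mult_left_le\<close>)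
  have U\<zeta>: "integrable lborel (\<lambda>X. ?U X * \<zeta> n X)" for n
    by (rule Bochner_Integration.integrable_bound[OF Uint]) (use \<zeta>01 in \<open>auto simp: abs_mult intro!: AE_I2 mult_left_le\<close>)
  have zero: "0 = (LINT X|lborel. ?V X * \<zeta> n X) + (LINT X|lborel. ?U X * \<zeta> n X) + (LINT X|lborel. Cm n X) - (LINT X|lborel. Cp n X)" for n
  proof -
    have "0 = (LINT X|lborel. partial i (\<lambda>X. u X * \<phi> n X) X)" using ibp(2)[of n] by simp
    also have "\<dots> = (LINT X|lborel. ?V X * \<zeta> n X + ?U X * \<zeta> n X + Cm n X - Cp n X)"
      using dec[of n] ibp(1)[of n] V\<zeta>[of n] U\<zeta>[of n] Cm(1)[of n] Cp(1)[of n]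
      by (intro integral_cong_AE) auto
    also have "\<dots> = (LINT X|lborel. ?V X * \<zeta> n X) + (LINT X|lborel. ?U X * \<zeta> n X) + (LINT X|lborel. Cm n X) - (LINT X|lborel. Cp n X)"
      using V\<zeta>[of n] U\<zeta>[of n] Cm(1)[of n] Cp(1)[of n] by (simp add: Bochner_Integration.integral_add Bochner_Integration.integral_diff)
    finally show ?thesis .
  qed
  have \<zeta>lim: "(\<lambda>n. \<zeta> n X) \<longlonglongrightarrow> 1" if "X \<in> \<Omega>" for X
  proof -
    have pos: "\<tau>m X > 0" "\<tau>p X > 0" using that unfolding \<tau>m_def \<tau>p_def by (cases X; simp add: mem_strip)+
    have "eventually (\<lambda>n. \<delta> n < \<tau>m X / 2) sequentially" "eventually (\<lambda>n. \<delta> n < \<tau>p X / 2) sequentially"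
      using pos by (intro order_tendstoD(2)[OF \<delta>lim]; simp)+
    then have "eventually (\<lambda>n. \<zeta> n X = 1) sequentially"
    proof eventually_elim
      case (elim n)
      then have "2 \<le> \<tau>m X / \<delta> n" "2 \<le> \<tau>p X / \<delta> n" using \<delta>(1)[of n] by (simp_all add: field_simps)
      then show ?case by (simp add: \<zeta>_def ramp_eq)
    qed
    then show ?thesis by (rule tendsto_eventually)
  qed
  \<comment> \<open>The cutoffs tend to 1 only inside the strip, so the limit is the full integral
    of \<open>W\<close> because \<open>W\<close> vanishes outside.\<close>
  have dct: "(\<lambda>n. LINT X|lborel. W X * \<zeta> n X) \<longlonglongrightarrow> (LINT X|lborel. W X)" if W: "integrable lborel W" "\<And>X. X \<notin> \<Omega> \<Longrightarrow> W X = 0" for W :: "'a \<times> real \<Rightarrow> real"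
  proof (rule integral_dominated_convergence[where w = "\<lambda>X. norm (W X)"])
    have [measurable]: "W \<in> borel_measurable lborel" using W(1) by simp
    show "W \<in> borel_measurable lborel" "(\<lambda>X. W X * \<zeta> n X) \<in> borel_measurable lborel" for n by measurable
    show "AE X in lborel. (\<lambda>n. W X * \<zeta> n X) \<longlonglongrightarrow> W X"
    proof (rule AE_I2)
      fix X show "(\<lambda>n. W X * \<zeta> n X) \<longlonglongrightarrow> W X"
        using tendsto_mult[OF tendsto_const[of "W X"] \<zeta>lim[of X]] W(2)[of X] by (cases "X \<in> \<Omega>") auto
    qed
    show "AE X in lborel. norm (W X * \<zeta> n X) \<le> norm (W X)" for n
      using \<zeta>01 by (auto simp: abs_mult intro!: AE_I2 mult_left_le)
    show "integrable lborel (\<lambda>X. norm (W X))" using W(1) by (rule integrable_norm)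
  qed
  have "(\<lambda>n. (LINT X|lborel. ?V X * \<zeta> n X) + (LINT X|lborel. ?U X * \<zeta> n X) + (LINT X|lborel. Cm n X) - (LINT X|lborel. Cp n X))
    \<longlonglongrightarrow> (LINT X|lborel. ?V X) + (LINT X|lborel. ?U X) + (LINT x|lborel. fm x * \<psi> (x, \<eta>m x) * bm x) - (LINT x|lborel. fp x * \<psi> (x, \<eta>p x) * bp x)"
    by (intro tendsto_add tendsto_diff dct Vint Uint Cm(2) Cp(2)) auto
  then have "(LINT X|lborel. ?V X) + (LINT X|lborel. ?U X) + (LINT x|lborel. fm x * \<psi> (x, \<eta>m x) * bm x) - (LINT x|lborel. fp x * \<psi> (x, \<eta>p x) * bp x) = 0"
    unfolding zero[symmetric] by (simp add: LIMSEQ_const_iff)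
  then show "(LINT X|lborel. ?U X) = - (LINT X|lborel. ?V X) + (LINT y|lborel. fp y * \<psi> (y, \<eta>p y) * bp y) - (LINT y|lborel. fm y * \<psi> (y, \<eta>m y) * bm y)"
    by linarith
qed

end

section \<open>Trace and weak gradient\<close>

lemma Cinf_compact_C1: "\<psi> \<in> Cinf_compact S \<Longrightarrow> \<psi> \<in> C1_compact"
  unfolding Cinf_compact_def C1_compact_def by blast

lemma set_integral_lebesgue_eq:
  fixes f :: "'a::euclidean_space \<Rightarrow> real"
  assumes "(\<lambda>x. indicator S x * f x) \<in> borel_measurable borel"
  shows "(LINT x:S|lebesgue. f x) = (LINT x|lborel. indicator S x * f x)"
    and "set_integrable lebesgue S f \<longleftrightarrow> integrable lborel (\<lambda>x. indicator S x * f x)"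
  using assms unfolding set_lebesgue_integral_def set_integrable_def
  by (simp_all add: integral_completion integrable_completion)

lemma grad_inner_fst:
  fixes i :: "'a::euclidean_space \<times> real"
  assumes "i \<in> Basis"
  shows "grad \<eta> y \<bullet> fst i = partial (fst i) \<eta> y"
proof (cases "fst i = 0")
  case True
  \<comment> \<open>Case of the vertical basis vector, whose base component is 0.\<close>
  have "partial 0 \<eta> y = 0" by (rule partialI) simp
  then show ?thesis using True by simp
next
  case False
  then have "fst i \<in> Basis" using assms by (auto simp: Basis_prod_def)
  then show ?thesis unfolding grad_def by (simp add: inner_sum_left_Basis)
qed

lemma area_bounded:
  fixes \<eta> :: "'a::euclidean_space \<Rightarrow> real"
  assumes lip: "\<And>x y. \<bar>\<eta> x - \<eta> y\<bar> \<le> C * norm (x - y)"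
  shows "\<exists>A\<ge>0. \<forall>y. area \<eta> y \<le> A"
proof -
  have "\<forall>b. \<exists>B. \<forall>x. \<bar>partial b \<eta> x\<bar> \<le> B" using partial_bounded[OF lip] by blast
  then obtain B where B: "\<And>b x. \<bar>partial b \<eta> x\<bar> \<le> B b" by metis
  define S where "S = (\<Sum>b\<in>(Basis::'a set). B b)"
  have g: "norm (grad \<eta> y) \<le> S" for y
  proof -
    have "norm (grad \<eta> y) \<le> (\<Sum>b\<in>Basis. norm (partial b \<eta> y *\<^sub>R b))" unfolding grad_def by (rule norm_sum)
    also have "\<dots> \<le> S" unfolding S_def by (rule sum_mono) (use B in simp)
    finally show ?thesis .
  qed
  have "area \<eta> y \<le> sqrt (1 + S\<^sup>2)" for y
    unfolding area_def using g[of y] by (intro real_sqrt_le_mono add_left_mono power_mono) auto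
  then show ?thesis by (intro exI[of _ "sqrt (1 + S\<^sup>2)"]) auto
qed

context strip_function
begin

lemma D_int:
  assumes K: "compact K" and i: "i \<in> Basis"
  shows "integrable lborel (\<lambda>X. indicator \<Omega> X * indicator K (fst X) * \<bar>D X \<bullet> i\<bar>)"
proof -
  have [measurable]: "K \<in> sets borel" using K by (auto intro: borel_compact)
  show ?thesis
  proof (rule Bochner_Integration.integrable_bound)
    show "integrable lborel (\<lambda>X. c * (indicator \<Omega> X * indicator K (fst X) * H X))"
      by (intro integrable_mult_right H_int K)
    show "AE X in lborel. norm (indicator \<Omega> X * indicator K (fst X) * \<bar>D X \<bullet> i\<bar>) \<le> norm (c * (indicator \<Omega> X * indicator K (fst X) * H X))"
      using D_bound
    proof eventually_elim
      case (elim X)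
      have "\<bar>D X \<bullet> i\<bar> \<le> norm (D X)" using Basis_le_norm[OF i] by simp
      then show ?case using elim c0 H0[of X] by (auto simp: indicator_def)
    qed
  qed measurable
qed

lemma L1_loc_if_lift_integrable:
  fixes f :: "'a \<times> real \<Rightarrow> real"
  assumes [measurable]: "f \<in> borel_measurable borel"
    and int: "\<And>K. compact K \<Longrightarrow> integrable lborel (\<lambda>X. indicator \<Omega> X * indicator K (fst X) * \<bar>f X\<bar>)"
  shows "f \<in> L1_loc \<Omega>"
  unfolding L1_loc_def
proof safe
  fix K assume K: "compact K" "K \<subseteq> \<Omega>"
  have [measurable]: "K \<in> sets borel" using K by (auto intro: borel_compact)
  have cK: "compact (fst ` K)" by (intro compact_continuous_image continuous_intros K)
  then have [measurable]: "fst ` K \<in> sets borel" by (auto intro: borel_compact)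
  have "integrable lborel (\<lambda>X. indicator K X * f X)"
  proof (rule Bochner_Integration.integrable_bound[OF int[OF cK]])
    show "AE X in lborel. norm (indicator K X * f X) \<le> norm (indicator \<Omega> X * indicator (fst ` K) (fst X) * \<bar>f X\<bar>)"
      using K(2) by (intro AE_I2) (auto simp: indicator_def)
  qed measurable
  then show "set_integrable lebesgue K f" by (subst set_integral_lebesgue_eq(2)) auto
qed

text \<open>A test function supported inside the open strip vanishes on both graphs, so integration
  by parts leaves no boundary terms.\<close>

lemma weak_gradient: "has_weak_gradient \<Omega> u D"
  unfolding has_weak_gradient_def
proof (intro conjI ballI)
  show "u \<in> L1_loc \<Omega>" by (rule L1_loc_if_lift_integrable[OF u_borel u_int])
  fix i :: "'a \<times> real" assume i: "i \<in> Basis"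
  show "(\<lambda>x. D x \<bullet> i) \<in> L1_loc \<Omega>" by (rule L1_loc_if_lift_integrable[OF _ D_int[OF _ i]]) measurable
  fix \<psi> assume \<psi>: "\<psi> \<in> Cinf_compact \<Omega>"
  then obtain K where K: "K \<subseteq> \<Omega>" "\<And>x. x \<notin> K \<Longrightarrow> \<psi> x = 0" unfolding Cinf_compact_def by blast
  note C1 = Cinf_compact_C1[OF \<psi>]
  have zero: "\<psi> (y, \<eta>p y) = 0" "\<psi> (y, \<eta>m y) = 0" for y using K by (auto simp: mem_strip intro!: K(2))
  have [measurable]: "\<psi> \<in> borel_measurable borel" "partial i \<psi> \<in> borel_measurable borel"
    using C1_compact_props[OF C1] i by (metis borel_measurable_continuous_onI)+
  have "(LINT X|lborel. indicator \<Omega> X * (u X * partial i \<psi> X)) = - (LINT X|lborel. indicator \<Omega> X * (\<psi> X * (D X \<bullet> i)))"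
    using integration_by_parts(3)[OF C1 i] zero by simp
  then show "(LINT x:\<Omega>|lebesgue. u x * partial i \<psi> x) = - (LINT x:\<Omega>|lebesgue. (D x \<bullet> i) * \<psi> x)"
    by (subst (1 2) set_integral_lebesgue_eq(1)) (auto simp: mult.commute mult.left_commute)
qed

lemma D_Lp:
  "(\<integral>\<^sup>+x\<in>\<Omega>. ennreal (norm (D x) powr p) \<partial>lebesgue) \<le> ennreal (c powr p) * (\<integral>\<^sup>+X. indicator \<Omega> X * ennreal (H X powr p) \<partial>lborel)"
proof -
  have "(\<integral>\<^sup>+x\<in>\<Omega>. ennreal (norm (D x) powr p) \<partial>lebesgue) = (\<integral>\<^sup>+x. ennreal (norm (D x) powr p) * indicator \<Omega> x \<partial>lborel)"
    by (simp add: nn_integral_completion)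
  also have "\<dots> \<le> (\<integral>\<^sup>+x. ennreal (c powr p) * (indicator \<Omega> x * ennreal (H x powr p)) \<partial>lborel)"
    using D_bound
  proof (intro nn_integral_mono_AE, eventually_elim)
    case (elim X)
    show ?case
    proof (cases "X \<in> \<Omega>")
      case True
      then have "norm (D X) powr p \<le> (c * H X) powr p" using elim p1 by (intro powr_mono2) auto
      also have "\<dots> = c powr p * H X powr p" using c0 H0 by (simp add: powr_mult)
      finally show ?thesis using True by (simp add: ennreal_mult[symmetric] ennreal_leI)
    qed simp
  qed
  also have "\<dots> = ennreal (c powr p) * (\<integral>\<^sup>+X. indicator \<Omega> X * ennreal (H X powr p) \<partial>lborel)"
    by (rule nn_integral_cmult) measurable
  finally show ?thesis .
qed

lemma in_hom_sobolev: "u \<in> hom_sobolev \<Omega> p"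
  unfolding hom_sobolev_def
proof (intro CollectI exI[of _ D] conjI ballI)
  show "has_weak_gradient \<Omega> u D" by (rule weak_gradient)
  fix i :: "'a \<times> real" assume i: "i \<in> Basis"
  have "(\<integral>\<^sup>+x\<in>\<Omega>. ennreal (\<bar>D x \<bullet> i\<bar> powr p) \<partial>lebesgue) \<le> (\<integral>\<^sup>+x\<in>\<Omega>. ennreal (norm (D x) powr p) \<partial>lebesgue)"
  proof (intro nn_integral_mono mult_right_mono ennreal_leI powr_mono2)
    show "\<bar>D x \<bullet> i\<bar> \<le> norm (D x)" for x using Basis_le_norm[OF i] by simp
  qed (use p1 in auto)
  also note D_Lp
  also have "ennreal (c powr p) * (\<integral>\<^sup>+X. indicator \<Omega> X * ennreal (H X powr p) \<partial>lborel) < \<infinity>"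
    using H_Lp by (simp add: ennreal_mult_less_top)
  finally show "(\<integral>\<^sup>+x\<in>\<Omega>. ennreal (\<bar>D x \<bullet> i\<bar> powr p) \<partial>lebesgue) < \<infinity>" .
qed

text \<open>The graphs are disjoint, so on the boundary the test for the upper graph separates them.
  The complement of the boundary has measure 0 and may carry any Borel extension.\<close>

definition trace_fun :: "'a \<times> real \<Rightarrow> real" where
  "trace_fun X = (if snd X = \<eta>p (fst X) then fp (fst X) else fm (fst X))"

lemma trace_fun_graph: "trace_fun (y, \<eta>p y) = fp y" "trace_fun (y, \<eta>m y) = fm y"
  using gap[of y] unfolding trace_fun_def by auto

lemma trace_fun_borel [measurable]: "trace_fun \<in> borel_measurable borel"
  unfolding trace_fun_def[abs_def] by measurable

lemma trace_fun_Lp: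
  assumes K: "compact K"
  shows "(\<integral>\<^sup>+x\<in>K. ennreal (\<bar>trace_fun x\<bar> powr p) \<partial>boundary_measure \<eta>m \<eta>p) < \<infinity>"
proof -
  have [measurable]: "K \<in> sets borel" using K by (auto intro: borel_compact)
  have Kx: "compact (fst ` K)" by (intro compact_continuous_image continuous_intros K)
  have bound: "(\<integral>\<^sup>+y. ennreal (area \<eta> y) * (ennreal (\<bar>f y\<bar> powr p) * indicator K (y, \<eta> y)) \<partial>lborel) < \<infinity>"
    if f: "f \<in> Lp_loc p" "f \<in> borel_measurable borel" and lip: "\<And>x y. \<bar>\<eta> x - \<eta> y\<bar> \<le> L * norm (x - y)" for f \<eta> :: "'a \<Rightarrow> real"
  proof -
    obtain A where A: "A \<ge> 0" "\<And>y. area \<eta> y \<le> A" using area_bounded[OF lip] by blast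
    have [measurable]: "f \<in> borel_measurable borel" "fst ` K \<in> sets borel" using f(2) Kx by (auto intro: borel_compact)
    have "(\<integral>\<^sup>+y. ennreal (area \<eta> y) * (ennreal (\<bar>f y\<bar> powr p) * indicator K (y, \<eta> y)) \<partial>lborel)
      \<le> (\<integral>\<^sup>+y. ennreal A * (ennreal (\<bar>f y\<bar> powr p) * indicator (fst ` K) y) \<partial>lborel)"
    proof (intro nn_integral_mono mult_mono ennreal_leI A mult_left_mono)
      fix y
      show "indicator K (y, \<eta> y) \<le> (indicator (fst ` K) y :: ennreal)" by (force simp: indicator_def)
    qed auto
    also have "\<dots> = ennreal A * (\<integral>\<^sup>+y. ennreal (\<bar>f y\<bar> powr p) * indicator (fst ` K) y \<partial>lborel)"
      by (rule nn_integral_cmult) measurable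
    also have "\<dots> < \<infinity>"
      using f(1) Kx unfolding Lp_loc_def by (auto simp: nn_integral_completion ennreal_mult_less_top)
    finally show ?thesis .
  qed
  have "(\<integral>\<^sup>+x\<in>K. ennreal (\<bar>trace_fun x\<bar> powr p) \<partial>boundary_measure \<eta>m \<eta>p) =
    (\<integral>\<^sup>+y. ennreal (area \<eta>m y) * (ennreal (\<bar>fm y\<bar> powr p) * indicator K (y, \<eta>m y)) \<partial>lborel)
    + (\<integral>\<^sup>+y. ennreal (area \<eta>p y) * (ennreal (\<bar>fp y\<bar> powr p) * indicator K (y, \<eta>p y)) \<partial>lborel)"
    by (subst nn_integral_boundary_measure[OF cont_eta]) (auto simp: trace_fun_graph)
  then show ?thesis using bound[OF fm_Lp fm_borel lipm] bound[OF fp_Lp fp_borel lipp] by simp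
qed

text \<open>On almost every vertical segment \<open>u\<close> equals \<open>w\<close> almost
  everywhere and \<open>H\<close> is integrable, its \<open>p\<close>-th power being so. There
  \<open>w\<close> has limits at both ends by continuity on the closure, and the estimates of
  \<open>u\<close> near the graphs force these limits to be the data by
  \<open>no_other_limit_at_endpoint\<close>.\<close>

lemma trace_fun_continuous:
  assumes w: "continuous_on (closure \<Omega>) w" and eq: "AE x in lebesgue. x \<in> \<Omega> \<longrightarrow> u x = w x"
  shows "AE x in boundary_measure \<eta>m \<eta>p. trace_fun x = w x"
proof (rule AE_boundary_measure[OF cont_eta])
  have "AE X in lborel. X \<in> \<Omega> \<longrightarrow> u X = w X" using eq by (simp add: AE_completion_iff)
  then have "AE X in lborel \<Otimes>\<^sub>M lborel. X \<in> \<Omega> \<longrightarrow> u X = w X" by (simp only: lborel_prod)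
  then have eq2: "AE y in lborel. AE t in lborel. (y, t) \<in> \<Omega> \<longrightarrow> u (y, t) = w (y, t)"
    by (rule lborel_pair.AE_pair)
  have "(\<integral>\<^sup>+y. (\<integral>\<^sup>+t. indicator \<Omega> (y, t) * ennreal (H (y, t) powr p) \<partial>lborel) \<partial>lborel) \<noteq> \<infinity>"
    using H_Lp by (subst nn_integral_lborel_prod[symmetric]) auto
  then have "AE y in lborel. (\<integral>\<^sup>+t. indicator \<Omega> (y, t) * ennreal (H (y, t) powr p) \<partial>lborel) \<noteq> \<infinity>"
    by (intro nn_integral_PInf_AE) (auto intro!: lborel.borel_measurable_nn_integral)
  with eq2 show "AE y in lborel. trace_fun (y, \<eta>m y) = w (y, \<eta>m y) \<and> trace_fun (y, \<eta>p y) = w (y, \<eta>p y)"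
  proof eventually_elim
    case (elim y)
    let ?S = "{\<eta>m y<..<\<eta>p y}"
    have lt: "\<eta>m y < \<eta>p y" by (rule gap)
    have Hm: "(\<lambda>t. H (y, t)) \<in> borel_measurable borel" by measurable
    have fin: "(\<integral>\<^sup>+t. indicator ?S t * ennreal (H (y, t)) \<partial>lborel) < \<infinity>"
    proof -
      have "(\<integral>\<^sup>+t. indicator ?S t * ennreal (H (y, t)) \<partial>lborel) \<le> (\<integral>\<^sup>+t. indicator ?S t + indicator \<Omega> (y, t) * ennreal (H (y, t) powr p) \<partial>lborel)"
      proof (rule nn_integral_mono)
        fix t
        show "indicator ?S t * ennreal (H (y, t)) \<le> indicator ?S t + indicator \<Omega> (y, t) * ennreal (H (y, t) powr p)"
          using ennreal_leI[OF le_1_plus_powr[of "H (y, t)" p]] p1 H0[of "(y, t)"] by (auto simp: indicator_def mem_strip)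
      qed
      also have "\<dots> = emeasure lborel ?S + (\<integral>\<^sup>+t. indicator \<Omega> (y, t) * ennreal (H (y, t) powr p) \<partial>lborel)"
        by (subst nn_integral_add) auto
      also have "\<dots> < \<infinity>" using elim(2) lt by (auto simp: top.not_eq_extremum)
      finally show ?thesis .
    qed
    have lim: "((\<lambda>t. w (y, t)) \<longlongrightarrow> w (y, e)) (at e within ?S)" if "e \<in> {\<eta>m y..\<eta>p y}" for e
    proof -
      have "Pair y ` closure ?S \<subseteq> closure \<Omega>"
      proof (rule image_closure_subset)
        show "Pair y ` ?S \<subseteq> closure \<Omega>" using closure_subset[of \<Omega>] by (auto simp: mem_strip)
      qed (auto intro!: continuous_intros)
      moreover have "closure ?S = {\<eta>m y..\<eta>p y}" using lt by (rule closure_greaterThanLessThan)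
      ultimately have "Pair y ` {\<eta>m y..\<eta>p y} \<subseteq> closure \<Omega>" by simp
      then have "continuous_on {\<eta>m y..\<eta>p y} (\<lambda>t. w (y, t))"
        by (intro continuous_on_compose2[OF w]) (auto intro!: continuous_intros)
      then have "((\<lambda>t. w (y, t)) \<longlongrightarrow> w (y, e)) (at e within {\<eta>m y..\<eta>p y})"
        using that by (simp add: continuous_on_def)
      then show ?thesis by (rule tendsto_within_subset) auto
    qed
    have "w (y, \<eta>m y) = fm y"
    proof (rule no_other_limit_at_endpoint[OF lt _ _ fin Hm lim])
      show "AE t in lborel. t \<in> ?S \<longrightarrow> \<bar>w (y, t) - fm y\<bar> \<le> \<bar>t - \<eta>m y\<bar> * H (y, t)"
        using elim(1)
      proof eventually_elim
        case (elim t)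
        show ?case
        proof
          assume t: "t \<in> ?S"
          then have "(y, t) \<in> \<Omega>" by (simp add: mem_strip)
          with elim near_m[of y t] t show "\<bar>w (y, t) - fm y\<bar> \<le> \<bar>t - \<eta>m y\<bar> * H (y, t)" by simp
        qed
      qed
    qed (use lt in auto)
    moreover have "w (y, \<eta>p y) = fp y"
    proof (rule no_other_limit_at_endpoint[OF lt _ _ fin Hm lim])
      show "AE t in lborel. t \<in> ?S \<longrightarrow> \<bar>w (y, t) - fp y\<bar> \<le> \<bar>t - \<eta>p y\<bar> * H (y, t)"
        using elim(1)
      proof eventually_elim
        case (elim t)
        show ?case
        proof
          assume t: "t \<in> ?S"
          then have "(y, t) \<in> \<Omega>" by (simp add: mem_strip)
          with elim near_p[of y t] t show "\<bar>w (y, t) - fp y\<bar> \<le> \<bar>t - \<eta>p y\<bar> * H (y, t)" by simp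
        qed
      qed
    qed (use lt in auto)
    ultimately show ?case by (simp add: trace_fun_graph)
  qed
qed

text \<open>The area element cancels the normalisation of the outer normal, so the surface integral
  becomes the base integrals of \<open>integration_by_parts\<close>, with the sign of each
  graph.\<close>

lemma boundary_integral:
  assumes \<psi>: "\<psi> \<in> C1_compact" and i: "i \<in> Basis"
  shows "(LINT x|boundary_measure \<eta>m \<eta>p. \<psi> x * trace_fun x * (outer_normal \<eta>m \<eta>p x \<bullet> i)) =
    (LINT y|lborel. fp y * \<psi> (y, \<eta>p y) * (snd i - partial (fst i) \<eta>p y))
    - (LINT y|lborel. fm y * \<psi> (y, \<eta>m y) * (snd i - partial (fst i) \<eta>m y))"
proof -
  obtain K M where K: "compact K" "\<And>x. x \<notin> K \<Longrightarrow> \<psi> x = 0" and M: "M \<ge> 0" "\<And>x. \<bar>\<psi> x\<bar> \<le> M" and c\<psi>: "continuous_on UNIV \<psi>"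
    using C1_compact_props[OF \<psi>] by metis
  have [measurable]: "\<psi> \<in> borel_measurable borel" using c\<psi> by (rule borel_measurable_continuous_onI)
  have [measurable]: "grad \<eta>m \<in> borel_measurable borel" "grad \<eta>p \<in> borel_measurable borel"
    using grad_borel cont_eta by auto
  have on [measurable]: "outer_normal \<eta>m \<eta>p \<in> borel_measurable borel"
    unfolding outer_normal_def[abs_def] by measurable
  define F where "F = (\<lambda>x. \<psi> x * trace_fun x * (outer_normal \<eta>m \<eta>p x \<bullet> i))"
  have [measurable]: "F \<in> borel_measurable borel" unfolding F_def by measurable
  have pos: "area \<eta> y > 0" for \<eta> :: "'a \<Rightarrow> real" and y using area_ge_1[of \<eta> y] by linarith
  have Fp: "area \<eta>p y * F (y, \<eta>p y) = fp y * \<psi> (y, \<eta>p y) * (snd i - partial (fst i) \<eta>p y)" for y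
  proof -
    have "outer_normal \<eta>m \<eta>p (y, \<eta>p y) = (- grad \<eta>p y, 1) /\<^sub>R area \<eta>p y" by (simp add: outer_normal_def area_def)
    then have "outer_normal \<eta>m \<eta>p (y, \<eta>p y) \<bullet> i = (snd i - grad \<eta>p y \<bullet> fst i) / area \<eta>p y"
      by (simp add: inner_prod_def divide_inverse algebra_simps)
    then show ?thesis using pos[of \<eta>p y] grad_inner_fst[OF i, of \<eta>p y] by (simp add: F_def trace_fun_graph)
  qed
  have Fm: "area \<eta>m y * F (y, \<eta>m y) = - (fm y * \<psi> (y, \<eta>m y) * (snd i - partial (fst i) \<eta>m y))" for y
  proof -
    have "outer_normal \<eta>m \<eta>p (y, \<eta>m y) = (grad \<eta>m y, -1) /\<^sub>R area \<eta>m y" using gap[of y] by (simp add: outer_normal_def area_def)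
    then have "outer_normal \<eta>m \<eta>p (y, \<eta>m y) \<bullet> i = - (snd i - grad \<eta>m y \<bullet> fst i) / area \<eta>m y"
      by (simp add: inner_prod_def divide_inverse algebra_simps)
    then have e: "area \<eta>m y * (outer_normal \<eta>m \<eta>p (y, \<eta>m y) \<bullet> i) = - (snd i - partial (fst i) \<eta>m y)"
      using pos[of \<eta>m y] grad_inner_fst[OF i, of \<eta>m y] by simp
    have "area \<eta>m y * F (y, \<eta>m y) = fm y * \<psi> (y, \<eta>m y) * (area \<eta>m y * (outer_normal \<eta>m \<eta>p (y, \<eta>m y) \<bullet> i))"
      by (simp add: F_def trace_fun_graph)
    then show ?thesis unfolding e by (simp only: mult_minus_right)
  qed
  have Kx: "compact (fst ` K)" by (intro compact_continuous_image continuous_intros K)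
  then have [measurable]: "fst ` K \<in> sets borel" by (auto intro: borel_compact)
  have int: "integrable lborel (\<lambda>y. f y * \<psi> (y, \<eta> y) * (snd i - partial (fst i) \<eta> y))"
    if fi: "integrable lborel (\<lambda>x. indicator (fst ` K) x * \<bar>f x\<bar>)" and [measurable]: "f \<in> borel_measurable borel"
      and lip: "\<And>x y. \<bar>\<eta> x - \<eta> y\<bar> \<le> L * norm (x - y)" and c: "continuous_on UNIV \<eta>" for f \<eta> :: "'a \<Rightarrow> real"
  proof -
    obtain B where B: "\<And>x. \<bar>partial (fst i) \<eta> x\<bar> \<le> B" using partial_bounded[OF lip] by blast
    have [measurable]: "partial (fst i) \<eta> \<in> borel_measurable borel" "\<eta> \<in> borel_measurable borel"
      using partial_borel_measurable[OF c] c by (auto intro: borel_measurable_continuous_onI)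
    show ?thesis
    proof (rule Bochner_Integration.integrable_bound)
      show "integrable lborel (\<lambda>y. (M * (\<bar>snd i\<bar> + B)) * (indicator (fst ` K) y * \<bar>f y\<bar>))" using fi by (rule integrable_mult_right)
      show "(\<lambda>y. f y * \<psi> (y, \<eta> y) * (snd i - partial (fst i) \<eta> y)) \<in> borel_measurable lborel" by measurable
      show "AE y in lborel. norm (f y * \<psi> (y, \<eta> y) * (snd i - partial (fst i) \<eta> y)) \<le> norm ((M * (\<bar>snd i\<bar> + B)) * (indicator (fst ` K) y * \<bar>f y\<bar>))"
      proof (rule AE_I2)
        fix y
        show "norm (f y * \<psi> (y, \<eta> y) * (snd i - partial (fst i) \<eta> y)) \<le> norm ((M * (\<bar>snd i\<bar> + B)) * (indicator (fst ` K) y * \<bar>f y\<bar>))"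
        proof (cases "y \<in> fst ` K")
          case False
          then have "\<psi> (y, \<eta> y) = 0" using K(2) by force
          then show ?thesis by simp
        next
          case True
          have "\<bar>snd i - partial (fst i) \<eta> y\<bar> \<le> \<bar>snd i\<bar> + B" using B[of y] by linarith
          then have "\<bar>\<psi> (y, \<eta> y)\<bar> * \<bar>snd i - partial (fst i) \<eta> y\<bar> \<le> M * (\<bar>snd i\<bar> + B)" using M by (intro mult_mono) auto
          then have "\<bar>f y\<bar> * (\<bar>\<psi> (y, \<eta> y)\<bar> * \<bar>snd i - partial (fst i) \<eta> y\<bar>) \<le> \<bar>f y\<bar> * (M * (\<bar>snd i\<bar> + B))" by (intro mult_left_mono) auto
          also have "\<dots> \<le> norm ((M * (\<bar>snd i\<bar> + B)) * (indicator (fst ` K) y * \<bar>f y\<bar>))" 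
          proof -
            have "\<bar>snd i\<bar> + B \<ge> 0" using order_trans[OF abs_ge_zero B[of y]] by simp
            then show ?thesis using True M(1) by (simp add: mult.commute abs_mult)
          qed
          finally show ?thesis by (simp add: abs_mult mult.assoc)
        qed
      qed
    qed
  qed
  have "(LINT x|boundary_measure \<eta>m \<eta>p. F x) = (LINT y|lborel. area \<eta>m y * F (y, \<eta>m y)) + (LINT y|lborel. area \<eta>p y * F (y, \<eta>p y))"
  proof (rule integral_boundary_measure[OF cont_eta])
    show "integrable lborel (\<lambda>y. area \<eta>m y * F (y, \<eta>m y))" unfolding Fm
      by (intro Bochner_Integration.integrable_minus int f_int Kx fm_borel lipm cont_eta)
    show "integrable lborel (\<lambda>y. area \<eta>p y * F (y, \<eta>p y))" unfolding Fp
      by (intro int f_int Kx fp_borel lipp cont_eta)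
  qed measurable
  then show ?thesis unfolding Fm Fp by (simp add: F_def)
qed

lemma has_trace_trace_fun: "has_trace \<eta>m \<eta>p p u trace_fun"
  unfolding has_trace_def
proof (intro conjI allI impI)
  show "trace_fun \<in> borel_measurable borel" by (rule trace_fun_borel)
  show "(\<integral>\<^sup>+x\<in>K. ennreal (\<bar>trace_fun x\<bar> powr p) \<partial>boundary_measure \<eta>m \<eta>p) < \<infinity>" if "compact K" for K
    by (rule trace_fun_Lp[OF that])
  show "AE x in boundary_measure \<eta>m \<eta>p. trace_fun x = w x"
    if "continuous_on (closure \<Omega>) w \<and> (AE x in lebesgue. x \<in> \<Omega> \<longrightarrow> u x = w x)" for w
    using trace_fun_continuous that by blast
  show "\<exists>G. has_weak_gradient \<Omega> u G \<and>
        (\<forall>\<psi>\<in>C1_compact. \<forall>i\<in>Basis.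
           set_integrable lebesgue \<Omega> (\<lambda>x. u x * partial i \<psi> x) \<and>
           (LINT x:\<Omega>|lebesgue. u x * partial i \<psi> x) =
             - (LINT x:\<Omega>|lebesgue. \<psi> x * (G x \<bullet> i))
             + (LINT x|boundary_measure \<eta>m \<eta>p. \<psi> x * trace_fun x * (outer_normal \<eta>m \<eta>p x \<bullet> i)))"
  proof (intro exI[of _ D] conjI ballI)
    show "has_weak_gradient \<Omega> u D" by (rule weak_gradient)
    fix \<psi> :: "'a \<times> real \<Rightarrow> real" and i :: "'a \<times> real" assume \<psi>: "\<psi> \<in> C1_compact" and i: "i \<in> Basis"
    have [measurable]: "\<psi> \<in> borel_measurable borel" "partial i \<psi> \<in> borel_measurable borel"
      using C1_compact_props[OF \<psi>] i by (metis borel_measurable_continuous_onI)+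
    show "set_integrable lebesgue \<Omega> (\<lambda>x. u x * partial i \<psi> x)"
      using integration_by_parts(1)[OF \<psi> i] by (subst set_integral_lebesgue_eq(2)) auto
    show "(LINT x:\<Omega>|lebesgue. u x * partial i \<psi> x) =
             - (LINT x:\<Omega>|lebesgue. \<psi> x * (D x \<bullet> i))
             + (LINT x|boundary_measure \<eta>m \<eta>p. \<psi> x * trace_fun x * (outer_normal \<eta>m \<eta>p x \<bullet> i))"
      using integration_by_parts(3)[OF \<psi> i] boundary_integral[OF \<psi> i]
      by (subst (1 2) set_integral_lebesgue_eq(1)) auto
  qed
qed

end

section \<open>Tent averages\<close>

definition tent :: "'a::euclidean_space \<Rightarrow> real \<Rightarrow> 'a \<Rightarrow> real" where
  "tent x e z = max 0 (1 - 2 * norm (z - x) / e)"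

text \<open>Dividing by the mass of the tent makes it unnecessary to compute that mass as a multiple of \<open>e ^ DIM('a)\<close>.\<close>

definition tent_avg :: "('a::euclidean_space \<Rightarrow> real) \<Rightarrow> 'a \<Rightarrow> real \<Rightarrow> real" where
  "tent_avg f x e = (LINT z|lborel. f z * tent x e z) / (LINT z|lborel. tent x e z)"

definition ball_vol :: "'a::euclidean_space itself \<Rightarrow> real \<Rightarrow> real" where
  "ball_vol _ e = measure lborel (ball (0::'a) e)"

definition mean_osc :: "('a::euclidean_space \<Rightarrow> real) \<Rightarrow> 'a \<Rightarrow> real \<Rightarrow> real" where
  "mean_osc f x e = (LINT z|lborel. indicator (ball x e) z * \<bar>f z - f x\<bar>) / ball_vol TYPE('a) e"

lemma ball_vol_eq:
  fixes x :: "'a::euclidean_space"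
  assumes "e \<ge> 0"
  shows "measure lborel (ball x e) = ball_vol TYPE('a) e" "ball_vol TYPE('a) e = e ^ DIM('a) * ball_vol TYPE('a) 1"
  unfolding ball_vol_def using content_ball_conv_unit_ball[OF assms, of x] content_ball_conv_unit_ball[OF assms, of "0::'a"] by auto

lemma ball_vol_pos: "e > 0 \<Longrightarrow> ball_vol TYPE('a::euclidean_space) e > 0"
  unfolding ball_vol_def by (rule content_ball_pos)

lemma emeasure_ball_eq_ball_vol:
  fixes x :: "'a::euclidean_space"
  assumes "e \<ge> 0"
  shows "emeasure lborel (ball x e) = ennreal (ball_vol TYPE('a) e)"
  using ball_vol_eq(1)[OF assms, of x] emeasure_lborel_ball_finite[of x e]
  by (metis emeasure_eq_ennreal_measure infinity_ennreal_def less_irrefl)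

lemma tent_bounds: "0 \<le> tent x e z" "e > 0 \<Longrightarrow> tent x e z \<le> 1"
  unfolding tent_def by auto

lemma tent_eq_0: "e > 0 \<Longrightarrow> e / 2 \<le> norm (z - x) \<Longrightarrow> tent x e z = 0"
  unfolding tent_def by (auto simp: max_def field_simps)

lemma tent_ge_half: "e > 0 \<Longrightarrow> norm (z - x) \<le> e / 4 \<Longrightarrow> 1 / 2 \<le> tent x e z"
  unfolding tent_def by (auto simp: max_def field_simps)

lemma tent_borel [measurable]: "tent x e \<in> borel_measurable borel"
  unfolding tent_def[abs_def] by measurable

text \<open>Outside \<open>ball x e\<close> both tents vanish. Inside, moving the centre and
  changing the radius each alter the scaled distance linearly, with factor
  \<open>2 / e' \<le> 16 / (7 * e)\<close>, rounded up to \<open>3 / e\<close>.\<close>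

lemma tent_lipschitz:
  fixes x y z :: "'a::euclidean_space"
  assumes e: "e > 0" and near: "norm (y - x) \<le> e / 8" "\<bar>e' - e\<bar> \<le> e / 8"
  shows "\<bar>tent y e' z - tent x e z\<bar> \<le> 3 / e * (norm (y - x) + \<bar>e' - e\<bar>) * indicator (ball x e) z"
proof -
  have e': "e' \<ge> 7 * e / 8" "e' \<le> 9 * e / 8" using near(2) by linarith+
  have "e' > 0" using e e' by linarith
  show ?thesis
  proof (cases "z \<in> ball x e")
    case False
    then have zx: "norm (z - x) \<ge> e" by (simp add: dist_norm norm_minus_commute)
    have "norm (z - x) \<le> norm (z - y) + norm (y - x)" using norm_triangle_ineq[of "z - y" "y - x"] by simp
    then have "norm (z - y) \<ge> 7 * e / 8" using zx near(1) by linarith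
    then have "norm (z - y) \<ge> e' / 2" using e' e by linarith
    then have "tent y e' z = 0" using \<open>e' > 0\<close> by (rule tent_eq_0[rotated])
    moreover have "tent x e z = 0" using zx e by (intro tent_eq_0) auto
    ultimately show ?thesis using False by simp
  next
    case True
    then have zx: "norm (z - x) \<le> e" by (simp add: dist_norm norm_minus_commute)
    have "\<bar>tent y e' z - tent x e z\<bar> \<le> \<bar>2 * norm (z - y) / e' - 2 * norm (z - x) / e\<bar>"
      unfolding tent_def by (auto simp: max_def)
    also have "2 * norm (z - y) / e' - 2 * norm (z - x) / e = (2 / e') * ((norm (z - y) - norm (z - x)) + norm (z - x) * ((e - e') / e))"
      using e \<open>e' > 0\<close> by (simp add: field_simps)
    also have "\<bar>\<dots>\<bar> = (2 / e') * \<bar>(norm (z - y) - norm (z - x)) + norm (z - x) * ((e - e') / e)\<bar>"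
      using \<open>e' > 0\<close> by (subst abs_mult) simp
    also have "\<dots> \<le> (3 / e) * (norm (y - x) + \<bar>e' - e\<bar>)"
    proof (rule mult_mono)
      show "2 / e' \<le> 3 / e" using e e' \<open>e' > 0\<close> by (simp add: field_simps)
      have 1: "\<bar>norm (z - y) - norm (z - x)\<bar> \<le> norm (y - x)"
        using norm_triangle_ineq3[of "z - y" "z - x"] by (simp add: norm_minus_commute)
      have "\<bar>norm (z - x) * ((e - e') / e)\<bar> = norm (z - x) / e * \<bar>e' - e\<bar>"
        using e by (simp add: abs_mult abs_divide abs_minus_commute)
      also have "\<dots> \<le> 1 * \<bar>e' - e\<bar>" using zx e by (intro mult_right_mono) auto
      finally have 2: "\<bar>norm (z - x) * ((e - e') / e)\<bar> \<le> \<bar>e' - e\<bar>" by (simp only: mult_1)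
      show "\<bar>(norm (z - y) - norm (z - x)) + norm (z - x) * ((e - e') / e)\<bar> \<le> norm (y - x) + \<bar>e' - e\<bar>"
        by (rule order_trans[OF abs_triangle_ineq add_mono[OF 1 2]])
    qed (use e in auto)
    finally show ?thesis using True by simp
  qed
qed

definition loc_integrable :: "('a::euclidean_space \<Rightarrow> real) \<Rightarrow> bool" where
  "loc_integrable f \<longleftrightarrow> f \<in> borel_measurable borel \<and> (\<forall>K. compact K \<longrightarrow> integrable lborel (\<lambda>x. indicator K x * \<bar>f x\<bar>))"

lemma loc_integrable_borel: "loc_integrable f \<Longrightarrow> f \<in> borel_measurable borel"
  unfolding loc_integrable_def by blast

lemma loc_integrable_const: "loc_integrable (\<lambda>_. c)"
  unfolding loc_integrable_def
proof (intro conjI allI impI)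
  fix K :: "'a set" assume K: "compact K"
  then have "K \<in> sets lborel" "emeasure lborel K < \<infinity>" using emeasure_compact_finite[OF K] by (auto intro: borel_compact)
  then show "integrable lborel (\<lambda>x. indicator K x * \<bar>c\<bar>)" by (intro integrable_mult_left integrable_real_indicator)
qed auto

lemma loc_integrable_bounded_mult:
  assumes f: "loc_integrable f" and [measurable]: "g \<in> borel_measurable borel" and g: "\<And>z. \<bar>g z\<bar> \<le> B" "\<And>z. z \<notin> ball x e \<Longrightarrow> g z = 0"
  shows "integrable lborel (\<lambda>z. f z * g z)"
proof (rule Bochner_Integration.integrable_bound)
  have [measurable]: "f \<in> borel_measurable borel" using f by (rule loc_integrable_borel)
  show "integrable lborel (\<lambda>z. B * (indicator (cball x e) z * \<bar>f z\<bar>))"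
    using f unfolding loc_integrable_def by (intro integrable_mult_right) auto
  show "(\<lambda>z. f z * g z) \<in> borel_measurable lborel" by measurable
  show "AE z in lborel. norm (f z * g z) \<le> norm (B * (indicator (cball x e) z * \<bar>f z\<bar>))"
  proof (rule AE_I2)
    fix z
    show "norm (f z * g z) \<le> norm (B * (indicator (cball x e) z * \<bar>f z\<bar>))"
    proof (cases "z \<in> ball x e")
      case True
      have "\<bar>f z\<bar> * \<bar>g z\<bar> \<le> \<bar>f z\<bar> * B" using g(1) by (intro mult_left_mono) auto
      also have "\<dots> \<le> \<bar>f z\<bar> * \<bar>B\<bar>" by (intro mult_left_mono) auto
      finally show ?thesis using True by (simp add: abs_mult mult.commute)
    qed (use g(2) in auto)
  qed
qed

lemma loc_integrable_diff_const:
  assumes f: "loc_integrable f" shows "loc_integrable (\<lambda>z. f z - m)"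
  unfolding loc_integrable_def
proof (intro conjI allI impI)
  have [measurable]: "f \<in> borel_measurable borel" using f by (rule loc_integrable_borel)
  show "(\<lambda>z. f z - m) \<in> borel_measurable borel" by measurable
  fix K :: "'a set" assume K: "compact K"
  have [measurable]: "K \<in> sets borel" using K by (auto intro: borel_compact)
  show "integrable lborel (\<lambda>x. indicator K x * \<bar>f x - m\<bar>)"
  proof (rule Bochner_Integration.integrable_bound)
    show "integrable lborel (\<lambda>x. indicator K x * \<bar>f x\<bar> + indicator K x * \<bar>m\<bar>)"
      using f loc_integrable_const[of m] K unfolding loc_integrable_def by (intro Bochner_Integration.integrable_add) auto
    show "AE x in lborel. norm (indicator K x * \<bar>f x - m\<bar>) \<le> norm (indicator K x * \<bar>f x\<bar> + indicator K x * \<bar>m\<bar>)"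
      by (intro AE_I2) (auto simp: indicator_def)
  qed measurable
qed

lemma mean_osc_integrable:
  assumes "loc_integrable f"
  shows "integrable lborel (\<lambda>z. indicator (ball x e) z * \<bar>f z - m\<bar>)"
proof -
  have "integrable lborel (\<lambda>z. (f z - m) * indicator (ball x e) z)"
    by (rule loc_integrable_bounded_mult[OF loc_integrable_diff_const[OF assms], where B = 1]) (auto simp: indicator_def)
  then have "integrable lborel (\<lambda>z. \<bar>(f z - m) * indicator (ball x e) z\<bar>)" by (rule integrable_abs)
  moreover have "(\<lambda>z. \<bar>(f z - m) * indicator (ball x e) z\<bar>) = (\<lambda>z. indicator (ball x e) z * \<bar>f z - m\<bar>)"
    by (auto simp: abs_mult mult.commute)
  ultimately show ?thesis by simp
qed

lemma tent_product_integrable: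
  assumes "loc_integrable f" "e > 0"
  shows "integrable lborel (\<lambda>z. f z * tent x e z)"
proof (rule loc_integrable_bounded_mult[OF assms(1), where B = 1 and x = x and e = e])
  show "\<bar>tent x e z\<bar> \<le> 1" for z using tent_bounds[where x = x and e = e and z = z] assms(2) by simp
  show "tent x e z = 0" if "z \<notin> ball x e" for z
    using that assms(2) by (intro tent_eq_0) (auto simp: dist_norm norm_minus_commute)
qed measurable

lemma tent_integrable: "e > 0 \<Longrightarrow> integrable lborel (tent x e)"
  using tent_product_integrable[OF loc_integrable_const[of 1]] by simp

lemma tent_mass_ge:
  fixes x :: "'a::euclidean_space"
  assumes e: "e > 0"
  shows "ball_vol TYPE('a) e / (2 * 4 ^ DIM('a)) \<le> (LINT z|lborel. tent x e z)"
proof -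
  have "ball_vol TYPE('a) e / (2 * 4 ^ DIM('a)) = ball_vol TYPE('a) (e / 4) / 2"
    using ball_vol_eq(2)[of e, where 'a = 'a] ball_vol_eq(2)[of "e/4", where 'a = 'a] e by (simp add: power_divide)
  also have "\<dots> = (LINT z|lborel. indicator (ball x (e / 4)) z * (1 / 2))"
    using ball_vol_eq(1)[where e = "e/4" and x = x] e by simp
  also have "\<dots> \<le> (LINT z|lborel. tent x e z)"
  proof (rule integral_mono)
    show "integrable lborel (\<lambda>z. indicator (ball x (e / 4)) z * (1 / 2 :: real))"
      by (intro integrable_mult_left integrable_real_indicator emeasure_lborel_ball_finite) auto
    show "integrable lborel (tent x e)" by (rule tent_integrable[OF e])
    show "indicator (ball x (e / 4)) z * (1 / 2) \<le> tent x e z" for z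
      using tent_ge_half[OF e, where z = z and x = x] tent_bounds(1)[where x = x and e = e and z = z] by (auto simp: indicator_def dist_norm norm_minus_commute)
  qed
  finally show ?thesis .
qed

text \<open>Bound for the volume of the ball over the mass of a nearby tent: a factor 2 for the
  height 1/2, \<open>4 ^ DIM('a)\<close> for the quarter ball on which it is reached, and
  \<open>2 ^ DIM('a)\<close> for a radius \<open>e'\<close> that may have shrunk to
  \<open>e / 2\<close>.\<close>

definition tent_ratio :: "'a::euclidean_space itself \<Rightarrow> real" where
  "tent_ratio _ = 2 * 8 ^ DIM('a)"

lemma tent_ratio_ge_1: "tent_ratio TYPE('a::euclidean_space) \<ge> 1"
  unfolding tent_ratio_def using one_le_power[of "8::real" "DIM('a)"] by linarith

lemma tent_mass_ge':
  fixes x y :: "'a::euclidean_space"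
  assumes e: "e > 0" and "\<bar>e' - e\<bar> \<le> e / 8"
  shows "ball_vol TYPE('a) e / tent_ratio TYPE('a) \<le> (LINT z|lborel. tent y e' z)" "e' > 0"
proof -
  have e': "e' \<ge> e / 2" using assms by linarith
  then show "e' > 0" using e by linarith
  have "(e / 2) ^ DIM('a) \<le> e' ^ DIM('a)" using e' e by (intro power_mono) auto
  then have "ball_vol TYPE('a) (e / 2) \<le> ball_vol TYPE('a) e'"
    using ball_vol_eq(2)[of "e/2", where 'a = 'a] ball_vol_eq(2)[of e', where 'a = 'a] e e' ball_vol_pos[of 1, where 'a='a]
    by (simp add: mult_right_mono)
  moreover have "ball_vol TYPE('a) (e / 2) = ball_vol TYPE('a) e / 2 ^ DIM('a)"
    using ball_vol_eq(2)[of e, where 'a = 'a] ball_vol_eq(2)[of "e/2", where 'a = 'a] e by (simp add: power_divide)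
  ultimately have "ball_vol TYPE('a) e / 2 ^ DIM('a) / (2 * 4 ^ DIM('a)) \<le> ball_vol TYPE('a) e' / (2 * 4 ^ DIM('a))"
    by (intro divide_right_mono) auto
  also have "\<dots> \<le> (LINT z|lborel. tent y e' z)" using \<open>e' > 0\<close> by (rule tent_mass_ge)
  also have "ball_vol TYPE('a) e / 2 ^ DIM('a) / (2 * 4 ^ DIM('a)) = ball_vol TYPE('a) e / tent_ratio TYPE('a)"
    unfolding tent_ratio_def by (simp add: power_mult_distrib[symmetric] mult.left_commute)
  finally show "ball_vol TYPE('a) e / tent_ratio TYPE('a) \<le> (LINT z|lborel. tent y e' z)" .
qed

lemma tent_avg_minus_const:
  fixes x :: "'a::euclidean_space"
  assumes f: "loc_integrable f" and e: "e > 0"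
  shows "tent_avg f x e - m = (LINT z|lborel. (f z - m) * tent x e z) / (LINT z|lborel. tent x e z)"
proof -
  have pos: "(LINT z|lborel. tent x e z) > 0"
    using tent_mass_ge[OF e, of x] ball_vol_pos[OF e, where 'a = 'a] by (smt (verit) divide_pos_pos zero_less_power)
  have "(LINT z|lborel. (f z - m) * tent x e z) = (LINT z|lborel. f z * tent x e z - m * tent x e z)"
    by (simp add: left_diff_distrib)
  also have "\<dots> = (LINT z|lborel. f z * tent x e z) - m * (LINT z|lborel. tent x e z)"
    using tent_product_integrable[OF f e] tent_integrable[OF e] by (subst Bochner_Integration.integral_diff) auto
  finally show ?thesis using pos unfolding tent_avg_def by (simp add: field_simps)
qed

text \<open>Averages reproduce constants, so \<open>f\<close> may be replaced by
  \<open>f - m\<close> throughout. The difference of two quotients splits into the change of the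
  numerator, which contributes \<open>3 * k\<close>, and the first quotient times the relative
  change of the mass, which contributes \<open>3 * k\<^sup>2\<close>. The number \<open>m\<close> is
  left free: it will be \<open>f x\<close> for the slope estimate and 0 for local Lipschitz
  continuity.\<close>

lemma tent_avg_bounds:
  fixes x y :: "'a::euclidean_space" and f :: "'a \<Rightarrow> real" and m :: real
  assumes f: "loc_integrable f" and e: "e > 0" and near: "norm (y - x) \<le> e / 8" "\<bar>e' - e\<bar> \<le> e / 8"
  defines "I \<equiv> LINT z|lborel. indicator (ball x e) z * \<bar>f z - m\<bar>"
  defines "V \<equiv> ball_vol TYPE('a) e" and "k \<equiv> tent_ratio TYPE('a)"
  shows "\<bar>tent_avg f x e - m\<bar> \<le> k * I / V"
    and "\<bar>tent_avg f y e' - tent_avg f x e\<bar> \<le> (3 * k + 3 * k\<^sup>2) * (norm (y - x) + \<bar>e' - e\<bar>) * (I / (e * V))"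
proof -
  define \<rho> where "\<rho> = norm (y - x) + \<bar>e' - e\<bar>"
  have \<rho>0: "\<rho> \<ge> 0" unfolding \<rho>_def by simp
  have V: "V > 0" unfolding V_def by (rule ball_vol_pos[OF e])
  have k: "k \<ge> 1" unfolding k_def by (rule tent_ratio_ge_1)
  have e': "e' > 0" using tent_mass_ge'(2)[OF e near(2)] .
  define DX where "DX = (LINT z|lborel. tent x e z)"
  define DY where "DY = (LINT z|lborel. tent y e' z)"
  define NX where "NX = (LINT z|lborel. (f z - m) * tent x e z)"
  define NY where "NY = (LINT z|lborel. (f z - m) * tent y e' z)"
  have DX: "V / k \<le> DX" unfolding DX_def V_def k_def by (rule tent_mass_ge'(1)[OF e]) (use e in simp)
  have DY: "V / k \<le> DY" unfolding DY_def V_def k_def by (rule tent_mass_ge'(1)[OF e near(2)])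
  have Vk: "V / k > 0" using V k by simp
  have Ii: "integrable lborel (\<lambda>z. indicator (ball x e) z * \<bar>f z - m\<bar>)" by (rule mean_osc_integrable[OF f])
  have I0: "I \<ge> 0" unfolding I_def by (intro integral_nonneg_AE AE_I2) auto
  note fm = loc_integrable_diff_const[OF f, of m]
  note iX = tent_product_integrable[OF fm e, of x] and iY = tent_product_integrable[OF fm e', of y]
  have NX: "\<bar>NX\<bar> \<le> I"
  proof -
    have "\<bar>NX\<bar> \<le> (LINT z|lborel. \<bar>(f z - m) * tent x e z\<bar>)" unfolding NX_def by (rule integral_abs_bound)
    also have "\<dots> \<le> I" unfolding I_def
    proof (rule integral_mono[OF integrable_abs[OF iX] Ii])
      fix z
      show "\<bar>(f z - m) * tent x e z\<bar> \<le> indicator (ball x e) z * \<bar>f z - m\<bar>"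
      proof (cases "z \<in> ball x e")
        case True
        then show ?thesis using tent_bounds(1)[where x = x and e = e and z = z] tent_bounds(2)[OF e, where x = x and z = z] by (simp add: abs_mult mult_left_le)
      next
        case False
        then have "tent x e z = 0" using e by (intro tent_eq_0) (auto simp: dist_norm norm_minus_commute)
        then show ?thesis by simp
      qed
    qed
    finally show ?thesis .
  qed
  have tl: "\<bar>tent y e' z - tent x e z\<bar> \<le> 3 / e * \<rho> * indicator (ball x e) z" for z
    unfolding \<rho>_def by (rule tent_lipschitz[OF e near])
  have NN: "\<bar>NY - NX\<bar> \<le> 3 / e * \<rho> * I"
  proof -
    have "NY - NX = (LINT z|lborel. (f z - m) * tent y e' z - (f z - m) * tent x e z)"
      unfolding NX_def NY_def using iX iY by simp
    also have "\<bar>\<dots>\<bar> \<le> (LINT z|lborel. \<bar>(f z - m) * tent y e' z - (f z - m) * tent x e z\<bar>)" by (rule integral_abs_bound)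
    also have "\<dots> \<le> (LINT z|lborel. 3 / e * \<rho> * (indicator (ball x e) z * \<bar>f z - m\<bar>))"
    proof (rule integral_mono)
      show "integrable lborel (\<lambda>z. \<bar>(f z - m) * tent y e' z - (f z - m) * tent x e z\<bar>)"
        by (intro integrable_abs Bochner_Integration.integrable_diff iX iY)
      show "integrable lborel (\<lambda>z. 3 / e * \<rho> * (indicator (ball x e) z * \<bar>f z - m\<bar>))" by (intro integrable_mult_right Ii)
      fix z
      have "\<bar>(f z - m) * tent y e' z - (f z - m) * tent x e z\<bar> = \<bar>f z - m\<bar> * \<bar>tent y e' z - tent x e z\<bar>"
        by (simp add: abs_mult[symmetric] right_diff_distrib)
      also have "\<dots> \<le> \<bar>f z - m\<bar> * (3 / e * \<rho> * indicator (ball x e) z)" using tl by (rule mult_left_mono) simp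
      finally show "\<bar>(f z - m) * tent y e' z - (f z - m) * tent x e z\<bar> \<le> 3 / e * \<rho> * (indicator (ball x e) z * \<bar>f z - m\<bar>)"
        by (simp add: mult_ac)
    qed
    also have "\<dots> = 3 / e * \<rho> * I" unfolding I_def by (rule integral_mult_right_zero)
    finally show ?thesis .
  qed
  have DD: "\<bar>DX - DY\<bar> \<le> 3 / e * \<rho> * V"
  proof -
    have "DY - DX = (LINT z|lborel. tent y e' z - tent x e z)"
      unfolding DX_def DY_def using tent_integrable[OF e, of x] tent_integrable[OF e', of y] by simp
    also have "\<bar>\<dots>\<bar> \<le> (LINT z|lborel. \<bar>tent y e' z - tent x e z\<bar>)" by (rule integral_abs_bound)
    also have "\<dots> \<le> (LINT z|lborel. 3 / e * \<rho> * indicator (ball x e) z)"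
    proof (rule integral_mono)
      show "integrable lborel (\<lambda>z. \<bar>tent y e' z - tent x e z\<bar>)"
        by (intro integrable_abs Bochner_Integration.integrable_diff tent_integrable e e')
      show "integrable lborel (\<lambda>z. 3 / e * \<rho> * indicator (ball x e) z)"
        by (intro integrable_mult_right integrable_real_indicator emeasure_lborel_ball_finite) auto
    qed (rule tl)
    also have "\<dots> = 3 / e * \<rho> * V" unfolding V_def using ball_vol_eq(1)[where e = e and x = x] e by simp
    finally show ?thesis by (simp add: abs_minus_commute)
  qed
  have eqX: "tent_avg f x e - m = NX / DX" unfolding NX_def DX_def by (rule tent_avg_minus_const[OF f e])
  have eqY: "tent_avg f y e' - m = NY / DY" unfolding NY_def DY_def by (rule tent_avg_minus_const[OF f e'])
  have DX0: "DX > 0" "DY > 0" using DX DY Vk by linarith+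
  have qX: "\<bar>NX / DX\<bar> \<le> k * I / V"
  proof -
    have "\<bar>NX / DX\<bar> = \<bar>NX\<bar> / DX" using DX0 by (simp add: abs_divide)
    also have "\<dots> \<le> I / (V / k)" using NX DX Vk I0 by (intro frac_le) auto
    finally show ?thesis by (simp add: mult.commute)
  qed
  then show "\<bar>tent_avg f x e - m\<bar> \<le> k * I / V" using eqX by simp
  have "tent_avg f y e' - tent_avg f x e = NY / DY - NX / DX" using eqX eqY by linarith
  also have "\<dots> = (NY - NX) / DY + (NX / DX) * ((DX - DY) / DY)"
    using DX0 by (simp add: field_simps)
  also have "\<bar>\<dots>\<bar> \<le> \<bar>NY - NX\<bar> / DY + \<bar>NX / DX\<bar> * (\<bar>DX - DY\<bar> / DY)"
    using DX0 abs_triangle_ineq[of "(NY - NX) / DY" "(NX / DX) * ((DX - DY) / DY)"] by (simp add: abs_mult abs_divide)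
  also have "\<dots> \<le> (3 / e * \<rho> * I) / (V / k) + (k * I / V) * ((3 / e * \<rho> * V) / (V / k))"
  proof (intro add_mono mult_mono)
    show "\<bar>NY - NX\<bar> / DY \<le> (3 / e * \<rho> * I) / (V / k)" using NN DY Vk I0 \<rho>0 e by (intro frac_le) auto
    show "\<bar>DX - DY\<bar> / DY \<le> (3 / e * \<rho> * V) / (V / k)" using DD DY Vk \<rho>0 e V by (intro frac_le) auto
  qed (use qX I0 V k DX0 in auto)
  also have "\<dots> = (3 * k + 3 * k\<^sup>2) * \<rho> * (I / (e * V))"
    using V e k by (simp add: field_simps power2_eq_square)
  finally show "\<bar>tent_avg f y e' - tent_avg f x e\<bar> \<le> (3 * k + 3 * k\<^sup>2) * (norm (y - x) + \<bar>e' - e\<bar>) * (I / (e * V))"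
    unfolding \<rho>_def .
qed

lemma tent_avg_mean_osc:
  fixes x y :: "'a::euclidean_space" and f :: "'a \<Rightarrow> real" 
  assumes f: "loc_integrable f" and e: "e > 0"
  shows "\<bar>tent_avg f x e - f x\<bar> \<le> tent_ratio TYPE('a) * mean_osc f x e"
    and "norm (y - x) \<le> e / 8 \<Longrightarrow> \<bar>e' - e\<bar> \<le> e / 8 \<Longrightarrow> \<bar>tent_avg f y e' - tent_avg f x e\<bar> \<le>
      (3 * tent_ratio TYPE('a) + 3 * (tent_ratio TYPE('a))\<^sup>2) * (norm (y - x) + \<bar>e' - e\<bar>) * (mean_osc f x e / e)"
  using tent_avg_bounds[OF f e, where m = "f x" and x = x and y = x and e' = e] tent_avg_bounds(2)[OF f e, where m = "f x" and x = x and y = y and e' = e'] e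
  by (simp_all add: mean_osc_def mult.commute)

lemma mean_osc_nonneg: "e > 0 \<Longrightarrow> mean_osc f (x :: 'a::euclidean_space) e \<ge> 0"
  unfolding mean_osc_def using ball_vol_pos[of e, where 'a = 'a]
  by (intro divide_nonneg_pos integral_nonneg_AE AE_I2) auto

text \<open>A locally uniform constant is wanted, and \<open>f\<close> may be unbounded near
  \<open>x0\<close>. Hence \<open>m = 0\<close>: the constant then depends only on the integral of
  \<open>\<bar>f\<bar>\<close> over one ball that contains all the balls involved.\<close>

lemma tent_avg_loc_lip:
  fixes f :: "'a::euclidean_space \<Rightarrow> real"
  assumes f: "loc_integrable f"
  shows "loc_lip {X. snd X > 0} (\<lambda>X. tent_avg f (fst X) (snd X))"
proof (rule loc_lipI)
  fix X0 :: "'a \<times> real" assume X0: "X0 \<in> {X. snd X > 0}"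
  obtain x0 e0 where X0e: "X0 = (x0, e0)" by (cases X0)
  have e0: "e0 > 0" using X0 X0e by simp
  define k where "k = tent_ratio TYPE('a)"
  have k: "k \<ge> 1" unfolding k_def by (rule tent_ratio_ge_1)
  define J where "J = (LINT z|lborel. indicator (cball x0 (2 * e0)) z * \<bar>f z\<bar>)"
  have Ji: "integrable lborel (\<lambda>z. indicator (cball x0 (2 * e0)) z * \<bar>f z\<bar>)" using f unfolding loc_integrable_def by auto
  have J0: "J \<ge> 0" unfolding J_def by (intro integral_nonneg_AE AE_I2) auto
  define C where "C = (3 * k + 3 * k\<^sup>2) * 2 * (J / (e0 / 2 * ball_vol TYPE('a) (e0 / 2)))"
  \<comment> \<open>Two points within \<open>r\<close> of \<open>X0\<close> are less than
    \<open>e0 / 16\<close> apart, and \<open>e0 / 16 \<le> e / 8\<close> because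
    \<open>e \<ge> e0 / 2\<close>; this is the closeness that \<open>tent_avg_bounds\<close> asks
    for.\<close>
  define r where "r = e0 / 32"
  have r: "r > 0" unfolding r_def using e0 by simp
  have C: "C \<ge> 0" unfolding C_def using k J0 e0 ball_vol_pos[of "e0/2", where 'a='a] by auto
  have "\<bar>tent_avg f (fst Y) (snd Y) - tent_avg f (fst Z) (snd Z)\<bar> \<le> C * dist Y Z" if Y: "dist X0 Y < r" and Z: "dist X0 Z < r" for Y Z
  proof -
    obtain y e where Ye: "Y = (y, e)" by (cases Y)
    obtain z e' where Ze: "Z = (z, e')" by (cases Z)
    have c: "norm (fst P) \<le> norm P" "\<bar>snd P\<bar> \<le> norm P" for P :: "'a \<times> real"
      using norm_fst_le[of "fst P" "snd P"] norm_snd_le[of "snd P" "fst P"] by auto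
    have y0: "norm (x0 - y) < r" "\<bar>e0 - e\<bar> < r" using c[of "X0 - Y"] Y unfolding dist_norm X0e Ye by auto
    have YZ: "norm (Y - Z) < 2 * r"
      using dist_triangle2[of Y Z X0] Y Z unfolding dist_norm by (simp add: norm_minus_commute)
    have yz: "norm (y - z) \<le> norm (Y - Z)" "\<bar>e - e'\<bar> \<le> norm (Y - Z)" using c[of "Y - Z"] unfolding Ye Ze by auto
    have ee: "e \<ge> e0 / 2" "e \<le> 3 / 2 * e0" "e > 0" using y0(2) e0 unfolding r_def by linarith+
    have near: "norm (z - y) \<le> e / 8" "\<bar>e' - e\<bar> \<le> e / 8"
      using yz YZ ee e0 unfolding r_def by (simp_all add: norm_minus_commute abs_minus_commute)
    define I where "I = (LINT w|lborel. indicator (ball y e) w * \<bar>f w - 0\<bar>)"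
    have I0: "I \<ge> 0" unfolding I_def by (intro integral_nonneg_AE AE_I2) auto
    have IJ: "I \<le> J" unfolding I_def J_def
    proof (rule integral_mono[OF mean_osc_integrable[OF f] Ji])
      fix w
      have "w \<in> cball x0 (2 * e0)" if "w \<in> ball y e"
      proof -
        have "dist x0 w \<le> dist x0 y + dist y w" by (rule dist_triangle)
        also have "\<dots> \<le> r + e" using that y0 by (simp add: dist_norm)
        also have "\<dots> \<le> 2 * e0" using ee e0 unfolding r_def by linarith
        finally show ?thesis by simp
      qed
      then show "indicator (ball y e) w * \<bar>f w - 0\<bar> \<le> indicator (cball x0 (2 * e0)) w * \<bar>f w\<bar>" by (auto simp: indicator_def)
    qed
    have "(e0 / 2) ^ DIM('a) \<le> e ^ DIM('a)" using ee e0 by (intro power_mono) auto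
    then have vv: "ball_vol TYPE('a) (e0 / 2) \<le> ball_vol TYPE('a) e"
      using ball_vol_eq(2)[of "e0/2", where 'a = 'a] ball_vol_eq(2)[of e, where 'a = 'a] ee e0 ball_vol_pos[of 1, where 'a='a]
      by (simp add: mult_right_mono)
    have "\<bar>tent_avg f z e' - tent_avg f y e\<bar> \<le> (3 * k + 3 * k\<^sup>2) * (norm (z - y) + \<bar>e' - e\<bar>) * (I / (e * ball_vol TYPE('a) e))"
      unfolding k_def I_def by (rule tent_avg_bounds(2)[OF f ee(3) near])
    also have "\<dots> \<le> (3 * k + 3 * k\<^sup>2) * (2 * norm (Y - Z)) * (J / (e0 / 2 * ball_vol TYPE('a) (e0 / 2)))"
    proof (intro mult_mono frac_le mult_left_mono)
      show "norm (z - y) + \<bar>e' - e\<bar> \<le> 2 * norm (Y - Z)" using yz by (simp add: norm_minus_commute abs_minus_commute)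
      show "e0 / 2 * ball_vol TYPE('a) (e0 / 2) > 0" using e0 ball_vol_pos[of "e0/2", where 'a='a] by simp
    qed (use k I0 J0 IJ ee vv e0 ball_vol_pos[of "e0/2", where 'a='a] ball_vol_pos[of e, where 'a='a] in \<open>auto intro: less_imp_le\<close>)
    also have "\<dots> = C * dist Y Z" unfolding C_def dist_norm by simp
    finally show ?thesis unfolding Ye Ze by (simp add: abs_minus_commute)
  qed
  then show "\<exists>r>0. \<exists>C\<ge>0. \<forall>y z. dist X0 y < r \<longrightarrow> dist X0 z < r \<longrightarrow> \<bar>tent_avg f (fst y) (snd y) - tent_avg f (fst z) (snd z)\<bar> \<le> C * dist y z"
    using r C by blast
qed

lemma mean_osc_borel [measurable]:
  fixes f :: "'a::euclidean_space \<Rightarrow> real"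
  assumes [measurable]: "f \<in> borel_measurable borel"
  shows "(\<lambda>X. mean_osc f (fst X) (snd X)) \<in> borel_measurable borel"
proof -
  have "ball_vol TYPE('a) = (\<lambda>e. if e \<ge> 0 then e ^ DIM('a) * ball_vol TYPE('a) 1 else 0)"
  proof
    fix e :: real
    show "ball_vol TYPE('a) e = (if e \<ge> 0 then e ^ DIM('a) * ball_vol TYPE('a) 1 else 0)"
    proof (cases "e \<ge> 0")
      case True
      then show ?thesis using ball_vol_eq(2)[OF True, where 'a = 'a] by (simp only: if_True)
    next
      case False
      then have "ball (0::'a) e = {}" by simp
      then show ?thesis using False by (simp add: ball_vol_def)
    qed
  qed
  moreover have "(\<lambda>e. if e \<ge> 0 then e ^ DIM('a) * ball_vol TYPE('a) 1 else 0) \<in> borel_measurable borel" by measurable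
  ultimately have v: "ball_vol TYPE('a) \<in> borel_measurable borel" by (simp only:)
  \<comment> \<open>The indicator of a ball that varies with \<open>X\<close> is turned into a
    condition on distances, which shows the integrand to be jointly measurable in \<open>X\<close>
    and \<open>z\<close>.\<close>
  have eq: "mean_osc f (fst X) (snd X) = (LINT z|lborel. (if dist (fst X) z < snd X then \<bar>f z - f (fst X)\<bar> else 0)) / ball_vol TYPE('a) (snd X)" for X :: "'a \<times> real"
    unfolding mean_osc_def
    by (rule arg_cong[where f = "\<lambda>y. y / ball_vol TYPE('a) (snd X)"], rule Bochner_Integration.integral_cong) (auto simp: indicator_def)
  have 1: "(\<lambda>X. LINT z|lborel. (if dist (fst X) z < snd X then \<bar>f z - f (fst X)\<bar> else 0)) \<in> borel_measurable (borel :: ('a \<times> real) measure)"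
    by measurable
  show ?thesis unfolding eq by (rule borel_measurable_divide[OF 1 measurable_compose[OF snd_borel v]])
qed

text \<open>Integrate the tangent inequality of the convex function \<open>t powr p\<close> at the
  mean \<open>m\<close> over \<open>S\<close>. The tangent inequality itself is Young's inequality
  for the conjugate exponents \<open>p\<close> and \<open>q\<close>. If the right-hand side is
  infinite, there is nothing to show.\<close>

lemma jensen_powr:
  fixes g :: "'a::euclidean_space \<Rightarrow> real"
  assumes g: "\<And>z. g z \<ge> 0" and [measurable]: "g \<in> borel_measurable borel" and S [measurable]: "S \<in> sets borel"
    and V: "emeasure lborel S = ennreal V" "V > 0" and int: "integrable lborel (\<lambda>z. indicator S z * g z)" and p: "p > 1"
  shows "ennreal (((LINT z|lborel. indicator S z * g z) / V) powr p) \<le> ennreal (1 / V) * (\<integral>\<^sup>+z. indicator S z * ennreal (g z powr p) \<partial>lborel)"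
proof -
  define m where "m = (LINT z|lborel. indicator S z * g z) / V"
  have m0: "m \<ge> 0" unfolding m_def using V g by (intro divide_nonneg_pos integral_nonneg_AE AE_I2) auto
  show ?thesis
  proof (cases "(\<integral>\<^sup>+z. indicator S z * ennreal (g z powr p) \<partial>lborel) = \<infinity>")
    case True
    then show ?thesis using V by (simp add: ennreal_mult_top)
  next
    case False
    have eqn: "ennreal (indicator S z * g z powr p) = indicator S z * ennreal (g z powr p)" for z by (auto simp: indicator_def)
    have ip: "integrable lborel (\<lambda>z. indicator S z * g z powr p)"
    proof (rule integrableI_nonneg)
      show "(\<integral>\<^sup>+z. ennreal (indicator S z * g z powr p) \<partial>lborel) < \<infinity>" unfolding eqn using False by (simp add: top.not_eq_extremum)
    qed auto
    have nn: "(\<integral>\<^sup>+z. indicator S z * ennreal (g z powr p) \<partial>lborel) = ennreal (LINT z|lborel. indicator S z * g z powr p)"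
      using nn_integral_eq_integral[OF ip] by (simp add: eqn)
    define q where "q = p / (p - 1)"
    have q: "q > 1" "1 / p + 1 / q = 1" using p unfolding q_def by (auto simp: field_simps)
    have tangent: "p * m powr (p - 1) * t \<le> t powr p + (p - 1) * m powr p" if "t \<ge> 0" for t
    proof -
      have "t * (m powr (p - 1)) \<le> t powr p / p + (m powr (p - 1)) powr q / q"
        using that m0 p q by (intro Youngs_inequality) auto
      also have "(m powr (p - 1)) powr q = m powr p" using p unfolding q_def by (simp add: powr_powr)
      finally have "p * (t * (m powr (p - 1))) \<le> p * (t powr p / p + m powr p / q)" using p by (intro mult_left_mono) auto
      also have "\<dots> = t powr p + (p - 1) * m powr p" using p unfolding q_def by (simp add: field_simps)
      finally show ?thesis by (simp add: mult_ac)
    qed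
    have iS: "integrable lborel (\<lambda>z. indicator S z * c)" for c :: real
      using V by (intro integrable_mult_left integrable_real_indicator) auto
    have mS: "measure lborel S = V" using V by (simp add: measure_def)
    have "(LINT z|lborel. p * m powr (p - 1) * (indicator S z * g z)) \<le> (LINT z|lborel. indicator S z * g z powr p + indicator S z * ((p - 1) * m powr p))"
    proof (rule integral_mono)
      show "integrable lborel (\<lambda>z. p * m powr (p - 1) * (indicator S z * g z))" by (intro integrable_mult_right int)
      show "integrable lborel (\<lambda>z. indicator S z * g z powr p + indicator S z * ((p - 1) * m powr p))"
        by (intro Bochner_Integration.integrable_add ip iS)
      show "p * m powr (p - 1) * (indicator S z * g z) \<le> indicator S z * g z powr p + indicator S z * ((p - 1) * m powr p)" for z
        using tangent[OF g[of z]] by (auto simp: indicator_def)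
    qed
    also have "\<dots> = (LINT z|lborel. indicator S z * g z powr p) + V * ((p - 1) * m powr p)"
      using ip iS[of "(p - 1) * m powr p"] mS V by (subst Bochner_Integration.integral_add) auto
    finally have "p * m powr (p - 1) * (V * m) \<le> (LINT z|lborel. indicator S z * g z powr p) + V * ((p - 1) * m powr p)"
      using V unfolding m_def by simp
    moreover have "m powr (p - 1) * m = m powr p"
      using m0 by (cases "m = 0") (auto simp: powr_diff)
    then have "p * m powr (p - 1) * (V * m) = p * V * m powr p" by (simp add: mult_ac)
    ultimately have "p * V * m powr p \<le> (LINT z|lborel. indicator S z * g z powr p) + V * ((p - 1) * m powr p)" by (simp only:)
    then have "V * m powr p \<le> (LINT z|lborel. indicator S z * g z powr p)" by (simp add: algebra_simps)
    then have "m powr p \<le> 1 / V * (LINT z|lborel. indicator S z * g z powr p)" using V by (simp add: field_simps)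
    then show ?thesis unfolding nn m_def[symmetric] using V by (simp add: ennreal_mult'[symmetric] ennreal_leI)
  qed
qed

section \<open>The extension operator\<close>

definition strip_extension where
  "strip_extension a \<eta>m \<eta>p fm fp X = (if X \<in> strip \<eta>m \<eta>p then
     (1 - (snd X - \<eta>m (fst X)) / (\<eta>p (fst X) - \<eta>m (fst X))) * tent_avg fm (fst X) (a * (snd X - \<eta>m (fst X)))
     + (snd X - \<eta>m (fst X)) / (\<eta>p (fst X) - \<eta>m (fst X)) * tent_avg fp (fst X) (a * (\<eta>p (fst X) - snd X)) else 0)"

definition slope_control where
  "slope_control a \<eta>m \<eta>p fm fp X = (if X \<in> strip \<eta>m \<eta>p then
     \<bar>fp (fst X) - fm (fst X)\<bar> / (\<eta>p (fst X) - \<eta>m (fst X))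
     + mean_osc fm (fst X) (a * (snd X - \<eta>m (fst X))) / (a * (snd X - \<eta>m (fst X)))
     + mean_osc fp (fst X) (a * (\<eta>p (fst X) - snd X)) / (a * (\<eta>p (fst X) - snd X)) else 0)"

text \<open>Sum of the coefficients found in \<open>slope_bound\<close>: 6 for the changing weight
  acting on the gap of the data, twice the constant of \<open>tent_avg_mean_osc\<close> for the
  moving averages (centre and radius each move by at most \<open>r\<close>), and 6 times
  \<open>tent_ratio\<close> for the changing weight acting on the deviation of the averages from the
  data.\<close>

definition slope_const :: "'a::euclidean_space itself \<Rightarrow> real" where
  "slope_const _ = 6 + 2 * (3 * tent_ratio TYPE('a) + 3 * (tent_ratio TYPE('a))\<^sup>2) + 6 * tent_ratio TYPE('a)"

locale strip_data = lipschitz_strip +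
  fixes fm fp :: "'a \<Rightarrow> real" and a p :: real
  assumes a: "0 < a" "a < 1" and p1: "p > 1"
    and fm_li: "loc_integrable fm" and fp_li: "loc_integrable fp"
    and fm_Lp: "fm \<in> Lp_loc p" and fp_Lp: "fp \<in> Lp_loc p"
begin

abbreviation "u \<equiv> strip_extension a \<eta>m \<eta>p fm fp"
abbreviation "H \<equiv> slope_control a \<eta>m \<eta>p fm fp"

lemma f_borel [measurable]: "fm \<in> borel_measurable borel" "fp \<in> borel_measurable borel"
  using fm_li fp_li by (auto intro: loc_integrable_borel)

lemma H_borel [measurable]: "H \<in> borel_measurable borel"
proof -
  have 1: "(\<lambda>X. mean_osc fm (fst X) (a * (snd X - \<eta>m (fst X)))) \<in> borel_measurable borel"
  proof -
    have "(\<lambda>X. (fst X, a * (snd X - \<eta>m (fst X)))) \<in> borel_measurable (borel :: ('a \<times> real) measure)" by measurable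
    from measurable_compose[OF this mean_osc_borel[OF f_borel(1)]] show ?thesis by simp
  qed
  have 2: "(\<lambda>X. mean_osc fp (fst X) (a * (\<eta>p (fst X) - snd X))) \<in> borel_measurable borel"
  proof -
    have "(\<lambda>X. (fst X, a * (\<eta>p (fst X) - snd X))) \<in> borel_measurable (borel :: ('a \<times> real) measure)" by measurable
    from measurable_compose[OF this mean_osc_borel[OF f_borel(2)]] show ?thesis by simp
  qed
  note [measurable] = 1 2
  show ?thesis unfolding slope_control_def[abs_def] by measurable
qed

lemma H_nonneg: "H X \<ge> 0"
proof (cases "X \<in> \<Omega>")
  case True
  then have "a * (snd X - \<eta>m (fst X)) > 0" "a * (\<eta>p (fst X) - snd X) > 0" using a unfolding strip_def by auto
  then show ?thesis using True mean_osc_nonneg gap[of "fst X"] unfolding slope_control_def by (auto intro!: add_nonneg_nonneg divide_nonneg_pos)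
qed (simp add: slope_control_def)

lemma depth_lipschitz:
  "\<bar>(snd X - \<eta>m (fst X)) - (snd Y - \<eta>m (fst Y))\<bar> \<le> (1 + L) * norm (X - Y)"
  "\<bar>(\<eta>p (fst X) - snd X) - (\<eta>p (fst Y) - snd Y)\<bar> \<le> (1 + L) * norm (X - Y)"
  using graph_distance_lipschitz[OF lipm, of 1 X Y] graph_distance_lipschitz[OF lipp, of "-1" X Y] L0 by auto

lemma norm_fst_diff_le: "norm (fst X - fst Y) \<le> norm (X - Y :: 'a \<times> real)"
  by (metis fst_diff norm_fst_le prod.collapse)

lemma u_loc_lip: "loc_lip \<Omega> u"
proof -
  have ll_lip: "loc_lip \<Omega> g" if "\<And>X Y. \<bar>g X - g Y\<bar> \<le> C * norm (X - Y)" for g :: "'a \<times> real \<Rightarrow> real" and C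
    using that by (intro loc_lip_lipschitz) (simp add: dist_norm)
  have tm: "loc_lip \<Omega> (\<lambda>X. snd X - \<eta>m (fst X))" and tp: "loc_lip \<Omega> (\<lambda>X. \<eta>p (fst X) - snd X)"
    by (rule ll_lip[OF depth_lipschitz(1)], rule ll_lip[OF depth_lipschitz(2)])
  have d: "loc_lip \<Omega> (\<lambda>X. \<eta>p (fst X) - \<eta>m (fst X))"
    using loc_lip_add[OF tm tp] by simp
  have th: "loc_lip \<Omega> (\<lambda>X. (snd X - \<eta>m (fst X)) / (\<eta>p (fst X) - \<eta>m (fst X)))"
  proof -
    have "\<eta>p (fst X) - \<eta>m (fst X) \<noteq> 0" for X :: "'a \<times> real" using gap[of "fst X"] by simp
    then show ?thesis unfolding divide_inverse by (intro loc_lip_mult[OF tm loc_lip_inverse[OF d]])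
  qed
  have comp: "loc_lip \<Omega> (\<lambda>X. tent_avg f (fst X) (a * \<tau> X))"
    if f: "loc_integrable f" and \<tau>: "\<And>X Y. \<bar>\<tau> X - \<tau> Y\<bar> \<le> (1 + L) * norm (X - Y)" and pos: "\<And>X. X \<in> \<Omega> \<Longrightarrow> \<tau> X > 0" for f \<tau>
  proof -
    have "loc_lip \<Omega> (\<lambda>X. (\<lambda>X. tent_avg f (fst X) (snd X)) (fst X, a * \<tau> X))"
    proof (rule loc_lip_compose[OF tent_avg_loc_lip[OF f]])
      fix X Y :: "'a \<times> real"
      have "dist (fst X, a * \<tau> X) (fst Y, a * \<tau> Y) \<le> norm (fst X - fst Y) + \<bar>a * \<tau> X - a * \<tau> Y\<bar>"
        using norm_Pair_le[of "fst X - fst Y" "a * \<tau> X - a * \<tau> Y"] by (simp add: dist_norm)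
      also have "\<bar>a * \<tau> X - a * \<tau> Y\<bar> = a * \<bar>\<tau> X - \<tau> Y\<bar>" using a by (simp add: right_diff_distrib[symmetric] abs_mult)
      also have "norm (fst X - fst Y) + a * \<bar>\<tau> X - \<tau> Y\<bar> \<le> norm (X - Y) + a * ((1 + L) * norm (X - Y))"
        using norm_fst_diff_le[of X Y] \<tau>[of X Y] a by (intro add_mono mult_left_mono) auto
      finally show "dist (fst X, a * \<tau> X) (fst Y, a * \<tau> Y) \<le> (1 + a * (1 + L)) * dist X Y"
        by (simp add: dist_norm algebra_simps)
      show "X \<in> \<Omega> \<Longrightarrow> (fst X, a * \<tau> X) \<in> {X. 0 < snd X}" using pos a by simp
    qed
    then show ?thesis by simp
  qed
  have Fm: "loc_lip \<Omega> (\<lambda>X. tent_avg fm (fst X) (a * (snd X - \<eta>m (fst X))))"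
    by (rule comp[OF fm_li depth_lipschitz(1)]) (simp add: strip_def)
  have Fp: "loc_lip \<Omega> (\<lambda>X. tent_avg fp (fst X) (a * (\<eta>p (fst X) - snd X)))"
    by (rule comp[OF fp_li depth_lipschitz(2)]) (simp add: strip_def)
  show ?thesis
  proof (rule loc_lip_open_cong[OF _ open_strip])
    show "loc_lip \<Omega> (\<lambda>X. (1 - (snd X - \<eta>m (fst X)) / (\<eta>p (fst X) - \<eta>m (fst X))) * tent_avg fm (fst X) (a * (snd X - \<eta>m (fst X)))
     + (snd X - \<eta>m (fst X)) / (\<eta>p (fst X) - \<eta>m (fst X)) * tent_avg fp (fst X) (a * (\<eta>p (fst X) - snd X)))"
      by (intro loc_lip_add loc_lip_mult loc_lip_diff loc_lip_const th Fm Fp)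
  qed (simp add: strip_extension_def)
qed

lemma u_borel [measurable]: "u \<in> borel_measurable borel"
proof -
  have "(\<lambda>X. if X \<in> \<Omega> then u X else 0) \<in> borel_measurable borel"
    by (rule borel_measurable_continuous_on_if) (auto intro: loc_lip_continuous_on[OF u_loc_lip])
  moreover have "(\<lambda>X. if X \<in> \<Omega> then u X else 0) = u" by (auto simp: strip_extension_def)
  ultimately show ?thesis by simp
qed

lemma split_data:
  assumes X: "(x, t) \<in> \<Omega>"
  defines "\<tau> \<equiv> t - \<eta>m x" and "\<sigma> \<equiv> \<eta>p x - t" and "d \<equiv> \<eta>p x - \<eta>m x"
  defines "Hm \<equiv> mean_osc fm x (a * \<tau>) / (a * \<tau>)" and "Hp \<equiv> mean_osc fp x (a * \<sigma>) / (a * \<sigma>)"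
  shows "\<tau> > 0" "\<sigma> > 0" "d = \<tau> + \<sigma>" "Hm \<ge> 0" "Hp \<ge> 0"
    and "H (x, t) = \<bar>fp x - fm x\<bar> / d + Hm + Hp"
    and "\<bar>tent_avg fm x (a * \<tau>) - fm x\<bar> \<le> tent_ratio TYPE('a) * (Hm * \<tau>)" "\<bar>tent_avg fp x (a * \<sigma>) - fp x\<bar> \<le> tent_ratio TYPE('a) * (Hp * \<sigma>)"
proof -
  show pos: "\<tau> > 0" "\<sigma> > 0" and "d = \<tau> + \<sigma>" using X unfolding \<tau>_def \<sigma>_def d_def mem_strip by auto
  then have ap: "a * \<tau> > 0" "a * \<sigma> > 0" using a by auto
  show "Hm \<ge> 0" "Hp \<ge> 0" using mean_osc_nonneg ap unfolding Hm_def Hp_def by (auto intro: divide_nonneg_pos)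
  show "H (x, t) = \<bar>fp x - fm x\<bar> / d + Hm + Hp"
    using X by (simp add: slope_control_def Hm_def Hp_def \<tau>_def \<sigma>_def d_def)
  \<comment> \<open>Because \<open>a < 1\<close>, the radius \<open>a * s\<close> may be replaced by
    the depth \<open>s\<close>.\<close>
  have le: "tent_ratio TYPE('a) * mean_osc f x (a * s) \<le> tent_ratio TYPE('a) * (mean_osc f x (a * s) / (a * s) * s)" if "s > 0" for f and s
  proof -
    have as: "a * s > 0" using a that by simp
    have "mean_osc f x (a * s) = mean_osc f x (a * s) / (a * s) * (a * s)" using as nonzero_eq_divide_eq less_imp_neq by (metis order_less_irrefl)
    also have "\<dots> \<le> mean_osc f x (a * s) / (a * s) * s"
      using a that mean_osc_nonneg[OF as, of f x] as by (intro mult_left_mono) auto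
    finally show ?thesis using tent_ratio_ge_1[where 'a = 'a] by (intro mult_left_mono) auto
  qed
  show "\<bar>tent_avg fm x (a * \<tau>) - fm x\<bar> \<le> tent_ratio TYPE('a) * (Hm * \<tau>)"
    using tent_avg_mean_osc(1)[OF fm_li ap(1), of x] le[OF pos(1), of fm] unfolding Hm_def by linarith
  show "\<bar>tent_avg fp x (a * \<sigma>) - fp x\<bar> \<le> tent_ratio TYPE('a) * (Hp * \<sigma>)"
    using tent_avg_mean_osc(1)[OF fp_li ap(2), of x] le[OF pos(2), of fp] unfolding Hp_def by linarith
qed

text \<open>Near the lower graph the average of \<open>fp\<close> is taken over a large ball, with
  an error proportional to the distance \<open>\<sigma>\<close> from the upper graph; its weight
  \<open>\<tau> / d\<close> turns this into \<open>\<tau> * (\<sigma> / d) \<le> \<tau>\<close>. So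
  all error terms carry the factor \<open>\<tau>\<close>. The roles are exchanged at the upper
  graph.\<close>

lemma u_near:
  assumes X: "(x, t) \<in> \<Omega>"
  shows "\<bar>u (x, t) - fm x\<bar> \<le> (t - \<eta>m x) * ((1 + tent_ratio TYPE('a)) * H (x, t))"
    and "\<bar>u (x, t) - fp x\<bar> \<le> (\<eta>p x - t) * ((1 + tent_ratio TYPE('a)) * H (x, t))"
proof -
  define \<tau> where "\<tau> = t - \<eta>m x"
  define \<sigma> where "\<sigma> = \<eta>p x - t"
  define d where "d = \<eta>p x - \<eta>m x"
  define Hm where "Hm = mean_osc fm x (a * \<tau>) / (a * \<tau>)"
  define Hp where "Hp = mean_osc fp x (a * \<sigma>) / (a * \<sigma>)"
  note S = split_data[OF X, folded \<tau>_def \<sigma>_def d_def, folded Hm_def Hp_def]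
  have k: "tent_ratio TYPE('a) \<ge> 1" by (rule tent_ratio_ge_1)
  have d: "d > 0" using S(1-3) by linarith
  define \<theta> where "\<theta> = \<tau> / d"
  define b where "b = \<bar>fp x - fm x\<bar> / d"
  have b0: "b \<ge> 0" using d unfolding b_def by simp
  have \<theta>: "1 - \<theta> = \<sigma> / d" "\<theta> \<ge> 0" "\<theta> \<le> 1" using S(1-3) d unfolding \<theta>_def by (auto simp: field_simps)
  have ueq: "u (x, t) = (1 - \<theta>) * tent_avg fm x (a * \<tau>) + \<theta> * tent_avg fp x (a * \<sigma>)"
    using X by (simp add: strip_extension_def \<theta>_def \<tau>_def \<sigma>_def d_def)
  have H: "H (x, t) = b + Hm + Hp" unfolding b_def by (rule S(6))
  define Em where "Em = tent_avg fm x (a * \<tau>) - fm x"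
  define Ep where "Ep = tent_avg fp x (a * \<sigma>) - fp x"
  have Em: "\<bar>Em\<bar> \<le> tent_ratio TYPE('a) * (Hm * \<tau>)" and Ep: "\<bar>Ep\<bar> \<le> tent_ratio TYPE('a) * (Hp * \<sigma>)" unfolding Em_def Ep_def by (rule S(7), rule S(8))
  have tri: "\<bar>A + B + C\<bar> \<le> \<bar>A\<bar> + \<bar>B\<bar> + \<bar>C\<bar>" for A B C :: real by linarith
  have m1: "(1 - \<theta>) * \<bar>Em\<bar> \<le> \<tau> * (tent_ratio TYPE('a) * Hm)"
  proof -
    have "(1 - \<theta>) * \<bar>Em\<bar> \<le> 1 * (tent_ratio TYPE('a) * (Hm * \<tau>))" using Em \<theta> by (intro mult_mono) auto
    then show ?thesis by (simp add: mult_ac)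
  qed
  have m2: "\<theta> * \<bar>Ep\<bar> \<le> \<tau> * (tent_ratio TYPE('a) * Hp)"
  proof -
    have "\<theta> * \<bar>Ep\<bar> \<le> \<theta> * (tent_ratio TYPE('a) * (Hp * \<sigma>))" using Ep \<theta> by (intro mult_left_mono) auto
    also have "\<dots> = \<tau> * (tent_ratio TYPE('a) * Hp) * (\<sigma> / d)" unfolding \<theta>_def by simp
    also have "\<dots> \<le> \<tau> * (tent_ratio TYPE('a) * Hp) * 1" using S k \<theta> by (intro mult_left_mono) auto
    finally show ?thesis by simp
  qed
  have m3: "(1 - \<theta>) * \<bar>Em\<bar> \<le> \<sigma> * (tent_ratio TYPE('a) * Hm)"
  proof -
    have "(1 - \<theta>) * \<bar>Em\<bar> \<le> (1 - \<theta>) * (tent_ratio TYPE('a) * (Hm * \<tau>))" using Em \<theta> by (intro mult_left_mono) auto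
    also have "\<dots> = \<sigma> * (tent_ratio TYPE('a) * Hm) * \<theta>" unfolding \<theta>(1) by (simp add: \<theta>_def)
    also have "\<dots> \<le> \<sigma> * (tent_ratio TYPE('a) * Hm) * 1" using S k \<theta> by (intro mult_left_mono) auto
    finally show ?thesis by simp
  qed
  have m4: "\<theta> * \<bar>Ep\<bar> \<le> \<sigma> * (tent_ratio TYPE('a) * Hp)"
  proof -
    have "\<theta> * \<bar>Ep\<bar> \<le> 1 * (tent_ratio TYPE('a) * (Hp * \<sigma>))" using Ep \<theta> by (intro mult_mono) auto
    then show ?thesis by (simp add: mult_ac)
  qed
  have fin: "b + tent_ratio TYPE('a) * Hm + tent_ratio TYPE('a) * Hp \<le> (1 + tent_ratio TYPE('a)) * H (x, t)"
    using k b0 S(4,5) unfolding H by (simp add: algebra_simps)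
  have "u (x, t) - fm x = \<theta> * (fp x - fm x) + (1 - \<theta>) * Em + \<theta> * Ep"
    unfolding ueq Em_def Ep_def by (simp add: algebra_simps)
  also have "\<bar>\<dots>\<bar> \<le> \<theta> * \<bar>fp x - fm x\<bar> + (1 - \<theta>) * \<bar>Em\<bar> + \<theta> * \<bar>Ep\<bar>"
    using tri[of "\<theta> * (fp x - fm x)" "(1 - \<theta>) * Em" "\<theta> * Ep"] \<theta>(2,3) by (simp add: abs_mult)
  also have "\<theta> * \<bar>fp x - fm x\<bar> = \<tau> * b" unfolding \<theta>_def b_def by simp
  also have "\<tau> * b + (1 - \<theta>) * \<bar>Em\<bar> + \<theta> * \<bar>Ep\<bar> \<le> \<tau> * (b + tent_ratio TYPE('a) * Hm + tent_ratio TYPE('a) * Hp)"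
    using m1 m2 by (simp add: distrib_left)
  also have "\<dots> \<le> \<tau> * ((1 + tent_ratio TYPE('a)) * H (x, t))" using S(1) fin by (intro mult_left_mono) auto
  finally show "\<bar>u (x, t) - fm x\<bar> \<le> (t - \<eta>m x) * ((1 + tent_ratio TYPE('a)) * H (x, t))" unfolding \<tau>_def .
  have "u (x, t) - fp x = (1 - \<theta>) * (fm x - fp x) + (1 - \<theta>) * Em + \<theta> * Ep"
    unfolding ueq Em_def Ep_def by (simp add: algebra_simps)
  also have "\<bar>\<dots>\<bar> \<le> (1 - \<theta>) * \<bar>fm x - fp x\<bar> + (1 - \<theta>) * \<bar>Em\<bar> + \<theta> * \<bar>Ep\<bar>"
    using tri[of "(1 - \<theta>) * (fm x - fp x)" "(1 - \<theta>) * Em" "\<theta> * Ep"] \<theta>(2,3) by (simp add: abs_mult)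
  also have "(1 - \<theta>) * \<bar>fm x - fp x\<bar> = \<sigma> * b" unfolding \<theta>(1) b_def by (simp add: abs_minus_commute)
  also have "\<sigma> * b + (1 - \<theta>) * \<bar>Em\<bar> + \<theta> * \<bar>Ep\<bar> \<le> \<sigma> * (b + tent_ratio TYPE('a) * Hm + tent_ratio TYPE('a) * Hp)"
    using m3 m4 by (simp add: distrib_left)
  also have "\<dots> \<le> \<sigma> * ((1 + tent_ratio TYPE('a)) * H (x, t))" using S(2) fin by (intro mult_left_mono) auto
  finally show "\<bar>u (x, t) - fp x\<bar> \<le> (\<eta>p x - t) * ((1 + tent_ratio TYPE('a)) * H (x, t))" unfolding \<sigma>_def .
qed

text \<open>The bound uses \<open>H\<close> at \<open>X\<close> only, although \<open>H\<close> may
  be wild nearby. For this \<open>Y\<close> is compared with \<open>X\<close> alone, within a radius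
  depending on \<open>X\<close>, which is enough to bound derivatives at \<open>X\<close>.\<close>

lemma slope_bound:
  assumes X: "X \<in> \<Omega>"
  shows "\<exists>r0>0. \<forall>Y. norm (Y - X) < r0 \<longrightarrow> \<bar>u Y - u X\<bar> \<le> slope_const TYPE('a) * (1 + L) * H X * norm (Y - X)"
proof -
  obtain x t where Xe: "X = (x, t)" by (cases X)
  have Xt: "(x, t) \<in> \<Omega>" using X Xe by simp
  define \<tau> where "\<tau> = t - \<eta>m x"
  define \<sigma> where "\<sigma> = \<eta>p x - t"
  define d where "d = \<eta>p x - \<eta>m x"
  define Hm where "Hm = mean_osc fm x (a * \<tau>) / (a * \<tau>)"
  define Hp where "Hp = mean_osc fp x (a * \<sigma>) / (a * \<sigma>)"
  note S = split_data[OF Xt, folded \<tau>_def \<sigma>_def d_def, folded Hm_def Hp_def]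
  have k: "tent_ratio TYPE('a) \<ge> 1" by (rule tent_ratio_ge_1)
  have d: "d > 0" using S(1-3) by linarith
  define b where "b = \<bar>fp x - fm x\<bar> / d"
  have b0: "b \<ge> 0" using d unfolding b_def by simp
  have H: "H X = b + Hm + Hp" unfolding b_def Xe by (rule S(6))
  define C1 where "C1 = 3 * tent_ratio TYPE('a) + 3 * (tent_ratio TYPE('a))\<^sup>2"
  have C1: "C1 \<ge> 0" using k unfolding C1_def by simp
  obtain r1 where r1: "r1 > 0" "ball X r1 \<subseteq> \<Omega>" using open_strip X openE by blast
  \<comment> \<open>\<open>r1\<close> keeps \<open>Y\<close> in the strip. The other bound makes
    \<open>8 * r\<close>, with \<open>r = (1 + L) * norm (Y - X)\<close>, at most both radii, so
    that base point and radii move by no more than one eighth of each radius.\<close>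
  define r0 where "r0 = min r1 (min (a * \<tau>) (a * \<sigma>) / (8 * (1 + L)))"
  have r0: "r0 > 0" using r1 S a L0 unfolding r0_def by auto
  have main: "\<bar>u Y - u X\<bar> \<le> slope_const TYPE('a) * (1 + L) * H X * norm (Y - X)" if Y: "norm (Y - X) < r0" for Y
  proof -
    obtain y s where Ye: "Y = (y, s)" by (cases Y)
    define r where "r = (1 + L) * norm (Y - X)"
    have rr: "norm (Y - X) \<le> r" "r \<ge> 0" unfolding r_def using L0 by (auto simp: mult_le_cancel_right1 algebra_simps)
    have "norm (Y - X) \<le> min (a * \<tau>) (a * \<sigma>) / (8 * (1 + L))" using Y unfolding r0_def by simp
    then have "(1 + L) * norm (Y - X) * 8 \<le> min (a * \<tau>) (a * \<sigma>)" using L0 by (simp add: field_simps)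
    then have r8: "8 * r \<le> a * \<tau>" "8 * r \<le> a * \<sigma>" unfolding r_def by auto
    have "Y \<in> ball X r1" using Y unfolding r0_def by (simp add: dist_norm norm_minus_commute)
    then have Y\<Omega>: "(y, s) \<in> \<Omega>" using r1 Ye by auto
    define \<tau>' where "\<tau>' = s - \<eta>m y"
    define \<sigma>' where "\<sigma>' = \<eta>p y - s"
    define d' where "d' = \<eta>p y - \<eta>m y"
    have p': "\<tau>' > 0" "\<sigma>' > 0" "d' = \<tau>' + \<sigma>'" using Y\<Omega> unfolding \<tau>'_def \<sigma>'_def d'_def mem_strip by auto
    have dt: "\<bar>\<tau>' - \<tau>\<bar> \<le> r" "\<bar>\<sigma>' - \<sigma>\<bar> \<le> r"
      using depth_lipschitz[of Y X] unfolding r_def \<tau>'_def \<tau>_def \<sigma>'_def \<sigma>_def Xe Ye by auto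
    have dy: "norm (y - x) \<le> r" using norm_fst_diff_le[of Y X] rr unfolding Xe Ye by simp
    have aH: "a * \<tau> \<le> \<tau>" "a * \<sigma> \<le> \<sigma>" using a S by (auto simp: mult_le_cancel_right1)
    have dd: "\<bar>d' - d\<bar> \<le> 2 * r" using dt unfolding p'(3) S(3) by linarith
    have d'2: "d' \<ge> d / 2" using dd r8 aH S(1-3) rr(2) by linarith
    have d'0: "d' > 0" using d'2 d by linarith
    define \<theta> where "\<theta> = \<tau> / d"
    define \<theta>' where "\<theta>' = \<tau>' / d'"
    have \<theta>': "0 \<le> \<theta>'" "\<theta>' \<le> 1" using p' d'0 unfolding \<theta>'_def by (auto simp: field_simps)
    have \<theta>01: "0 \<le> \<theta>" "\<theta> \<le> 1" using S(1-3) d unfolding \<theta>_def by (auto simp: field_simps)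
    \<comment> \<open>The depth changes by at most \<open>r\<close>, the gap \<open>d\<close> by at
      most \<open>2 * r\<close>, and the new gap is at least \<open>d / 2\<close>; this adds up to
      \<open>2 + 4 = 6\<close>.\<close>
    have dth: "\<bar>\<theta>' - \<theta>\<bar> \<le> 6 * r / d"
    proof -
      have "\<theta>' - \<theta> = (\<tau>' - \<tau>) / d' + \<theta> * ((d - d') / d')" using d d'0 unfolding \<theta>'_def \<theta>_def by (simp add: field_simps)
      also have "\<bar>\<dots>\<bar> \<le> \<bar>\<tau>' - \<tau>\<bar> / d' + \<theta> * (\<bar>d - d'\<bar> / d')"
        using abs_triangle_ineq[of "(\<tau>' - \<tau>) / d'" "\<theta> * ((d - d') / d')"] d'0 \<theta>01 by (simp add: abs_mult abs_divide)
      also have "\<dots> \<le> r / (d / 2) + 1 * (2 * r / (d / 2))"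
      proof (intro add_mono mult_mono)
        show "\<bar>\<tau>' - \<tau>\<bar> / d' \<le> r / (d / 2)" using dt(1) d'2 d rr by (intro frac_le) auto
        show "\<bar>d - d'\<bar> / d' \<le> 2 * r / (d / 2)" using dd d'2 d rr by (intro frac_le) (auto simp: abs_minus_commute)
      qed (use \<theta>01 d'0 in auto)
      also have "\<dots> = 6 * r / d" by simp
      finally show ?thesis .
    qed
    have near: "norm (y - x) \<le> (a * \<tau>) / 8" "norm (y - x) \<le> (a * \<sigma>) / 8" using dy r8 by linarith+
    have ar: "a * r \<le> r" using a rr(2) by (simp add: mult_left_le_one_le)
    have adt: "\<bar>a * \<tau>' - a * \<tau>\<bar> \<le> r" "\<bar>a * \<sigma>' - a * \<sigma>\<bar> \<le> r"
    proof -
      have "\<bar>a * \<tau>' - a * \<tau>\<bar> = a * \<bar>\<tau>' - \<tau>\<bar>" "\<bar>a * \<sigma>' - a * \<sigma>\<bar> = a * \<bar>\<sigma>' - \<sigma>\<bar>"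
        using a by (simp_all add: right_diff_distrib[symmetric] abs_mult)
      then show "\<bar>a * \<tau>' - a * \<tau>\<bar> \<le> r" "\<bar>a * \<sigma>' - a * \<sigma>\<bar> \<le> r"
        using ar mult_left_mono[OF dt(1), of a] mult_left_mono[OF dt(2), of a] a by linarith+
    qed
    have near2: "\<bar>a * \<tau>' - a * \<tau>\<bar> \<le> (a * \<tau>) / 8" "\<bar>a * \<sigma>' - a * \<sigma>\<bar> \<le> (a * \<sigma>) / 8" using adt r8 by linarith+
    have ap: "a * \<tau> > 0" "a * \<sigma> > 0" using a S by auto
    define FX where "FX = tent_avg fm x (a * \<tau>)"
    define FY where "FY = tent_avg fm y (a * \<tau>')"
    define GX where "GX = tent_avg fp x (a * \<sigma>)"
    define GY where "GY = tent_avg fp y (a * \<sigma>')"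
    have FF: "\<bar>FY - FX\<bar> \<le> C1 * (2 * r) * Hm"
    proof -
      have "\<bar>FY - FX\<bar> \<le> C1 * (norm (y - x) + \<bar>a * \<tau>' - a * \<tau>\<bar>) * Hm"
        unfolding FY_def FX_def C1_def Hm_def by (rule tent_avg_mean_osc(2)[OF fm_li ap(1) near(1) near2(1)])
      also have "\<dots> \<le> C1 * (2 * r) * Hm" using dy adt(1) C1 S(4) by (intro mult_right_mono mult_left_mono) auto
      finally show ?thesis .
    qed
    have GG: "\<bar>GY - GX\<bar> \<le> C1 * (2 * r) * Hp"
    proof -
      have "\<bar>GY - GX\<bar> \<le> C1 * (norm (y - x) + \<bar>a * \<sigma>' - a * \<sigma>\<bar>) * Hp"
        unfolding GY_def GX_def C1_def Hp_def by (rule tent_avg_mean_osc(2)[OF fp_li ap(2) near(2) near2(2)])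
      also have "\<dots> \<le> C1 * (2 * r) * Hp" using dy adt(2) C1 S(5) by (intro mult_right_mono mult_left_mono) auto
      finally show ?thesis .
    qed
    have dE: "\<bar>\<theta>' - \<theta>\<bar> * \<bar>FX - fm x\<bar> \<le> 6 * r * (tent_ratio TYPE('a) * Hm)" "\<bar>\<theta>' - \<theta>\<bar> * \<bar>GX - fp x\<bar> \<le> 6 * r * (tent_ratio TYPE('a) * Hp)"
    proof -
      have "tent_ratio TYPE('a) * (Hm * \<tau>) \<le> tent_ratio TYPE('a) * (Hm * d)" "tent_ratio TYPE('a) * (Hp * \<sigma>) \<le> tent_ratio TYPE('a) * (Hp * d)"
        using S(1-5) k by (auto intro!: mult_left_mono)
      then have "\<bar>FX - fm x\<bar> \<le> tent_ratio TYPE('a) * (Hm * d)" "\<bar>GX - fp x\<bar> \<le> tent_ratio TYPE('a) * (Hp * d)"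
        using S(7,8) unfolding FX_def GX_def by linarith+
      then have "\<bar>\<theta>' - \<theta>\<bar> * \<bar>FX - fm x\<bar> \<le> (6 * r / d) * (tent_ratio TYPE('a) * (Hm * d))" "\<bar>\<theta>' - \<theta>\<bar> * \<bar>GX - fp x\<bar> \<le> (6 * r / d) * (tent_ratio TYPE('a) * (Hp * d))"
        using rr d by (intro mult_mono[OF dth]; simp)+
      then show "\<bar>\<theta>' - \<theta>\<bar> * \<bar>FX - fm x\<bar> \<le> 6 * r * (tent_ratio TYPE('a) * Hm)" "\<bar>\<theta>' - \<theta>\<bar> * \<bar>GX - fp x\<bar> \<le> 6 * r * (tent_ratio TYPE('a) * Hp)"
        using d by (simp_all add: field_simps)
    qed
    have bb: "\<bar>\<theta>' - \<theta>\<bar> * \<bar>fp x - fm x\<bar> \<le> 6 * r * b"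
    proof -
      have "\<bar>\<theta>' - \<theta>\<bar> * \<bar>fp x - fm x\<bar> \<le> (6 * r / d) * \<bar>fp x - fm x\<bar>" using dth by (intro mult_right_mono) auto
      then show ?thesis unfolding b_def by simp
    qed
    have uX: "u X = (1 - \<theta>) * FX + \<theta> * GX" using Xt by (simp add: Xe strip_extension_def FX_def GX_def \<theta>_def \<tau>_def \<sigma>_def d_def)
    have uY: "u Y = (1 - \<theta>') * FY + \<theta>' * GY" using Y\<Omega> by (simp add: Ye strip_extension_def FY_def GY_def \<theta>'_def \<tau>'_def \<sigma>'_def d'_def)
    have tri: "\<bar>A + B - C + E + G\<bar> \<le> \<bar>A\<bar> + \<bar>B\<bar> + \<bar>C\<bar> + \<bar>E\<bar> + \<bar>G\<bar>" for A B C E G :: real by linarith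
    \<comment> \<open>Data values are subtracted from the averages, so that the change of the
      weight, of order \<open>r / d\<close>, multiplies only the gap of the data and errors of order
      at most \<open>d\<close>.\<close>
    have "u Y - u X = (\<theta>' - \<theta>) * (fp x - fm x) + (1 - \<theta>') * (FY - FX) - (\<theta>' - \<theta>) * (FX - fm x) + \<theta>' * (GY - GX) + (\<theta>' - \<theta>) * (GX - fp x)"
      unfolding uX uY by (simp add: algebra_simps)
    also have "\<bar>\<dots>\<bar> \<le> \<bar>\<theta>' - \<theta>\<bar> * \<bar>fp x - fm x\<bar> + (1 - \<theta>') * \<bar>FY - FX\<bar> + \<bar>\<theta>' - \<theta>\<bar> * \<bar>FX - fm x\<bar> + \<theta>' * \<bar>GY - GX\<bar> + \<bar>\<theta>' - \<theta>\<bar> * \<bar>GX - fp x\<bar>"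
      using tri[of "(\<theta>' - \<theta>) * (fp x - fm x)" "(1 - \<theta>') * (FY - FX)" "(\<theta>' - \<theta>) * (FX - fm x)" "\<theta>' * (GY - GX)" "(\<theta>' - \<theta>) * (GX - fp x)"] \<theta>'
      unfolding abs_mult by simp
    also have "\<dots> \<le> 6 * r * b + C1 * (2 * r) * Hm + 6 * r * (tent_ratio TYPE('a) * Hm) + C1 * (2 * r) * Hp + 6 * r * (tent_ratio TYPE('a) * Hp)"
    proof (intro add_mono bb dE)
      have "(1 - \<theta>') * \<bar>FY - FX\<bar> \<le> 1 * \<bar>FY - FX\<bar>" using \<theta>' by (intro mult_right_mono) auto
      also have "\<dots> \<le> C1 * (2 * r) * Hm" using FF by (simp only: mult_1)
      finally show "(1 - \<theta>') * \<bar>FY - FX\<bar> \<le> C1 * (2 * r) * Hm" .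
      have "\<theta>' * \<bar>GY - GX\<bar> \<le> 1 * \<bar>GY - GX\<bar>" using \<theta>' by (intro mult_right_mono) auto
      also have "\<dots> \<le> C1 * (2 * r) * Hp" using GG by (simp only: mult_1)
      finally show "\<theta>' * \<bar>GY - GX\<bar> \<le> C1 * (2 * r) * Hp" .
    qed
    also have "\<dots> = r * (6 * b + (2 * C1 + 6 * tent_ratio TYPE('a)) * Hm + (2 * C1 + 6 * tent_ratio TYPE('a)) * Hp)" by (simp add: algebra_simps)
    also have "\<dots> \<le> r * (slope_const TYPE('a) * H X)"
    proof (rule mult_left_mono[OF _ rr(2)])
      have sc: "slope_const TYPE('a) = 6 + 2 * C1 + 6 * tent_ratio TYPE('a)" unfolding slope_const_def C1_def ..
      have "6 * b \<le> slope_const TYPE('a) * b" "(2 * C1 + 6 * tent_ratio TYPE('a)) * Hm \<le> slope_const TYPE('a) * Hm" "(2 * C1 + 6 * tent_ratio TYPE('a)) * Hp \<le> slope_const TYPE('a) * Hp"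
        unfolding sc using b0 S(4,5) C1 k by (auto intro!: mult_right_mono)
      then show "6 * b + (2 * C1 + 6 * tent_ratio TYPE('a)) * Hm + (2 * C1 + 6 * tent_ratio TYPE('a)) * Hp \<le> slope_const TYPE('a) * H X"
        unfolding H distrib_left by linarith
    qed
    also have "\<dots> = slope_const TYPE('a) * (1 + L) * H X * norm (Y - X)" unfolding r_def by simp
    finally show ?thesis .
  qed
  show ?thesis using r0 main by blast
qed

text \<open>\<open>u\<close> may jump at the boundary of the strip, so
  \<open>partial_borel_measurable\<close> does not apply to it. Limits of difference quotients along
  a sequence are Borel everywhere, and equal the partial derivatives at almost every point of the
  strip.\<close>

definition Du :: "'a \<times> real \<Rightarrow> 'a \<times> real" where
  "Du X = (\<Sum>i\<in>Basis. lim (\<lambda>n. (u (X + (1 / Suc n) *\<^sub>R i) - u X) / (1 / Suc n)) *\<^sub>R i)"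

lemma Du_borel [measurable]: "Du \<in> borel_measurable borel"
  unfolding Du_def[abs_def]
proof (intro borel_measurable_sum borel_measurable_scaleR borel_measurable_const borel_measurable_lim_metric)
  fix i :: "'a \<times> real" and n :: nat
  show "(\<lambda>X. (u (X + (1 / Suc n) *\<^sub>R i) - u X) / (1 / Suc n)) \<in> borel_measurable borel" by measurable
qed

lemma Du_eq:
  assumes i: "i \<in> Basis"
  shows "AE X in lborel. X \<in> \<Omega> \<longrightarrow> partial i u X = Du X \<bullet> i"
  using loc_lip_AE_dir_diff[OF u_loc_lip open_strip, of i]
proof eventually_elim
  case (elim X)
  show ?case
  proof
    assume "X \<in> \<Omega>"
    then have "(\<lambda>n. (u (X + (1 / Suc n) *\<^sub>R i) - u X) / (1 / Suc n)) \<longlonglongrightarrow> partial i u X" using elim partial_lim by blast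
    then have "lim (\<lambda>n. (u (X + (1 / Suc n) *\<^sub>R i) - u X) / (1 / Suc n)) = partial i u X" by (rule limI)
    then show "partial i u X = Du X \<bullet> i" unfolding Du_def using i by (simp add: inner_sum_left_Basis)
  qed
qed

lemma Du_bound:
  "AE X in lborel. X \<in> \<Omega> \<longrightarrow> norm (Du X) \<le> real DIM('a \<times> real) * (slope_const TYPE('a) * (1 + L) * H X)"
proof -
  have "AE X in lborel. \<forall>i\<in>Basis. X \<in> \<Omega> \<longrightarrow> dir_diff i u X \<and> partial i u X = Du X \<bullet> i"
  proof (subst AE_finite_all)
    show "\<forall>i\<in>Basis. AE X in lborel. X \<in> \<Omega> \<longrightarrow> dir_diff i u X \<and> partial i u X = Du X \<bullet> i"
    proof
      fix i :: "'a \<times> real" assume "i \<in> Basis"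
      from loc_lip_AE_dir_diff[OF u_loc_lip open_strip, of i] Du_eq[OF this]
      show "AE X in lborel. X \<in> \<Omega> \<longrightarrow> dir_diff i u X \<and> partial i u X = Du X \<bullet> i" by eventually_elim blast
    qed
  qed simp
  then show ?thesis
  proof eventually_elim
    case (elim X)
    show ?case
    proof
      assume X: "X \<in> \<Omega>"
      obtain r0 where r0: "r0 > 0" "\<And>Y. norm (Y - X) < r0 \<Longrightarrow> \<bar>u Y - u X\<bar> \<le> slope_const TYPE('a) * (1 + L) * H X * norm (Y - X)"
        using slope_bound[OF X] by blast
      have *: "\<bar>Du X \<bullet> i\<bar> \<le> slope_const TYPE('a) * (1 + L) * H X" if i: "i \<in> Basis" for i
      proof -
        have "\<bar>partial i u X\<bar> \<le> slope_const TYPE('a) * (1 + L) * H X"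
        proof (rule partial_bound)
          show "dir_diff i u X" using elim X i by blast
          show "eventually (\<lambda>t. \<bar>u (X + t *\<^sub>R i) - u X\<bar> \<le> slope_const TYPE('a) * (1 + L) * H X * \<bar>t\<bar>) (at 0)"
            unfolding eventually_at
          proof (intro exI[of _ r0] conjI ballI impI)
            fix t :: real assume "t \<noteq> 0 \<and> dist t 0 < r0"
            then show "\<bar>u (X + t *\<^sub>R i) - u X\<bar> \<le> slope_const TYPE('a) * (1 + L) * H X * \<bar>t\<bar>"
              using r0(2)[of "X + t *\<^sub>R i"] i by simp
          qed (fact r0)
        qed
        then show ?thesis using elim X i by simp
      qed
      \<comment> \<open>The passage from coordinates to the norm is the source of the factor
        \<open>DIM('a \<times> real)\<close>.\<close>
      have "norm (Du X) \<le> (\<Sum>i\<in>Basis. \<bar>Du X \<bullet> i\<bar>)" by (rule norm_le_l1)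
      also have "\<dots> \<le> (\<Sum>i\<in>(Basis :: ('a \<times> real) set). slope_const TYPE('a) * (1 + L) * H X)" using * by (rule sum_mono)
      finally show "norm (Du X) \<le> real DIM('a \<times> real) * (slope_const TYPE('a) * (1 + L) * H X)" by simp
    qed
  qed
qed

end

section \<open>Energy estimate\<close>

text \<open>The integral of \<open>screened_seminorm_pow\<close> with respect to
  \<open>lborel\<close> and on an arbitrary Euclidean space, the form in which Tonelli's theorem is
  applied to Borel data.\<close>

definition screened_energy :: "real \<Rightarrow> ('a::euclidean_space \<Rightarrow> real) \<Rightarrow> ('a \<Rightarrow> real) \<Rightarrow> ennreal" where
  "screened_energy p s f = (\<integral>\<^sup>+x. (\<integral>\<^sup>+h. ennreal (\<bar>f (x + h) - f x\<bar> powr p / norm h powr (p + real DIM('a) - 1)) * indicator (ball 0 (s x)) h \<partial>lborel) \<partial>lborel)"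

lemma nn_integral_powr_tail:
  fixes r q v :: real
  assumes "r > 0" "q > 0" "v > 0"
  shows "(\<integral>\<^sup>+e. ennreal (e powr (- (q + 1)) / v) * indicator {r..} e \<partial>lborel) = ennreal (r powr (- q) / (v * q))"
proof -
  have "(\<integral>\<^sup>+e. ennreal (e powr (- (q + 1)) / v) * indicator {r..} e \<partial>lborel) = ennreal (0 - (- (r powr (- q) / (v * q))))"
  proof (rule nn_integral_FTC_atLeast[where F = "\<lambda>e. - (e powr (- q) / (v * q))"])
    show "((\<lambda>e. - (e powr (- q) / (v * q))) has_real_derivative x powr (- (q + 1)) / v) (at x)" if "r \<le> x" for x
    proof -
      have "x > 0" using that assms by simp
      have "((\<lambda>e. e powr (- q)) has_real_derivative (- q) * x powr (- q - 1)) (at x)"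
        using \<open>x > 0\<close> by (rule has_real_derivative_powr)
      then have "((\<lambda>e. - (e powr (- q) / (v * q))) has_real_derivative - ((- q) * x powr (- q - 1) / (v * q))) (at x)"
        by (intro DERIV_minus DERIV_cdivide)
      moreover have "- ((- q) * x powr (- q - 1) / (v * q)) = x powr (- (q + 1)) / v"
        using assms by simp
      ultimately show ?thesis by simp
    qed
    show "((\<lambda>e. - (e powr (- q) / (v * q))) \<longlongrightarrow> 0) at_top"
    proof -
      have "((\<lambda>e. e powr (- q)) \<longlongrightarrow> 0) at_top" using assms by (intro tendsto_neg_powr filterlim_ident) auto
      then have "((\<lambda>e. - (e powr (- q) / (v * q))) \<longlongrightarrow> - (0 / (v * q))) at_top" using assms by (intro tendsto_intros) auto
      then show ?thesis by simp
    qed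
  qed (use assms in auto)
  then show ?thesis by simp
qed

text \<open>Jensen's inequality, a translation to the origin, and the scaling of the volume of the
  ball, which adds \<open>DIM('a)\<close> to the exponent \<open>p\<close> of
  \<open>e\<close>.\<close>

lemma mean_osc_powr_le:
  fixes f :: "'a::euclidean_space \<Rightarrow> real"
  assumes f: "loc_integrable f" and e: "e > 0" and p: "p > 1"
  shows "ennreal ((mean_osc f x e / e) powr p) \<le> ennreal (e powr (- (real DIM('a) + p)) / ball_vol TYPE('a) 1) *
    (\<integral>\<^sup>+h. indicator (ball 0 e) h * ennreal (\<bar>f (x + h) - f x\<bar> powr p) \<partial>lborel)"
proof -
  have [measurable]: "f \<in> borel_measurable borel" using f by (rule loc_integrable_borel)
  let ?V = "ball_vol TYPE('a) e"
  have V: "?V > 0" using e by (rule ball_vol_pos)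
  have "ennreal (mean_osc f x e powr p) \<le> ennreal (1 / ?V) * (\<integral>\<^sup>+z. indicator (ball x e) z * ennreal (\<bar>f z - f x\<bar> powr p) \<partial>lborel)"
    unfolding mean_osc_def
    by (rule jensen_powr) (use e V p mean_osc_integrable[OF f] emeasure_ball_eq_ball_vol[of e x] in auto)
  also have "(\<integral>\<^sup>+z. indicator (ball x e) z * ennreal (\<bar>f z - f x\<bar> powr p) \<partial>lborel) = (\<integral>\<^sup>+h. indicator (ball 0 e) h * ennreal (\<bar>f (x + h) - f x\<bar> powr p) \<partial>lborel)"
  proof -
    have "(\<integral>\<^sup>+z. indicator (ball x e) z * ennreal (\<bar>f z - f x\<bar> powr p) \<partial>lborel) = (\<integral>\<^sup>+z. indicator (ball x e) z * ennreal (\<bar>f z - f x\<bar> powr p) \<partial>distr lborel borel ((+) x))"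
      by (simp only: lborel_distr_plus)
    also have "\<dots> = (\<integral>\<^sup>+h. indicator (ball x e) (x + h) * ennreal (\<bar>f (x + h) - f x\<bar> powr p) \<partial>lborel)"
    proof (rule nn_integral_distr)
      have [measurable]: "ball x e \<in> sets borel" by simp
      show "(\<lambda>z. indicator (ball x e) z * ennreal (\<bar>f z - f x\<bar> powr p)) \<in> borel_measurable (distr lborel borel ((+) x))"
        unfolding measurable_distr_eq1 by measurable
    qed measurable
    also have "\<dots> = (\<integral>\<^sup>+h. indicator (ball 0 e) h * ennreal (\<bar>f (x + h) - f x\<bar> powr p) \<partial>lborel)"
      by (intro nn_integral_cong) (auto simp: indicator_def dist_norm)
    finally show ?thesis .
  qed
  finally have 1: "ennreal (mean_osc f x e powr p) \<le> ennreal (1 / ?V) * (\<integral>\<^sup>+h. indicator (ball 0 e) h * ennreal (\<bar>f (x + h) - f x\<bar> powr p) \<partial>lborel)" .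
  have "(mean_osc f x e / e) powr p = e powr (- p) * mean_osc f x e powr p"
  proof -
    have "(mean_osc f x e / e) powr p = mean_osc f x e powr p / e powr p" by (rule powr_divide)
    then show ?thesis by (simp add: powr_minus divide_inverse mult.commute)
  qed
  then have "ennreal ((mean_osc f x e / e) powr p) = ennreal (e powr (- p)) * ennreal (mean_osc f x e powr p)" by (simp add: ennreal_mult)
  also have "\<dots> \<le> ennreal (e powr (- p)) * (ennreal (1 / ?V) * (\<integral>\<^sup>+h. indicator (ball 0 e) h * ennreal (\<bar>f (x + h) - f x\<bar> powr p) \<partial>lborel))"
    using 1 by (rule mult_left_mono) simp
  also have "\<dots> = ennreal (e powr (- p) * (1 / ?V)) * (\<integral>\<^sup>+h. indicator (ball 0 e) h * ennreal (\<bar>f (x + h) - f x\<bar> powr p) \<partial>lborel)"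
    using V by (subst ennreal_mult) (auto simp: mult.assoc)
  also have "e powr (- p) * (1 / ?V) = e powr (- (real DIM('a) + p)) / ball_vol TYPE('a) 1"
  proof -
    have "?V = e powr real DIM('a) * ball_vol TYPE('a) 1" using ball_vol_eq(2)[of e, where 'a = 'a] e by (simp add: powr_realpow)
    moreover have "e powr (- (real DIM('a) + p)) = e powr (- p) / e powr real DIM('a)" using powr_diff[of e "- p" "real DIM('a)"] by (simp only: minus_add add.commute diff_conv_add_uminus minus_add_distrib)
    ultimately show ?thesis by simp
  qed
  finally show ?thesis .
qed

text \<open>After exchanging the integrals, an increment \<open>h\<close> is seen exactly by the
  radii between \<open>norm h\<close> and \<open>R\<close>. The tail integral of
  \<open>e powr (- (q + 1))\<close> from \<open>norm h\<close> equals
  \<open>norm h powr (- q) / q\<close>, which is the kernel of the seminorm, and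
  \<open>norm h < R\<close> is the screening.\<close>

lemma mean_osc_energy_line:
  fixes f :: "'a::euclidean_space \<Rightarrow> real"
  assumes f: "loc_integrable f" and p: "p > 1" and R: "R > 0"
  defines "q \<equiv> real DIM('a) + p - 1"
  shows "(\<integral>\<^sup>+e. indicator {0<..<R} e * ennreal ((mean_osc f x e / e) powr p) \<partial>lborel)
    \<le> ennreal (1 / (ball_vol TYPE('a) 1 * q)) * (\<integral>\<^sup>+h. ennreal (\<bar>f (x + h) - f x\<bar> powr p / norm h powr q) * indicator (ball 0 R) h \<partial>lborel)"
proof -
  have [measurable]: "f \<in> borel_measurable borel" using f by (rule loc_integrable_borel)
  let ?v = "ball_vol TYPE('a) 1"
  have v: "?v > 0" by (rule ball_vol_pos) simp
  have q: "q > 0" using p unfolding q_def by simp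
  have [measurable]: "ball (0::'a) R \<in> sets borel" by simp
  have "(\<integral>\<^sup>+e. indicator {0<..<R} e * ennreal ((mean_osc f x e / e) powr p) \<partial>lborel)
    \<le> (\<integral>\<^sup>+e. (\<integral>\<^sup>+h. indicator {0<..<R} e * ennreal (e powr (- (q + 1)) / ?v) * (indicator {h. norm h < e} h * ennreal (\<bar>f (x + h) - f x\<bar> powr p)) \<partial>lborel) \<partial>lborel)"
  proof (rule nn_integral_mono)
    fix e :: real
    have ball: "indicator (ball 0 e) h = (indicator {h. norm h < e} h :: ennreal)" for h :: 'a by (simp add: indicator_def)
    have m: "(\<lambda>h::'a. indicator {h. norm h < e} h * ennreal (\<bar>f (x + h) - f x\<bar> powr p)) \<in> borel_measurable lborel" by measurable
    show "indicator {0<..<R} e * ennreal ((mean_osc f x e / e) powr p) \<le>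
      (\<integral>\<^sup>+h. indicator {0<..<R} e * ennreal (e powr (- (q + 1)) / ?v) * (indicator {h. norm h < e} h * ennreal (\<bar>f (x + h) - f x\<bar> powr p)) \<partial>lborel)"
    proof (cases "e \<in> {0<..<R}")
      case True
      then have "ennreal ((mean_osc f x e / e) powr p) \<le> ennreal (e powr (- (q + 1)) / ?v) *
        (\<integral>\<^sup>+h. indicator {h. norm h < e} h * ennreal (\<bar>f (x + h) - f x\<bar> powr p) \<partial>lborel)"
        using mean_osc_powr_le[OF f _ p, of e x] by (simp add: q_def ball)
      then show ?thesis using True m by (subst nn_integral_cmult) auto
    qed simp
  qed
  also have "\<dots> = (\<integral>\<^sup>+h. (\<integral>\<^sup>+e. indicator {0<..<R} e * ennreal (e powr (- (q + 1)) / ?v) * (indicator {h. norm h < e} h * ennreal (\<bar>f (x + h) - f x\<bar> powr p)) \<partial>lborel) \<partial>lborel)"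
  proof (rule lborel_pair.Fubini')
    have "(\<lambda>(h, e). indicator {0<..<R} e * ennreal (e powr (- (q + 1)) / ?v) * ((if norm h < e then 1 else 0) * ennreal (\<bar>f (x + h) - f x\<bar> powr p)))
      \<in> borel_measurable (lborel \<Otimes>\<^sub>M lborel)" by measurable
    moreover have "indicator {h. norm h < e} h = (if norm h < e then 1 else 0 :: ennreal)" for h :: 'a and e by (simp add: indicator_def)
    ultimately show "(\<lambda>(h, e). indicator {0<..<R} e * ennreal (e powr (- (q + 1)) / ?v) * (indicator {h. norm h < e} h * ennreal (\<bar>f (x + h) - f x\<bar> powr p)))
      \<in> borel_measurable (lborel \<Otimes>\<^sub>M lborel)" by (simp only:)
  qed
  also have "\<dots> \<le> (\<integral>\<^sup>+h. ennreal (1 / (?v * q)) * (ennreal (\<bar>f (x + h) - f x\<bar> powr p / norm h powr q) * indicator (ball 0 R) h) \<partial>lborel)"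
  proof (rule nn_integral_mono_AE)
    \<comment> \<open>At \<open>h = 0\<close> the tail integral diverges.\<close>
    have "AE h in lborel. h \<noteq> (0::'a)" by (rule AE_lborel_singleton)
    then show "AE h in lborel. (\<integral>\<^sup>+e. indicator {0<..<R} e * ennreal (e powr (- (q + 1)) / ?v) * (indicator {h. norm h < e} h * ennreal (\<bar>f (x + h) - f x\<bar> powr p)) \<partial>lborel)
      \<le> ennreal (1 / (?v * q)) * (ennreal (\<bar>f (x + h) - f x\<bar> powr p / norm h powr q) * indicator (ball 0 R) h)"
    proof eventually_elim
      case (elim h)
      then have h: "norm h > 0" by simp
      let ?\<Delta> = "\<bar>f (x + h) - f x\<bar> powr p"
      have "(\<integral>\<^sup>+e. indicator {0<..<R} e * ennreal (e powr (- (q + 1)) / ?v) * (indicator {h. norm h < e} h * ennreal ?\<Delta>) \<partial>lborel)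
        \<le> (\<integral>\<^sup>+e. (ennreal (e powr (- (q + 1)) / ?v) * indicator {norm h..} e) * (ennreal ?\<Delta> * indicator (ball 0 R) h) \<partial>lborel)"
        by (rule nn_integral_mono) (auto simp: indicator_def)
      also have "\<dots> = (\<integral>\<^sup>+e. ennreal (e powr (- (q + 1)) / ?v) * indicator {norm h..} e \<partial>lborel) * (ennreal ?\<Delta> * indicator (ball 0 R) h)"
        by (rule nn_integral_multc) measurable
      also have "\<dots> = ennreal (norm h powr (- q) / (?v * q)) * (ennreal ?\<Delta> * indicator (ball 0 R) h)"
        by (subst nn_integral_powr_tail[OF h q v]) simp
      also have "\<dots> = ennreal (norm h powr (- q) / (?v * q) * ?\<Delta>) * indicator (ball 0 R) h"
        using v q by (subst ennreal_mult) (auto simp: mult.assoc)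
      also have "norm h powr (- q) / (?v * q) * ?\<Delta> = 1 / (?v * q) * (?\<Delta> / norm h powr q)"
        using h by (simp add: powr_minus field_simps)
      also have "ennreal (1 / (?v * q) * (?\<Delta> / norm h powr q)) * indicator (ball 0 R) h = ennreal (1 / (?v * q)) * (ennreal (?\<Delta> / norm h powr q) * indicator (ball 0 R) h)"
        using v q by (subst ennreal_mult) (auto simp: mult.assoc)
      finally show ?case .
    qed
  qed
  also have "\<dots> = ennreal (1 / (?v * q)) * (\<integral>\<^sup>+h. ennreal (\<bar>f (x + h) - f x\<bar> powr p / norm h powr q) * indicator (ball 0 R) h \<partial>lborel)"
    by (rule nn_integral_cmult) measurable
  finally show ?thesis .
qed

text \<open>On a vertical line the substitution \<open>e = a * \<tau>\<close> maps the segment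
  inside the strip onto \<open>{0<..<R}\<close> with \<open>R = a * (\<eta>p x - \<eta>m x)\<close>,
  for either depth, and costs a factor \<open>1 / a\<close>.\<close>

lemma mean_osc_energy:
  fixes f \<eta>m \<eta>p :: "'a::euclidean_space \<Rightarrow> real"
  assumes f: "loc_integrable f" and p: "p > 1" and a: "a > 0" and gap: "\<And>y. \<eta>m y < \<eta>p y"
    and [measurable]: "\<eta>m \<in> borel_measurable borel" "\<eta>p \<in> borel_measurable borel" and S [measurable]: "strip \<eta>m \<eta>p \<in> sets borel"
    and \<tau>: "\<tau> = (\<lambda>X. snd X - \<eta>m (fst X)) \<or> \<tau> = (\<lambda>X. \<eta>p (fst X) - snd X)"
  shows "(\<integral>\<^sup>+X. indicator (strip \<eta>m \<eta>p) X * ennreal ((mean_osc f (fst X) (a * \<tau> X) / (a * \<tau> X)) powr p) \<partial>lborel)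
    \<le> ennreal (1 / (a * (ball_vol TYPE('a) 1 * (real DIM('a) + p - 1)))) * screened_energy p (\<lambda>x. a * (\<eta>p x - \<eta>m x)) f"
proof -
  have fb [measurable]: "f \<in> borel_measurable borel" using f by (rule loc_integrable_borel)
  have [measurable]: "\<tau> \<in> borel_measurable borel" using \<tau> by auto
  have om [measurable]: "(\<lambda>X. mean_osc f (fst X) (a * \<tau> X)) \<in> borel_measurable borel"
  proof -
    have "(\<lambda>X. (fst X, a * \<tau> X)) \<in> borel_measurable (borel :: ('a \<times> real) measure)" by measurable
    from measurable_compose[OF this mean_osc_borel[OF fb]] show ?thesis by simp
  qed
  have ob: "(\<lambda>e. mean_osc f x e) \<in> borel_measurable borel" for x
  proof -
    have "(\<lambda>e. (x, e)) \<in> borel_measurable borel" by (intro borel_measurable_continuous_onI continuous_intros)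
    from measurable_compose[OF this mean_osc_borel[OF fb]] show ?thesis by simp
  qed
  let ?c = "ball_vol TYPE('a) 1 * (real DIM('a) + p - 1)"
  have c: "?c > 0" using ball_vol_pos[of 1, where 'a='a] p by simp
  have "(\<integral>\<^sup>+X. indicator (strip \<eta>m \<eta>p) X * ennreal ((mean_osc f (fst X) (a * \<tau> X) / (a * \<tau> X)) powr p) \<partial>lborel)
    = (\<integral>\<^sup>+x. (\<integral>\<^sup>+t. indicator (strip \<eta>m \<eta>p) (x, t) * ennreal ((mean_osc f x (a * \<tau> (x, t)) / (a * \<tau> (x, t))) powr p) \<partial>lborel) \<partial>lborel)"
    by (subst nn_integral_lborel_prod) auto
  also have "\<dots> \<le> (\<integral>\<^sup>+x. ennreal (1 / (a * ?c)) * (\<integral>\<^sup>+h. ennreal (\<bar>f (x + h) - f x\<bar> powr p / norm h powr (p + real DIM('a) - 1)) * indicator (ball 0 (a * (\<eta>p x - \<eta>m x))) h \<partial>lborel) \<partial>lborel)"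
  proof (rule nn_integral_mono)
    fix x :: 'a
    define R where "R = a * (\<eta>p x - \<eta>m x)"
    have R: "R > 0" using a gap[of x] unfolding R_def by simp
    define g where "g = (\<lambda>e. indicator {0<..<R} e * ennreal ((mean_osc f x e / e) powr p))"
    have [measurable]: "g \<in> borel_measurable borel" unfolding g_def using ob[of x] by measurable
    have geq: "indicator (strip \<eta>m \<eta>p) (x, t) * ennreal ((mean_osc f x (a * \<tau> (x, t)) / (a * \<tau> (x, t))) powr p) = g (a * \<tau> (x, t))" for t
    proof -
      have "(x, t) \<in> strip \<eta>m \<eta>p \<longleftrightarrow> a * \<tau> (x, t) \<in> {0<..<R}"
        using \<tau> a unfolding R_def strip_def by (auto simp: zero_less_mult_iff)
      then show ?thesis unfolding g_def by (simp add: indicator_def)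
    qed
    obtain c0 s where cs: "s = 1 \<or> s = (-1::real)" "\<And>t. \<tau> (x, t) = s * (t - c0)"
    proof (rule disjE[OF \<tau>])
      assume "\<tau> = (\<lambda>X. snd X - \<eta>m (fst X))" then show thesis using that[of 1 "\<eta>m x"] by simp
    next
      assume "\<tau> = (\<lambda>X. \<eta>p (fst X) - snd X)" then show thesis using that[of "-1" "\<eta>p x"] by simp
    qed
    have "(\<integral>\<^sup>+t. g (a * \<tau> (x, t)) \<partial>lborel) = \<bar>s / a\<bar> * (\<integral>\<^sup>+e. g (a * \<tau> (x, c0 + (s / a) * e)) \<partial>lborel)"
      using cs a by (intro nn_integral_real_affine) auto
    also have "\<bar>s / a\<bar> = 1 / a" using cs(1) a by (auto simp: abs_divide)
    also have "(\<integral>\<^sup>+e. g (a * \<tau> (x, c0 + (s / a) * e)) \<partial>lborel) = (\<integral>\<^sup>+e. g e \<partial>lborel)"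
    proof (rule nn_integral_cong)
      fix e :: real
      have "a * \<tau> (x, c0 + (s / a) * e) = e" unfolding cs(2) using cs(1) a by auto
      then show "g (a * \<tau> (x, c0 + (s / a) * e)) = g e" by simp
    qed
    also have "(\<integral>\<^sup>+e. g e \<partial>lborel) \<le> ennreal (1 / ?c) * (\<integral>\<^sup>+h. ennreal (\<bar>f (x + h) - f x\<bar> powr p / norm h powr (real DIM('a) + p - 1)) * indicator (ball 0 R) h \<partial>lborel)"
      unfolding g_def by (rule mean_osc_energy_line[OF f p R])
    finally have "(\<integral>\<^sup>+t. g (a * \<tau> (x, t)) \<partial>lborel) \<le> ennreal (1 / a) * (ennreal (1 / ?c) * (\<integral>\<^sup>+h. ennreal (\<bar>f (x + h) - f x\<bar> powr p / norm h powr (real DIM('a) + p - 1)) * indicator (ball 0 R) h \<partial>lborel))"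
      by (simp add: mult_left_mono)
    also have "\<dots> = ennreal (1 / (a * ?c)) * (\<integral>\<^sup>+h. ennreal (\<bar>f (x + h) - f x\<bar> powr p / norm h powr (p + real DIM('a) - 1)) * indicator (ball 0 R) h \<partial>lborel)"
      using a c by (simp add: ennreal_mult'[symmetric] mult.assoc[symmetric] add.commute)
    finally show "(\<integral>\<^sup>+t. indicator (strip \<eta>m \<eta>p) (x, t) * ennreal ((mean_osc f x (a * \<tau> (x, t)) / (a * \<tau> (x, t))) powr p) \<partial>lborel)
      \<le> ennreal (1 / (a * ?c)) * (\<integral>\<^sup>+h. ennreal (\<bar>f (x + h) - f x\<bar> powr p / norm h powr (p + real DIM('a) - 1)) * indicator (ball 0 (a * (\<eta>p x - \<eta>m x))) h \<partial>lborel)"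
      unfolding geq R_def .
  qed
  also have "\<dots> = ennreal (1 / (a * ?c)) * screened_energy p (\<lambda>x. a * (\<eta>p x - \<eta>m x)) f"
    unfolding screened_energy_def
  proof (rule nn_integral_cmult)
    have "(\<lambda>x. \<integral>\<^sup>+h. ennreal (\<bar>f (x + h) - f x\<bar> powr p / norm h powr (p + real DIM('a) - 1)) * (if norm h < a * (\<eta>p x - \<eta>m x) then 1 else 0) \<partial>lborel) \<in> borel_measurable lborel"
      by measurable
    moreover have "indicator (ball 0 e) h = (if norm h < e then 1 else 0 :: ennreal)" for h :: 'a and e by (simp add: indicator_def)
    ultimately show "(\<lambda>x. \<integral>\<^sup>+h. ennreal (\<bar>f (x + h) - f x\<bar> powr p / norm h powr (p + real DIM('a) - 1)) * indicator (ball 0 (a * (\<eta>p x - \<eta>m x))) h \<partial>lborel) \<in> borel_measurable lborel"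
      by (simp only:)
  qed
  finally show ?thesis .
qed

text \<open>The integrand is constant along each vertical segment. Its length \<open>d\<close> turns
  the weight \<open>d powr (- p)\<close> into \<open>d powr (- (p - 1))\<close>.\<close>

lemma gap_energy:
  fixes fm fp \<eta>m \<eta>p :: "'a::euclidean_space \<Rightarrow> real"
  assumes [measurable]: "fm \<in> borel_measurable borel" "fp \<in> borel_measurable borel" "\<eta>m \<in> borel_measurable borel" "\<eta>p \<in> borel_measurable borel"
      "strip \<eta>m \<eta>p \<in> sets borel" and gap: "\<And>y. \<eta>m y < \<eta>p y"
  shows "(\<integral>\<^sup>+X. indicator (strip \<eta>m \<eta>p) X * ennreal ((\<bar>fp (fst X) - fm (fst X)\<bar> / (\<eta>p (fst X) - \<eta>m (fst X))) powr p) \<partial>lborel)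
    = weighted_gap p \<eta>m \<eta>p fm fp"
proof -
  have "(\<integral>\<^sup>+X. indicator (strip \<eta>m \<eta>p) X * ennreal ((\<bar>fp (fst X) - fm (fst X)\<bar> / (\<eta>p (fst X) - \<eta>m (fst X))) powr p) \<partial>lborel)
    = (\<integral>\<^sup>+x. (\<integral>\<^sup>+t. indicator (strip \<eta>m \<eta>p) (x, t) * ennreal ((\<bar>fp x - fm x\<bar> / (\<eta>p x - \<eta>m x)) powr p) \<partial>lborel) \<partial>lborel)"
    by (subst nn_integral_lborel_prod) auto
  also have "\<dots> = (\<integral>\<^sup>+x. ennreal (\<bar>fp x - fm x\<bar> powr p / (\<eta>p x - \<eta>m x) powr (p - 1)) \<partial>lborel)"
  proof (rule nn_integral_cong)
    fix x :: 'a
    let ?d = "\<eta>p x - \<eta>m x"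
    have d: "?d > 0" using gap[of x] by simp
    have "(\<integral>\<^sup>+t. indicator (strip \<eta>m \<eta>p) (x, t) * ennreal ((\<bar>fp x - fm x\<bar> / ?d) powr p) \<partial>lborel)
      = (\<integral>\<^sup>+t. ennreal ((\<bar>fp x - fm x\<bar> / ?d) powr p) * indicator {\<eta>m x<..<\<eta>p x} t \<partial>lborel)"
      by (intro nn_integral_cong) (auto simp: indicator_def strip_def)
    also have "\<dots> = ennreal ((\<bar>fp x - fm x\<bar> / ?d) powr p) * ennreal ?d"
      using gap[of x] by (subst nn_integral_cmult_indicator) auto
    also have "\<dots> = ennreal ((\<bar>fp x - fm x\<bar> / ?d) powr p * ?d)" using d by (simp add: ennreal_mult)
    also have "(\<bar>fp x - fm x\<bar> / ?d) powr p * ?d = \<bar>fp x - fm x\<bar> powr p / ?d powr (p - 1)"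
      using d by (simp add: powr_divide powr_diff)
    finally show "(\<integral>\<^sup>+t. indicator (strip \<eta>m \<eta>p) (x, t) * ennreal ((\<bar>fp x - fm x\<bar> / ?d) powr p) \<partial>lborel) = ennreal (\<bar>fp x - fm x\<bar> powr p / ?d powr (p - 1))" .
  qed
  finally show ?thesis by (simp add: weighted_gap_def nn_integral_completion)
qed

lemma powr_sum3_le:
  fixes x y z p :: real
  assumes "x \<ge> 0" "y \<ge> 0" "z \<ge> 0" "p > 0"
  shows "(x + y + z) powr p \<le> 3 powr p * (x powr p + y powr p + z powr p)"
proof -
  define m where "m = max x (max y z)"
  have m: "x + y + z \<le> 3 * m" "m \<ge> 0" "m powr p \<le> x powr p + y powr p + z powr p"
    using assms unfolding m_def by (auto simp: max_def)
  have "(x + y + z) powr p \<le> (3 * m) powr p" using assms m by (intro powr_mono2) auto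
  also have "\<dots> = 3 powr p * m powr p" using m by (simp add: powr_mult)
  also have "\<dots> \<le> 3 powr p * (x powr p + y powr p + z powr p)" using m by (intro mult_left_mono) auto
  finally show ?thesis .
qed

text \<open>\<open>3 powr p\<close> comes from splitting the sum of three terms in
  \<open>slope_control\<close>. The bracket dominates both the factor 1 of the gap term and the
  factor of \<open>mean_osc_energy\<close>.\<close>

definition energy_const :: "'a::euclidean_space itself \<Rightarrow> real \<Rightarrow> real \<Rightarrow> real" where
  "energy_const _ a p = 3 powr p * (1 + 1 / (a * (ball_vol TYPE('a) 1 * (real DIM('a) + p - 1))))"

context strip_data
begin

lemma H_energy:
  "(\<integral>\<^sup>+X. indicator \<Omega> X * ennreal (H X powr p) \<partial>lborel) \<le> ennreal (energy_const TYPE('a) a p) *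
    (weighted_gap p \<eta>m \<eta>p fm fp + screened_energy p (\<lambda>x. a * (\<eta>p x - \<eta>m x)) fm + screened_energy p (\<lambda>x. a * (\<eta>p x - \<eta>m x)) fp)"
proof -
  let ?k = "1 / (a * (ball_vol TYPE('a) 1 * (real DIM('a) + p - 1)))"
  have k0: "?k \<ge> 0" using a p1 ball_vol_pos[of 1, where 'a='a] by simp
  define A where "A = (\<lambda>X::'a \<times> real. (\<bar>fp (fst X) - fm (fst X)\<bar> / (\<eta>p (fst X) - \<eta>m (fst X))) powr p)"
  define B where "B = (\<lambda>X::'a \<times> real. (mean_osc fm (fst X) (a * (snd X - \<eta>m (fst X))) / (a * (snd X - \<eta>m (fst X)))) powr p)"
  define C where "C = (\<lambda>X::'a \<times> real. (mean_osc fp (fst X) (a * (\<eta>p (fst X) - snd X)) / (a * (\<eta>p (fst X) - snd X))) powr p)"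
  have om: "(\<lambda>X. mean_osc f (fst X) (a * \<tau> X)) \<in> borel_measurable borel" if "f \<in> borel_measurable borel" "\<tau> \<in> borel_measurable borel" for f and \<tau> :: "'a \<times> real \<Rightarrow> real"
  proof -
    have [measurable]: "\<tau> \<in> borel_measurable borel" by fact
    have "(\<lambda>X. (fst X, a * \<tau> X)) \<in> borel_measurable (borel :: ('a \<times> real) measure)" by measurable
    from measurable_compose[OF this mean_osc_borel[OF that(1)]] show ?thesis by simp
  qed
  have [measurable]: "(\<lambda>X. mean_osc fm (fst X) (a * (snd X - \<eta>m (fst X)))) \<in> borel_measurable borel"
    "(\<lambda>X. mean_osc fp (fst X) (a * (\<eta>p (fst X) - snd X))) \<in> borel_measurable borel"
    by (rule om; measurable)+
  have [measurable]: "A \<in> borel_measurable borel" "B \<in> borel_measurable borel" "C \<in> borel_measurable borel"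
    unfolding A_def B_def C_def by measurable
  have "(\<integral>\<^sup>+X. indicator \<Omega> X * ennreal (H X powr p) \<partial>lborel) \<le>
    (\<integral>\<^sup>+X. ennreal (3 powr p) * (indicator \<Omega> X * ennreal (A X) + indicator \<Omega> X * ennreal (B X) + indicator \<Omega> X * ennreal (C X)) \<partial>lborel)"
  proof (rule nn_integral_mono)
    fix X
    show "indicator \<Omega> X * ennreal (H X powr p) \<le> ennreal (3 powr p) * (indicator \<Omega> X * ennreal (A X) + indicator \<Omega> X * ennreal (B X) + indicator \<Omega> X * ennreal (C X))"
    proof (cases "X \<in> \<Omega>")
      case True
      then have pos: "a * (snd X - \<eta>m (fst X)) > 0" "a * (\<eta>p (fst X) - snd X) > 0" using a unfolding strip_def by auto
      have "H X powr p \<le> 3 powr p * (A X + B X + C X)"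
        unfolding A_def B_def C_def slope_control_def using True pos mean_osc_nonneg[OF pos(1)] mean_osc_nonneg[OF pos(2)] gap[of "fst X"] p1
        by (simp only: if_True) (intro powr_sum3_le divide_nonneg_pos, auto)
      then have "ennreal (H X powr p) \<le> ennreal (3 powr p * (A X + B X + C X))" by (rule ennreal_leI)
      also have "\<dots> = ennreal (3 powr p) * ennreal (A X + B X + C X)" by (rule ennreal_mult) (auto simp: A_def B_def C_def)
      also have "ennreal (A X + B X + C X) = ennreal (A X) + ennreal (B X) + ennreal (C X)"
      proof -
        have "ennreal (A X + B X + C X) = ennreal (A X + B X) + ennreal (C X)" by (rule ennreal_plus) (auto simp: A_def B_def C_def)
        also have "ennreal (A X + B X) = ennreal (A X) + ennreal (B X)" by (rule ennreal_plus) (auto simp: A_def B_def)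
        finally show ?thesis .
      qed
      finally have "ennreal (H X powr p) \<le> ennreal (3 powr p) * (ennreal (A X) + ennreal (B X) + ennreal (C X))" .
      then show ?thesis using True by simp
    qed simp
  qed
  also have "\<dots> = ennreal (3 powr p) * ((\<integral>\<^sup>+X. indicator \<Omega> X * ennreal (A X) \<partial>lborel) + (\<integral>\<^sup>+X. indicator \<Omega> X * ennreal (B X) \<partial>lborel) + (\<integral>\<^sup>+X. indicator \<Omega> X * ennreal (C X) \<partial>lborel))"
    by (simp add: nn_integral_cmult nn_integral_add)
  also have "\<dots> \<le> ennreal (3 powr p) * (ennreal (1 + ?k) * weighted_gap p \<eta>m \<eta>p fm fp + ennreal (1 + ?k) * screened_energy p (\<lambda>x. a * (\<eta>p x - \<eta>m x)) fm + ennreal (1 + ?k) * screened_energy p (\<lambda>x. a * (\<eta>p x - \<eta>m x)) fp)"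
  proof (intro mult_left_mono add_mono)
    have "(\<integral>\<^sup>+X. indicator \<Omega> X * ennreal (A X) \<partial>lborel) = 1 * weighted_gap p \<eta>m \<eta>p fm fp"
      unfolding A_def mult_1 by (rule gap_energy) (auto simp: gap)
    also have "\<dots> \<le> ennreal (1 + ?k) * weighted_gap p \<eta>m \<eta>p fm fp"
      using k0 by (intro mult_right_mono) (auto simp flip: ennreal_1 intro: ennreal_leI)
    finally show "(\<integral>\<^sup>+X. indicator \<Omega> X * ennreal (A X) \<partial>lborel) \<le> ennreal (1 + ?k) * weighted_gap p \<eta>m \<eta>p fm fp" .
    have kk: "ennreal ?k * S \<le> ennreal (1 + ?k) * S" for S by (intro mult_right_mono ennreal_leI) auto
    have "(\<integral>\<^sup>+X. indicator \<Omega> X * ennreal (B X) \<partial>lborel) \<le> ennreal ?k * screened_energy p (\<lambda>x. a * (\<eta>p x - \<eta>m x)) fm"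
      unfolding B_def
      by (rule mean_osc_energy[OF fm_li p1 a(1) gap eta_borel strip_borel, where \<tau> = "\<lambda>X. snd X - \<eta>m (fst X)"]) simp
    then show "(\<integral>\<^sup>+X. indicator \<Omega> X * ennreal (B X) \<partial>lborel) \<le> ennreal (1 + ?k) * screened_energy p (\<lambda>x. a * (\<eta>p x - \<eta>m x)) fm"
      using kk by (rule order_trans)
    have "(\<integral>\<^sup>+X. indicator \<Omega> X * ennreal (C X) \<partial>lborel) \<le> ennreal ?k * screened_energy p (\<lambda>x. a * (\<eta>p x - \<eta>m x)) fp"
      unfolding C_def
      by (rule mean_osc_energy[OF fp_li p1 a(1) gap eta_borel strip_borel, where \<tau> = "\<lambda>X. \<eta>p (fst X) - snd X"]) simp
    then show "(\<integral>\<^sup>+X. indicator \<Omega> X * ennreal (C X) \<partial>lborel) \<le> ennreal (1 + ?k) * screened_energy p (\<lambda>x. a * (\<eta>p x - \<eta>m x)) fp"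
      using kk by (rule order_trans)
  qed simp
  also have "\<dots> = ennreal (energy_const TYPE('a) a p) * (weighted_gap p \<eta>m \<eta>p fm fp + screened_energy p (\<lambda>x. a * (\<eta>p x - \<eta>m x)) fm + screened_energy p (\<lambda>x. a * (\<eta>p x - \<eta>m x)) fp)"
  proof -
    have "ennreal (energy_const TYPE('a) a p) = ennreal (3 powr p) * ennreal (1 + ?k)"
      unfolding energy_const_def using k0 by (intro ennreal_mult) auto
    then show ?thesis by (simp only: distrib_left mult.assoc)
  qed
  finally show ?thesis .
qed

end

section \<open>Dependence on the boundary data\<close>

text \<open>The dimension and \<open>slope_const\<close> come from \<open>Du_bound\<close>. The
  factor \<open>1 + tent_ratio\<close> enters because \<open>u_near\<close> holds with this multiple
  of the controlling function, and one function has to serve for the gradient and for the approach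
  to the data.\<close>

definition extension_const :: "'a::euclidean_space itself \<Rightarrow> real \<Rightarrow> real \<Rightarrow> real" where
  "extension_const _ a p = (real DIM('a \<times> real) * slope_const TYPE('a) * (1 + tent_ratio TYPE('a))) powr p * energy_const TYPE('a) a p"

context strip_data
begin

lemma scaled_energy:
  "(\<integral>\<^sup>+X. indicator \<Omega> X * ennreal (((1 + tent_ratio TYPE('a)) * H X) powr p) \<partial>lborel) =
    ennreal ((1 + tent_ratio TYPE('a)) powr p) * (\<integral>\<^sup>+X. indicator \<Omega> X * ennreal (H X powr p) \<partial>lborel)"
proof -
  have k: "tent_ratio TYPE('a) \<ge> 1" by (rule tent_ratio_ge_1)
  have "(\<integral>\<^sup>+X. indicator \<Omega> X * ennreal (((1 + tent_ratio TYPE('a)) * H X) powr p) \<partial>lborel) =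
    (\<integral>\<^sup>+X. ennreal ((1 + tent_ratio TYPE('a)) powr p) * (indicator \<Omega> X * ennreal (H X powr p)) \<partial>lborel)"
  proof (rule nn_integral_cong)
    fix X
    have "((1 + tent_ratio TYPE('a)) * H X) powr p = (1 + tent_ratio TYPE('a)) powr p * H X powr p"
      by (rule powr_mult)
    then show "indicator \<Omega> X * ennreal (((1 + tent_ratio TYPE('a)) * H X) powr p) = ennreal ((1 + tent_ratio TYPE('a)) powr p) * (indicator \<Omega> X * ennreal (H X powr p))"
      by (simp add: ennreal_mult mult_ac)
  qed
  also have "\<dots> = ennreal ((1 + tent_ratio TYPE('a)) powr p) * (\<integral>\<^sup>+X. indicator \<Omega> X * ennreal (H X powr p) \<partial>lborel)"
    by (rule nn_integral_cmult) measurable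
  finally show ?thesis .
qed

lemma strip_function_extension:
  assumes fin: "(\<integral>\<^sup>+X. indicator \<Omega> X * ennreal (H X powr p) \<partial>lborel) < \<infinity>"
  shows "strip_function \<eta>m \<eta>p L u (\<lambda>X. (1 + tent_ratio TYPE('a)) * H X) fm fp Du (real DIM('a \<times> real) * (slope_const TYPE('a) * (1 + L))) p"
proof
  let ?k = "tent_ratio TYPE('a)"
  have k: "?k \<ge> 1" by (rule tent_ratio_ge_1)
  have sc: "slope_const TYPE('a) \<ge> 0" using k unfolding slope_const_def by simp
  show "loc_lip \<Omega> u" by (rule u_loc_lip)
  show "u \<in> borel_measurable borel" "fm \<in> borel_measurable borel" "fp \<in> borel_measurable borel" "Du \<in> borel_measurable borel"
    by (rule u_borel f_borel Du_borel)+
  show "(\<lambda>X. (1 + ?k) * H X) \<in> borel_measurable borel" by measurable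
  show "0 \<le> (1 + ?k) * H X" for X using k H_nonneg by simp
  show "AE X in lborel. X \<in> \<Omega> \<longrightarrow> partial i u X = Du X \<bullet> i" if "i \<in> Basis" for i by (rule Du_eq[OF that])
  show "AE X in lborel. X \<in> \<Omega> \<longrightarrow> norm (Du X) \<le> real DIM('a \<times> real) * (slope_const TYPE('a) * (1 + L)) * ((1 + ?k) * H X)"
    using Du_bound
  proof eventually_elim
    case (elim X)
    have "1 * H X \<le> (1 + ?k) * H X" using k H_nonneg by (intro mult_right_mono) auto
    then have "real DIM('a \<times> real) * (slope_const TYPE('a) * (1 + L)) * H X \<le> real DIM('a \<times> real) * (slope_const TYPE('a) * (1 + L)) * ((1 + ?k) * H X)"
      using sc L0 by (intro mult_left_mono) auto
    then have le: "real DIM('a \<times> real) * (slope_const TYPE('a) * (1 + L) * H X) \<le> real DIM('a \<times> real) * (slope_const TYPE('a) * (1 + L)) * ((1 + ?k) * H X)"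
      by (simp only: mult.assoc)
    then show ?case using elim order_trans[OF _ le] by blast
  qed
  show "0 \<le> real DIM('a \<times> real) * (slope_const TYPE('a) * (1 + L))" using sc L0 by simp
  show "\<bar>u (x, t) - fm x\<bar> \<le> (t - \<eta>m x) * ((1 + ?k) * H (x, t))" if "(x, t) \<in> \<Omega>" for x t by (rule u_near(1)[OF that])
  show "\<bar>u (x, t) - fp x\<bar> \<le> (\<eta>p x - t) * ((1 + ?k) * H (x, t))" if "(x, t) \<in> \<Omega>" for x t by (rule u_near(2)[OF that])
  show "p > 1" by (rule p1)
  show "fm \<in> Lp_loc p" "fp \<in> Lp_loc p" by (rule fm_Lp fp_Lp)+
  show "(\<integral>\<^sup>+X. indicator \<Omega> X * ennreal (((1 + ?k) * H X) powr p) \<partial>lborel) < \<infinity>"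
    unfolding scaled_energy using fin by (simp add: ennreal_mult_less_top)
qed

lemma energy_bound:
  assumes fin: "(\<integral>\<^sup>+X. indicator \<Omega> X * ennreal (H X powr p) \<partial>lborel) < \<infinity>"
  shows "(\<integral>\<^sup>+x\<in>\<Omega>. ennreal (norm (Du x) powr p) \<partial>lebesgue) \<le>
    ennreal (extension_const TYPE('a) a p * (1 + L) powr p) *
      (weighted_gap p \<eta>m \<eta>p fm fp + screened_energy p (\<lambda>x. a * (\<eta>p x - \<eta>m x)) fm + screened_energy p (\<lambda>x. a * (\<eta>p x - \<eta>m x)) fp)"
proof -
  interpret F: strip_function \<eta>m \<eta>p L u "\<lambda>X. (1 + tent_ratio TYPE('a)) * H X" fm fp Du "real DIM('a \<times> real) * (slope_const TYPE('a) * (1 + L))" p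
    by (rule strip_function_extension[OF fin])
  let ?k = "tent_ratio TYPE('a)"
  let ?s = "slope_const TYPE('a)"
  let ?N = "real DIM('a \<times> real)"
  let ?R = "weighted_gap p \<eta>m \<eta>p fm fp + screened_energy p (\<lambda>x. a * (\<eta>p x - \<eta>m x)) fm + screened_energy p (\<lambda>x. a * (\<eta>p x - \<eta>m x)) fp"
  have k: "?k \<ge> 1" by (rule tent_ratio_ge_1)
  have sc: "?s \<ge> 0" using k unfolding slope_const_def by simp
  have "(\<integral>\<^sup>+x\<in>\<Omega>. ennreal (norm (Du x) powr p) \<partial>lebesgue) \<le> ennreal ((?N * (?s * (1 + L))) powr p) * (\<integral>\<^sup>+X. indicator \<Omega> X * ennreal (((1 + ?k) * H X) powr p) \<partial>lborel)"
    by (rule F.D_Lp)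
  also have "\<dots> = ennreal ((?N * (?s * (1 + L))) powr p) * (ennreal ((1 + ?k) powr p) * (\<integral>\<^sup>+X. indicator \<Omega> X * ennreal (H X powr p) \<partial>lborel))"
    unfolding scaled_energy ..
  also have "\<dots> \<le> ennreal ((?N * (?s * (1 + L))) powr p) * (ennreal ((1 + ?k) powr p) * (ennreal (energy_const TYPE('a) a p) * ?R))"
    by (intro mult_left_mono H_energy) auto
  also have "\<dots> = ennreal (extension_const TYPE('a) a p * (1 + L) powr p) * ?R"
  proof -
    have e0: "energy_const TYPE('a) a p \<ge> 0" unfolding energy_const_def using a p1 ball_vol_pos[of 1, where 'a='a] by simp
    have "extension_const TYPE('a) a p * (1 + L) powr p = (?N * (?s * (1 + L))) powr p * ((1 + ?k) powr p * energy_const TYPE('a) a p)"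
      unfolding extension_const_def using k sc L0 by (simp add: powr_mult mult_ac)
    then have "ennreal (extension_const TYPE('a) a p * (1 + L) powr p) = ennreal ((?N * (?s * (1 + L))) powr p) * (ennreal ((1 + ?k) powr p) * ennreal (energy_const TYPE('a) a p))"
      using e0 by (simp only: ennreal_mult powr_ge_zero mult_nonneg_nonneg)
    then show ?thesis by (simp only: mult.assoc)
  qed
  finally show ?thesis .
qed

end

text \<open>
  The boundary data are only Lebesgue measurable, and \<open>f \<circ> fst\<close> need not be Borel then; a Borel version
  avoids working with completions of product measures. The averages do not see the arbitrary choice
  of the version, so linearity is kept.
\<close>

definition borel_version :: "('a::euclidean_space \<Rightarrow> real) \<Rightarrow> 'a \<Rightarrow> real" where
  "borel_version f = (SOME g. g \<in> borel_measurable borel \<and> (AE x in lborel. f x = g x))"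

lemma borel_version:
  assumes "f \<in> borel_measurable lebesgue"
  shows "borel_version f \<in> borel_measurable borel" "AE x in lborel. f x = borel_version f x"
proof -
  have "\<exists>g. g \<in> borel_measurable borel \<and> (AE x in lborel. f x = g x)"
    using completion_ex_borel_measurable_real[OF assms] by auto
  from someI_ex[OF this] show "borel_version f \<in> borel_measurable borel" "AE x in lborel. f x = borel_version f x"
    unfolding borel_version_def by blast+
qed

lemma AE_lborel_shift:
  fixes x :: "'a::euclidean_space"
  assumes "AE z in lborel. P z"
  shows "AE h in lborel. P (x + h)"
proof -
  obtain N where N: "{z \<in> space lborel. \<not> P z} \<subseteq> N" "emeasure lborel N = 0" "N \<in> sets lborel"
    using assms by (rule AE_E)
  have "AE z in lborel. z \<notin> N" using N by (intro AE_not_in) auto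
  then have "AE z in distr lborel borel ((+) x). z \<notin> N" by (simp only: lborel_distr_plus)
  then have "AE h in lborel. x + h \<notin> N"
    using N(3) by (subst (asm) AE_distr_iff) auto
  then show ?thesis by eventually_elim (use N(1) in auto)
qed

lemma Lp_loc_AE_cong:
  assumes f: "f \<in> Lp_loc p" and g: "g \<in> borel_measurable borel" and eq: "AE x in lborel. f x = g x"
  shows "g \<in> Lp_loc p"
  unfolding Lp_loc_def
proof (intro CollectI conjI allI impI)
  show "g \<in> borel_measurable lebesgue" using g by (simp add: measurable_completion)
  fix K :: "'a set" assume "compact K"
  then have "(\<integral>\<^sup>+x\<in>K. ennreal (\<bar>f x\<bar> powr p) \<partial>lebesgue) < \<infinity>" using f unfolding Lp_loc_def by blast
  moreover have "(\<integral>\<^sup>+x\<in>K. ennreal (\<bar>f x\<bar> powr p) \<partial>lborel) = (\<integral>\<^sup>+x\<in>K. ennreal (\<bar>g x\<bar> powr p) \<partial>lborel)"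
    by (rule nn_integral_cong_AE, use eq in eventually_elim) simp
  ultimately show "(\<integral>\<^sup>+x\<in>K. ennreal (\<bar>g x\<bar> powr p) \<partial>lebesgue) < \<infinity>" by (simp add: nn_integral_completion)
qed

text \<open>The integrand contains \<open>f (x + h)\<close>; for fixed \<open>x\<close> the
  exceptional \<open>h\<close> form a translate of a null set, which is again null.\<close>

lemma screened_energy_AE_cong:
  fixes f g :: "real ^ 'n \<Rightarrow> real"
  assumes eq: "AE x in lborel. f x = g x"
  shows "screened_seminorm_pow p s f = screened_energy p s g"
proof -
  have "screened_seminorm_pow p s f = screened_energy p s f"
    unfolding screened_seminorm_pow_def screened_energy_def by (simp add: nn_integral_completion)
  also have "\<dots> = screened_energy p s g"
    unfolding screened_energy_def
  proof (rule nn_integral_cong_AE, use eq in eventually_elim)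
    case (elim x)
    show ?case
      by (rule nn_integral_cong_AE, use AE_lborel_shift[OF eq, of x] in eventually_elim) (simp add: elim)
  qed
  finally show ?thesis .
qed

lemma weighted_gap_AE_cong:
  assumes "AE x in lborel. fm x = gm x" "AE x in lborel. fp x = gp x"
  shows "weighted_gap p \<eta>m \<eta>p fm fp = weighted_gap p \<eta>m \<eta>p gm gp"
  unfolding weighted_gap_def nn_integral_completion
  by (rule nn_integral_cong_AE, use assms in eventually_elim) simp

section \<open>Linearity of the extension and proof of the theorem\<close>

lemma tent_avg_linear:
  assumes f: "loc_integrable f" and g: "loc_integrable g" and h: "h \<in> borel_measurable borel"
    and eq: "AE z in lborel. h z = \<alpha> * f z + \<beta> * g z" and e: "e > 0"
  shows "tent_avg h x e = \<alpha> * tent_avg f x e + \<beta> * tent_avg g x e"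
proof -
  have [measurable]: "f \<in> borel_measurable borel" "g \<in> borel_measurable borel" "h \<in> borel_measurable borel"
    using f g h by (auto intro: loc_integrable_borel)
  have "(LINT z|lborel. h z * tent x e z) = (LINT z|lborel. \<alpha> * (f z * tent x e z) + \<beta> * (g z * tent x e z))"
    by (rule integral_cong_AE, measurable, use eq in eventually_elim) (simp add: algebra_simps)
  also have "\<dots> = \<alpha> * (LINT z|lborel. f z * tent x e z) + \<beta> * (LINT z|lborel. g z * tent x e z)"
    using tent_product_integrable[OF f e] tent_product_integrable[OF g e] by (subst Bochner_Integration.integral_add) auto
  finally show ?thesis unfolding tent_avg_def by (simp add: add_divide_distrib)
qed

text \<open>A supremum of reals is informative only for sets bounded above; any Lipschitz constant
  supplies the bound on the difference quotients. Nonnegativity comes from one quotient at two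
  distinct points, 0 and a basis vector.\<close>

lemma lip_seminorm_bound:
  fixes \<eta> :: "'a::euclidean_space \<Rightarrow> real"
  assumes "\<exists>C. C-lipschitz_on UNIV \<eta>"
  shows "\<bar>\<eta> x - \<eta> y\<bar> \<le> lip_seminorm \<eta> * norm (x - y)" "lip_seminorm \<eta> \<ge> 0"
proof -
  obtain C where C: "C-lipschitz_on UNIV \<eta>" using assms by blast
  let ?Q = "\<lambda>(x, y). \<bar>\<eta> x - \<eta> y\<bar> / norm (x - y)"
  have bdd: "bdd_above (?Q ` {(x, y). x \<noteq> y})"
  proof (rule bdd_aboveI)
    fix q assume "q \<in> ?Q ` {(x, y). x \<noteq> y}"
    then obtain x y where "x \<noteq> y" "q = \<bar>\<eta> x - \<eta> y\<bar> / norm (x - y)" by auto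
    moreover have "\<bar>\<eta> x - \<eta> y\<bar> \<le> C * norm (x - y)" using lipschitz_onD[OF C, of x y] by (simp add: dist_norm)
    ultimately show "q \<le> C" by (simp add: divide_le_eq)
  qed
  have upper: "\<bar>\<eta> x - \<eta> y\<bar> / norm (x - y) \<le> lip_seminorm \<eta>" if "x \<noteq> y" for x y
    using cSUP_upper[OF _ bdd, of "(x, y)"] that unfolding lip_seminorm_def by simp
  show "\<bar>\<eta> x - \<eta> y\<bar> \<le> lip_seminorm \<eta> * norm (x - y)"
    using upper[of x y] by (cases "x = y") (auto simp: divide_le_eq)
  obtain b :: 'a where "b \<in> Basis" using nonempty_Basis by blast
  then have "b \<noteq> 0" by auto
  then show "lip_seminorm \<eta> \<ge> 0" using order_trans[OF _ upper[of b 0]] by simp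
qed

lemma boundary_data_borel_version:
  fixes fm fp :: "real ^ 'n \<Rightarrow> real"
  assumes D: "(fm, fp) \<in> boundary_data a p \<eta>m \<eta>p" and p: "p > 1"
  shows "loc_integrable (borel_version fm)" "loc_integrable (borel_version fp)" "borel_version fm \<in> Lp_loc p" "borel_version fp \<in> Lp_loc p"
    "AE x in lborel. fm x = borel_version fm x" "AE x in lborel. fp x = borel_version fp x"
proof -
  have L: "fm \<in> Lp_loc p" "fp \<in> Lp_loc p" using D unfolding boundary_data_def by auto
  then have m: "fm \<in> borel_measurable lebesgue" "fp \<in> borel_measurable lebesgue" unfolding Lp_loc_def by auto
  show eq: "AE x in lborel. fm x = borel_version fm x" "AE x in lborel. fp x = borel_version fp x" using borel_version(2) m by auto
  show Lp: "borel_version fm \<in> Lp_loc p" "borel_version fp \<in> Lp_loc p"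
    using Lp_loc_AE_cong[OF L(1) borel_version(1)[OF m(1)] eq(1)] Lp_loc_AE_cong[OF L(2) borel_version(1)[OF m(2)] eq(2)] by auto
  show "loc_integrable (borel_version fm)" "loc_integrable (borel_version fp)"
    unfolding loc_integrable_def using borel_version(1) m Lp_loc_abs_integrable[OF Lp(1) borel_version(1)[OF m(1)]] Lp_loc_abs_integrable[OF Lp(2) borel_version(1)[OF m(2)]] p by auto
qed

text \<open>Tent averages are integrals and depend only on the class of the datum. So relations
  between data that hold almost everywhere become identities between the extensions at every
  point.\<close>

lemma extension_linear:
  fixes \<eta>m \<eta>p :: "real ^ 'n \<Rightarrow> real"
  assumes a: "a > 0" and p: "p > 1"
  shows "linear_ae (boundary_data a p \<eta>m \<eta>p) (strip \<eta>m \<eta>p) (\<lambda>(fm, fp). strip_extension a \<eta>m \<eta>p (borel_version fm) (borel_version fp))"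
  unfolding linear_ae_def
proof (intro ballI allI impI)
  fix f g h :: "(real ^ 'n \<Rightarrow> real) \<times> (real ^ 'n \<Rightarrow> real)" and \<alpha> \<beta> :: real
  assume D: "f \<in> boundary_data a p \<eta>m \<eta>p" "g \<in> boundary_data a p \<eta>m \<eta>p" "h \<in> boundary_data a p \<eta>m \<eta>p"
    and lin: "(AE x in lebesgue. fst h x = \<alpha> * fst f x + \<beta> * fst g x) \<and> (AE x in lebesgue. snd h x = \<alpha> * snd f x + \<beta> * snd g x)"
  obtain fm fp gm gp hm hp where e: "f = (fm, fp)" "g = (gm, gp)" "h = (hm, hp)" by (cases f, cases g, cases h) auto
  note F = boundary_data_borel_version[OF D(1)[unfolded e] p] and G = boundary_data_borel_version[OF D(2)[unfolded e] p] and H = boundary_data_borel_version[OF D(3)[unfolded e] p]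
  have lm: "AE x in lborel. hm x = \<alpha> * fm x + \<beta> * gm x" and lp: "AE x in lborel. hp x = \<alpha> * fp x + \<beta> * gp x"
    using lin unfolding e by (simp_all add: AE_completion_iff)
  have m: "AE x in lborel. borel_version hm x = \<alpha> * borel_version fm x + \<beta> * borel_version gm x"
    using lm F(5) G(5) H(5) by eventually_elim simp
  have pp: "AE x in lborel. borel_version hp x = \<alpha> * borel_version fp x + \<beta> * borel_version gp x"
    using lp F(6) G(6) H(6) by eventually_elim simp
  have "strip_extension a \<eta>m \<eta>p (borel_version hm) (borel_version hp) X = \<alpha> * strip_extension a \<eta>m \<eta>p (borel_version fm) (borel_version fp) X + \<beta> * strip_extension a \<eta>m \<eta>p (borel_version gm) (borel_version gp) X" for X
  proof (cases "X \<in> strip \<eta>m \<eta>p")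
    case True
    then have pos: "a * (snd X - \<eta>m (fst X)) > 0" "a * (\<eta>p (fst X) - snd X) > 0" using a unfolding strip_def by auto
    have lincomb: "(1 - \<theta>) * (\<alpha> * A + \<beta> * B) + \<theta> * (\<alpha> * C + \<beta> * E) = \<alpha> * ((1 - \<theta>) * A + \<theta> * C) + \<beta> * ((1 - \<theta>) * B + \<theta> * E)"
      for \<theta> A B C E :: real by (simp add: algebra_simps)
    show ?thesis unfolding strip_extension_def
      by (simp only: True if_True lincomb tent_avg_linear[OF F(1) G(1) loc_integrable_borel[OF H(1)] m pos(1)]
          tent_avg_linear[OF F(2) G(2) loc_integrable_borel[OF H(2)] pp pos(2)])
  qed (simp add: strip_extension_def)
  then show "AE x in lebesgue. x \<in> strip \<eta>m \<eta>p \<longrightarrow> (\<lambda>(fm, fp). strip_extension a \<eta>m \<eta>p (borel_version fm) (borel_version fp)) h x =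
     \<alpha> * (\<lambda>(fm, fp). strip_extension a \<eta>m \<eta>p (borel_version fm) (borel_version fp)) f x + \<beta> * (\<lambda>(fm, fp). strip_extension a \<eta>m \<eta>p (borel_version fm) (borel_version fp)) g x"
    unfolding e by simp
qed

lemma extension_const_pos:
  assumes "a > 0" "p > 1"
  shows "extension_const TYPE('a::euclidean_space) a p > 0"
proof -
  have "slope_const TYPE('a) > 0" "1 + tent_ratio TYPE('a) > 0"
    using tent_ratio_ge_1[where 'a = 'a] unfolding slope_const_def by (auto intro!: add_pos_nonneg)
  moreover have "energy_const TYPE('a) a p > 0"
  proof -
    have "a * (ball_vol TYPE('a) 1 * (real DIM('a) + p - 1)) > 0"
      using assms ball_vol_pos[of 1, where 'a='a] by (intro mult_pos_pos) auto
    then show ?thesis unfolding energy_const_def by (intro mult_pos_pos add_pos_pos) auto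
  qed
  ultimately show ?thesis unfolding extension_const_def by simp
qed

theorem theorem5p3:
  fixes a p :: real
  assumes "0 < a" "a < 1" "1 < p"
  shows "\<exists>c>0. \<forall>(\<eta>m :: real ^ 'n \<Rightarrow> real) (\<eta>p :: real ^ 'n \<Rightarrow> real).
    (\<exists>C. C-lipschitz_on UNIV \<eta>m) \<and> (\<exists>C. C-lipschitz_on UNIV \<eta>p) \<and> (\<forall>y. \<eta>m y < \<eta>p y) \<longrightarrow>
    (\<exists>T. linear_ae (boundary_data a p \<eta>m \<eta>p) (strip \<eta>m \<eta>p) T \<and>
      (\<forall>(fm, fp)\<in>boundary_data a p \<eta>m \<eta>p.
        T (fm, fp) \<in> hom_sobolev (strip \<eta>m \<eta>p) p \<and>
        (\<exists>g. has_trace \<eta>m \<eta>p p (T (fm, fp)) g \<and>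
          (AE y in lebesgue. g (y, \<eta>m y) = fm y) \<and>
          (AE y in lebesgue. g (y, \<eta>p y) = fp y)) \<and>
        (\<exists>G. has_weak_gradient (strip \<eta>m \<eta>p) (T (fm, fp)) G \<and>
          (\<integral>\<^sup>+x\<in>strip \<eta>m \<eta>p. ennreal (norm (G x) powr p) \<partial>lebesgue) \<le>
            ennreal (c * (1 + (lip_seminorm \<eta>m + lip_seminorm \<eta>p)) powr p)
              * weighted_gap p \<eta>m \<eta>p fm fp
            + ennreal (c * (1 + (lip_seminorm \<eta>m + lip_seminorm \<eta>p)) powr p)
              * screened_seminorm_pow p (\<lambda>y. a * (\<eta>p y - \<eta>m y)) fm
            + ennreal (c * (1 + (lip_seminorm \<eta>m + lip_seminorm \<eta>p)) powr p)
              * screened_seminorm_pow p (\<lambda>y. a * (\<eta>p y - \<eta>m y)) fp)))"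
\<comment> \<open>The constant depends on \<open>a\<close>, \<open>p\<close> and the dimension only
  and is fixed before the two graphs are introduced.\<close>
proof (intro exI[of _ "extension_const TYPE(real ^ 'n) a p"] conjI allI impI)
  show "extension_const TYPE(real ^ 'n) a p > 0" using assms by (intro extension_const_pos) auto
  fix \<eta>m \<eta>p :: "real ^ 'n \<Rightarrow> real"
  assume \<eta>: "(\<exists>C. C-lipschitz_on UNIV \<eta>m) \<and> (\<exists>C. C-lipschitz_on UNIV \<eta>p) \<and> (\<forall>y. \<eta>m y < \<eta>p y)"
  define L where "L = lip_seminorm \<eta>m + lip_seminorm \<eta>p"
  let ?T = "\<lambda>(fm, fp). strip_extension a \<eta>m \<eta>p (borel_version fm) (borel_version fp)"
  let ?\<sigma> = "\<lambda>y. a * (\<eta>p y - \<eta>m y)"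
  have lip: "\<And>x y. \<bar>\<eta>m x - \<eta>m y\<bar> \<le> lip_seminorm \<eta>m * norm (x - y)" "\<And>x y. \<bar>\<eta>p x - \<eta>p y\<bar> \<le> lip_seminorm \<eta>p * norm (x - y)"
    and lip0: "lip_seminorm \<eta>m \<ge> 0" "lip_seminorm \<eta>p \<ge> 0"
    using \<eta> by (auto intro: lip_seminorm_bound)
  have main: "?T (fm, fp) \<in> hom_sobolev (strip \<eta>m \<eta>p) p \<and>
      (\<exists>g. has_trace \<eta>m \<eta>p p (?T (fm, fp)) g \<and> (AE y in lebesgue. g (y, \<eta>m y) = fm y) \<and> (AE y in lebesgue. g (y, \<eta>p y) = fp y)) \<and>
      (\<exists>G. has_weak_gradient (strip \<eta>m \<eta>p) (?T (fm, fp)) G \<and>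
        (\<integral>\<^sup>+x\<in>strip \<eta>m \<eta>p. ennreal (norm (G x) powr p) \<partial>lebesgue) \<le>
          ennreal (extension_const TYPE(real ^ 'n) a p * (1 + L) powr p) * weighted_gap p \<eta>m \<eta>p fm fp
          + ennreal (extension_const TYPE(real ^ 'n) a p * (1 + L) powr p) * screened_seminorm_pow p ?\<sigma> fm
          + ennreal (extension_const TYPE(real ^ 'n) a p * (1 + L) powr p) * screened_seminorm_pow p ?\<sigma> fp)"
    if D: "(fm, fp) \<in> boundary_data a p \<eta>m \<eta>p" for fm fp
  proof -
    note B = boundary_data_borel_version[OF D assms(3)]
    \<comment> \<open>The sum \<open>L\<close> of the two seminorms serves as a common Lipschitz
      constant of both graphs.\<close>
    interpret S: strip_data \<eta>m \<eta>p L "borel_version fm" "borel_version fp" a p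
    proof
      show "\<bar>\<eta>m x - \<eta>m y\<bar> \<le> L * norm (x - y)" for x y
        using lip(1)[of x y] mult_right_mono[of "lip_seminorm \<eta>m" L "norm (x - y)"] lip0 unfolding L_def by simp
      show "\<bar>\<eta>p x - \<eta>p y\<bar> \<le> L * norm (x - y)" for x y
        using lip(2)[of x y] mult_right_mono[of "lip_seminorm \<eta>p" L "norm (x - y)"] lip0 unfolding L_def by simp
    qed (use \<eta> lip0 assms B in \<open>auto simp: L_def\<close>)
    have gapeq: "weighted_gap p \<eta>m \<eta>p fm fp = weighted_gap p \<eta>m \<eta>p (borel_version fm) (borel_version fp)" by (rule weighted_gap_AE_cong[OF B(5,6)])
    have seq: "screened_seminorm_pow p ?\<sigma> fm = screened_energy p ?\<sigma> (borel_version fm)" "screened_seminorm_pow p ?\<sigma> fp = screened_energy p ?\<sigma> (borel_version fp)"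
      by (rule screened_energy_AE_cong[OF B(5)], rule screened_energy_AE_cong[OF B(6)])
    \<comment> \<open>The hypotheses on the data enter here: the three finite quantities of
      \<open>boundary_data\<close>, unchanged by passing to Borel versions, make the energy of the
      controlling function finite.\<close>
    have fin: "(\<integral>\<^sup>+X. indicator (strip \<eta>m \<eta>p) X * ennreal (slope_control a \<eta>m \<eta>p (borel_version fm) (borel_version fp) X powr p) \<partial>lborel) < \<infinity>"
    proof (rule le_less_trans[OF S.H_energy])
      show "ennreal (energy_const TYPE(real ^ 'n) a p) * (weighted_gap p \<eta>m \<eta>p (borel_version fm) (borel_version fp) + screened_energy p ?\<sigma> (borel_version fm) + screened_energy p ?\<sigma> (borel_version fp)) < \<infinity>"
        using D gapeq seq unfolding boundary_data_def by (auto simp: ennreal_mult_less_top)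
    qed
    interpret F: strip_function \<eta>m \<eta>p L "strip_extension a \<eta>m \<eta>p (borel_version fm) (borel_version fp)" "\<lambda>X. (1 + tent_ratio TYPE(real ^ 'n)) * slope_control a \<eta>m \<eta>p (borel_version fm) (borel_version fp) X"
      "borel_version fm" "borel_version fp" S.Du "real DIM((real ^ 'n) \<times> real) * (slope_const TYPE(real ^ 'n) * (1 + L))" p
      by (rule S.strip_function_extension[OF fin])
    have "AE y in lebesgue. F.trace_fun (y, \<eta>m y) = fm y" "AE y in lebesgue. F.trace_fun (y, \<eta>p y) = fp y"
      unfolding F.trace_fun_graph using B(5,6) by (auto simp: AE_completion_iff eq_commute)
    moreover have "(\<integral>\<^sup>+x\<in>strip \<eta>m \<eta>p. ennreal (norm (S.Du x) powr p) \<partial>lebesgue) \<le>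
          ennreal (extension_const TYPE(real ^ 'n) a p * (1 + L) powr p) * weighted_gap p \<eta>m \<eta>p fm fp
          + ennreal (extension_const TYPE(real ^ 'n) a p * (1 + L) powr p) * screened_seminorm_pow p ?\<sigma> fm
          + ennreal (extension_const TYPE(real ^ 'n) a p * (1 + L) powr p) * screened_seminorm_pow p ?\<sigma> fp"
      using S.energy_bound[OF fin] unfolding gapeq seq distrib_left .
    ultimately show ?thesis using F.in_hom_sobolev F.has_trace_trace_fun F.weak_gradient by (simp only: prod.case) blast
  qed
  show "\<exists>T. linear_ae (boundary_data a p \<eta>m \<eta>p) (strip \<eta>m \<eta>p) T \<and>
      (\<forall>(fm, fp)\<in>boundary_data a p \<eta>m \<eta>p.
        T (fm, fp) \<in> hom_sobolev (strip \<eta>m \<eta>p) p \<and>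
        (\<exists>g. has_trace \<eta>m \<eta>p p (T (fm, fp)) g \<and>
          (AE y in lebesgue. g (y, \<eta>m y) = fm y) \<and>
          (AE y in lebesgue. g (y, \<eta>p y) = fp y)) \<and>
        (\<exists>G. has_weak_gradient (strip \<eta>m \<eta>p) (T (fm, fp)) G \<and>
          (\<integral>\<^sup>+x\<in>strip \<eta>m \<eta>p. ennreal (norm (G x) powr p) \<partial>lebesgue) \<le>
            ennreal (extension_const TYPE(real ^ 'n) a p * (1 + (lip_seminorm \<eta>m + lip_seminorm \<eta>p)) powr p)
              * weighted_gap p \<eta>m \<eta>p fm fp
            + ennreal (extension_const TYPE(real ^ 'n) a p * (1 + (lip_seminorm \<eta>m + lip_seminorm \<eta>p)) powr p)
              * screened_seminorm_pow p (\<lambda>y. a * (\<eta>p y - \<eta>m y)) fm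
            + ennreal (extension_const TYPE(real ^ 'n) a p * (1 + (lip_seminorm \<eta>m + lip_seminorm \<eta>p)) powr p)
              * screened_seminorm_pow p (\<lambda>y. a * (\<eta>p y - \<eta>m y)) fp))"
  proof (intro exI[of _ ?T] conjI)
    show "linear_ae (boundary_data a p \<eta>m \<eta>p) (strip \<eta>m \<eta>p) ?T" using assms by (intro extension_linear) auto
  qed (rule ballI, rule case_prodI2, rule main[unfolded L_def], simp)
qed

end
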